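(* Let $k$ be a field with $\operatorname{char}(k)\neq 2,3$. Each orbit in $V^{ss}_k/G_k$ represents exactly one isomorphism class of reduced Freudenthal algebras of dimension $9$ over $k$, and every reduced Freudenthal algebra of dimension $9$ over $k$ is, up to isomorphism, represented by some orbit in $V^{ss}_k/G_k$.
   Context: Setting. $V_6$ is the $6$-dimensional space of column vectors over $k$ with standard basis $e_1,\dots,e_6$; $J$ is the alternating bilinear form on $V_6$ with matrix $M_J=\begin{pmatrix}0&I_3\\-I_3&0\end{pmatrix}$; $G=Sp_6=\{g\in GL_6: gM_Jg^t=M_J\}$. $G$ acts on $V=\wedge^3V_6$; write $e_ie_je_l=e_i\wedge e_j\wedge e_l$. Let $\psi:\wedge^3V_6\to V_6$, $\psi(v_1\wedge v_2\wedge v_3)=J(v_2,v_3)v_1-J(v_1,v_3)v_2+J(v_1,v_2)v_3$, and $X=\ker\psi$ (dimension $14$). The subspace $W=\{v\wedge(e_1e_4+e_2e_5+e_3e_6):v\in V_6\}$ is $G$-stable, $\wedge^3V_6=X\oplus W$, and $\psi|_W:W\to V_6$ is a $G$-isomorphism; through it write $V=X\oplus V_6$, with elements $\tilde x=(x,v)$ and $g.(x,v)=(gx,gv)$. Invariants. Let $\partial/\partial e_m$ be the operator with $\frac{\partial}{\partial e_m}(e_i\wedge e_j\wedge e_l)=\delta_{im}e_j\wedge e_l-\delta_{jm}e_i\wedge e_l+\delta_{lm}e_i\wedge e_j$, let $\tau=e_1\wedge\cdots\wedge e_6$, and for $w\in\wedge^3V_6$ define $\phi(w)=(\phi_{ij}(w))_{6\times6}$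 by $w\wedge\frac{\partial}{\partial e_i}(w)\wedge e_j=\phi_{ij}(w)\tau$. Then $\phi(w)^2=f(w)I_6$ for a quartic form $f$. Put $f_1=-\frac14 f|_X$ and $f_2((x,v))=-\frac12 v^tM_J\phi(x)v$; both are $G$-invariant. $V^{ss}=\{(x,v): f_1(x)\ne0,\ f_2((x,v))\neq0\}$. A subscript $k$ denotes $k$-rational points; $V^{ss}_k/G_k$ is the set of $G_k$-orbits in $V^{ss}_k$. Freudenthal algebras. For a composition algebra $(C,N_C)$ over $k$ with conjugation $x\mapsto\overline x$ and $\Gamma=\operatorname{diag}(\gamma_1,\gamma_2,\gamma_3)\in GL_3(k)$, let $\mathcal H_3(C,\Gamma)=\{Y\in M_3(C):\Gamma^{-1}\overline Y^{t}\Gamma=Y\}$ with product $Y\cdot Z=\frac12(YZ+ZY)$. These are the reduced Freudenthal algebras; $\dim\mathcal H_3(C,\Gamma)=3(\dim C+1)$, so those of dimension $9$ are the $\mathcal H_3(K,\Gamma)$ with $K$ a $2$-dimensional composition algebra (a quadratic field extension of $k$ or $k\times k$). The $2$-flag attached to $x$. For $x\in X_k$ with $f_1(x)=i\in k^\times$, a pair $(K\subset C)$ of composition algebras with $\dim K=2$, $\dim C=8$ is attached, up to isomorphism, as follows. If $-i\in k^{\times2}$, it is $(k\times k\subset Zorn(k))$, where $Zorn(k)$ is the split octonion algebra. If $-i\notin k^{\times2}$, then $x$ is $G_k$-equivalent to an element $-e_1e_2e_3-y_0e_4e_5e_6+y_1e_1e_5e_6+y_2e_4e_2e_6+y_3e_4e_5e_3$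 with $y_0\in k$, $y_1,y_2,y_3\in k^\times$ and $y_1y_2y_3-\frac14y_0^2=i$; then $K=k(\sqrt{-i})$ and $C$ is the octonion algebra containing $K$ whose norm is $N_K\perp y_1N_K\perp y_2N_K\perp y_3N_K$. "Represents". The orbit of $\tilde x=(x,v)\in V^{ss}_k$, with attached $2$-flag $(K\subset C)$, represents the isomorphism class of $\mathcal H_3(K',\Gamma)$ if $K'\simeq K$ and $N_C\simeq N_K\otimes\langle1,\gamma_2\gamma_3,\gamma_1\gamma_3,\gamma_1\gamma_2\rangle$. (Equivalently, $N_C\simeq N_K\otimes\langle1,-b_1\rangle\otimes\langle1,-c_1\rangle$ and the bilinear trace form of the algebra is $\langle1,1,1\rangle\perp b_{N_K}\otimes\langle-b_1,-c_1,b_1c_1\rangle$, where $b_{N_K}$ is the polar form of $N_K$.) *)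

theory Defs
  imports "HOL-Analysis.Analysis"
begin

section \<open>Exterior algebra of a coordinate space\<close>

text \<open>
  A multivector over \<open>k^n\<close> is a coefficient family indexed by the subsets of the index type: the
  coefficient at \<open>{i\<^sub>1 < \<dots> < i\<^sub>r}\<close> is the one of \<open>e\<^sub>i\<^sub>1 \<and> \<dots> \<and> e\<^sub>i\<^sub>r\<close>. The linear order on the index type
  only fixes the sign of these basis vectors. Pitfall: on the type \<open>6\<close> we have \<open>6 = 0\<close>, so the order
  is \<open>6 < 1 < 2 < 3 < 4 < 5\<close>. Nothing below depends on it, because \<open>e\<^sub>i \<and> e\<^sub>j \<and> e\<^sub>l\<close> is always written
  as a wedge product and only alternating expressions are extended by \<open>lift3\<close>.
\<close>

definition shuffle_sign :: "'n::linorder set \<Rightarrow> 'n set \<Rightarrow> 'k::comm_ring_1" where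
  "shuffle_sign A B = (- 1) ^ card {(a, b). a \<in> A \<and> b \<in> B \<and> b < a}"

definition wedge ::
  "('k::comm_ring_1, 'n::{finite,linorder} set) vec \<Rightarrow> ('k, 'n set) vec \<Rightarrow> ('k, 'n set) vec"
  (infixl \<open>\<and>\<^sub>w\<close> 72) where
  "u \<and>\<^sub>w v = (\<chi> S. \<Sum>A\<in>Pow S. shuffle_sign A (S - A) * u $ A * v $ (S - A))"

definition vec_ext :: "'k::comm_ring_1 ^ 'n::finite \<Rightarrow> ('k, 'n set) vec" where
  "vec_ext v = (\<Sum>i\<in>UNIV. axis {i} (v $ i))"

definition ee :: "'n::finite \<Rightarrow> ('k::comm_ring_1, 'n set) vec" where
  "ee i = vec_ext (axis i 1)"

definition grade :: "nat \<Rightarrow> ('k::comm_ring_1, 'n::finite set) vec set" where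
  "grade r = {w. \<forall>S. card S \<noteq> r \<longrightarrow> w $ S = 0}"

text \<open>The linear map on trivectors with \<open>e\<^sub>i \<and> e\<^sub>j \<and> e\<^sub>l \<mapsto> F i j l\<close>, for \<open>F\<close> alternating.\<close>

definition lift3 ::
  "('n::{finite,linorder} \<Rightarrow> 'n \<Rightarrow> 'n \<Rightarrow> 'k::comm_ring_1 ^ 'm::finite) \<Rightarrow> ('k, 'n set) vec \<Rightarrow> 'k ^ 'm"
  where
  "lift3 F w = (\<Sum>(i, j, l) \<in> {(i, j, l). i < j \<and> j < l}. w $ {i, j, l} *s F i j l)"

section \<open>The representation of \<open>Sp\<^sub>6\<close> on \<open>X \<oplus> V\<^sub>6\<close>\<close>

type_synonym 'k multivector6 = "('k, 6 set) vec"

definition MJ :: "'k::comm_ring_1 ^ 6 ^ 6" where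
  "MJ = (\<chi> i j. if (i, j) \<in> {(1, 4), (2, 5), (3, 6)} then 1
                else if (i, j) \<in> {(4, 1), (5, 2), (6, 3)} then - 1 else 0)"

text \<open>The bilinear form \<open>u\<^sup>t M v\<close>.\<close>

definition bform :: "'k::comm_ring_1 ^ 6 ^ 6 \<Rightarrow> 'k ^ 6 \<Rightarrow> 'k ^ 6 \<Rightarrow> 'k" where
  "bform M u v = (\<Sum>i\<in>UNIV. u $ i * (M *v v) $ i)"

abbreviation J :: "'k::comm_ring_1 ^ 6 \<Rightarrow> 'k ^ 6 \<Rightarrow> 'k" where
  "J \<equiv> bform MJ"

definition Sp6 :: "('k::field ^ 6 ^ 6) set" where
  "Sp6 = {g. invertible g \<and> g ** MJ ** transpose g = MJ}"

definition act3 :: "'k::field ^ 6 ^ 6 \<Rightarrow> 'k multivector6 \<Rightarrow> 'k multivector6" where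
  "act3 g = lift3 (\<lambda>i j l. vec_ext (g *v axis i 1) \<and>\<^sub>w vec_ext (g *v axis j 1)
                             \<and>\<^sub>w vec_ext (g *v axis l 1))"

definition psi :: "'k::field multivector6 \<Rightarrow> 'k ^ 6" where
  "psi = lift3 (\<lambda>i j l. J (axis j 1) (axis l 1) *s axis i 1
                        - J (axis i 1) (axis l 1) *s axis j 1
                        + J (axis i 1) (axis j 1) *s axis l 1)"

definition Xspace :: "'k::field multivector6 set" where
  "Xspace = {w \<in> grade 3. psi w = 0}"

definition pd :: "6 \<Rightarrow> 'k::field multivector6 \<Rightarrow> 'k multivector6" where
  "pd m = lift3 (\<lambda>i j l. of_bool (i = m) *s (ee j \<and>\<^sub>w ee l) - of_bool (j = m) *s (ee i \<and>\<^sub>w ee l)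
                         + of_bool (l = m) *s (ee i \<and>\<^sub>w ee j))"

definition tau :: "'k::field multivector6" where
  "tau = ee 1 \<and>\<^sub>w ee 2 \<and>\<^sub>w ee 3 \<and>\<^sub>w ee 4 \<and>\<^sub>w ee 5 \<and>\<^sub>w ee 6"

definition phi :: "'k::field multivector6 \<Rightarrow> 'k ^ 6 ^ 6" where
  "phi w = (\<chi> i j. THE c. w \<and>\<^sub>w pd i w \<and>\<^sub>w ee j = c *s tau)"

definition quartic :: "'k::field multivector6 \<Rightarrow> 'k" where
  "quartic w = (THE c. phi w ** phi w = mat c)"

definition f1 :: "'k::field multivector6 \<Rightarrow> 'k" where
  "f1 x = - (1 / 4) * quartic x"

definition f2 :: "'k::field multivector6 \<times> ('k ^ 6) \<Rightarrow> 'k" where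
  "f2 = (\<lambda>(x, v). - (1 / 2) * bform (MJ ** phi x) v v)"

definition Vss :: "('k::field multivector6 \<times> ('k ^ 6)) set" where
  "Vss = {(x, v). x \<in> Xspace \<and> f1 x \<noteq> 0 \<and> f2 (x, v) \<noteq> 0}"

definition orbit ::
  "'k::field multivector6 \<times> ('k ^ 6) \<Rightarrow> ('k multivector6 \<times> ('k ^ 6)) set" where
  "orbit = (\<lambda>(x, v). (\<lambda>g. (act3 g x, g *v v)) ` Sp6)"

definition Vss_orbits :: "('k::field multivector6 \<times> ('k ^ 6)) set set" where
  "Vss_orbits = orbit ` Vss"

section \<open>Nonassociative algebras and quadratic forms\<close>

text \<open>
  Structures live on a linear subspace, the carrier, of an ambient vector space whose addition is
  that of its type.
\<close>

record ('k, 'a) vspace =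
  carrier :: "'a set"
  smul :: "'k \<Rightarrow> 'a \<Rightarrow> 'a"

record ('k, 'a) nalg = "('k, 'a) vspace" +
  mul :: "'a \<Rightarrow> 'a \<Rightarrow> 'a"

record ('k, 'a) normed_alg = "('k, 'a) nalg" +
  unit :: "'a"
  nrm :: "'a \<Rightarrow> 'k"

definition vspace :: "('k::field, 'a::ab_group_add, 'z) vspace_scheme \<Rightarrow> bool" where
  "vspace A \<longleftrightarrow> vector_space (smul A) \<and> module.subspace (smul A) (carrier A)"

definition vdim :: "('k::field, 'a::ab_group_add, 'z) vspace_scheme \<Rightarrow> nat" where
  "vdim A = vector_space.dim (smul A) (carrier A)"

definition lin_iso ::
  "('a \<Rightarrow> 'b) \<Rightarrow> ('k::field, 'a::ab_group_add, 'y) vspace_scheme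
    \<Rightarrow> ('k, 'b::ab_group_add, 'z) vspace_scheme \<Rightarrow> bool" where
  "lin_iso h A B \<longleftrightarrow> bij_betw h (carrier A) (carrier B)
     \<and> (\<forall>x\<in>carrier A. \<forall>y\<in>carrier A. h (x + y) = h x + h y)
     \<and> (\<forall>c. \<forall>x\<in>carrier A. h (smul A c x) = smul B c (h x))"

definition nalgebra :: "('k::field, 'a::ab_group_add, 'z) nalg_scheme \<Rightarrow> bool" where
  "nalgebra A \<longleftrightarrow> vspace A
     \<and> (\<forall>x\<in>carrier A. \<forall>y\<in>carrier A. mul A x y \<in> carrier A)
     \<and> (\<forall>x\<in>carrier A. \<forall>y\<in>carrier A. \<forall>z\<in>carrier A.
           mul A (x + y) z = mul A x z + mul A y z \<and> mul A z (x + y) = mul A z x + mul A z y)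
     \<and> (\<forall>c. \<forall>x\<in>carrier A. \<forall>y\<in>carrier A.
           mul A (smul A c x) y = smul A c (mul A x y) \<and> mul A x (smul A c y) = smul A c (mul A x y))"

definition alg_iso ::
  "('a \<Rightarrow> 'b) \<Rightarrow> ('k::field, 'a::ab_group_add, 'y) nalg_scheme
    \<Rightarrow> ('k, 'b::ab_group_add, 'z) nalg_scheme \<Rightarrow> bool" where
  "alg_iso h A B \<longleftrightarrow> lin_iso h A B
     \<and> (\<forall>x\<in>carrier A. \<forall>y\<in>carrier A. h (mul A x y) = mul B (h x) (h y))"

definition alg_isomorphic ::
  "('k::field, 'a::ab_group_add, 'y) nalg_scheme
    \<Rightarrow> ('k, 'b::ab_group_add, 'z) nalg_scheme \<Rightarrow> bool" (infix \<open>\<simeq>\<^sub>a\<close> 50) where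
  "A \<simeq>\<^sub>a B \<longleftrightarrow> (\<exists>h. alg_iso h A B)"

definition polar :: "('a::ab_group_add \<Rightarrow> 'k::field) \<Rightarrow> 'a \<Rightarrow> 'a \<Rightarrow> 'k" where
  "polar q x y = q (x + y) - q x - q y"

definition quadratic_form ::
  "('k::field, 'a::ab_group_add, 'z) vspace_scheme \<Rightarrow> ('a \<Rightarrow> 'k) \<Rightarrow> bool" where
  "quadratic_form A q \<longleftrightarrow>
     (\<forall>c. \<forall>x\<in>carrier A. q (smul A c x) = c\<^sup>2 * q x)
     \<and> (\<forall>x\<in>carrier A. \<forall>y\<in>carrier A. \<forall>z\<in>carrier A. polar q (x + y) z = polar q x z + polar q y z)
     \<and> (\<forall>c. \<forall>x\<in>carrier A. \<forall>y\<in>carrier A. polar q (smul A c x) y = c * polar q x y)"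

definition nondegenerate ::
  "('k::field, 'a::ab_group_add, 'z) vspace_scheme \<Rightarrow> ('a \<Rightarrow> 'k) \<Rightarrow> bool" where
  "nondegenerate A q \<longleftrightarrow> (\<forall>x\<in>carrier A. (\<forall>y\<in>carrier A. polar q x y = 0) \<longrightarrow> x = 0)"

definition isometric ::
  "('k::field, 'a::ab_group_add, 'y) vspace_scheme \<Rightarrow> ('a \<Rightarrow> 'k)
    \<Rightarrow> ('k, 'b::ab_group_add, 'z) vspace_scheme \<Rightarrow> ('b \<Rightarrow> 'k) \<Rightarrow> bool" where
  "isometric A p B q \<longleftrightarrow> (\<exists>h. lin_iso h A B \<and> (\<forall>x\<in>carrier A. q (h x) = p x))"

section \<open>Composition algebras\<close>

definition composition_algebra :: "('k::field, 'a::ab_group_add) normed_alg \<Rightarrow> bool" where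
  "composition_algebra C \<longleftrightarrow> nalgebra C
     \<and> unit C \<in> carrier C \<and> unit C \<noteq> 0
     \<and> (\<forall>x\<in>carrier C. mul C (unit C) x = x \<and> mul C x (unit C) = x)
     \<and> quadratic_form C (nrm C) \<and> nondegenerate C (nrm C)
     \<and> (\<forall>x\<in>carrier C. \<forall>y\<in>carrier C. nrm C (mul C x y) = nrm C x * nrm C y)"

definition conj_of :: "('k::field, 'a::ab_group_add) normed_alg \<Rightarrow> 'a \<Rightarrow> 'a" where
  "conj_of C x = smul C (polar (nrm C) x (unit C)) (unit C) - x"

definition two_flag ::
  "('k::field, 'a::ab_group_add) normed_alg \<Rightarrow> ('k, 'a) normed_alg \<Rightarrow> bool" where
  "two_flag K C \<longleftrightarrow> composition_algebra K \<and> composition_algebra C \<and> vdim K = 2 \<and> vdim C = 8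
     \<and> carrier K \<subseteq> carrier C \<and> K = C\<lparr>carrier := carrier K\<rparr>"

text \<open>The algebra \<open>k[t] / (t\<^sup>2 - d)\<close>, with \<open>(a, b)\<close> for \<open>a + b t\<close>. It is \<open>k(\<surd>d)\<close> for a non-square \<open>d\<close>.\<close>

definition quad_ext :: "'k::field \<Rightarrow> ('k, 'k \<times> 'k) normed_alg" where
  "quad_ext d = \<lparr>carrier = UNIV, smul = (\<lambda>c (a, b). (c * a, c * b)),
     mul = (\<lambda>(a, b) (a', b'). (a * a' + d * b * b', a * b' + b * a')),
     unit = (1, 0), nrm = (\<lambda>(a, b). a\<^sup>2 - d * b\<^sup>2)\<rparr>"

definition dot3 :: "'k::field ^ 3 \<Rightarrow> 'k ^ 3 \<Rightarrow> 'k" where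
  "dot3 u v = (\<Sum>i\<in>UNIV. u $ i * v $ i)"

definition crossp3 :: "'k::field ^ 3 \<Rightarrow> 'k ^ 3 \<Rightarrow> 'k ^ 3" where
  "crossp3 u v = vector [u $ 2 * v $ 3 - u $ 3 * v $ 2,
                         u $ 3 * v $ 1 - u $ 1 * v $ 3,
                         u $ 1 * v $ 2 - u $ 2 * v $ 1]"

text \<open>
  Zorn's vector matrices: \<open>(a, u, v, b)\<close> is the matrix with rows \<open>a, u\<close> and \<open>v, b\<close>. The diagonal
  matrices form the copy of \<open>k \<times> k\<close> in the split flag.
\<close>

definition Zorn :: "('k::field, 'k \<times> ('k ^ 3) \<times> ('k ^ 3) \<times> 'k) normed_alg" where
  "Zorn = \<lparr>carrier = UNIV, smul = (\<lambda>c (a, u, v, b). (c * a, c *s u, c *s v, c * b)),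
     mul = (\<lambda>(a, u, v, b) (a', u', v', b').
       (a * a' + dot3 u v', a *s u' + b' *s u - crossp3 v v',
        a' *s v + b *s v' + crossp3 u u', b * b' + dot3 v u')),
     unit = (1, 0, 0, 1), nrm = (\<lambda>(a, u, v, b). a * b - dot3 u v)\<rparr>"

definition Zorn_diag :: "('k::field \<times> ('k ^ 3) \<times> ('k ^ 3) \<times> 'k) set" where
  "Zorn_diag = {(a, 0, 0, b) | a b. True}"

text \<open>The quadratic space \<open>N\<^sub>K \<otimes> \<langle>a\<^sub>1, a\<^sub>2, a\<^sub>3, a\<^sub>4\<rangle> = a\<^sub>1 N\<^sub>K \<bottom> a\<^sub>2 N\<^sub>K \<bottom> a\<^sub>3 N\<^sub>K \<bottom> a\<^sub>4 N\<^sub>K\<close> on \<open>K\<^sup>4\<close>.\<close>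

definition fourfold :: "('k::field, 'a::ab_group_add) normed_alg \<Rightarrow> ('k, 'a ^ 4) vspace" where
  "fourfold K = \<lparr>carrier = {z. \<forall>i. z $ i \<in> carrier K}, smul = (\<lambda>c z. \<chi> i. smul K c (z $ i))\<rparr>"

definition norm_tensor ::
  "('k::field, 'a::ab_group_add) normed_alg \<Rightarrow> 'k ^ 4 \<Rightarrow> 'a ^ 4 \<Rightarrow> 'k" where
  "norm_tensor K a z = (\<Sum>i\<in>UNIV. a $ i * nrm K (z $ i))"

section \<open>Reduced Freudenthal algebras\<close>

text \<open>
  With \<open>\<Gamma> = diag(\<gamma>\<^sub>1, \<gamma>\<^sub>2, \<gamma>\<^sub>3)\<close>, the \<open>(i, j)\<close> entry of \<open>\<Gamma>\<^sup>-\<^sup>1 Y\<^sup>* \<Gamma>\<close>, for \<open>Y\<^sup>*\<close> the conjugate transpose of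
  \<open>Y\<close>, is \<open>\<gamma>\<^sub>i\<^sup>-\<^sup>1 \<gamma>\<^sub>j\<close> times the conjugate of \<open>Y\<^sub>j\<^sub>i\<close>.
\<close>

definition mat3_mul ::
  "('k::field, 'a::ab_group_add) normed_alg \<Rightarrow> 'a ^ 3 ^ 3 \<Rightarrow> 'a ^ 3 ^ 3 \<Rightarrow> 'a ^ 3 ^ 3" where
  "mat3_mul C Y Z = (\<chi> i j. \<Sum>l\<in>UNIV. mul C (Y $ i $ l) (Z $ l $ j))"

definition H3 :: "('k::field, 'a::ab_group_add) normed_alg \<Rightarrow> 'k ^ 3 \<Rightarrow> ('k, 'a ^ 3 ^ 3) nalg" where
  "H3 C \<gamma> =
    \<lparr>carrier = {Y. (\<forall>i j. Y $ i $ j \<in> carrier C)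
        \<and> (\<forall>i j. smul C (inverse (\<gamma> $ i) * \<gamma> $ j) (conj_of C (Y $ j $ i)) = Y $ i $ j)},
     smul = (\<lambda>c Y. \<chi> i j. smul C c (Y $ i $ j)),
     mul = (\<lambda>Y Z. \<chi> i j. smul C (1 / 2) ((mat3_mul C Y Z + mat3_mul C Z Y) $ i $ j))\<rparr>"

text \<open>
  Composition algebras have dimension at most 8, so each is isomorphic to one whose carrier is a
  subspace of \<open>k\<^sup>8\<close>, and quantifying over these covers all of them up to isomorphism.
\<close>

definition reduced_freudenthal :: "('k::field, 'a::ab_group_add) nalg \<Rightarrow> bool" where
  "reduced_freudenthal A \<longleftrightarrow> nalgebra A
     \<and> (\<exists>(C :: ('k, 'k ^ 8) normed_alg) \<gamma>. composition_algebra C \<and> (\<forall>i. \<gamma> $ i \<noteq> 0) \<and> A \<simeq>\<^sub>a H3 C \<gamma>)"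

section \<open>The algebra represented by an orbit\<close>

definition normal_form :: "'k::field \<Rightarrow> 'k \<Rightarrow> 'k \<Rightarrow> 'k \<Rightarrow> 'k multivector6" where
  "normal_form y0 y1 y2 y3 =
     - (ee 1 \<and>\<^sub>w ee 2 \<and>\<^sub>w ee 3) - y0 *s (ee 4 \<and>\<^sub>w ee 5 \<and>\<^sub>w ee 6)
     + y1 *s (ee 1 \<and>\<^sub>w ee 5 \<and>\<^sub>w ee 6) + y2 *s (ee 4 \<and>\<^sub>w ee 2 \<and>\<^sub>w ee 6) + y3 *s (ee 4 \<and>\<^sub>w ee 5 \<and>\<^sub>w ee 3)"

definition nonzero_square :: "'k::field \<Rightarrow> bool" where
  "nonzero_square a \<longleftrightarrow> (\<exists>b. b \<noteq> 0 \<and> a = b\<^sup>2)"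

definition attached ::
  "'k::field multivector6 \<Rightarrow> ('k, 'a::ab_group_add) normed_alg \<Rightarrow> ('k, 'a) normed_alg \<Rightarrow> bool" where
  "attached x K C \<longleftrightarrow> two_flag K C \<and>
     (if nonzero_square (- f1 x)
      then \<exists>h. alg_iso h C (Zorn :: ('k, _) normed_alg) \<and> h ` carrier K = Zorn_diag
      else K \<simeq>\<^sub>a quad_ext (- f1 x) \<and>
        (\<exists>y0 y1 y2 y3. y1 \<noteq> 0 \<and> y2 \<noteq> 0 \<and> y3 \<noteq> 0 \<and> y1 * y2 * y3 - 1 / 4 * y0\<^sup>2 = f1 x
           \<and> (\<exists>g\<in>Sp6. act3 g x = normal_form y0 y1 y2 y3)
           \<and> isometric C (nrm C) (fourfold K) (norm_tensor K (vector [1, y1, y2, y3]))))"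

definition represents ::
  "('k::field multivector6 \<times> ('k ^ 6)) set \<Rightarrow> ('k, 'a::ab_group_add) nalg \<Rightarrow> bool" where
  "represents Orb A \<longleftrightarrow>
     (\<exists>(x, v) \<in> Orb. \<exists>(K :: ('k, 'k ^ 8) normed_alg) C (K' :: ('k, 'k ^ 8) normed_alg) \<gamma>.
        attached x K C
        \<and> composition_algebra K' \<and> vdim K' = 2 \<and> (\<forall>i. \<gamma> $ i \<noteq> 0) \<and> A \<simeq>\<^sub>a H3 K' \<gamma>
        \<and> K' \<simeq>\<^sub>a K
        \<and> isometric C (nrm C) (fourfold K)
            (norm_tensor K (vector [1, \<gamma> $ 2 * \<gamma> $ 3, \<gamma> $ 1 * \<gamma> $ 3, \<gamma> $ 1 * \<gamma> $ 2])))"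

end

theory Submission
  imports Defs
begin

text \<open>
  The proof has two halves: the norm form of the octonion algebra attached to a point is an invariant of
  its orbit that can be prescribed freely, and among the algebras over a fixed quadratic algebra this form
  decides isomorphism.

  Write \<open>Q = k[t] / (t\<^sup>2 - d)\<close> with \<open>d = - f\<^sub>1(x)\<close>. A point \<open>(x, v)\<close> represents \<open>H\<^sub>3(K', \<Gamma>)\<close> if \<open>K' \<cong> Q\<close> (up to
  a square factor of \<open>d\<close>) and \<open>N \<otimes> \<langle>1, \<gamma>\<^sub>2 \<gamma>\<^sub>3, \<gamma>\<^sub>1 \<gamma>\<^sub>3, \<gamma>\<^sub>1 \<gamma>\<^sub>2\<rangle>\<close>, for the norm \<open>N\<close> of \<open>Q\<close>, is the norm form of the
  attached octonion algebra.

  Uniqueness. The attached octonion algebra is defined through a choice of a normal form of \<open>x\<close>. In suitable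
  coordinates its norm is \<open>N \<bottom> - f\<^sub>2(x, _)\<close> (\<open>isometric_normal_forms\<close>), so the invariance of \<open>f\<^sub>2\<close> (\<open>f2_act3\<close>) makes
  it independent of the choice; in the split case \<open>N\<close> takes all values, so that every choice of entries gives the
  same form (\<open>split_flag\<close>). Hence the orbit determines the isometry class (\<open>attached_unique\<close>). By an argument
  of Jacobson an isometry of the underlying quadratic forms over \<open>k\<close> can be corrected by reflections until it is
  \<open>Q\<close>-linear and fixes the first basis vector (\<open>witt_move\<close>, \<open>commute_step\<close>). What remains is an isometry of ternary
  hermitian forms, and conjugation by its matrix is an isomorphism of the Freudenthal algebras
  (\<open>H3_iso_of_isometric\<close>).

  Existence for an orbit. If \<open>d\<close> is no square, half of the transposed covariant \<open>\<phi>(x)\<close> is an operator \<open>S\<close> with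
  \<open>S\<^sup>2 = d\<close> that is skew for \<open>J\<close>. It makes \<open>k\<^sup>6\<close> a hermitian space of dimension 3 over \<open>k(\<surd>d)\<close>, and \<open>x\<close>, as an
  alternating form, allows \<open>S\<close> to be moved between its arguments (\<open>tri_phi\<close>). An orthogonal basis of the hermitian
  space, rescaled in its first vector, extends to a symplectic basis in which \<open>x\<close> has the normal form with
  \<open>y\<^sub>0 = 0\<close> (\<open>normal_form_exists\<close>), and \<open>\<gamma>\<^sub>i = 1 / y\<^sub>i\<close> is a solution.

  Existence for an algebra. Every \<open>\<Gamma>\<close> gives a normal form whose \<open>y\<^sub>i\<close> agree with \<open>\<gamma>\<^sub>2 \<gamma>\<^sub>3, \<gamma>\<^sub>1 \<gamma>\<^sub>3, \<gamma>\<^sub>1 \<gamma>\<^sub>2\<close> up to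
  norms from \<open>Q\<close> and have product \<open>- d\<close>. The octonion algebra itself is a double Cayley-Dickson double of \<open>Q\<close>
  (\<open>nonsplit_flag_exists\<close>) or Zorn's algebra (\<open>split_flag_exists\<close>).

  The invariance of \<open>f\<^sub>1\<close> and \<open>f\<^sub>2\<close> rests on the equivariance of \<open>\<phi>\<close>, hence on the fact that symplectic matrices have
  determinant one (\<open>wedge6_Sp6\<close>). This is the place where 3 has to be invertible.
\<close>

section \<open>Linear isomorphisms and isometries\<close>

lemma vspace_closed:
  assumes "vspace A" "x \<in> carrier A" "y \<in> carrier A"
  shows "x + y \<in> carrier A" "smul A c x \<in> carrier A" "0 \<in> carrier A" "x - y \<in> carrier A" "- x \<in> carrier A"
proof -
  interpret vector_space "smul A" using assms by (simp add: vspace_def)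
  show "x + y \<in> carrier A" "smul A c x \<in> carrier A" "0 \<in> carrier A" "x - y \<in> carrier A" "- x \<in> carrier A"
    using assms by (auto simp: vspace_def subspace_add subspace_scale subspace_0 subspace_diff subspace_neg)
qed

lemma vspace_vector_space: "vspace A \<Longrightarrow> vector_space (smul A)"
  by (simp add: vspace_def)

lemma lin_iso_trans: "lin_iso h A B \<Longrightarrow> lin_iso h' B C \<Longrightarrow> lin_iso (h' \<circ> h) A C"
  unfolding lin_iso_def using bij_betw_trans[of h "carrier A" "carrier B" h' "carrier C"]
  by (auto simp: bij_betw_apply)

lemma lin_iso_inv:
  assumes h: "lin_iso h A B" and A: "vspace A"
  shows "lin_iso (inv_into (carrier A) h) B A"
proof -
  let ?g = "inv_into (carrier A) h"
  have bij: "bij_betw h (carrier A) (carrier B)" using h by (simp add: lin_iso_def)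
  have gb: "bij_betw ?g (carrier B) (carrier A)" using bij by (rule bij_betw_inv_into)
  have hg: "h (?g y) = y" if "y \<in> carrier B" for y using bij that by (rule bij_betw_inv_into_right)
  have gh: "?g (h x) = x" if "x \<in> carrier A" for x using bij that by (rule bij_betw_inv_into_left)
  have gc: "?g y \<in> carrier A" if "y \<in> carrier B" for y using gb that by (rule bij_betw_apply)
  show ?thesis unfolding lin_iso_def
  proof (intro conjI ballI allI gb)
    fix x y assume xy: "x \<in> carrier B" "y \<in> carrier B"
    have "h (?g x + ?g y) = x + y" using h xy gc hg by (simp add: lin_iso_def)
    then show "?g (x + y) = ?g x + ?g y" using gh[of "?g x + ?g y"] vspace_closed[OF A gc gc] xy by simp
  next
    fix c x assume x: "x \<in> carrier B"
    have "h (smul A c (?g x)) = smul B c x" using h x gc hg by (simp add: lin_iso_def)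
    then show "?g (smul B c x) = smul A c (?g x)"
      using gh[of "smul A c (?g x)"] vspace_closed(2)[OF A gc[OF x] gc[OF x]] by simp
  qed
qed

lemma lin_iso_zero:
  assumes h: "lin_iso h A B" and A: "vspace A" and B: "vspace B"
  shows "h 0 = 0"
proof -
  interpret a: vector_space "smul A" using A by (rule vspace_vector_space)
  interpret b: vector_space "smul B" using B by (rule vspace_vector_space)
  have 0: "0 \<in> carrier A" using A a.subspace_0 by (auto simp: vspace_def)
  then have "h (smul A 0 0) = smul B 0 (h 0)" using h unfolding lin_iso_def by blast
  then show ?thesis by simp
qed

lemma alg_iso_trans: "alg_iso h A B \<Longrightarrow> alg_iso h' B C \<Longrightarrow> alg_iso (h' \<circ> h) A C"
  unfolding alg_iso_def using lin_iso_trans[of h A B h' C]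
  by (auto simp: lin_iso_def bij_betw_apply)

lemma alg_iso_inv:
  assumes h: "alg_iso h A B" and A: "nalgebra A"
  shows "alg_iso (inv_into (carrier A) h) B A"
  unfolding alg_iso_def
proof (intro conjI ballI)
  show "lin_iso (inv_into (carrier A) h) B A"
    using h A by (intro lin_iso_inv) (auto simp: alg_iso_def nalgebra_def)
  let ?g = "inv_into (carrier A) h"
  have bij: "bij_betw h (carrier A) (carrier B)" using h by (simp add: alg_iso_def lin_iso_def)
  fix x y assume xy: "x \<in> carrier B" "y \<in> carrier B"
  have gc: "?g y \<in> carrier A" if "y \<in> carrier B" for y
    using bij_betw_inv_into[OF bij] that by (rule bij_betw_apply)
  have "h (mul A (?g x) (?g y)) = mul B x y"
    using h xy gc bij_betw_inv_into_right[OF bij] by (simp add: alg_iso_def)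
  moreover have "mul A (?g x) (?g y) \<in> carrier A" using A gc xy by (simp add: nalgebra_def)
  ultimately show "?g (mul B x y) = mul A (?g x) (?g y)"
    using bij_betw_inv_into_left[OF bij] by metis
qed

lemma alg_isomorphic_trans: "A \<simeq>\<^sub>a B \<Longrightarrow> B \<simeq>\<^sub>a C \<Longrightarrow> A \<simeq>\<^sub>a C"
  unfolding alg_isomorphic_def using alg_iso_trans by blast

lemma alg_isomorphic_sym: "A \<simeq>\<^sub>a B \<Longrightarrow> nalgebra A \<Longrightarrow> B \<simeq>\<^sub>a A"
  unfolding alg_isomorphic_def using alg_iso_inv by blast

lemma isometric_trans: "isometric A p B q \<Longrightarrow> isometric B q C r \<Longrightarrow> isometric A p C r"
proof -
  assume "isometric A p B q" "isometric B q C r"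
  then obtain h h' where "lin_iso h A B" "\<forall>x\<in>carrier A. q (h x) = p x"
    "lin_iso h' B C" "\<forall>x\<in>carrier B. r (h' x) = q x" unfolding isometric_def by blast
  then have "lin_iso (h' \<circ> h) A C \<and> (\<forall>x\<in>carrier A. r ((h' \<circ> h) x) = p x)"
    using lin_iso_trans[of h A B h' C] by (auto simp: lin_iso_def bij_betw_apply)
  then show ?thesis unfolding isometric_def by blast
qed

lemma isometric_sym: "isometric A p B q \<Longrightarrow> vspace A \<Longrightarrow> isometric B q A p"
proof -
  assume "isometric A p B q" and A: "vspace A"
  then obtain h where h: "lin_iso h A B" "\<forall>x\<in>carrier A. q (h x) = p x" unfolding isometric_def by blast
  have bij: "bij_betw h (carrier A) (carrier B)" using h by (simp add: lin_iso_def)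
  have "p (inv_into (carrier A) h y) = q y" if "y \<in> carrier B" for y
    using h(2) bij_betw_inv_into_right[OF bij that] bij_betw_apply[OF bij_betw_inv_into[OF bij] that] by metis
  then show ?thesis unfolding isometric_def using lin_iso_inv[OF h(1) A] by blast
qed

section \<open>Composition algebras\<close>

locale comp_alg =
  fixes C :: "('k::field, 'a::ab_group_add) normed_alg"
  assumes comp: "composition_algebra C"
begin

abbreviation "X \<equiv> carrier C"
abbreviation "N \<equiv> nrm C"
abbreviation "m \<equiv> mul C"
abbreviation "s \<equiv> smul C"
abbreviation "e \<equiv> unit C"
abbreviation "b \<equiv> polar (nrm C)"

lemma alg: "nalgebra C" and vs: "vspace C"
  using comp by (simp_all add: composition_algebra_def nalgebra_def)

sublocale V: vector_space "smul C"
  using vs by (rule vspace_vector_space)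

lemma closed [simp]:
  "x \<in> X \<Longrightarrow> y \<in> X \<Longrightarrow> x + y \<in> X" "x \<in> X \<Longrightarrow> s c x \<in> X" "0 \<in> X" "x \<in> X \<Longrightarrow> y \<in> X \<Longrightarrow> x - y \<in> X" "x \<in> X \<Longrightarrow> - x \<in> X"
  "x \<in> X \<Longrightarrow> y \<in> X \<Longrightarrow> m x y \<in> X" "e \<in> X"
  using vspace_closed[OF vs] comp by (auto simp: composition_algebra_def nalgebra_def)

lemma mul_bilinear:
  "x \<in> X \<Longrightarrow> y \<in> X \<Longrightarrow> z \<in> X \<Longrightarrow> m (x + y) z = m x z + m y z"
  "x \<in> X \<Longrightarrow> y \<in> X \<Longrightarrow> z \<in> X \<Longrightarrow> m z (x + y) = m z x + m z y"
  "x \<in> X \<Longrightarrow> y \<in> X \<Longrightarrow> m (s c x) y = s c (m x y)"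
  "x \<in> X \<Longrightarrow> y \<in> X \<Longrightarrow> m x (s c y) = s c (m x y)"
  using comp by (simp_all add: composition_algebra_def nalgebra_def)

lemma mul_neg: "x \<in> X \<Longrightarrow> z \<in> X \<Longrightarrow> m (- x) z = - m x z" "x \<in> X \<Longrightarrow> z \<in> X \<Longrightarrow> m x (- z) = - m x z"
  using mul_bilinear(3)[of x z "- 1"] mul_bilinear(4)[of x z "- 1"] by simp_all

lemma mul_diff:
  assumes "x \<in> X" "y \<in> X" "z \<in> X"
  shows "m (x - y) z = m x z - m y z" "m z (x - y) = m z x - m z y"
  using mul_bilinear(1)[of x "- y" z] mul_bilinear(2)[of x "- y" z] mul_neg assms by simp_all

lemma unit_mul [simp]: "x \<in> X \<Longrightarrow> m e x = x" "x \<in> X \<Longrightarrow> m x e = x" "e \<noteq> 0"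
  using comp by (simp_all add: composition_algebra_def)

lemma nrm_mul: "x \<in> X \<Longrightarrow> y \<in> X \<Longrightarrow> N (m x y) = N x * N y"
  using comp by (simp add: composition_algebra_def)

lemma nrm_scale: "x \<in> X \<Longrightarrow> N (s c x) = c\<^sup>2 * N x"
  using comp by (simp add: composition_algebra_def quadratic_form_def)

lemma polar_sym: "b x y = b y x"
  by (simp add: polar_def add.commute)

lemma polar_bilinear:
  "x \<in> X \<Longrightarrow> y \<in> X \<Longrightarrow> z \<in> X \<Longrightarrow> b (x + y) z = b x z + b y z"
  "x \<in> X \<Longrightarrow> y \<in> X \<Longrightarrow> z \<in> X \<Longrightarrow> b z (x + y) = b z x + b z y"
  "x \<in> X \<Longrightarrow> y \<in> X \<Longrightarrow> b (s c x) y = c * b x y"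
  "x \<in> X \<Longrightarrow> y \<in> X \<Longrightarrow> b x (s c y) = c * b x y"
proof -
  show 1: "b (x + y) z = b x z + b y z" if "x \<in> X" "y \<in> X" "z \<in> X" for x y z
    using comp that unfolding composition_algebra_def quadratic_form_def by blast
  show 2: "b (s c x) y = c * b x y" if "x \<in> X" "y \<in> X" for x y
    using comp that unfolding composition_algebra_def quadratic_form_def by blast
  show "x \<in> X \<Longrightarrow> y \<in> X \<Longrightarrow> z \<in> X \<Longrightarrow> b z (x + y) = b z x + b z y"
    using 1[of x y z] by (simp add: polar_sym)
  show "x \<in> X \<Longrightarrow> y \<in> X \<Longrightarrow> b x (s c y) = c * b x y"
    using 2[of y x] by (simp add: polar_sym)
qed

lemma polar_neg: "x \<in> X \<Longrightarrow> y \<in> X \<Longrightarrow> b (- x) y = - b x y"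
  using polar_bilinear(3)[of x y "- 1"] by simp

lemma polar_diff: "x \<in> X \<Longrightarrow> y \<in> X \<Longrightarrow> z \<in> X \<Longrightarrow> b (x - y) z = b x z - b y z"
  using polar_bilinear(1)[of x "- y" z] polar_neg[of y z] by simp

lemma polar_self: "x \<in> X \<Longrightarrow> b x x = 2 * N x"
proof -
  assume x: "x \<in> X"
  have "x + x = s 2 x" using V.scale_left_distrib[of 1 1 x] by simp
  then have "N (x + x) = 4 * N x" using nrm_scale[OF x, of 2] by simp
  then show ?thesis by (simp add: polar_def)
qed

lemma nondeg: "x \<in> X \<Longrightarrow> (\<And>y. y \<in> X \<Longrightarrow> b x y = 0) \<Longrightarrow> x = 0"
  using comp unfolding composition_algebra_def nondegenerate_def by blast

lemma polar_cancel: "x \<in> X \<Longrightarrow> x' \<in> X \<Longrightarrow> (\<And>y. y \<in> X \<Longrightarrow> b x y = b x' y) \<Longrightarrow> x = x'"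
  using nondeg[of "x - x'"] polar_diff by simp

lemma polar_mul_left: "x \<in> X \<Longrightarrow> y \<in> X \<Longrightarrow> z \<in> X \<Longrightarrow> b (m x y) (m x z) = N x * b y z"
  unfolding polar_def using nrm_mul[of x "y + z"] by (simp add: mul_bilinear(2)[symmetric] nrm_mul algebra_simps)

text \<open>
  The composition law, linearised in both factors. Setting one argument to the unit gives the quadratic
  equation of an element and the adjoint identities.
\<close>

lemma polar_mul_exchange:
  assumes "x \<in> X" "y \<in> X" "z \<in> X" "w \<in> X"
  shows "b (m x y) (m z w) + b (m z y) (m x w) = b x z * b y w"
proof -
  have "b (m (x + z) y) (m (x + z) w) = N (x + z) * b y w" using assms by (simp add: polar_mul_left)
  moreover have "b (m (x + z) y) (m (x + z) w)
      = b (m x y) (m x w) + b (m x y) (m z w) + (b (m z y) (m x w) + b (m z y) (m z w))"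
    using assms by (simp add: mul_bilinear polar_bilinear)
  moreover have "N (x + z) = N x + N z + b x z" by (simp add: polar_def)
  ultimately show ?thesis using assms by (simp add: polar_mul_left algebra_simps)
qed

lemma nrm_unit: "N e = 1"
proof -
  have "N e \<noteq> 0"
  proof
    assume "N e = 0"
    then have z: "N x = 0" if "x \<in> X" for x using nrm_mul[of e x] that by simp
    have "e = 0" by (rule nondeg) (simp_all add: polar_def z)
    then show False using unit_mul by simp
  qed
  then show ?thesis using nrm_mul[of e e] by simp
qed

text \<open>The quadratic equation that every element of a composition algebra satisfies.\<close>

lemma quadratic: "x \<in> X \<Longrightarrow> m x x = s (b x e) x - s (N x) e"
proof (rule polar_cancel)
  assume x: "x \<in> X"
  show "m x x \<in> X" "s (b x e) x - s (N x) e \<in> X" using x by simp_all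
  fix y assume y: "y \<in> X"
  have "b (m x x) y + b x (m x y) = b x e * b x y"
    using polar_mul_exchange[of x x e y] x y by simp
  moreover have "b x (m x y) = N x * b e y" using polar_mul_left[of x e y] x y by simp
  ultimately show "b (m x x) y = b (s (b x e) x - s (N x) e) y"
    using x y by (simp add: polar_diff polar_bilinear algebra_simps)
qed

abbreviation "cj \<equiv> conj_of C"

lemma conj_closed [simp]: "x \<in> X \<Longrightarrow> cj x \<in> X"
  by (simp add: conj_of_def)

lemma conj_add: "x \<in> X \<Longrightarrow> y \<in> X \<Longrightarrow> cj (x + y) = cj x + cj y"
  by (simp add: conj_of_def polar_bilinear V.scale_left_distrib)

lemma conj_scale: "x \<in> X \<Longrightarrow> cj (s c x) = s c (cj x)"
  by (simp add: conj_of_def polar_bilinear V.scale_right_diff_distrib)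

lemma conj_unit: "cj e = e"
proof -
  have "b e e = 2" by (simp add: polar_self nrm_unit)
  moreover have "s 2 e = e + e" using V.scale_left_distrib[of 1 1 e] by simp
  ultimately show ?thesis by (simp add: conj_of_def)
qed

lemma conj_conj: "x \<in> X \<Longrightarrow> cj (cj x) = x"
proof -
  assume x: "x \<in> X"
  have "b (cj x) e = b x e" using x
    by (simp add: conj_of_def polar_diff polar_bilinear polar_self nrm_unit)
  then show ?thesis by (simp add: conj_of_def)
qed

lemma polar_adjoint:
  assumes "x \<in> X" "y \<in> X" "z \<in> X"
  shows "b (m x y) z = b y (m (cj x) z)" "b (m x y) z = b x (m z (cj y))"
proof -
  have 1: "m (cj x) z = s (b x e) z - m x z"
    unfolding conj_of_def using assms by (simp add: mul_bilinear mul_diff)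
  have "b (m x y) z + b y (m x z) = b x e * b y z"
    using polar_mul_exchange[of x y e z] assms by simp
  then show "b (m x y) z = b y (m (cj x) z)"
    unfolding 1 using assms by (simp add: polar_sym[of y] polar_diff polar_bilinear eq_diff_eq)
  have 2: "m z (cj y) = s (b y e) z - m z y"
    unfolding conj_of_def using assms by (simp add: mul_bilinear mul_diff)
  have "b (m x y) z + b (m z y) x = b x z * b y e"
    using polar_mul_exchange[of x y z e] assms by simp
  then show "b (m x y) z = b x (m z (cj y))"
    unfolding 2 using assms by (simp add: polar_sym[of x] polar_diff polar_bilinear eq_diff_eq mult.commute)
qed

lemma conj_mul: "x \<in> X \<Longrightarrow> y \<in> X \<Longrightarrow> cj (m x y) = m (cj y) (cj x)"
proof (rule polar_cancel)
  assume x: "x \<in> X" and y: "y \<in> X"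
  show "cj (m x y) \<in> X" "m (cj y) (cj x) \<in> X" using x y by simp_all
  fix z assume z: "z \<in> X"
  have a: "b (cj u) z = b e (m u z)" if "u \<in> X" for u
    using polar_adjoint(2)[of e "cj u" z] polar_adjoint(1)[of "cj u" e z] that z by (simp add: conj_conj)
  have "b (cj (m x y)) z = b e (m (m x y) z)" using a x y by simp
  also have "\<dots> = b (cj z) (m x y)" using polar_adjoint(2)[of "m x y" z e] x y z by (simp add: polar_sym)
  also have "\<dots> = b (m (cj x) (cj z)) y"  using polar_adjoint(1)[of x y "cj z"] x y z by (simp add: polar_sym)
  also have "\<dots> = b (m (cj y) (cj x)) z"
  proof -
    have "b (m (cj x) (cj z)) y = b (cj x) (m y z)"
      using polar_adjoint(2)[of "cj x" "cj z" y] x y z by (simp add: conj_conj)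
    also have "\<dots> = b (m (cj y) (cj x)) z"
      using polar_adjoint(1)[of "cj y" "cj x" z] x y z by (simp add: conj_conj)
    finally show ?thesis .
  qed
  finally show "b (cj (m x y)) z = b (m (cj y) (cj x)) z" .
qed

end


lemma comp_alg_intro: "composition_algebra C \<Longrightarrow> comp_alg C"
  by (rule comp_alg.intro)

section \<open>Isomorphisms of composition algebras preserve the norm\<close>

lemma alg_iso_unit:
  assumes h: "alg_iso h C D" and C: "comp_alg C" and D: "comp_alg D"
  shows "h (unit C) = unit D"
proof -
  interpret C: comp_alg C by fact
  interpret D: comp_alg D by fact
  have bij: "bij_betw h (carrier C) (carrier D)" using h by (simp add: alg_iso_def lin_iso_def)
  then obtain x where x: "x \<in> carrier C" "h x = unit D" using D.closed(7) by (metis bij_betw_iff_bijections)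
  have "h (mul C x (unit C)) = mul D (h x) (h (unit C))" using h x C.closed(7) unfolding alg_iso_def by blast
  then show ?thesis using x C.unit_mul D.unit_mul(1)[of "h (unit C)"] bij_betw_apply[OF bij C.closed(7)] by simp
qed

text \<open>
  On the line of the unit the norm is the square of the scalar. Off this line the norm is a coefficient of the
  quadratic equation of the element, which an isomorphism preserves.
\<close>

lemma alg_iso_nrm:
  assumes h: "alg_iso h C D" and C: "comp_alg C" and D: "comp_alg D" and x: "x \<in> carrier C"
  shows "nrm D (h x) = nrm C x"
proof -
  interpret C: comp_alg C by fact
  interpret D: comp_alg D by fact
  have bij: "bij_betw h (carrier C) (carrier D)" using h by (simp add: alg_iso_def lin_iso_def)
  have hc: "h x \<in> carrier D" if "x \<in> carrier C" for x using bij that by (rule bij_betw_apply)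
  have add: "h (x + y) = h x + h y" if "x \<in> carrier C" "y \<in> carrier C" for x y
    using h that by (simp add: alg_iso_def lin_iso_def)
  have sc: "h (smul C c x) = smul D c (h x)" if "x \<in> carrier C" for x c
    using h that by (simp add: alg_iso_def lin_iso_def)
  have u: "h (unit C) = unit D" using h C D by (rule alg_iso_unit)
  have inj: "inj_on h (carrier C)" using bij by (simp add: bij_betw_def)
  show ?thesis
  proof (cases "\<exists>c. h x = smul D c (unit D)")
    case True
    then obtain c where c: "h x = smul D c (unit D)" by blast
    then have "h x = h (smul C c (unit C))" by (simp add: sc u)
    then have "x = smul C c (unit C)" using inj x by (simp add: inj_on_eq_iff)
    then show ?thesis using c by (simp add: C.nrm_scale D.nrm_scale C.nrm_unit D.nrm_unit)
  next
    case False
    let ?t = "polar (nrm C) x (unit C)" and ?t' = "polar (nrm D) (h x) (unit D)"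
    have "mul C x x + smul C (nrm C x) (unit C) = smul C ?t x" using C.quadratic[OF x] by simp
    then have "h (mul C x x + smul C (nrm C x) (unit C)) = h (smul C ?t x)" by simp
    moreover have "h (mul C x x) = mul D (h x) (h x)" using h x by (simp add: alg_iso_def)
    ultimately have "mul D (h x) (h x) + smul D (nrm C x) (unit D) = smul D ?t (h x)"
      using x by (simp add: add sc u)
    moreover have "mul D (h x) (h x) + smul D (nrm D (h x)) (unit D) = smul D ?t' (h x)"
      using D.quadratic[OF hc[OF x]] by simp
    ultimately have "smul D (nrm C x) (unit D) - smul D (nrm D (h x)) (unit D)
        = smul D ?t (h x) - smul D ?t' (h x)" by (metis add_diff_cancel_left)
    then have eq: "smul D (nrm C x - nrm D (h x)) (unit D) = smul D (?t - ?t') (h x)"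
      by (simp add: D.V.scale_left_diff_distrib)
    have "?t - ?t' = 0"
    proof (rule ccontr)
      assume nz: "?t - ?t' \<noteq> 0"
      have "h x = smul D (inverse (?t - ?t')) (smul D (?t - ?t') (h x))" using nz by simp
      then show False using False eq by (metis D.V.scale_scale)
    qed
    then have "smul D (nrm C x - nrm D (h x)) (unit D) = 0" using eq by simp
    then show ?thesis using D.unit_mul(3) by simp
  qed
qed

lemma alg_iso_polar:
  assumes h: "alg_iso h C D" and C: "comp_alg C" and D: "comp_alg D"
    and x: "x \<in> carrier C" and y: "y \<in> carrier C"
  shows "polar (nrm D) (h x) (h y) = polar (nrm C) x y"
proof -
  interpret C: comp_alg C by fact
  have "h (x + y) = h x + h y" using h x y by (simp add: alg_iso_def lin_iso_def)
  then show ?thesis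
    unfolding polar_def using alg_iso_nrm[OF h C D] x y C.closed(1)[OF x y] by metis
qed

lemma alg_iso_conj:
  assumes h: "alg_iso h C D" and C: "comp_alg C" and D: "comp_alg D" and x: "x \<in> carrier C"
  shows "h (conj_of C x) = conj_of D (h x)"
proof -
  interpret C: comp_alg C by fact
  interpret D: comp_alg D by fact
  have lin: "h (x + y) = h x + h y" "h (smul C c x) = smul D c (h x)"
    if "x \<in> carrier C" "y \<in> carrier C" for x y c
    using h that by (simp_all add: alg_iso_def lin_iso_def)
  have "h (y - x) = h y - h x" if "y \<in> carrier C" for y
    using lin(1)[of "y - x" x] that x by simp
  then show ?thesis
    unfolding conj_of_def using x
    by (simp add: lin(2)[OF C.closed(7) x] alg_iso_unit[OF h C D] alg_iso_polar[OF h C D x, of "unit C", simplified alg_iso_unit[OF h C D]])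
qed

section \<open>Quadratic composition algebras\<close>

lemma quad_ext_simps [simp]:
  "carrier (quad_ext d) = UNIV" "smul (quad_ext d) c (a, b) = (c * a, c * b)"
  "mul (quad_ext d) (a, b) (a', b') = (a * a' + d * b * b', a * b' + b * a')"
  "unit (quad_ext d) = (1, 0)" "nrm (quad_ext d) (a, b) = a\<^sup>2 - d * b\<^sup>2"
  by (simp_all add: quad_ext_def)

lemma polar_quad_ext: "polar (nrm (quad_ext d)) (a, b) (a', b') = 2 * (a * a' - d * b * b')"
  by (simp add: polar_def power2_eq_square algebra_simps)

lemma conj_quad_ext: "conj_of (quad_ext d) (a, b) = (a, - b)"
  by (simp add: conj_of_def polar_quad_ext)

lemma vector_space_quad_ext: "vector_space (smul (quad_ext (d :: 'k::field)))"
  by unfold_locales (auto simp: algebra_simps)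

lemma composition_algebra_quad_ext:
  assumes "(2 :: 'k::field) \<noteq> 0" "(d :: 'k) \<noteq> 0"
  shows "composition_algebra (quad_ext d)"
proof -
  interpret vector_space "smul (quad_ext d)" by (rule vector_space_quad_ext)
  have "vspace (quad_ext d)" by (simp add: vspace_def vector_space_quad_ext)
  moreover have "nondegenerate (quad_ext d) (nrm (quad_ext d))"
    unfolding nondegenerate_def
  proof (intro ballI impI)
    fix x :: "'k \<times> 'k" assume z: "\<forall>y\<in>carrier (quad_ext d). polar (nrm (quad_ext d)) x y = 0"
    obtain a b where x: "x = (a, b)" by (cases x)
    have "polar (nrm (quad_ext d)) x (1, 0) = 0" "polar (nrm (quad_ext d)) x (0, 1) = 0"
      using z by simp_all
    then show "x = 0" using assms by (simp add: x polar_quad_ext zero_prod_def)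
  qed
  moreover have "quadratic_form (quad_ext d) (nrm (quad_ext d))"
    unfolding quadratic_form_def by (auto simp: polar_quad_ext power2_eq_square algebra_simps)
  ultimately show ?thesis
    unfolding composition_algebra_def nalgebra_def
    by (auto simp: zero_prod_def power2_eq_square algebra_simps)
qed

text \<open>
  An element outside the line of the unit, corrected by half its trace, has trace zero, so its square is a scalar
  \<open>d\<close>. The norm is nondegenerate, so \<open>d\<close> is nonzero.
\<close>

lemma alg_iso_quad_ext:
  assumes K: "comp_alg (K :: ('k::field, 'a::ab_group_add) normed_alg)" and dim: "vdim K = 2" and k: "(2::'k) \<noteq> 0"
  shows "\<exists>d h. d \<noteq> 0 \<and> alg_iso h (quad_ext d) K"
proof -
  interpret comp_alg K by fact
  have sub: "V.subspace X" using vs by (simp add: vspace_def)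
  obtain B where B: "B \<subseteq> X" "V.independent B" "X \<subseteq> V.span B" "card B = 2"
    using V.basis_exists[of X] dim unfolding vdim_def by auto
  have span: "V.span B = X" using B sub by (simp add: V.span_minimal subset_antisym)
  have fin: "finite B" using B(4) by (metis card.infinite zero_neq_numeral)
  have "V.independent {e}" by simp
  have not1: "\<exists>x\<in>X. x \<notin> V.span {e}"
  proof (rule ccontr)
    assume "\<not> ?thesis"
    then have "B \<subseteq> V.span {e}" using B by blast
    then show False using V.independent_span_bound[of "{e}" B] B by auto
  qed
  then obtain u where uX: "u \<in> X" and u: "u \<notin> V.span {e}" by blast
  have ind: "V.independent {u, e}"
    using u by (simp add: V.independent_insert)
  have spant: "x \<in> V.span {u, e}" if "x \<in> X" for x
  proof (rule ccontr)
    assume x: "x \<notin> V.span {u, e}"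
    then have "V.independent {x, u, e}" using ind by (simp add: V.independent_insert)
    moreover have "{x, u, e} \<subseteq> V.span B" using that uX span by simp
    ultimately have "card {x, u, e} \<le> 2" using V.independent_span_bound[OF fin] B(4) by metis
    moreover have "x \<noteq> u" "x \<noteq> e" "u \<noteq> e" using x u by (auto intro: V.span_base)
    ultimately show False by simp
  qed
  define w where "w = u - s (b u e / 2) e"
  have wX: "w \<in> X" using uX by (simp add: w_def)
  have bee: "b e e = 2" by (simp add: polar_self nrm_unit)
  have we: "b w e = 0" using uX k by (simp add: w_def polar_diff polar_bilinear bee)
  have gen: "\<exists>a c. x = s a e + s c w" if x: "x \<in> X" for x
  proof -
    obtain c where "x - s c u \<in> V.span {e}" using spant[OF x] by (auto simp: V.span_insert)
    then obtain a where "x - s c u = s a e" by (auto simp: V.span_singleton)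
    then have "x = s a e + s c u" by (simp add: diff_eq_eq)
    then have "x = s (a + c * (b u e / 2)) e + s c w"
      by (simp add: w_def V.scale_left_distrib V.scale_right_diff_distrib)
    then show ?thesis by blast
  qed
  have w0: "w \<noteq> 0"
  proof
    assume "w = 0"
    then show False using u gen[OF uX] by (auto simp: V.span_singleton)
  qed
  define d where "d = - N w"
  have d0: "d \<noteq> 0"
  proof
    assume "d = 0"
    then have "N w = 0" by (simp add: d_def)
    have "w = 0"
    proof (rule nondeg[OF wX])
      fix y assume "y \<in> X"
      then obtain a c where "y = s a e + s c w" using gen by blast
      then show "b w y = 0" using wX \<open>N w = 0\<close> by (simp add: polar_bilinear we polar_self)
    qed
    then show False using w0 by simp
  qed
  have ww: "m w w = s d e" using quadratic[OF wX] by (simp add: we d_def)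
  define g where "g = (\<lambda>(a, c). s a e + s c w)"
  have inj: "inj g"
  proof (rule injI)
    fix x y assume eq: "g x = g y"
    obtain a c a' c' where xy: "x = (a, c)" "y = (a', c')" by (cases x, cases y)
    have 0: "s (a - a') e + s (c - c') w = 0"
      using eq by (simp add: g_def xy V.scale_left_diff_distrib algebra_simps)
    have "b (s (a - a') e + s (c - c') w) e = 2 * (a - a')" using wX by (simp add: polar_bilinear we bee)
    moreover have "b 0 e = 0" using polar_bilinear(3)[of e e 0] by simp
    ultimately have "a = a'" using k 0 by simp
    then have "s (c - c') w = 0" using 0 by simp
    then show "x = y" using w0 \<open>a = a'\<close> xy by simp
  qed
  have "bij_betw g UNIV X"
    unfolding bij_betw_def using inj gen wX by (auto simp: g_def image_def)
  moreover have "g (x + y) = g x + g y" for x y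
    by (cases x; cases y) (simp add: g_def V.scale_left_distrib)
  moreover have "g (smul (quad_ext d) c x) = s c (g x)" for c x
    by (cases x) (simp add: g_def V.scale_right_distrib)
  moreover have "g (mul (quad_ext d) x y) = m (g x) (g y)" for x y
  proof (cases x; cases y)
    fix a c a' c' assume xy: "x = (a, c)" "y = (a', c')"
    have "m (g x) (g y) = (s a (s a' e) + s c (s c' (s d e))) + (s a (s c' w) + s c (s a' w))"
      using wX by (simp add: g_def xy mul_bilinear ww V.scale_right_distrib add_ac mult_ac)
    also have "\<dots> = s (a * a' + d * c * c') e + s (a * c' + c * a') w"
      unfolding V.scale_scale V.scale_left_distrib by (simp add: mult.commute mult.left_commute)
    finally show "g (mul (quad_ext d) x y) = m (g x) (g y)" by (simp add: g_def xy)
  qed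
  ultimately have "alg_iso g (quad_ext d) K" by (simp add: alg_iso_def lin_iso_def)
  then show ?thesis using d0 by blast
qed

section \<open>Dimensions\<close>

text \<open>
  This counts the dimension of a space of matrices entry by entry: \<open>F l\<close> places a vector in position \<open>l\<close>, and
  \<open>\<pi> l\<close> reads it off.
\<close>

lemma (in vector_space) direct_sum_basis:
  fixes F :: "'i \<Rightarrow> 'c::ab_group_add \<Rightarrow> 'b" and \<pi> :: "'i \<Rightarrow> 'b \<Rightarrow> 'c" and sc :: "'a \<Rightarrow> 'c \<Rightarrow> 'c"
  assumes V: "vector_space sc" and I: "finite I"
    and \<pi>_add: "\<And>l x y. \<pi> l (x + y) = \<pi> l x + \<pi> l y" and \<pi>_scale: "\<And>l c x. \<pi> l (scale c x) = sc c (\<pi> l x)"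
    and same: "\<And>l x. l \<in> I \<Longrightarrow> x \<in> B l \<Longrightarrow> \<pi> l (F l x) = x"
    and other: "\<And>l l' x. l \<in> I \<Longrightarrow> l' \<in> I \<Longrightarrow> l \<noteq> l' \<Longrightarrow> x \<in> B l' \<Longrightarrow> \<pi> l (F l' x) = 0"
    and ind: "\<And>l. l \<in> I \<Longrightarrow> module.independent sc (B l)"
  shows "independent (\<Union>l\<in>I. F l ` B l)"
    and "(\<forall>l\<in>I. finite (B l)) \<Longrightarrow> card (\<Union>l\<in>I. F l ` B l) = (\<Sum>l\<in>I. card (B l))"
    and "l \<in> I \<Longrightarrow> finite (\<Union>l\<in>I. F l ` B l) \<Longrightarrow> finite (B l)"
proof -
  interpret V: vector_space sc by fact
  let ?S = "\<Union>l\<in>I. F l ` B l"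
  have \<pi>_sum: "\<pi> l (sum f t) = (\<Sum>x\<in>t. \<pi> l (f x))" for l and f :: "'b \<Rightarrow> 'b" and t
  proof -
    have "\<pi> l 0 = 0" using \<pi>_scale[of l 0 0] by simp
    then show ?thesis by (induction t rule: infinite_finite_induct) (auto simp: \<pi>_add)
  qed
  have inj: "inj_on (F l) (B l)" if "l \<in> I" for l by (rule inj_on_inverseI[of _ "\<pi> l"]) (simp add: same that)
  show "independent ?S"
    unfolding dependent_explicit
  proof (rule notI, elim exE conjE bexE)
    fix t u v0 assume t: "finite t" "t \<subseteq> ?S" "(\<Sum>v\<in>t. scale (u v) v) = 0" and v0: "v0 \<in> t" "u v0 \<noteq> 0"
    from t v0 obtain l b0 where l: "l \<in> I" "b0 \<in> B l" "v0 = F l b0" by blast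
    define tl where "tl = {b \<in> B l. F l b \<in> t}"
    have fin: "finite tl"
      using finite_vimage_IntI[OF t(1) inj[OF l(1)]] by (simp add: tl_def vimage_def Int_def conj_commute)
    have "0 = \<pi> l (\<Sum>v\<in>t. scale (u v) v)" using t(3) \<pi>_scale[of l 0 0] by simp
    also have "\<dots> = (\<Sum>v\<in>t. sc (u v) (\<pi> l v))" by (simp add: \<pi>_sum \<pi>_scale)
    also have "\<dots> = (\<Sum>v\<in>F l ` tl. sc (u v) (\<pi> l v))"
    proof (rule sum.mono_neutral_right[OF t(1)])
      show "F l ` tl \<subseteq> t" by (auto simp: tl_def)
      show "\<forall>v\<in>t - F l ` tl. sc (u v) (\<pi> l v) = 0"
      proof
        fix v assume v: "v \<in> t - F l ` tl"
        then obtain l' x where x: "l' \<in> I" "x \<in> B l'" "v = F l' x" using t(2) by blast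
        then have "l \<noteq> l'" using v by (auto simp: tl_def)
        then show "sc (u v) (\<pi> l v) = 0" using other[OF l(1) x(1)] x by simp
      qed
    qed
    also have "\<dots> = (\<Sum>x\<in>tl. sc (u (F l x)) x)"
    proof (subst sum.reindex)
      show "inj_on (F l) tl" using inj[OF l(1)] by (rule inj_on_subset) (auto simp: tl_def)
      show "sum ((\<lambda>v. sc (u v) (\<pi> l v)) \<circ> F l) tl = (\<Sum>x\<in>tl. sc (u (F l x)) x)"
        by (rule sum.cong) (auto simp: tl_def same[OF l(1)])
    qed
    finally have "(\<Sum>x\<in>tl. sc (u (F l x)) x) = 0" by simp
    moreover have "tl \<subseteq> B l" "b0 \<in> tl" "u (F l b0) \<noteq> 0" using l v0 by (auto simp: tl_def)
    ultimately show False
      using V.independentD[OF ind[OF l(1)] fin, where u = "\<lambda>x. u (F l x)" and v = b0] by simp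
  qed
  show "card ?S = (\<Sum>l\<in>I. card (B l))" if fin: "\<forall>l\<in>I. finite (B l)"
  proof -
    have 0: "0 \<notin> B l" if "l \<in> I" for l using ind[OF that] V.dependent_zero by blast
    have "card ?S = (\<Sum>l\<in>I. card (F l ` B l))"
    proof (rule card_UN_disjoint[OF I])
      show "\<forall>i\<in>I. finite (F i ` B i)" using fin by simp
      show "\<forall>i\<in>I. \<forall>j\<in>I. i \<noteq> j \<longrightarrow> F i ` B i \<inter> F j ` B j = {}"
      proof (intro ballI impI equals0I)
        fix i j v assume ij: "i \<in> I" "j \<in> I" "i \<noteq> j" and "v \<in> F i ` B i \<inter> F j ` B j"
        then obtain x y where "x \<in> B i" "y \<in> B j" "v = F i x" "v = F j y" by blast
        then have "x = 0" using same[OF ij(1)] other[OF ij] by metis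
        then show False using 0[OF ij(1)] \<open>x \<in> B i\<close> by simp
      qed
    qed
    also have "\<dots> = (\<Sum>l\<in>I. card (B l))" by (rule sum.cong[OF refl]) (simp add: card_image inj)
    finally show ?thesis .
  qed
  show "finite (B l)" if "l \<in> I" "finite ?S"
  proof -
    have "finite (F l ` B l)" using that I by (meson UN_upper finite_subset)
    then show ?thesis using finite_imageD inj[OF that(1)] by blast
  qed
qed

lemma vdim_iso:
  assumes h: "lin_iso h A B" and A: "vspace A" and B: "vspace B"
  shows "vdim A = vdim B"
proof -
  interpret a: vector_space "smul A" using A by (rule vspace_vector_space)
  interpret b: vector_space "smul B" using B by (rule vspace_vector_space)
  have bij: "bij_betw h (carrier A) (carrier B)" using h by (simp add: lin_iso_def)
  have add: "h (x + y) = h x + h y" if "x \<in> carrier A" "y \<in> carrier A" for x y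
    using h that by (simp add: lin_iso_def)
  have sc: "h (smul A c x) = smul B c (h x)" if "x \<in> carrier A" for x c
    using h that by (simp add: lin_iso_def)
  have sA: "a.subspace (carrier A)" using A by (simp add: vspace_def)
  have sB: "b.subspace (carrier B)" using B by (simp add: vspace_def)
  have h0: "h 0 = 0" using h A B by (rule lin_iso_zero)
  have hsum: "h (\<Sum>v\<in>t. smul A (u v) v) = (\<Sum>v\<in>t. smul B (u v) (h v)) \<and> (\<Sum>v\<in>t. smul A (u v) v) \<in> carrier A"
    if "finite t" "t \<subseteq> carrier A" for t u
    using that
  proof (induction t rule: finite_induct)
    case empty
    then show ?case using h0 a.subspace_0[OF sA] by simp
  next
    case (insert x t)
    then show ?case using a.subspace_scale[OF sA] a.subspace_add[OF sA] by (simp add: add sc)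
  qed
  obtain S where S: "S \<subseteq> carrier A" "a.independent S" "carrier A \<subseteq> a.span S" "card S = a.dim (carrier A)"
    by (rule a.basis_exists)
  have spanS: "a.span S = carrier A" using S sA by (simp add: a.span_minimal subset_antisym)
  have inj: "inj_on h S" using bij S(1) by (auto simp: bij_betw_def intro: inj_on_subset)
  have hS: "h ` S \<subseteq> carrier B" using bij S(1) by (auto simp: bij_betw_def)
  have ind: "b.independent (h ` S)"
    unfolding b.dependent_explicit
  proof (rule notI, elim exE conjE bexE)
    fix t u v assume t: "finite t" "t \<subseteq> h ` S" "(\<Sum>v\<in>t. smul B (u v) v) = 0" and v: "v \<in> t" "u v \<noteq> 0"
    from t(1,2) obtain t' where t': "finite t'" "t' \<subseteq> S" "t = h ` t'" by (metis finite_subset_image)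
    have injt: "inj_on h t'" using inj t'(2) by (rule inj_on_subset)
    have t'A: "t' \<subseteq> carrier A" using t'(2) S(1) by blast
    have "h (\<Sum>v\<in>t'. smul A (u (h v)) v) = (\<Sum>v\<in>t'. smul B (u (h v)) (h v))"
      by (rule hsum[OF t'(1) t'A, THEN conjunct1])
    also have "\<dots> = 0" using t(3) unfolding t'(3) sum.reindex[OF injt] by (simp add: o_def)
    finally have "h (\<Sum>v\<in>t'. smul A (u (h v)) v) = h 0" using h0 by simp
    moreover have "(\<Sum>v\<in>t'. smul A (u (h v)) v) \<in> carrier A"
      by (rule hsum[OF t'(1) t'A, THEN conjunct2])
    ultimately have "(\<Sum>v\<in>t'. smul A (u (h v)) v) = 0"
      using bij a.subspace_0[OF sA] by (metis bij_betw_imp_inj_on inj_onD)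
    moreover obtain v' where "v' \<in> t'" "v = h v'" using v t'(3) by blast
    ultimately show False
      using a.independentD[OF S(2) t'(1,2), where u = "\<lambda>v. u (h v)" and v = v'] v(2) by simp
  qed
  have "carrier B \<subseteq> b.span (h ` S)"
  proof
    fix y assume "y \<in> carrier B"
    then obtain x where x: "x \<in> carrier A" "y = h x" using bij by (metis bij_betw_iff_bijections)
    then have "x \<in> a.span S" using S(3) by blast
    then obtain t r where t: "finite t" "t \<subseteq> S" "x = (\<Sum>v\<in>t. smul A (r v) v)"
      unfolding a.span_explicit by blast
    have "t \<subseteq> carrier A" using t(2) S(1) by blast
    then have "y = (\<Sum>v\<in>t. smul B (r v) (h v))" unfolding x(2) t(3) by (rule hsum[OF t(1), THEN conjunct1])
    then show "y \<in> b.span (h ` S)"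
      using t(2) by (auto intro!: b.span_sum b.span_scale intro: b.span_base)
  qed
  then have "b.dim (carrier B) = card (h ` S)" using b.dim_unique[OF hS _ ind refl] by blast
  then show ?thesis using S(4) by (simp add: vdim_def card_image[OF inj])
qed

section \<open>Reduced Freudenthal algebras\<close>

lemma H3_simps [simp]:
  "carrier (H3 C \<gamma>) = {Y. (\<forall>i j. Y $ i $ j \<in> carrier C)
        \<and> (\<forall>i j. smul C (inverse (\<gamma> $ i) * \<gamma> $ j) (conj_of C (Y $ j $ i)) = Y $ i $ j)}"
  "smul (H3 C \<gamma>) c Y = (\<chi> i j. smul C c (Y $ i $ j))"
  "mul (H3 C \<gamma>) Y Z = (\<chi> i j. smul C (1 / 2) ((mat3_mul C Y Z + mat3_mul C Z Y) $ i $ j))"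
  by (simp_all add: H3_def)

context comp_alg
begin

lemma vector_space_H3: "vector_space (smul (H3 C \<gamma>))"
  by unfold_locales (simp_all add: vec_eq_iff V.scale_right_distrib V.scale_left_distrib)

lemma vspace_H3: "vspace (H3 C \<gamma>)"
proof -
  interpret W: vector_space "smul (H3 C \<gamma>)" by (rule vector_space_H3)
  have c0: "cj 0 = 0" using conj_scale[of 0 0] by simp
  have "W.subspace (carrier (H3 C \<gamma>))"
    unfolding W.subspace_def
  proof (intro conjI ballI allI)
    show "0 \<in> carrier (H3 C \<gamma>)" by (simp add: c0)
  next
    fix Y Z assume "Y \<in> carrier (H3 C \<gamma>)" "Z \<in> carrier (H3 C \<gamma>)"
    then show "Y + Z \<in> carrier (H3 C \<gamma>)" by (simp add: conj_add V.scale_right_distrib)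
  next
    fix c Y assume "Y \<in> carrier (H3 C \<gamma>)"
    then have Y: "Y $ i $ j \<in> X" "s (inverse (\<gamma> $ i) * \<gamma> $ j) (cj (Y $ j $ i)) = Y $ i $ j" for i j by auto
    have "s (inverse (\<gamma> $ i) * \<gamma> $ j) (cj (s c (Y $ j $ i))) = s c (Y $ i $ j)" for i j
      unfolding conj_scale[OF Y(1)] Y(2)[of i j, symmetric] by (rule V.scale_left_commute)
    then show "smul (H3 C \<gamma>) c Y \<in> carrier (H3 C \<gamma>)" using Y(1) by simp
  qed
  then show ?thesis by (simp add: vspace_def vector_space_H3)
qed

lemma sum_mem: "(\<And>i. i \<in> I \<Longrightarrow> f i \<in> X) \<Longrightarrow> sum f I \<in> X"
  by (induction I rule: infinite_finite_induct) auto

lemma conj_sum: "(\<And>i. i \<in> I \<Longrightarrow> f i \<in> X) \<Longrightarrow> cj (sum f I) = (\<Sum>i\<in>I. cj (f i))"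
proof (induction I rule: infinite_finite_induct)
  case (insert x F)
  then show ?case by (simp add: conj_add sum_mem)
qed (use conj_scale[of 0 0] in simp_all)

lemma nalgebra_H3:
  assumes \<gamma>: "\<forall>i. \<gamma> $ i \<noteq> 0"
  shows "nalgebra (H3 C \<gamma>)"
proof -
  let ?H = "H3 C \<gamma>"
  have mm: "\<forall>i j. mat3_mul C Y Z $ i $ j \<in> X" if "Y \<in> carrier ?H" "Z \<in> carrier ?H" for Y Z
    using that by (auto simp: mat3_mul_def intro: sum_mem)
  have star: "s (inverse (\<gamma> $ i) * \<gamma> $ j) (cj (mat3_mul C Y Z $ j $ i)) = mat3_mul C Z Y $ i $ j"
    if Y: "Y \<in> carrier ?H" and Z: "Z \<in> carrier ?H" for Y Z i j
  proof -
    have c: "Y $ i $ j \<in> X" "Z $ i $ j \<in> X" for i j using Y Z by auto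
    have "s (inverse (\<gamma> $ i) * \<gamma> $ j) (m (cj (Z $ l $ i)) (cj (Y $ j $ l))) = m (Z $ i $ l) (Y $ l $ j)" for l
    proof -
      have "m (Z $ i $ l) (Y $ l $ j)
          = m (s (inverse (\<gamma> $ i) * \<gamma> $ l) (cj (Z $ l $ i))) (s (inverse (\<gamma> $ l) * \<gamma> $ j) (cj (Y $ j $ l)))"
        using Y Z by auto
      also have "\<dots> = s (inverse (\<gamma> $ i) * \<gamma> $ l * (inverse (\<gamma> $ l) * \<gamma> $ j)) (m (cj (Z $ l $ i)) (cj (Y $ j $ l)))"
        using c by (simp add: mul_bilinear)
      also have "inverse (\<gamma> $ i) * \<gamma> $ l * (inverse (\<gamma> $ l) * \<gamma> $ j) = inverse (\<gamma> $ i) * \<gamma> $ j"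
        using \<gamma> by simp
      finally show ?thesis by simp
    qed
    then show ?thesis
      using c by (simp add: mat3_mul_def conj_sum conj_mul V.scale_sum_right)
  qed
  have bil: "mat3_mul C (Y + Y') Z = mat3_mul C Y Z + mat3_mul C Y' Z"
    "mat3_mul C Z (Y + Y') = mat3_mul C Z Y + mat3_mul C Z Y'"
    "mat3_mul C (smul ?H c Y) Z = smul ?H c (mat3_mul C Y Z)"
    "mat3_mul C Z (smul ?H c Y) = smul ?H c (mat3_mul C Z Y)"
    if "Y \<in> carrier ?H" "Y' \<in> carrier ?H" "Z \<in> carrier ?H" for Y Y' Z c
    using that by (simp_all add: vec_eq_iff mat3_mul_def mul_bilinear sum.distrib V.scale_sum_right)
  show ?thesis unfolding nalgebra_def
  proof (intro conjI ballI allI)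
    show "vspace ?H" by (rule vspace_H3)
  next
    fix Y Z assume YZ: "Y \<in> carrier ?H" "Z \<in> carrier ?H"
    have "s (inverse (\<gamma> $ i) * \<gamma> $ j) (cj (s (1 / 2) (mat3_mul C Y Z $ j $ i + mat3_mul C Z Y $ j $ i)))
      = s (1 / 2) (mat3_mul C Y Z $ i $ j + mat3_mul C Z Y $ i $ j)" for i j
    proof -
      have "s (inverse (\<gamma> $ i) * \<gamma> $ j) (cj (s (1 / 2) (mat3_mul C Y Z $ j $ i + mat3_mul C Z Y $ j $ i)))
         = s (1 / 2) (s (inverse (\<gamma> $ i) * \<gamma> $ j) (cj (mat3_mul C Y Z $ j $ i)) + s (inverse (\<gamma> $ i) * \<gamma> $ j) (cj (mat3_mul C Z Y $ j $ i)))"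
        using mm YZ by (simp add: conj_scale conj_add V.scale_right_distrib mult.commute)
      then show ?thesis using star YZ by (simp add: add.commute)
    qed
    then show "mul ?H Y Z \<in> carrier ?H" using mm YZ by simp
  next
    fix Y Y' Z assume "Y \<in> carrier ?H" "Y' \<in> carrier ?H" "Z \<in> carrier ?H"
    then show "mul ?H (Y + Y') Z = mul ?H Y Z + mul ?H Y' Z" "mul ?H Z (Y + Y') = mul ?H Z Y + mul ?H Z Y'"
      by (simp_all add: vec_eq_iff bil V.scale_right_distrib del: H3_simps(1))
  next
    fix c Y Z assume YZ: "Y \<in> carrier ?H" "Z \<in> carrier ?H"
    show "mul ?H (smul ?H c Y) Z = smul ?H c (mul ?H Y Z)" "mul ?H Y (smul ?H c Z) = smul ?H c (mul ?H Y Z)"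
      using bil(3,4)[OF YZ(1) YZ(1) YZ(2)] bil(3,4)[OF YZ(2) YZ(2) YZ(1)]
      by (simp_all add: vec_eq_iff V.scale_right_distrib mult.commute del: H3_simps(1))
  qed
qed

end

lemma H3_iso:
  fixes K :: "('k::field, 'a::ab_group_add) normed_alg" and K' :: "('k, 'b::ab_group_add) normed_alg"
  assumes h: "alg_iso h K K'" and K: "comp_alg K" and K': "comp_alg K'"
  shows "H3 K \<gamma> \<simeq>\<^sub>a H3 K' \<gamma>"
proof -
  interpret K: comp_alg K by fact
  interpret K': comp_alg K' by fact
  have bij: "bij_betw h (carrier K) (carrier K')" using h by (simp add: alg_iso_def lin_iso_def)
  have inj: "h x = h y \<longleftrightarrow> x = y" if "x \<in> carrier K" "y \<in> carrier K" for x y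
    using bij that unfolding bij_betw_def by (meson inj_on_eq_iff)
  have lin: "h (x + y) = h x + h y" "h (smul K c x) = smul K' c (h x)" "h (mul K x y) = mul K' (h x) (h y)"
    if "x \<in> carrier K" "y \<in> carrier K" for x y c
    using h that by (simp_all add: alg_iso_def lin_iso_def)
  have lin2: "h (smul K c x) = smul K' c (h x)" if "x \<in> carrier K" for x c
    using h that by (simp add: alg_iso_def lin_iso_def)
  have cj: "h (conj_of K x) = conj_of K' (h x)" if "x \<in> carrier K" for x by (rule alg_iso_conj[OF h K K' that])
  have hc: "h x \<in> carrier K'" if "x \<in> carrier K" for x using bij that by (rule bij_betw_apply)
  have h0: "h 0 = 0" using lin(2)[OF K.closed(3) K.closed(3), of 0] by simp
  have hsum: "h (sum f I) = (\<Sum>i\<in>I. h (f i))" if "\<And>i. i \<in> I \<Longrightarrow> f i \<in> carrier K" for f and I :: "3 set"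
    using that by (induction I rule: infinite_finite_induct) (auto simp: h0 lin K.sum_mem)
  define H where "H Y = (\<chi> i j. h (Y $ i $ j))" for Y :: "'a ^ 3 ^ 3"
  have HH: "H Y \<in> carrier (H3 K' \<gamma>) \<longleftrightarrow> Y \<in> carrier (H3 K \<gamma>)" if "\<forall>i j. Y $ i $ j \<in> carrier K" for Y
  proof -
    have "smul K' a (conj_of K' (h (Y $ j $ i))) = h (Y $ i $ j) \<longleftrightarrow> smul K a (conj_of K (Y $ j $ i)) = Y $ i $ j" for a i j
    proof -
      have Yc: "Y $ i $ j \<in> carrier K" for i j using that by simp
      have "h (smul K a (conj_of K (Y $ j $ i))) = smul K' a (conj_of K' (h (Y $ j $ i)))"
        unfolding lin2[OF K.conj_closed[OF Yc]] cj[OF Yc] ..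
      then show ?thesis using inj[OF K.closed(2)[OF K.conj_closed[OF Yc]] Yc] by metis
    qed
    then show ?thesis using that by (simp add: H_def hc)
  qed
  have mm: "\<forall>i j. mat3_mul K Y Z $ i $ j \<in> carrier K" if "Y \<in> carrier (H3 K \<gamma>)" "Z \<in> carrier (H3 K \<gamma>)" for Y Z
    using that by (auto simp: mat3_mul_def intro: K.sum_mem)
  have hm: "h (mat3_mul K Y Z $ i $ j) = mat3_mul K' (H Y) (H Z) $ i $ j"
    if "Y \<in> carrier (H3 K \<gamma>)" "Z \<in> carrier (H3 K \<gamma>)" for Y Z i j
    using that by (simp add: mat3_mul_def H_def hsum lin)
  have "bij_betw H (carrier (H3 K \<gamma>)) (carrier (H3 K' \<gamma>))"
  proof (rule bij_betw_imageI)
    show "inj_on H (carrier (H3 K \<gamma>))"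
      by (rule inj_onI) (auto simp: H_def vec_eq_iff inj)
    show "H ` carrier (H3 K \<gamma>) = carrier (H3 K' \<gamma>)"
    proof
      show "H ` carrier (H3 K \<gamma>) \<subseteq> carrier (H3 K' \<gamma>)"
      proof
        fix Z assume "Z \<in> H ` carrier (H3 K \<gamma>)"
        then obtain Y where Y: "Y \<in> carrier (H3 K \<gamma>)" "Z = H Y" by blast
        then have "\<forall>i j. Y $ i $ j \<in> carrier K" by simp
        from HH[OF this] show "Z \<in> carrier (H3 K' \<gamma>)" using Y by blast
      qed
      show "carrier (H3 K' \<gamma>) \<subseteq> H ` carrier (H3 K \<gamma>)"
      proof
        fix Z assume Z: "Z \<in> carrier (H3 K' \<gamma>)"
        define Y where "Y = (\<chi> i j. inv_into (carrier K) h (Z $ i $ j))"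
        have Yc: "\<forall>i j. Y $ i $ j \<in> carrier K"
          using Z bij_betw_apply[OF bij_betw_inv_into[OF bij]] by (simp add: Y_def)
        have HY: "H Y = Z" using Z bij_betw_inv_into_right[OF bij] by (simp add: H_def Y_def vec_eq_iff)
        then show "Z \<in> H ` carrier (H3 K \<gamma>)" using HH[OF Yc] Z by blast
      qed
    qed
  qed
  moreover have "H (Y + Z) = H Y + H Z" if "Y \<in> carrier (H3 K \<gamma>)" "Z \<in> carrier (H3 K \<gamma>)" for Y Z
    using that by (simp add: H_def vec_eq_iff lin)
  moreover have "H (smul (H3 K \<gamma>) c Y) = smul (H3 K' \<gamma>) c (H Y)" if "Y \<in> carrier (H3 K \<gamma>)" for c Y
    using that by (simp add: H_def vec_eq_iff lin2)
  moreover have "H (mul (H3 K \<gamma>) Y Z) = mul (H3 K' \<gamma>) (H Y) (H Z)"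
    if YZ: "Y \<in> carrier (H3 K \<gamma>)" "Z \<in> carrier (H3 K \<gamma>)" for Y Z
  proof -
    have "h (smul K (1 / 2) (mat3_mul K Y Z $ i $ j + mat3_mul K Z Y $ i $ j))
        = smul K' (1 / 2) (mat3_mul K' (H Y) (H Z) $ i $ j + mat3_mul K' (H Z) (H Y) $ i $ j)" for i j
      using mm[OF YZ] mm[OF YZ(2,1)] unfolding hm[OF YZ, symmetric] hm[OF YZ(2,1), symmetric]
      by (simp add: lin2 lin(1))
    then show ?thesis by (simp add: vec_eq_iff) (simp add: H_def)
  qed
  ultimately have "alg_iso H (H3 K \<gamma>) (H3 K' \<gamma>)" unfolding alg_iso_def lin_iso_def by blast
  then show ?thesis unfolding alg_isomorphic_def by blast
qed

context comp_alg
begin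

definition H3_unit :: "('k ^ 3) \<Rightarrow> 3 \<times> 3 \<Rightarrow> 'a \<Rightarrow> 'a ^ 3 ^ 3" where
  "H3_unit \<gamma> l x = (\<chi> i j. if (i, j) = l then x
     else if (j, i) = l then s (inverse (\<gamma> $ i) * \<gamma> $ j) (cj x) else 0)"

lemma H3_unit_closed:
  assumes \<gamma>: "\<forall>i. \<gamma> $ i \<noteq> 0" and x: "x \<in> X" and l: "fst l = snd l \<Longrightarrow> cj x = x"
  shows "H3_unit \<gamma> l x \<in> carrier (H3 C \<gamma>)"
proof -
  have c0: "cj 0 = 0" using conj_scale[of 0 0] by simp
  obtain a b where ab: "l = (a, b)" by (cases l)
  have "s (inverse (\<gamma> $ i) * \<gamma> $ j) (cj (H3_unit \<gamma> l x $ j $ i)) = H3_unit \<gamma> l x $ i $ j" for i j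
  proof -
    have l': "a = b \<Longrightarrow> cj x = x" using l ab by simp
    have inv: "inverse (\<gamma> $ i) * \<gamma> $ j * (inverse (\<gamma> $ j) * \<gamma> $ i) = 1" for i j using \<gamma> by (simp add: field_simps)
    consider "i = a" "j = b" "a \<noteq> b" | "i = b" "j = a" "a \<noteq> b" | "i = a" "j = b" "a = b"
      | "(i, j) \<noteq> (a, b)" "(j, i) \<noteq> (a, b)" by (cases "a = b") auto
    then show ?thesis
    proof cases
      case 1 then show ?thesis using x by (simp add: H3_unit_def ab conj_scale conj_conj inv)
    next
      case 2 then show ?thesis by (simp add: H3_unit_def ab)
    next
      case 3
      then have e: "cj x = x" "a = i" "b = i" "j = i" using l' by auto
      show ?thesis unfolding ab e(2-4) using \<gamma> by (simp add: H3_unit_def e(1))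
    next
      case 4
      then have "H3_unit \<gamma> l x $ i $ j = 0" "H3_unit \<gamma> l x $ j $ i = 0"
        unfolding H3_unit_def ab vec_lambda_beta by metis+
      then show ?thesis by (simp add: c0)
    qed
  qed
  moreover have "H3_unit \<gamma> l x $ i $ j \<in> X" for i j using x by (simp add: H3_unit_def)
  ultimately show ?thesis by simp
qed

text \<open>
  The diagonal entries are fixed by the conjugation, hence scalars because 2 is invertible, and the three
  entries above the diagonal are arbitrary. So the dimension is \<open>3 (dim C + 1)\<close>.
\<close>

lemma vdim_H3:
  assumes \<gamma>: "\<forall>i. \<gamma> $ i \<noteq> 0" and k: "(2::'k) \<noteq> 0"
  shows "vdim (H3 C \<gamma>) = 9 \<longleftrightarrow> vdim C = 2"
proof -
  interpret W: vector_space "smul (H3 C \<gamma>)" by (rule vector_space_H3)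
  obtain B where B: "B \<subseteq> X" "V.independent B" "X \<subseteq> V.span B" "card B = V.dim X"
    by (rule V.basis_exists)
  define I :: "(3 \<times> 3) set" where "I = {(1, 1), (2, 2), (3, 3), (1, 2), (1, 3), (2, 3)}"
  define BB where "BB l = (if fst l = snd l then {e} else B)" for l :: "3 \<times> 3"
  let ?F = "H3_unit \<gamma>"
  define \<pi> where "\<pi> l Y = Y $ fst l $ snd l" for l :: "3 \<times> 3" and Y :: "'a ^ 3 ^ 3"
  let ?S = "\<Union>l\<in>I. ?F l ` BB l"
  have fin: "finite I" by (simp add: I_def)
  have same: "\<pi> l (?F l x) = x" for l x by (simp add: \<pi>_def H3_unit_def)
  have other: "\<pi> l (?F l' x) = 0" if "l \<in> I" "l' \<in> I" "l \<noteq> l'" for l l' x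
    using that by (auto simp: I_def \<pi>_def H3_unit_def)
  have ind: "V.independent (BB l)" for l by (simp add: BB_def B)
  have base: "V.independent {e}" by simp
  have \<pi>_lin: "\<pi> l (Y + Z) = \<pi> l Y + \<pi> l Z" "\<pi> l (smul (H3 C \<gamma>) c Y) = s c (\<pi> l Y)" for l Y Z c
    by (simp_all add: \<pi>_def)
  note dsb = W.direct_sum_basis[where \<pi> = \<pi> and F = ?F and I = I and B = BB, OF V.vector_space_axioms fin
      \<pi>_lin same other ind]
  have BX: "BB l \<subseteq> X" for l using B by (auto simp: BB_def)
  have SH: "?S \<subseteq> carrier (H3 C \<gamma>)"
  proof
    fix v assume "v \<in> ?S"
    then obtain l x where l: "x \<in> BB l" "v = ?F l x" by blast
    moreover have "x \<in> X" using l BX by blast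
    moreover have "fst l = snd l \<Longrightarrow> cj x = x" using l by (simp add: BB_def conj_unit)
    ultimately show "v \<in> carrier (H3 C \<gamma>)" using H3_unit_closed[OF \<gamma>] by blast
  qed
  have add: "?F l (x + y) = ?F l x + ?F l y" if "x \<in> X" "y \<in> X" for l x y
    using that by (simp add: H3_unit_def vec_eq_iff conj_add V.scale_right_distrib)
  have sc: "?F l (s c x) = smul (H3 C \<gamma>) c (?F l x)" if "x \<in> X" for l c x
    using that by (simp add: H3_unit_def vec_eq_iff conj_scale mult.commute)
  have F0: "?F l 0 = 0" for l using sc[of 0 l 0] by (simp add: vec_eq_iff)
  have Fspan: "?F l x \<in> W.span ?S" if l: "l \<in> I" and x: "x \<in> V.span (BB l)" for l x
  proof -
    have "V.subspace {x \<in> X. ?F l x \<in> W.span ?S}"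
      unfolding V.subspace_def by (auto simp: F0 W.span_zero add sc W.span_add W.span_scale simp del: H3_simps)
    moreover have "BB l \<subseteq> {x \<in> X. ?F l x \<in> W.span ?S}"
      using BX[of l] l by (auto intro!: W.span_base)
    ultimately have "V.span (BB l) \<subseteq> {x \<in> X. ?F l x \<in> W.span ?S}" by (rule V.span_minimal[rotated])
    then show ?thesis using x by blast
  qed
  have HS: "carrier (H3 C \<gamma>) \<subseteq> W.span ?S"
  proof
    fix Y assume "Y \<in> carrier (H3 C \<gamma>)"
    then have Y: "Y $ i $ j \<in> X" "s (inverse (\<gamma> $ i) * \<gamma> $ j) (cj (Y $ j $ i)) = Y $ i $ j" for i j by auto
    have diag: "Y $ i $ i \<in> V.span {e}" for i
    proof -
      have "cj (Y $ i $ i) = Y $ i $ i" using Y(2)[of i i] \<gamma> by simp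
      then have "s (b (Y $ i $ i) e) e = Y $ i $ i + Y $ i $ i" by (simp add: conj_of_def diff_eq_eq)
      also have "\<dots> = s 2 (Y $ i $ i)" using V.scale_left_distrib[of 1 1 "Y $ i $ i"] by simp
      finally have "s (1 / 2) (s (b (Y $ i $ i) e) e) = s (1 / 2) (s 2 (Y $ i $ i))" by simp
      then have "Y $ i $ i = s (b (Y $ i $ i) e / 2) e" using k by simp
      then show ?thesis by (auto simp: V.span_singleton)
    qed
    have "Y = (\<Sum>l\<in>I. ?F l (\<pi> l Y))"
      unfolding vec_eq_iff forall_3 using Y(2)[of 2 1] Y(2)[of 3 1] Y(2)[of 3 2]
      by (simp add: I_def H3_unit_def \<pi>_def)
    also have "\<dots> \<in> W.span ?S"
    proof (rule W.span_sum)
      fix l assume l: "l \<in> I"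
      have "\<pi> l Y \<in> V.span (BB l)"
        using diag Y(1) B(3) by (cases l) (auto simp: \<pi>_def BB_def)
      then show "?F l (\<pi> l Y) \<in> W.span ?S" using Fspan l by blast
    qed
    finally show "Y \<in> W.span ?S" .
  qed
  have dim: "vdim (H3 C \<gamma>) = card ?S"
    unfolding vdim_def using W.dim_unique[OF SH HS dsb(1) refl] by simp
  have card: "card ?S = 3 + 3 * card B" if "finite B"
  proof -
    have "card ?S = (\<Sum>l\<in>I. card (BB l))" using that by (intro dsb(2)) (auto simp: BB_def)
    then show ?thesis by (simp add: I_def BB_def)
  qed
  show ?thesis
  proof
    assume "vdim (H3 C \<gamma>) = 9"
    then have "card ?S = 9" using dim by simp
    moreover have "finite ?S" using \<open>card ?S = 9\<close> by (intro card_ge_0_finite) simp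
    then have "finite (BB (1, 2))" by (intro dsb(3)) (simp_all add: I_def)
    then have "finite B" by (simp add: BB_def)
    ultimately show "vdim C = 2" using card B(4) by (simp add: vdim_def)
  next
    assume "vdim C = 2"
    then have "card B = 2" using B(4) by (simp add: vdim_def)
    moreover have "finite B" using \<open>card B = 2\<close> by (intro card_ge_0_finite) simp
    ultimately show "vdim (H3 C \<gamma>) = 9" using dim card by simp
  qed
qed

end

section \<open>The quadratic space of a norm form\<close>

lemma fourfold_simps [simp]:
  "carrier (fourfold K) = {z. \<forall>i. z $ i \<in> carrier K}" "smul (fourfold K) c z = (\<chi> i. smul K c (z $ i))"
  by (simp_all add: fourfold_def)

lemma isometric_fourfold:
  assumes h: "alg_iso h K K'" and K: "comp_alg K" and K': "comp_alg K'"
  shows "isometric (fourfold K) (norm_tensor K c) (fourfold K') (norm_tensor K' c)"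
proof -
  interpret K: comp_alg K by fact
  interpret K': comp_alg K' by fact
  have bij: "bij_betw h (carrier K) (carrier K')" using h by (simp add: alg_iso_def lin_iso_def)
  have inj: "h x = h y \<longleftrightarrow> x = y" if "x \<in> carrier K" "y \<in> carrier K" for x y
    using bij that unfolding bij_betw_def by (meson inj_on_eq_iff)
  have hc: "h x \<in> carrier K'" if "x \<in> carrier K" for x using bij that by (rule bij_betw_apply)
  define H where "H z = (\<chi> i. h (z $ i))" for z :: "_ ^ 4"
  have "bij_betw H (carrier (fourfold K)) (carrier (fourfold K'))"
  proof (rule bij_betw_imageI)
    show "inj_on H (carrier (fourfold K))" by (rule inj_onI) (auto simp: H_def vec_eq_iff inj)
    show "H ` carrier (fourfold K) = carrier (fourfold K')"
    proof
      show "H ` carrier (fourfold K) \<subseteq> carrier (fourfold K')" by (auto simp: H_def hc)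
      show "carrier (fourfold K') \<subseteq> H ` carrier (fourfold K)"
      proof
        fix z assume z: "z \<in> carrier (fourfold K')"
        let ?y = "\<chi> i. inv_into (carrier K) h (z $ i)"
        have "?y \<in> carrier (fourfold K)" using z bij_betw_apply[OF bij_betw_inv_into[OF bij]] by simp
        moreover have "H ?y = z" using z bij_betw_inv_into_right[OF bij] by (simp add: H_def vec_eq_iff)
        ultimately show "z \<in> H ` carrier (fourfold K)" by (metis imageI)
      qed
    qed
  qed
  moreover have "H (x + y) = H x + H y" if "x \<in> carrier (fourfold K)" "y \<in> carrier (fourfold K)" for x y
    using that h by (simp add: H_def vec_eq_iff alg_iso_def lin_iso_def)
  moreover have "H (smul (fourfold K) a x) = smul (fourfold K') a (H x)" if "x \<in> carrier (fourfold K)" for a x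
    using that h by (simp add: H_def vec_eq_iff alg_iso_def lin_iso_def)
  moreover have "norm_tensor K' c (H x) = norm_tensor K c x" if "x \<in> carrier (fourfold K)" for x
    using that by (simp add: H_def norm_tensor_def alg_iso_nrm[OF h K K'])
  ultimately show ?thesis unfolding isometric_def lin_iso_def by blast
qed

lemma vspace_fourfold:
  assumes "comp_alg K" shows "vspace (fourfold K)"
proof -
  interpret comp_alg K by fact
  have "vector_space (smul (fourfold K))"
    by unfold_locales (simp_all add: vec_eq_iff V.scale_right_distrib V.scale_left_distrib)
  moreover from this interpret F: vector_space "smul (fourfold K)" .
  have "F.subspace (carrier (fourfold K))" unfolding F.subspace_def by simp
  ultimately show ?thesis by (simp add: vspace_def)
qed

section \<open>Witt extension for hermitian spaces\<close>

locale quad_space = vector_space scale for scale :: "'k::field \<Rightarrow> 'v::ab_group_add \<Rightarrow> 'v" +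
  fixes q :: "'v \<Rightarrow> 'k"
  assumes q_scale: "q (scale c x) = c\<^sup>2 * q x"
    and polar_add: "polar q (x + y) z = polar q x z + polar q y z"
    and polar_scale: "polar q (scale c x) y = c * polar q x y"
    and two: "(2::'k) \<noteq> 0"
begin

abbreviation "b \<equiv> polar q"

lemma b_sym: "b x y = b y x"
  by (simp add: polar_def add.commute)

lemma b_right: "b z (x + y) = b z x + b z y" "b y (scale c x) = c * b y x"
  using polar_add polar_scale by (simp_all add: b_sym)

lemma b_neg: "b (- x) y = - b x y" "b y (- x) = - b y x"
  using polar_scale[of "- 1" x y] b_right(2)[of y "- 1" x] by simp_all

lemma b_diff: "b (x - y) z = b x z - b y z" "b z (x - y) = b z x - b z y"
  using polar_add[of x "- y" z] b_right(1)[of z x "- y"] by (simp_all add: b_neg)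

lemma b_self: "b x x = 2 * q x"
proof -
  have "x + x = scale 2 x" using scale_left_distrib[of 1 1 x] by simp
  then show ?thesis using q_scale[of 2 x] by (simp add: polar_def)
qed

lemma q_neg: "q (- x) = q x"
  using q_scale[of "- 1" x] by simp

lemma q_add: "q (x + y) = q x + q y + b x y"
  by (simp add: polar_def)

definition isometry :: "('v \<Rightarrow> 'k) \<Rightarrow> ('v \<Rightarrow> 'v) \<Rightarrow> bool" where
  "isometry p f \<longleftrightarrow> bij f \<and> (\<forall>x y. f (x + y) = f x + f y) \<and> (\<forall>c x. f (scale c x) = scale c (f x))
     \<and> (\<forall>x. q (f x) = p x)"

lemma isometry_comp: "isometry p f \<Longrightarrow> isometry q g \<Longrightarrow> isometry p (g \<circ> f)"
  by (auto simp: isometry_def intro: bij_comp)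

definition reflect :: "'v \<Rightarrow> 'v \<Rightarrow> 'v" where
  "reflect u x = x - scale (b x u / q u) u"

lemma reflect_fix: "b x u = 0 \<Longrightarrow> reflect u x = x"
  by (simp add: reflect_def)

lemma isometry_reflect:
  assumes u: "q u \<noteq> 0"
  shows "isometry q (reflect u)"
proof -
  have add: "reflect u (x + y) = reflect u x + reflect u y" for x y
    by (simp add: reflect_def polar_add scale_left_distrib add_divide_distrib algebra_simps)
  have sc: "reflect u (scale c x) = scale c (reflect u x)" for c x
    by (simp add: reflect_def polar_scale scale_right_diff_distrib)
  have "reflect u (reflect u x) = x" for x
  proof -
    have "b (reflect u x) u = - b x u"
      using u by (simp add: reflect_def b_diff polar_scale b_self)
    then show ?thesis unfolding reflect_def[of u "reflect u x"] by (simp add: reflect_def)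
  qed
  then have "bij (reflect u)" by (rule involuntory_imp_bij)
  moreover have "q (reflect u x) = q x" for x
  proof -
    have "q (reflect u x) = q x + (b x u / q u)\<^sup>2 * q u - b x u / q u * b x u"
      unfolding reflect_def diff_conv_add_uminus q_add by (simp add: q_neg q_scale b_neg b_right)
    also have "(b x u / q u)\<^sup>2 * q u = b x u / q u * b x u" using u by (simp add: power2_eq_square)
    finally show ?thesis by simp
  qed
  ultimately show ?thesis by (simp add: isometry_def add sc)
qed

text \<open>
  A vector can be moved to any other vector of the same nonzero length by at most two reflections: if
  \<open>a - c\<close> is isotropic, then \<open>a + c\<close> is not, and the reflection in it takes \<open>a\<close> to \<open>- c\<close>.
\<close>

lemma witt_move:
  assumes eq: "q a = q c" and nz: "q c \<noteq> 0"
  shows "\<exists>\<rho>. isometry q \<rho> \<and> \<rho> a = c \<and> (\<forall>x. b x a = 0 \<longrightarrow> b x c = 0 \<longrightarrow> \<rho> x = x)"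
proof (cases "q (a - c) = 0")
  case False
  have "b a (a - c) = q (a - c)"
    using eq q_add[of a "- c"] by (simp add: b_diff b_neg b_self q_neg)
  then have "reflect (a - c) a = c" using False by (simp add: reflect_def)
  then show ?thesis using isometry_reflect[OF False] reflect_fix by (auto simp: b_diff)
next
  case True
  have "q (a + c) + q (a - c) = 4 * q c"
    using eq unfolding diff_conv_add_uminus q_add by (simp add: q_neg b_neg)
  moreover have "(4::'k) \<noteq> 0" using two by (metis mult_eq_0_iff numeral_times_numeral semiring_norm(12) semiring_norm(11) semiring_norm(13))
  ultimately have ac: "q (a + c) \<noteq> 0" using True nz by simp
  have "b a (a + c) = q (a + c)" using eq by (simp add: q_add b_right b_self)
  then have 1: "reflect (a + c) a = - c" using ac by (simp add: reflect_def)
  have 2: "reflect c (- c) = c"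
    using nz scale_left_distrib[of 1 1 c] by (simp add: reflect_def b_neg b_self)
  have "isometry q (reflect c \<circ> reflect (a + c))"
    by (intro isometry_comp isometry_reflect ac nz)
  then show ?thesis using 1 2 reflect_fix by (intro exI[of _ "reflect c \<circ> reflect (a + c)"]) (auto simp: b_right)
qed

end

text \<open>
  The skew operator \<open>S\<close> with square \<open>d\<close> makes the space a module over \<open>k[t] / (t\<^sup>2 - d)\<close>, and \<open>q\<close> is the diagonal
  \<open>h(x, x)\<close> of a hermitian form \<open>h\<close>. The \<open>k\<close>-bilinear conditions \<open>b x y = 0\<close> and \<open>b x (S y) = 0\<close> together say
  that \<open>x\<close> and \<open>y\<close> are orthogonal for \<open>h\<close>.
\<close>

locale herm_space = quad_space scale q
  for scale :: "'k::field \<Rightarrow> 'v::ab_group_add \<Rightarrow> 'v" and q +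
  fixes S :: "'v \<Rightarrow> 'v" and d :: 'k
  assumes S_add: "S (x + y) = S x + S y" and S_scale: "S (scale c x) = scale c (S x)"
    and S_S: "S (S x) = scale d x" and S_skew: "polar q (S x) y = - polar q x (S y)"
    and d0: "d \<noteq> 0"
begin

lemma b_S_self: "b x (S x) = 0"
proof -
  have "b x (S x) = - b x (S x)" using S_skew[of x x] b_sym[of x "S x"] by simp
  then have "2 * b x (S x) = 0" by (metis add.right_inverse mult_2)
  then show ?thesis using two by simp
qed

lemma b_S_S: "b (S x) (S y) = - d * b x y"
  using S_skew[of x "S y"] by (simp add: S_S b_right)

lemma q_S: "q (S x) = - d * q x"
proof -
  have "2 * q (S x) = 2 * (- d * q x)" using b_S_S[of x x] by (simp add: b_self)
  then show ?thesis using two by (metis mult_left_cancel)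
qed

text \<open>
  The heart of Jacobson's theorem. An isometry of the underlying quadratic spaces is corrected by
  reflections, one orthogonal hermitian line after the other, until it commutes with \<open>S\<close>.
\<close>

lemma commute_step:
  assumes H0: "herm_space scale p S d" and f: "isometry p f"
    and W: "\<And>w. w \<in> W \<Longrightarrow> f (S w) = S (f w)"
    and orth: "\<And>w. w \<in> W \<Longrightarrow> polar p w0 w = 0 \<and> polar p w0 (S w) = 0" and w0: "p w0 \<noteq> 0"
  shows "\<exists>g. isometry p g \<and> (\<forall>w\<in>insert w0 W. g (S w) = S (g w) \<and> g w = f w)"
proof -
  interpret P: herm_space scale p S d by fact
  have fq: "q (f x) = p x" and fadd: "f (x + y) = f x + f y" for x y using f by (auto simp: isometry_def)
  have fb: "b (f x) (f y) = polar p x y" for x y by (simp add: polar_def fq fadd[symmetric])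
  let ?a = "f (S w0)" and ?c = "S (f w0)"
  have "q ?a = q ?c" "q ?c \<noteq> 0" using w0 d0 by (simp_all add: fq q_S P.q_S)
  then obtain \<rho> where \<rho>: "isometry q \<rho>" "\<rho> ?a = ?c" "\<And>x. b x ?a = 0 \<Longrightarrow> b x ?c = 0 \<Longrightarrow> \<rho> x = x"
    using witt_move by blast
  have 0: "\<rho> (f w0) = f w0" by (intro \<rho>(3)) (simp_all add: fb P.b_S_self b_S_self)
  have 1: "\<rho> (f w) = f w" "\<rho> (f (S w)) = f (S w)" if "w \<in> W" for w
  proof -
    have o: "polar p w w0 = 0" "polar p (S w) w0 = 0" using orth[OF that] by (simp_all add: P.b_sym)
    have "polar p w (S w0) = 0" using P.S_skew[of w w0] o by simp
    moreover have "b (f w) ?c = 0" using S_skew[of "f w" "f w0"] o W[OF that, symmetric] by (simp add: fb)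
    ultimately show "\<rho> (f w) = f w" by (intro \<rho>(3)) (simp_all add: fb)
    show "\<rho> (f (S w)) = f (S w)"
    proof (rule \<rho>(3))
      show "b (f (S w)) ?a = 0" using o by (simp add: fb P.b_S_S)
      show "b (f (S w)) ?c = 0" using o by (simp add: W[OF that] b_S_S fb)
    qed
  qed
  have "isometry p (\<rho> \<circ> f)" using f \<rho>(1) by (rule isometry_comp)
  moreover have "(\<rho> \<circ> f) (S w) = S ((\<rho> \<circ> f) w) \<and> (\<rho> \<circ> f) w = f w" if "w \<in> insert w0 W" for w
    using that W by (auto simp: 0 1 \<rho>(2) W[symmetric])
  ultimately show ?thesis by blast
qed

end

section \<open>Matrices over a quadratic algebra\<close>

lemma mul_quad_ext: "mul (quad_ext d) x y = (fst x * fst y + d * snd x * snd y, fst x * snd y + snd x * fst y)"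
  by (cases x; cases y) simp

lemma smul_quad_ext: "smul (quad_ext d) c x = (c * fst x, c * snd x)"
  by (cases x) simp

lemma conj_quad_ext': "conj_of (quad_ext d) x = (fst x, - snd x)"
  by (cases x) (simp add: conj_quad_ext)

definition kstar :: "('k::field \<times> 'k) ^ 3 ^ 3 \<Rightarrow> ('k \<times> 'k) ^ 3 ^ 3" where
  "kstar Y = (\<chi> i j. (fst (Y $ j $ i), - snd (Y $ j $ i)))"

definition kdiag :: "'k::field ^ 3 \<Rightarrow> ('k \<times> 'k) ^ 3 ^ 3" where
  "kdiag c = (\<chi> i j. if i = j then (c $ i, 0) else 0)"

abbreviation kmul :: "'k::field \<Rightarrow> ('k \<times> 'k) ^ 3 ^ 3 \<Rightarrow> ('k \<times> 'k) ^ 3 ^ 3 \<Rightarrow> ('k \<times> 'k) ^ 3 ^ 3" where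
  "kmul d \<equiv> mat3_mul (quad_ext d)"

lemma kmul_nth: "kmul d Y Z $ i $ j =
   (\<Sum>l\<in>UNIV. (fst (Y $ i $ l) * fst (Z $ l $ j) + d * snd (Y $ i $ l) * snd (Z $ l $ j),
               fst (Y $ i $ l) * snd (Z $ l $ j) + snd (Y $ i $ l) * fst (Z $ l $ j)))"
  by (simp add: mat3_mul_def mul_quad_ext)

lemma kmul_assoc: "kmul d (kmul d X Y) Z = kmul d X (kmul d Y Z)"
  by (simp add: vec_eq_iff kmul_nth sum_3 prod_eq_iff algebra_simps)

lemma kmul_add: "kmul d (X + Y) Z = kmul d X Z + kmul d Y Z" "kmul d Z (X + Y) = kmul d Z X + kmul d Z Y"
  by (simp_all add: vec_eq_iff kmul_nth sum_3 prod_eq_iff algebra_simps)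

lemma kmul_scale:
  "kmul d (\<chi> i j. (c * fst (X $ i $ j), c * snd (X $ i $ j))) Z
     = (\<chi> i j. (c * fst (kmul d X Z $ i $ j), c * snd (kmul d X Z $ i $ j)))"
  "kmul d Z (\<chi> i j. (c * fst (X $ i $ j), c * snd (X $ i $ j)))
     = (\<chi> i j. (c * fst (kmul d Z X $ i $ j), c * snd (kmul d Z X $ i $ j)))"
  by (simp_all add: vec_eq_iff kmul_nth sum_3 prod_eq_iff algebra_simps)

lemma kmul_diag: "kmul d X (kdiag c) $ i $ j = (c $ j * fst (X $ i $ j), c $ j * snd (X $ i $ j))"
  "kmul d (kdiag c) X $ i $ j = (c $ i * fst (X $ i $ j), c $ i * snd (X $ i $ j))"
proof -
  have "kmul d X (kdiag c) $ i $ j = (\<Sum>l\<in>UNIV. if l = j then (c $ j * fst (X $ i $ j), c $ j * snd (X $ i $ j)) else 0)"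
    unfolding kmul_nth by (rule sum.cong) (auto simp: kdiag_def zero_prod_def mult.commute)
  then show "kmul d X (kdiag c) $ i $ j = (c $ j * fst (X $ i $ j), c $ j * snd (X $ i $ j))" by simp
  have "kmul d (kdiag c) X $ i $ j = (\<Sum>l\<in>UNIV. if l = i then (c $ i * fst (X $ i $ j), c $ i * snd (X $ i $ j)) else 0)"
    unfolding kmul_nth by (rule sum.cong) (auto simp: kdiag_def zero_prod_def)
  then show "kmul d (kdiag c) X $ i $ j = (c $ i * fst (X $ i $ j), c $ i * snd (X $ i $ j))" by simp
qed

lemma kmul_one: "kmul d X (kdiag 1) = X" "kmul d (kdiag 1) X = X"
  by (simp_all add: vec_eq_iff kmul_diag)

lemma kstar_kmul: "kstar (kmul d X Y) = kmul d (kstar Y) (kstar X)"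
  by (simp add: vec_eq_iff kstar_def kmul_nth sum_3 prod_eq_iff algebra_simps)

text \<open>The dual weights: \<open>\<gamma>\<^sub>1 \<gamma>\<^sub>2 \<gamma>\<^sub>3 \<Gamma>\<^sup>-\<^sup>1\<close>.\<close>

definition cofactors :: "'k::field ^ 3 \<Rightarrow> 'k ^ 3" where
  "cofactors \<gamma> = vector [\<gamma> $ 2 * \<gamma> $ 3, \<gamma> $ 1 * \<gamma> $ 3, \<gamma> $ 1 * \<gamma> $ 2]"

text \<open>
  The cofactors are proportional to the inverses of the \<open>\<gamma>\<^sub>i\<close>. In this form the defining symmetry says that \<open>Y\<close>
  is self-adjoint for the hermitian form with diagonal entries \<open>cofactors \<gamma>\<close>.
\<close>

lemma H3_quad_ext_carrier:
  assumes \<gamma>: "\<forall>i. \<gamma> $ i \<noteq> 0"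
  shows "Y \<in> carrier (H3 (quad_ext d) \<gamma>) \<longleftrightarrow>
    kmul d Y (kdiag (cofactors \<gamma>)) = kmul d (kdiag (cofactors \<gamma>)) (kstar Y)"
proof -
  have c: "inverse (\<gamma> $ i) * \<gamma> $ j * cofactors \<gamma> $ j = cofactors \<gamma> $ i" "cofactors \<gamma> $ j \<noteq> 0" for i j
    using \<gamma> exhaust_3[of i] exhaust_3[of j] by (auto simp: cofactors_def field_simps)
  have e: "inverse (\<gamma> $ i) * \<gamma> $ j * a = b \<longleftrightarrow> cofactors \<gamma> $ j * b = cofactors \<gamma> $ i * a" for i j a b
  proof -
    have "cofactors \<gamma> $ i * a = cofactors \<gamma> $ j * (inverse (\<gamma> $ i) * \<gamma> $ j * a)"
      unfolding c(1)[of i j, symmetric] by (simp only: mult_ac)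
    then show ?thesis using mult_left_cancel[OF c(2)[of j], of b "inverse (\<gamma> $ i) * \<gamma> $ j * a"] by auto
  qed
  have e': "- (inverse (\<gamma> $ i) * \<gamma> $ j * a) = b \<longleftrightarrow> cofactors \<gamma> $ j * b = - (cofactors \<gamma> $ i * a)" for i j a b
    using e[of i j "- a" b] by simp
  show ?thesis
    by (simp add: e e' vec_eq_iff kmul_diag smul_quad_ext conj_quad_ext' kstar_def prod_eq_iff)
qed

text \<open>
  An isometry \<open>V\<close> of hermitian forms conjugates the matrices that are self-adjoint for one form to those that are
  self-adjoint for the other.
\<close>

lemma H3_conj_iso:
  assumes \<gamma>: "\<forall>i. \<gamma> $ i \<noteq> 0" and \<gamma>': "\<forall>i. \<gamma>' $ i \<noteq> 0"
    and VW: "kmul d V W = kdiag 1" "kmul d W V = kdiag 1"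
    and V: "kmul d (kmul d V (kdiag (cofactors \<gamma>'))) (kstar V) = kdiag (cofactors \<gamma>)"
    and W: "kmul d (kmul d W (kdiag (cofactors \<gamma>))) (kstar W) = kdiag (cofactors \<gamma>')"
  shows "H3 (quad_ext d) \<gamma> \<simeq>\<^sub>a H3 (quad_ext d) \<gamma>'"
proof -
  have maps: "kmul d (kmul d W Y) V \<in> carrier (H3 (quad_ext d) \<gamma>')"
    if Y: "Y \<in> carrier (H3 (quad_ext d) \<gamma>)" and \<gamma>: "\<forall>i. \<gamma> $ i \<noteq> 0" and \<gamma>': "\<forall>i. \<gamma>' $ i \<noteq> 0"
    and VW: "kmul d V W = kdiag 1" "kmul d W V = kdiag 1"
    and V: "kmul d (kmul d V (kdiag (cofactors \<gamma>'))) (kstar V) = kdiag (cofactors \<gamma>)"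
    and W: "kmul d (kmul d W (kdiag (cofactors \<gamma>))) (kstar W) = kdiag (cofactors \<gamma>')"
    for Y V W and \<gamma> \<gamma>' :: "'a ^ 3"
  proof -
    let ?D = "kdiag (cofactors \<gamma>)" and ?D' = "kdiag (cofactors \<gamma>')"
    have VD: "kmul d V ?D' = kmul d ?D (kstar W)"
      unfolding W[symmetric] by (metis VW(1) kmul_assoc kmul_one(2))
    have DV: "kmul d ?D' (kstar V) = kmul d W ?D"
      unfolding V[symmetric] by (metis VW(2) kmul_assoc kmul_one(2))
    have YD: "kmul d Y ?D = kmul d ?D (kstar Y)" using Y H3_quad_ext_carrier[OF \<gamma>] by blast
    have "kmul d (kmul d (kmul d W Y) V) ?D' = kmul d W (kmul d (kmul d Y ?D) (kstar W))"
      by (simp only: kmul_assoc VD)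
    also have "\<dots> = kmul d (kmul d (kmul d W ?D) (kstar Y)) (kstar W)"
      by (simp only: YD kmul_assoc)
    also have "\<dots> = kmul d ?D' (kstar (kmul d (kmul d W Y) V))"
      by (simp only: DV[symmetric] kstar_kmul kmul_assoc)
    finally show ?thesis using H3_quad_ext_carrier[OF \<gamma>'] by blast
  qed
  define H where "H Y = kmul d (kmul d W Y) V" for Y
  define G where "G Z = kmul d (kmul d V Z) W" for Z
  have GH: "G (H Y) = Y" and HG: "H (G Y) = Y" for Y
  proof -
    have "G (H Y) = kmul d (kmul d (kmul d V W) Y) (kmul d V W)" by (simp only: G_def H_def kmul_assoc)
    then show "G (H Y) = Y" by (simp only: VW kmul_one)
    have "H (G Y) = kmul d (kmul d (kmul d W V) Y) (kmul d W V)" by (simp only: G_def H_def kmul_assoc)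
    then show "H (G Y) = Y" by (simp only: VW kmul_one)
  qed
  have Hc: "H Y \<in> carrier (H3 (quad_ext d) \<gamma>')" if "Y \<in> carrier (H3 (quad_ext d) \<gamma>)" for Y
    unfolding H_def using that by (rule maps[OF _ \<gamma> \<gamma>' VW V W])
  have Gc: "G Y \<in> carrier (H3 (quad_ext d) \<gamma>)" if "Y \<in> carrier (H3 (quad_ext d) \<gamma>')" for Y
    unfolding G_def using that by (rule maps[OF _ \<gamma>' \<gamma> VW(2,1) W V])
  have "bij_betw H (carrier (H3 (quad_ext d) \<gamma>)) (carrier (H3 (quad_ext d) \<gamma>'))"
    by (rule bij_betw_byWitness[where f' = G]) (use GH HG Hc Gc in blast)+
  moreover have add: "H (X + Y) = H X + H Y" for X Y by (simp add: H_def kmul_add)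
  moreover have sc: "H (\<chi> i j. smul (quad_ext d) c (X $ i $ j)) = (\<chi> i j. smul (quad_ext d) c (H X $ i $ j))" for c X
    by (simp add: H_def kmul_scale smul_quad_ext)
  moreover have mul: "H (kmul d X Y) = kmul d (H X) (H Y)" for X Y
  proof -
    have "kmul d (H X) (H Y) = kmul d (kmul d W (kmul d X (kmul d (kmul d V W) Y))) V"
      by (simp only: H_def kmul_assoc)
    then show ?thesis by (simp only: VW kmul_one) (simp only: H_def)
  qed
  moreover have "H (mul (H3 (quad_ext d) \<gamma>) X Y) = mul (H3 (quad_ext d) \<gamma>') (H X) (H Y)" for X Y
    by (simp only: H3_simps(3) sc add mul)
  ultimately have "alg_iso H (H3 (quad_ext d) \<gamma>) (H3 (quad_ext d) \<gamma>')"
    unfolding alg_iso_def lin_iso_def by (simp only: H3_simps(2)) blast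
  then show ?thesis unfolding alg_isomorphic_def by blast
qed

lemma vector_4:
  "(vector [a, b, c, e] :: 'a::zero ^ 4) $ 1 = a" "(vector [a, b, c, e] :: 'a ^ 4) $ 2 = b"
  "(vector [a, b, c, e] :: 'a ^ 4) $ 3 = c" "(vector [a, b, c, e] :: 'a ^ 4) $ 4 = e"
  unfolding vector_def by simp_all

section \<open>From quadratic to hermitian isometries\<close>

definition ksqrt :: "'k::field \<Rightarrow> ('k \<times> 'k) ^ 4 \<Rightarrow> ('k \<times> 'k) ^ 4" where
  "ksqrt d z = (\<chi> i. (d * snd (z $ i), fst (z $ i)))"

lemma smul_fourfold_quad_ext: "smul (fourfold (quad_ext d)) c z = (\<chi> i. (c * fst (z $ i), c * snd (z $ i)))"
  by (simp add: smul_quad_ext)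

lemma norm_tensor_quad_ext:
  "norm_tensor (quad_ext d) c z = (\<Sum>i\<in>UNIV. c $ i * ((fst (z $ i))\<^sup>2 - d * (snd (z $ i))\<^sup>2))"
  unfolding norm_tensor_def by (rule sum.cong) (auto simp: quad_ext_def split: prod.split)

lemma polar_norm_tensor: "polar (norm_tensor (quad_ext d) c) z z'
    = 2 * (\<Sum>i\<in>UNIV. c $ i * (fst (z $ i) * fst (z' $ i) - d * snd (z $ i) * snd (z' $ i)))"
  unfolding polar_def norm_tensor_quad_ext sum_subtractf[symmetric] sum_distrib_left
  by (rule sum.cong) (auto simp: power2_eq_square algebra_simps)

lemma herm_space_norm_tensor:
  assumes "(2 :: 'k::field) \<noteq> 0" "(d :: 'k) \<noteq> 0"
  shows "herm_space (smul (fourfold (quad_ext d))) (norm_tensor (quad_ext d) c) (ksqrt d) d"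
proof
  fix a a' and x y z :: "('k \<times> 'k) ^ 4"
  let ?s = "smul (fourfold (quad_ext d))" and ?q = "norm_tensor (quad_ext d) c"
  show "?s a (x + y) = ?s a x + ?s a y" "?s (a + a') x = ?s a x + ?s a' x" "?s a (?s a' x) = ?s (a * a') x"
    "?s 1 x = x"
    by (simp_all add: vec_eq_iff smul_fourfold_quad_ext algebra_simps del: fourfold_simps)
  show "?q (?s a x) = a\<^sup>2 * ?q x"
    unfolding norm_tensor_quad_ext sum_distrib_left smul_fourfold_quad_ext
    by (rule sum.cong) (auto simp: power2_eq_square algebra_simps)
  show "polar ?q (x + y) z = polar ?q x z + polar ?q y z"
    unfolding polar_norm_tensor distrib_left[symmetric] sum.distrib[symmetric]
    by (simp add: algebra_simps)
  show "polar ?q (?s a x) y = a * polar ?q x y"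
    unfolding polar_norm_tensor smul_fourfold_quad_ext
    by (simp add: sum_distrib_left algebra_simps)
  show "ksqrt d (x + y) = ksqrt d x + ksqrt d y" "ksqrt d (?s a x) = ?s a (ksqrt d x)"
    "ksqrt d (ksqrt d x) = ?s d x"
    by (simp_all add: ksqrt_def vec_eq_iff smul_fourfold_quad_ext algebra_simps del: fourfold_simps)
  show "polar ?q (ksqrt d x) y = - polar ?q x (ksqrt d y)"
    unfolding polar_norm_tensor ksqrt_def minus_mult_right sum_negf[symmetric] by (simp add: algebra_simps)
qed (use assms in auto)

definition kunit :: "4 \<Rightarrow> ('k::field \<times> 'k) ^ 4" where
  "kunit i = axis i (1, 0)"

lemma kunit_nth: "kunit i $ j = (if i = j then (1, 0) else 0)"
  by (simp add: kunit_def axis_def eq_commute)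

lemma norm_tensor_kunit: "norm_tensor (quad_ext d) c (kunit i) = c $ i"
proof -
  have "norm_tensor (quad_ext d) c (kunit i) = (\<Sum>l\<in>UNIV. if l = i then c $ i else 0)"
    unfolding norm_tensor_quad_ext by (rule sum.cong) (auto simp: kunit_nth)
  then show ?thesis by simp
qed

text \<open>
  Linearity over the quadratic algebra, whose generator acts as \<open>ksqrt d\<close>.
\<close>

definition klinear :: "'k::field \<Rightarrow> (('k \<times> 'k) ^ 4 \<Rightarrow> ('k \<times> 'k) ^ 4) \<Rightarrow> bool" where
  "klinear d f \<longleftrightarrow> (\<forall>x y. f (x + y) = f x + f y) \<and>
    (\<forall>a x. f (smul (fourfold (quad_ext d)) a x) = smul (fourfold (quad_ext d)) a (f x)) \<and>
    (\<forall>i. f (ksqrt d (kunit i)) = ksqrt d (f (kunit i)))"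

lemma klinear_expand:
  assumes f: "klinear d f"
  shows "f z $ j = (\<Sum>i\<in>UNIV. mul (quad_ext d) (z $ i) (f (kunit i) $ j))"
proof -
  let ?s = "smul (fourfold (quad_ext d))"
  have add: "f (x + y) = f x + f y" and sc: "f (?s a x) = ?s a (f x)"
    and S: "f (ksqrt d (kunit i)) = ksqrt d (f (kunit i))" for x y a i
    using f unfolding klinear_def by blast+
  have f0: "f 0 = 0" using add[of 0 0] by simp
  have sum: "f (sum g I) = (\<Sum>i\<in>I. f (g i))" for g and I :: "4 set"
    by (induction I rule: infinite_finite_induct) (auto simp: f0 add)
  have "z = (\<Sum>i\<in>UNIV. ?s (fst (z $ i)) (kunit i) + ?s (snd (z $ i)) (ksqrt d (kunit i)))"
  proof (unfold vec_eq_iff, rule allI)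
    fix j
    have "(\<Sum>i\<in>UNIV. ?s (fst (z $ i)) (kunit i) + ?s (snd (z $ i)) (ksqrt d (kunit i))) $ j
        = (\<Sum>i\<in>UNIV. if i = j then z $ j else 0)"
      unfolding sum_component
      by (rule sum.cong) (auto simp: smul_fourfold_quad_ext kunit_nth ksqrt_def prod_eq_iff simp del: fourfold_simps)
    then show "z $ j = (\<Sum>i\<in>UNIV. ?s (fst (z $ i)) (kunit i) + ?s (snd (z $ i)) (ksqrt d (kunit i))) $ j"
      by simp
  qed
  then have "f z = f (\<Sum>i\<in>UNIV. ?s (fst (z $ i)) (kunit i) + ?s (snd (z $ i)) (ksqrt d (kunit i)))"
    by (rule arg_cong)
  also have "\<dots> = (\<Sum>i\<in>UNIV. ?s (fst (z $ i)) (f (kunit i)) + ?s (snd (z $ i)) (ksqrt d (f (kunit i))))"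
    by (simp only: sum add sc S)
  finally show ?thesis
    unfolding sum_component
    by (simp add: smul_fourfold_quad_ext ksqrt_def mul_quad_ext mult_ac del: fourfold_simps)
qed

lemma klinear_inv:
  assumes f: "klinear d f" and bij: "bij f"
  shows "klinear d (inv f)"
proof -
  let ?s = "smul (fourfold (quad_ext d))"
  have add: "f (x + y) = f x + f y" and sc: "f (?s a x) = ?s a (f x)" for x y a
    using f unfolding klinear_def by blast+
  have S: "f (ksqrt d z) = ksqrt d (f z)" for z
  proof (unfold vec_eq_iff, rule allI)
    fix j
    show "f (ksqrt d z) $ j = ksqrt d (f z) $ j"
      unfolding klinear_expand[OF f, of "ksqrt d z"]
      unfolding ksqrt_def vec_lambda_beta klinear_expand[OF f, of z]
      by (simp add: mul_quad_ext prod_eq_iff fst_sum snd_sum sum_distrib_left algebra_simps)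
  qed
  have fi: "f (inv f y) = y" for y using bij by (simp add: bij_is_surj surj_f_inv_f)
  have eq: "inv f y = x" if "f x = y" for x y using bij that by (metis bij_inv_eq_iff)
  show ?thesis unfolding klinear_def
    by (intro conjI allI eq) (simp_all only: add sc S fi)
qed

definition shift :: "3 \<Rightarrow> 4" where
  "shift i = (if i = 1 then 2 else if i = 2 then 3 else 4)"

lemma shift_inj: "shift i = shift j \<longleftrightarrow> i = j" "shift i \<noteq> 1"
  using exhaust_3[of i] exhaust_3[of j] by (auto simp: shift_def)

lemma sum_4_shift: "sum f (UNIV :: 4 set) = f 1 + (\<Sum>i\<in>UNIV. f (shift i))"
  by (simp add: sum_4 sum_3 shift_def add.assoc)

definition kblock :: "(('k::field \<times> 'k) ^ 4 \<Rightarrow> ('k \<times> 'k) ^ 4) \<Rightarrow> ('k \<times> 'k) ^ 3 ^ 3" where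
  "kblock f = (\<chi> i j. f (kunit (shift i)) $ shift j)"

text \<open>
  An isometry that is linear over the quadratic algebra and fixes the first basis vector is a
  hermitian isometry of the orthogonal complement, given by the lower right block of its matrix.
\<close>

lemma klinear_block:
  fixes d :: "'k::field"
  assumes two: "(2::'k) \<noteq> 0" and d: "d \<noteq> 0"
    and f: "klinear d f" and fix1: "f (kunit 1) = kunit 1"
    and iso: "\<And>x. norm_tensor (quad_ext d) c' (f x) = norm_tensor (quad_ext d) c x"
    and c'1: "c' $ 1 = 1"
  shows "f (kunit (shift i)) $ 1 = 0"
    and "kmul d (kmul d (kblock f) (kdiag (\<chi> l. c' $ shift l))) (kstar (kblock f)) = kdiag (\<chi> l. c $ shift l)"
proof -
  interpret P: herm_space "smul (fourfold (quad_ext d))" "norm_tensor (quad_ext d) c" "ksqrt d" d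
    using two d by (rule herm_space_norm_tensor)
  have b: "polar (norm_tensor (quad_ext d) c') (f x) (f y) = polar (norm_tensor (quad_ext d) c) x y" for x y
    using f by (simp add: polar_def iso klinear_def flip: iso)
  have S: "f (ksqrt d (kunit i)) = ksqrt d (f (kunit i))" for i using f by (simp add: klinear_def)
  let ?w = kunit
  show first: "f (?w (shift i)) $ 1 = 0" for i
  proof -
    have "polar (norm_tensor (quad_ext d) c') (f (?w (shift i))) (f (?w 1)) = 0"
      unfolding b unfolding polar_norm_tensor by (intro mult_eq_0_iff[THEN iffD2] disjI2 sum.neutral) (auto simp: kunit_nth shift_inj)
    moreover have "polar (norm_tensor (quad_ext d) c') (f (?w (shift i))) (f (ksqrt d (?w 1))) = 0"
      unfolding b unfolding polar_norm_tensor by (intro mult_eq_0_iff[THEN iffD2] disjI2 sum.neutral) (auto simp: kunit_nth ksqrt_def shift_inj)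
    ultimately show ?thesis
      unfolding S fix1 polar_norm_tensor
      using two d c'1 by (simp add: sum_4 kunit_nth ksqrt_def prod_eq_iff)
  qed
  show "kmul d (kmul d (kblock f) (kdiag (\<chi> l. c' $ shift l))) (kstar (kblock f)) = kdiag (\<chi> l. c $ shift l)"
  proof (unfold vec_eq_iff, intro allI)
    fix i j
    have re: "(\<Sum>l\<in>UNIV. c' $ shift l * (fst (f (?w (shift i)) $ shift l) * fst (f (?w (shift j)) $ shift l)
        - d * snd (f (?w (shift i)) $ shift l) * snd (f (?w (shift j)) $ shift l))) = (if i = j then c $ shift i else 0)"
    proof -
      have "polar (norm_tensor (quad_ext d) c) (?w (shift i)) (?w (shift j)) = 2 * (if i = j then c $ shift i else 0)"
      proof -
        have "(\<Sum>l\<in>UNIV. c $ l * (fst (?w (shift i) $ l) * fst (?w (shift j) $ l) - d * snd (?w (shift i) $ l) * snd (?w (shift j) $ l)))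
           = (\<Sum>l\<in>UNIV. if l = shift i then (if i = j then c $ shift i else 0) else 0)"
          by (rule sum.cong) (auto simp: kunit_nth shift_inj)
        then show ?thesis unfolding polar_norm_tensor by simp
      qed
      then show ?thesis
        unfolding b[symmetric] unfolding polar_norm_tensor sum_4_shift first using two by simp
    qed
    have im: "(\<Sum>l\<in>UNIV. c' $ shift l * (snd (f (?w (shift i)) $ shift l) * fst (f (?w (shift j)) $ shift l)
        - fst (f (?w (shift i)) $ shift l) * snd (f (?w (shift j)) $ shift l))) = 0"
    proof -
      have "polar (norm_tensor (quad_ext d) c) (?w (shift i)) (ksqrt d (?w (shift j))) = 0"
        unfolding polar_norm_tensor by (intro mult_eq_0_iff[THEN iffD2] disjI2 sum.neutral) (auto simp: kunit_nth ksqrt_def)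
      then have "2 * (\<Sum>l\<in>UNIV. - d * (c' $ shift l * (snd (f (?w (shift i)) $ shift l) * fst (f (?w (shift j)) $ shift l)
        - fst (f (?w (shift i)) $ shift l) * snd (f (?w (shift j)) $ shift l)))) = 0"
        unfolding b[symmetric] unfolding S unfolding polar_norm_tensor sum_4_shift first ksqrt_def by (simp add: algebra_simps)
      then show ?thesis using two d unfolding sum_distrib_left[symmetric] by simp
    qed
    show "kmul d (kmul d (kblock f) (kdiag (\<chi> l. c' $ shift l))) (kstar (kblock f)) $ i $ j
        = kdiag (\<chi> l. c $ shift l) $ i $ j"
      unfolding kmul_nth[of d "kmul d _ _"] kmul_diag
      using re im
      by (simp add: kstar_def kblock_def kdiag_def prod_eq_iff fst_sum snd_sum algebra_simps)
  qed
qed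

lemma kblock_inverse:
  assumes f: "klinear d f" and g: "klinear d g" and gf: "\<And>x. g (f x) = x"
    and first: "\<And>i. f (kunit (shift i)) $ 1 = 0"
  shows "kmul d (kblock f) (kblock g) = kdiag 1"
proof (unfold vec_eq_iff, intro allI)
  fix i j
  have "(\<Sum>l\<in>UNIV. mul (quad_ext d) (f (kunit (shift i)) $ l) (g (kunit l) $ shift j)) = kunit (shift i) $ shift j"
    using klinear_expand[OF g, of "f (kunit (shift i))" "shift j"] by (simp add: gf)
  then show "kmul d (kblock f) (kblock g) $ i $ j = kdiag 1 $ i $ j"
    unfolding sum_4_shift first
    by (simp add: kmul_nth kblock_def kdiag_def kunit_nth shift_inj mul_quad_ext zero_prod_def[symmetric])
qed

text \<open>
  Norm forms that become isometric after adding the norm of the quadratic algebra belong to isomorphic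
  Freudenthal algebras: this is Witt cancellation and Jacobson's theorem in one step.
\<close>

theorem H3_iso_of_isometric:
  fixes d :: "'k::field"
  assumes two: "(2::'k) \<noteq> 0" and d: "d \<noteq> 0"
    and \<gamma>: "\<forall>i. \<gamma> $ i \<noteq> 0" and \<gamma>': "\<forall>i. \<gamma>' $ i \<noteq> 0"
    and iso: "isometric (fourfold (quad_ext d))
        (norm_tensor (quad_ext d) (vector [1, \<gamma> $ 2 * \<gamma> $ 3, \<gamma> $ 1 * \<gamma> $ 3, \<gamma> $ 1 * \<gamma> $ 2]))
      (fourfold (quad_ext d))
        (norm_tensor (quad_ext d) (vector [1, \<gamma>' $ 2 * \<gamma>' $ 3, \<gamma>' $ 1 * \<gamma>' $ 3, \<gamma>' $ 1 * \<gamma>' $ 2]))"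
  shows "H3 (quad_ext d) \<gamma> \<simeq>\<^sub>a H3 (quad_ext d) \<gamma>'"
proof -
  define c :: "'k ^ 4" where "c = vector [1, \<gamma> $ 2 * \<gamma> $ 3, \<gamma> $ 1 * \<gamma> $ 3, \<gamma> $ 1 * \<gamma> $ 2]"
  define c' :: "'k ^ 4" where "c' = vector [1, \<gamma>' $ 2 * \<gamma>' $ 3, \<gamma>' $ 1 * \<gamma>' $ 3, \<gamma>' $ 1 * \<gamma>' $ 2]"
  let ?s = "smul (fourfold (quad_ext d))" and ?p = "norm_tensor (quad_ext d) c" and ?q = "norm_tensor (quad_ext d) c'"
  have c1: "c $ 1 = 1" "c' $ 1 = 1" by (simp_all add: c_def c'_def vector_4)
  have cs: "(\<chi> l. c $ shift l) = cofactors \<gamma>" "(\<chi> l. c' $ shift l) = cofactors \<gamma>'"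
    by (simp_all add: vec_eq_iff forall_3 c_def c'_def cofactors_def shift_def vector_4 vector_3)
  have cnz: "c $ i \<noteq> 0" for i using \<gamma> exhaust_4[of i] by (auto simp: c_def vector_4)
  interpret P: herm_space ?s ?p "ksqrt d" d using two d by (rule herm_space_norm_tensor)
  interpret Q: herm_space ?s ?q "ksqrt d" d using two d by (rule herm_space_norm_tensor)
  have pw: "?p (kunit i) = c $ i" and qw: "?q (kunit i) = c' $ i" for i
    by (rule norm_tensor_kunit)+
  have orth: "polar ?p (kunit i) (kunit j) = 0 \<and> polar ?p (kunit i) (ksqrt d (kunit j)) = 0" if "i \<noteq> j" for i j
    unfolding polar_norm_tensor using that
    by (auto intro!: sum.neutral simp: kunit_nth ksqrt_def)
  obtain f0 where f0: "Q.isometry ?p f0"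
    using iso unfolding isometric_def c_def[symmetric] c'_def[symmetric] Q.isometry_def lin_iso_def
    by (auto simp: quad_ext_def simp del: fourfold_simps(2))
  have "?q (f0 (kunit 1)) = ?q (kunit 1)" "?q (kunit 1) \<noteq> 0"
    using f0 by (simp_all add: Q.isometry_def pw qw c1)
  then obtain \<rho> where \<rho>: "Q.isometry ?q \<rho>" "\<rho> (f0 (kunit 1)) = kunit 1" using Q.witt_move by blast
  define f1 where "f1 = \<rho> \<circ> f0"
  have f1: "Q.isometry ?p f1" "f1 (kunit 1) = kunit 1"
    using Q.isometry_comp[OF f0 \<rho>(1)] \<rho>(2) by (simp_all add: f1_def)
  note step = Q.commute_step[OF P.herm_space_axioms]
  have ex: "\<exists>g. Q.isometry ?p g \<and> (\<forall>w\<in>kunit ` insert 1 I. g (ksqrt d w) = ksqrt d (g w)) \<and> g (kunit 1) = kunit 1"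
    if "finite I" "1 \<notin> I" for I
    using that
  proof (induction I rule: finite_induct)
    case empty
    then show ?case using step[OF f1(1), of "{}" "kunit 1"] f1(2) by (auto simp: pw c1 simp del: fourfold_simps)
  next
    case (insert i I)
    have "1 \<notin> I" using insert.prems by simp
    from insert.IH[OF this] obtain g where g: "Q.isometry ?p g"
      "\<And>w. w \<in> kunit ` insert 1 I \<Longrightarrow> g (ksqrt d w) = ksqrt d (g w)" "g (kunit 1) = kunit 1" by blast
    have "polar ?p (kunit i) w = 0 \<and> polar ?p (kunit i) (ksqrt d w) = 0" if "w \<in> kunit ` insert 1 I" for w
    proof -
      from that obtain l where "l \<in> insert 1 I" "w = kunit l" by blast
      moreover from this have "i \<noteq> l" using insert.hyps insert.prems by auto
      ultimately show ?thesis using orth by simp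
    qed
    from step[where W = "kunit ` insert 1 I", OF g(1,2) this] show ?case using g(3) by (auto simp: pw cnz simp del: fourfold_simps)
  qed
  obtain f where f: "Q.isometry ?p f" "\<And>i. f (ksqrt d (kunit i)) = ksqrt d (f (kunit i))" "f (kunit 1) = kunit 1"
    using ex[of "UNIV - {1}"] by (auto simp del: fourfold_simps)
  have bij: "bij f" using f(1) by (simp add: Q.isometry_def)
  have kl: "klinear d f" using f by (simp add: klinear_def Q.isometry_def del: fourfold_simps)
  have kl': "klinear d (inv f)" using kl bij by (rule klinear_inv)
  have fi: "f (inv f y) = y" "inv f (f y) = y" for y
    using bij by (simp_all add: bij_is_surj surj_f_inv_f bij_is_inj inv_f_f)
  have qf: "?q (f x) = ?p x" for x using f(1) by (simp add: Q.isometry_def)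
  have pf: "?p (inv f x) = ?q x" for x using qf[of "inv f x"] by (simp add: fi)
  have fix': "inv f (kunit 1) = kunit 1" using fi(2)[of "kunit 1"] by (simp add: f(3))
  note B = klinear_block[OF two d kl f(3) qf c1(2)] and B' = klinear_block[OF two d kl' fix' pf c1(1)]
  show ?thesis
    by (rule H3_conj_iso[OF \<gamma> \<gamma>' kblock_inverse[OF kl kl' fi(2) B(1)] kblock_inverse[OF kl' kl fi(1) B'(1)]
          B(2)[unfolded cs] B'(2)[unfolded cs]])
qed

section \<open>Multivectors\<close>

lemma vec_ext_nth: "vec_ext v $ S = (\<Sum>i\<in>UNIV. if S = {i} then v $ i else 0)"
  by (auto simp: vec_ext_def sum_component axis_def intro!: sum.cong)

lemma vec_ext_singleton [simp]: "vec_ext v $ {i} = v $ i"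
  by (simp add: vec_ext_nth eq_commute[of i])

lemma vec_ext_other: "card S \<noteq> 1 \<Longrightarrow> vec_ext v $ S = 0"
  unfolding vec_ext_nth by (rule sum.neutral) auto

lemma vec_ext_add: "vec_ext (u + v) = vec_ext u + vec_ext v"
  by (simp add: vec_eq_iff vec_ext_nth sum.distrib[symmetric] cong: if_cong) (auto intro: sum.cong)

lemma vec_ext_scale: "vec_ext (c *s v) = c *s vec_ext v"
  by (simp add: vec_eq_iff vec_ext_nth sum_distrib_left) (auto intro: sum.cong)

lemma smult_sum: "(c :: 'a::comm_ring_1) *s sum f I = (\<Sum>i\<in>I. c *s f i)"
  by (induction I rule: infinite_finite_induct) (auto simp: vector_add_ldistrib)

lemma vec_ext_zero [simp]: "vec_ext 0 = 0"
  using vec_ext_scale[of 0 0] by simp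

lemma vec_ext_sum: "vec_ext (sum f I) = (\<Sum>i\<in>I. vec_ext (f i))"
  by (induction I rule: infinite_finite_induct) (auto simp: vec_ext_add)

lemma vec_ext_expand: "vec_ext v = (\<Sum>i\<in>UNIV. v $ i *s ee i)"
proof -
  have "v = (\<Sum>i\<in>UNIV. v $ i *s axis i 1)"
    by (simp add: vec_eq_iff sum_component axis_def if_distrib cong: if_cong)
  then have "vec_ext v = vec_ext (\<Sum>i\<in>UNIV. v $ i *s axis i 1)" by simp
  then show ?thesis by (simp only: vec_ext_sum vec_ext_scale ee_def)
qed

lemma ee_axis: "ee i = axis {i} 1"
proof (unfold vec_eq_iff, rule allI)
  fix S
  have "ee i $ S = (\<Sum>j\<in>UNIV. if j = i then of_bool (S = {i}) else 0)"
    unfolding ee_def vec_ext_nth by (rule sum.cong) (auto simp: axis_def)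
  then show "ee i $ S = axis {i} 1 $ S" by (auto simp: axis_def)
qed

lemma wedge_nth: "(u \<and>\<^sub>w v) $ S = (\<Sum>A\<in>Pow S. shuffle_sign A (S - A) * u $ A * v $ (S - A))"
  by (simp add: wedge_def)

lemma wedge_add_left: "(u + u') \<and>\<^sub>w v = u \<and>\<^sub>w v + u' \<and>\<^sub>w v"
  by (simp add: vec_eq_iff wedge_nth algebra_simps sum.distrib)

lemma wedge_add_right: "u \<and>\<^sub>w (v + v') = u \<and>\<^sub>w v + u \<and>\<^sub>w v'"
  by (simp add: vec_eq_iff wedge_nth algebra_simps sum.distrib)

lemma wedge_scale_left: "(c *s u) \<and>\<^sub>w v = c *s (u \<and>\<^sub>w v)"
  by (simp add: vec_eq_iff wedge_nth algebra_simps sum_distrib_left)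

lemma wedge_scale_right: "u \<and>\<^sub>w (c *s v) = c *s (u \<and>\<^sub>w v)"
  by (simp add: vec_eq_iff wedge_nth algebra_simps sum_distrib_left)

lemma wedge_zero_left [simp]: "0 \<and>\<^sub>w v = 0"
  by (simp add: vec_eq_iff wedge_nth)

lemma wedge_zero_right [simp]: "v \<and>\<^sub>w 0 = 0"
  by (simp add: vec_eq_iff wedge_nth)

lemma wedge_minus_left: "(- u) \<and>\<^sub>w v = - (u \<and>\<^sub>w v)"
  by (simp add: vec_eq_iff wedge_nth sum_negf)

lemma wedge_minus_right: "u \<and>\<^sub>w (- v) = - (u \<and>\<^sub>w v)"
  by (simp add: vec_eq_iff wedge_nth sum_negf)

lemma wedge_sum_left: "sum f I \<and>\<^sub>w v = (\<Sum>i\<in>I. f i \<and>\<^sub>w v)"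
  by (induction I rule: infinite_finite_induct) (auto simp: wedge_add_left)

lemma wedge_sum_right: "v \<and>\<^sub>w sum f I = (\<Sum>i\<in>I. v \<and>\<^sub>w f i)"
  by (induction I rule: infinite_finite_induct) (auto simp: wedge_add_right)

lemmas wedge_linear = wedge_add_left wedge_add_right wedge_scale_left wedge_scale_right
  wedge_minus_left wedge_minus_right

lemma shuffle_sign_Un_left:
  fixes A B C :: "'n::{finite,linorder} set"
  assumes "A \<inter> B = {}"
  shows "(shuffle_sign (A \<union> B) C :: 'k::comm_ring_1) = shuffle_sign A C * shuffle_sign B C"
proof -
  have "card {(a, b). a \<in> A \<union> B \<and> b \<in> C \<and> b < a}
      = card ({(a, b). a \<in> A \<and> b \<in> C \<and> b < a} \<union> {(a, b). a \<in> B \<and> b \<in> C \<and> b < a})"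
    by (rule arg_cong[of _ _ card]) auto
  also have "\<dots> = card {(a, b). a \<in> A \<and> b \<in> C \<and> b < a} + card {(a, b). a \<in> B \<and> b \<in> C \<and> b < a}"
    using assms by (intro card_Un_disjoint) auto
  finally show ?thesis by (simp add: shuffle_sign_def power_add)
qed

lemma shuffle_sign_Un_right:
  fixes A B C :: "'n::{finite,linorder} set"
  assumes "B \<inter> C = {}"
  shows "(shuffle_sign A (B \<union> C) :: 'k::comm_ring_1) = shuffle_sign A B * shuffle_sign A C"
proof -
  have "card {(a, b). a \<in> A \<and> b \<in> B \<union> C \<and> b < a}
      = card ({(a, b). a \<in> A \<and> b \<in> B \<and> b < a} \<union> {(a, b). a \<in> A \<and> b \<in> C \<and> b < a})"
    by (rule arg_cong[of _ _ card]) auto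
  also have "\<dots> = card {(a, b). a \<in> A \<and> b \<in> B \<and> b < a} + card {(a, b). a \<in> A \<and> b \<in> C \<and> b < a}"
    using assms by (intro card_Un_disjoint) auto
  finally show ?thesis by (simp add: shuffle_sign_def power_add)
qed

lemma shuffle_sign_empty [simp]: "shuffle_sign {} B = 1" "shuffle_sign A {} = 1"
  by (simp_all add: shuffle_sign_def)

lemma shuffle_sign_singletons [simp]: "shuffle_sign {a} {b} = (if b < a then - 1 else 1)"
proof -
  have "{(x, y). x \<in> {a} \<and> y \<in> {b} \<and> y < x} = (if b < a then {(a, b)} else {})" by auto
  then show ?thesis unfolding shuffle_sign_def by simp
qed

lemma shuffle_sign_insert_left:
  fixes A B :: "'n::{finite,linorder} set"
  assumes "a \<notin> A" 
  shows "shuffle_sign (insert a A) B = shuffle_sign {a} B * (shuffle_sign A B :: 'k::comm_ring_1)"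
  using shuffle_sign_Un_left[of "{a}" A B] assms by simp

lemma shuffle_sign_insert_right:
  fixes A B :: "'n::{finite,linorder} set"
  assumes "b \<notin> B"
  shows "shuffle_sign {a} (insert b B) = (if b < a then - 1 else 1) * (shuffle_sign {a} B :: 'k::comm_ring_1)"
  using shuffle_sign_Un_right[of "{b}" B "{a}"] assms by simp

text \<open>
  Both bracketings expand into a sum over ordered partitions of \<open>S\<close> into three blocks, and the signs
  agree because inversions between blocks add up.
\<close>

lemma wedge_assoc: "(u \<and>\<^sub>w v) \<and>\<^sub>w z = u \<and>\<^sub>w (v \<and>\<^sub>w (z :: ('k::comm_ring_1, 'n::{finite,linorder} set) vec))"
proof (unfold vec_eq_iff, rule allI)
  fix S :: "'n set"
  define F :: "'n set \<Rightarrow> 'n set \<Rightarrow> 'k" where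
    "F A B = shuffle_sign A B * shuffle_sign A (S - A - B) * shuffle_sign B (S - A - B)
              * (u $ A * v $ B * z $ (S - A - B))" for A B
  have "((u \<and>\<^sub>w v) \<and>\<^sub>w z) $ S = (\<Sum>T\<in>Pow S. \<Sum>A\<in>Pow T. F A (T - A))"
  proof (subst wedge_nth, rule sum.cong[OF refl])
    fix T assume T: "T \<in> Pow S"
    show "shuffle_sign T (S - T) * (u \<and>\<^sub>w v) $ T * z $ (S - T) = (\<Sum>A\<in>Pow T. F A (T - A))"
      unfolding wedge_nth sum_distrib_left sum_distrib_right
    proof (rule sum.cong[OF refl])
      fix A assume A: "A \<in> Pow T"
      then have "T = A \<union> (T - A)" "S - A - (T - A) = S - T" using T by auto
      moreover have "(shuffle_sign (A \<union> (T - A)) (S - T) :: 'k)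
          = shuffle_sign A (S - T) * shuffle_sign (T - A) (S - T)"
        by (rule shuffle_sign_Un_left) auto
      ultimately show "shuffle_sign T (S - T) * (shuffle_sign A (T - A) * u $ A * v $ (T - A))
          * z $ (S - T) = F A (T - A)" unfolding F_def by (simp add: mult_ac)
    qed
  qed
  also have "\<dots> = (\<Sum>(T, A)\<in>(SIGMA T:Pow S. Pow T). F A (T - A))"
    by (rule sum.Sigma) auto
  also have "\<dots> = (\<Sum>(A, B)\<in>(SIGMA A:Pow S. Pow (S - A)). F A B)"
    by (rule sum.reindex_bij_witness[where i = "\<lambda>(A, B). (A \<union> B, A)" and j = "\<lambda>(T, A). (A, T - A)"])
       auto
  also have "\<dots> = (\<Sum>A\<in>Pow S. \<Sum>B\<in>Pow (S - A). F A B)"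
    by (rule sum.Sigma[symmetric]) auto
  also have "\<dots> = (u \<and>\<^sub>w (v \<and>\<^sub>w z)) $ S"
  proof (subst wedge_nth, rule sum.cong[OF refl])
    fix A assume A: "A \<in> Pow S"
    show "(\<Sum>B\<in>Pow (S - A). F A B) = shuffle_sign A (S - A) * u $ A * (v \<and>\<^sub>w z) $ (S - A)"
      unfolding wedge_nth sum_distrib_left
    proof (rule sum.cong[OF refl])
      fix B assume B: "B \<in> Pow (S - A)"
      then have "S - A = B \<union> (S - A - B)" by auto
      moreover have "(shuffle_sign A (B \<union> (S - A - B)) :: 'k)
          = shuffle_sign A B * shuffle_sign A (S - A - B)"
        by (rule shuffle_sign_Un_right) auto
      ultimately have "(shuffle_sign A (S - A) :: 'k) = shuffle_sign A B * shuffle_sign A (S - A - B)"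
        by metis
      then show "F A B = shuffle_sign A (S - A) * u $ A
          * (shuffle_sign B (S - A - B) * v $ B * z $ (S - A - B))"
        unfolding F_def by (simp add: mult_ac)
    qed
  qed
  finally show "((u \<and>\<^sub>w v) \<and>\<^sub>w z) $ S = (u \<and>\<^sub>w (v \<and>\<^sub>w z)) $ S" .
qed

lemma wedge_axis_nth:
  fixes u :: "('k::comm_ring_1, 'n::{finite,linorder} set) vec"
  shows "(u \<and>\<^sub>w axis B 1) $ S = (if B \<subseteq> S then shuffle_sign (S - B) B * u $ (S - B) else 0)"
proof -
  have *: "S - A = B \<longleftrightarrow> B \<subseteq> S \<and> A = S - B" if "A \<in> Pow S" for A using that by auto
  have "(u \<and>\<^sub>w axis B 1) $ S
      = (\<Sum>A\<in>Pow S. if A = S - B then (if B \<subseteq> S then shuffle_sign (S - B) B * u $ (S - B) else 0) else 0)"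
    unfolding wedge_nth by (rule sum.cong) (auto simp: axis_def * double_diff)
  also have "\<dots> = (if B \<subseteq> S then shuffle_sign (S - B) B * u $ (S - B) else 0)"
    by (subst sum.delta) auto
  finally show ?thesis .
qed

lemma wedge_axis:
  "(axis A 1 :: ('k::comm_ring_1, 'n::{finite,linorder} set) vec) \<and>\<^sub>w axis B 1
     = (if A \<inter> B = {} then shuffle_sign A B *s axis (A \<union> B) 1 else 0)"
proof (unfold vec_eq_iff, rule allI)
  fix S :: "'n set"
  show "(axis A 1 \<and>\<^sub>w axis B 1) $ S
      = (if A \<inter> B = {} then shuffle_sign A B *s axis (A \<union> B) (1::'k) else 0) $ S"
    unfolding wedge_axis_nth by (cases "B \<subseteq> S \<and> A = S - B") (auto simp: axis_def)
qed

lemma vec_ext_wedge_self [simp]: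
  fixes v :: "'k::comm_ring_1 ^ 'n::{finite,linorder}"
  shows "vec_ext v \<and>\<^sub>w vec_ext v = 0"
proof (unfold vec_eq_iff, rule allI)
  fix S :: "'n set"
  show "(vec_ext v \<and>\<^sub>w vec_ext v) $ S = 0 $ S"
  proof (cases "card S = 2")
    case True
    then obtain i j where "S = {i, j}" "i \<noteq> j" by (auto simp: card_2_iff)
    then obtain i j where S: "S = {i, j}" "i < j" by (metis insert_commute linorder_neqE)
    then have "{j} - {i} = {j}" "{i, j} - {j} = {i}" "{i, j} - {i} = {j}" by auto
    moreover have "Pow S = {{}, {i}, {j}, {i, j}}" unfolding S by auto
    moreover have "{j} \<noteq> {i}" "{i} \<noteq> {i, j}" "{j} \<noteq> {i, j}" using S by auto
    ultimately show ?thesis using S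
      by (simp add: wedge_nth vec_ext_other algebra_simps)
  next
    case False
    have "vec_ext v $ A * vec_ext v $ (S - A) = 0" if "A \<in> Pow S" for A
    proof (cases "card A = 1 \<and> card (S - A) = 1")
      case True
      then have "card S = 2" using that card_Diff_subset[of A S] by (simp add: card_gt_0_iff)
      with False show ?thesis by simp
    qed (auto simp: vec_ext_other)
    then show ?thesis by (auto simp: wedge_nth mult.assoc intro!: sum.neutral)
  qed
qed

lemma vec_ext_anticommute:
  "vec_ext u \<and>\<^sub>w vec_ext v = - (vec_ext v \<and>\<^sub>w vec_ext (u :: 'k::comm_ring_1 ^ 'n::{finite,linorder}))"
proof -
  have "vec_ext (u + v) \<and>\<^sub>w vec_ext (u + v) = 0" by (rule vec_ext_wedge_self)
  then show ?thesis unfolding vec_ext_add wedge_add_left wedge_add_right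
    by (simp add: eq_neg_iff_add_eq_0 add.commute)
qed

lemma vec_ext_left_anticommute:
  "vec_ext u \<and>\<^sub>w (vec_ext v \<and>\<^sub>w z)
     = - (vec_ext v \<and>\<^sub>w (vec_ext u \<and>\<^sub>w (z :: ('k::comm_ring_1, 'n::{finite,linorder} set) vec)))"
  by (metis vec_ext_anticommute wedge_assoc wedge_minus_left)

lemma vec_ext_wedge_self_left [simp]:
  "vec_ext v \<and>\<^sub>w (vec_ext v \<and>\<^sub>w (z :: ('k::comm_ring_1, 'n::{finite,linorder} set) vec)) = 0"
  by (metis vec_ext_wedge_self wedge_assoc wedge_zero_left)

lemma wedge_grade:
  fixes u :: "('k::comm_ring_1, 'n::{finite,linorder} set) vec"
  assumes "u \<in> grade r" "v \<in> grade s"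
  shows "u \<and>\<^sub>w v \<in> grade (r + s)"
  unfolding grade_def
proof (intro CollectI allI impI)
  fix S :: "'n set" assume S: "card S \<noteq> r + s"
  have "u $ A * v $ (S - A) = 0" if "A \<in> Pow S" for A
  proof -
    have "card S = card A + card (S - A)"
      using that by (metis PowD card_Un_disjnt Diff_partition disjnt_def Diff_disjoint finite)
    then have "card A \<noteq> r \<or> card (S - A) \<noteq> s" using S by auto
    then show ?thesis using assms by (auto simp: grade_def)
  qed
  then show "(u \<and>\<^sub>w v) $ S = 0" by (auto simp: wedge_nth mult.assoc intro!: sum.neutral)
qed

lemma vec_ext_grade: "vec_ext v \<in> grade 1"
  by (auto simp: grade_def vec_ext_other)

lemma grade_add: "u \<in> grade r \<Longrightarrow> v \<in> grade r \<Longrightarrow> u + v \<in> grade r"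
  by (auto simp: grade_def)

lemma grade_scale: "u \<in> grade r \<Longrightarrow> c *s u \<in> grade r"
  by (auto simp: grade_def)

lemma grade_zero: "0 \<in> grade r"
  by (auto simp: grade_def)

lemma grade_sum: "(\<And>i. i \<in> I \<Longrightarrow> f i \<in> grade r) \<Longrightarrow> sum f I \<in> grade r"
  by (induction I rule: infinite_finite_induct) (auto simp: grade_add grade_zero)

lemma grade_top: "z \<in> grade CARD('n) \<Longrightarrow> z = z $ UNIV *s axis (UNIV :: 'n::finite set) 1"
  by (auto simp: grade_def vec_eq_iff axis_def dest: card_eq_UNIV_imp_eq_UNIV[OF finite])

subsection \<open>Trivectors\<close>

text \<open>
  Associated to the right, as rewriting with \<open>wedge_assoc\<close> leaves a product.
\<close>

definition decomp3 ::
  "('k::comm_ring_1, 'n::{finite,linorder}) vec \<Rightarrow> ('k, 'n) vec \<Rightarrow> ('k, 'n) vec \<Rightarrow> ('k, 'n set) vec" where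
  "decomp3 u v z = vec_ext u \<and>\<^sub>w (vec_ext v \<and>\<^sub>w vec_ext z)"

lemma decomp3_grade: "decomp3 u v z \<in> grade 3"
  using wedge_grade[OF vec_ext_grade wedge_grade[OF vec_ext_grade vec_ext_grade]]
  by (simp add: decomp3_def numeral_3_eq_3)

lemma decomp3_sorted:
  assumes "i < j" "j < l"
  shows "decomp3 (axis i 1) (axis j 1) (axis l 1) = axis {i, j, l} 1"
proof -
  have "j \<noteq> l" "i \<noteq> j" "i \<noteq> l" "\<not> j < i" "\<not> l < i" "\<not> l < j" using assms by auto
  then show ?thesis
    unfolding decomp3_def ee_def[symmetric] ee_axis
    by (simp add: wedge_axis vector_smult_assoc shuffle_sign_insert_right insert_commute)
qed

lemma sum_triples_delta:
  fixes f :: "'n::{finite,linorder} \<Rightarrow> 'n \<Rightarrow> 'n \<Rightarrow> 'k::comm_ring_1"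
  assumes "i < j" "j < l"
  shows "(\<Sum>(a, b, c)\<in>{(a, b, c). a < b \<and> b < c}. f a b c * of_bool ({a, b, c} = {i, j, l})) = f i j l"
proof -
  have *: "{a, b, c} = {i, j, l} \<longleftrightarrow> (a, b, c) = (i, j, l)" if "a < b" "b < c" for a b c
  proof
    assume eq: "{a, b, c} = {i, j, l}"
    have "Min {a, b, c} = a" "Min {i, j, l} = i" "Max {a, b, c} = c" "Max {i, j, l} = l"
      using that assms by (auto simp: min_def max_def)
    then have "a = i" "c = l" using eq by auto
    moreover have "b = j" using eq that assms calculation by (metis insertE insertI1 insertCI order_less_irrefl singletonD)
    ultimately show "(a, b, c) = (i, j, l)" by simp
  qed simp
  have "(\<Sum>(a, b, c)\<in>{(a, b, c). a < b \<and> b < c}. f a b c * of_bool ({a, b, c} = {i, j, l}))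
      = (\<Sum>t\<in>{(a, b, c). a < b \<and> b < c}. if t = (i, j, l) then f i j l else 0)"
    by (rule sum.cong) (auto simp: * of_bool_def split: if_splits)
  also have "\<dots> = f i j l" using assms by (subst sum.delta) auto
  finally show ?thesis .
qed

lemma grade3_expand:
  fixes w :: "('k::comm_ring_1, 'n::{finite,linorder} set) vec"
  assumes "w \<in> grade 3"
  shows "w = (\<Sum>(i, j, l)\<in>{(i, j, l). i < j \<and> j < l}. w $ {i, j, l} *s axis {i, j, l} 1)"
proof (unfold vec_eq_iff, rule allI)
  fix S :: "'n set"
  have R: "(\<Sum>(i, j, l)\<in>{(i, j, l). i < j \<and> j < l}. w $ {i, j, l} *s axis {i, j, l} 1) $ S
      = (\<Sum>(i, j, l)\<in>{(i, j, l). i < j \<and> j < l}. w $ {i, j, l} * of_bool ({i, j, l} = S))"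
    unfolding sum_component by (rule sum.cong) (auto simp: axis_def)
  show "w $ S = (\<Sum>(i, j, l)\<in>{(i, j, l). i < j \<and> j < l}. w $ {i, j, l} *s axis {i, j, l} 1) $ S"
  proof (cases "card S = 3")
    case True
    then have fin: "finite S" by simp
    obtain i j l where S: "S = {i, j, l}" "i < j" "j < l"
    proof -
      define xs where "xs = sorted_list_of_set S"
      have "length xs = 3" "sorted xs" "distinct xs" "set xs = S" using fin True by (auto simp: xs_def)
      then obtain a b c where "xs = [a, b, c]" by (auto simp: numeral_3_eq_3 length_Suc_conv)
      with \<open>sorted xs\<close> \<open>distinct xs\<close> \<open>set xs = S\<close> show ?thesis by (intro that[of a b c]) auto
    qed
    show ?thesis unfolding R unfolding S(1)
      using sum_triples_delta[OF S(2,3), of "\<lambda>a b c. w $ {a, b, c}"] by simp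
  next
    case False
    have "card {i, j, l} = 3" if "i < j" "j < l" for i j l :: 'n
    proof -
      have "i \<noteq> j" "i \<noteq> l" "j \<noteq> l" using that by auto
      then show ?thesis by simp
    qed
    then have "\<And>i j l. i < j \<Longrightarrow> j < l \<Longrightarrow> {i, j, l} \<noteq> S" using False by blast
    then have "(\<Sum>(i, j, l)\<in>{(i, j, l). i < j \<and> j < l}. w $ {i, j, l} * of_bool ({i, j, l} = S)) = 0"
      by (intro sum.neutral) auto
    then show ?thesis unfolding R using assms False by (simp add: grade_def)
  qed
qed

text \<open>
  Identities that are linear in a trivector need to be checked on decomposable trivectors only.
\<close>

lemma grade3_induct [consumes 1, case_names zero add decomp]:
  fixes w :: "('k::comm_ring_1, 'n::{finite,linorder} set) vec"
  assumes "w \<in> grade 3"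
    and z: "P 0"
    and add: "\<And>u v. u \<in> grade 3 \<Longrightarrow> v \<in> grade 3 \<Longrightarrow> P u \<Longrightarrow> P v \<Longrightarrow> P (u + v)"
    and dec: "\<And>c u v z. P (c *s decomp3 u v z)"
  shows "P w"
proof -
  have S: "P (sum f I) \<and> sum f I \<in> grade 3" if "finite I" "\<And>t. t \<in> I \<Longrightarrow> P (f t) \<and> f t \<in> grade 3"
    for f and I :: "('n \<times> 'n \<times> 'n) set"
    using that by (induction I rule: finite_induct) (auto simp: z add grade_add grade_zero)
  have "P (\<Sum>(i, j, l)\<in>{(i, j, l). i < j \<and> j < l}. w $ {i, j, l} *s axis {i, j, l} 1)"
  proof (rule S[THEN conjunct1])
    fix t :: "'n \<times> 'n \<times> 'n" assume "t \<in> {(i, j, l). i < j \<and> j < l}"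
    then obtain i j l where "t = (i, j, l)" "i < j" "j < l" by auto
    then show "P (case t of (i, j, l) \<Rightarrow> w $ {i, j, l} *s axis {i, j, l} 1) 
        \<and> (case t of (i, j, l) \<Rightarrow> w $ {i, j, l} *s axis {i, j, l} 1) \<in> grade 3"
      using dec[of "w $ {i, j, l}" "axis i 1" "axis j 1" "axis l 1"]
        grade_scale[OF decomp3_grade[of "axis i 1" "axis j 1" "axis l 1"], of "w $ {i, j, l}"]
      by (simp add: decomp3_sorted)
  qed simp
  then show ?thesis using grade3_expand[OF assms(1)] by simp
qed

definition alternating3 :: "('n \<Rightarrow> 'n \<Rightarrow> 'n \<Rightarrow> 'b::ab_group_add) \<Rightarrow> bool" where
  "alternating3 F \<longleftrightarrow> (\<forall>i j l. F j i l = - F i j l \<and> F i l j = - F i j l \<and> F i i l = 0)"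

lemma alternating3_eq_0:
  fixes F :: "'n::linorder \<Rightarrow> 'n \<Rightarrow> 'n \<Rightarrow> 'b::ab_group_add"
  assumes alt: "alternating3 F" and sorted: "\<And>i j l. i < j \<Longrightarrow> j < l \<Longrightarrow> F i j l = 0"
  shows "F i j l = 0"
proof -
  have a: "F j i l = - F i j l" "F i l j = - F i j l" "F i i l = 0" for i j l
    using alt unfolding alternating3_def by blast+
  have b: "F l i l = 0" for i l
    using a(2)[of l i l] a(3)[of l i] by simp
  have b': "F i l l = 0" for i l
    using a(1)[of l i l] b[of l i] by simp
  have c: "F i j l = 0" if "i < j" for i j l
  proof -
    consider "l < i" | "l = i" | "i < l" "l < j" | "l = j" | "j < l" using that by (meson linorder_neqE)
    then show ?thesis
    proof cases
      case 1 then show ?thesis using sorted[of l i j] that a(1)[of l i j] a(2)[of i l j] by simp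
    next
      case 3 then show ?thesis using sorted[of i l j] a(2)[of i l j] by simp
    qed (simp_all add: b b' sorted that)
  qed
  consider "i < j" | "i = j" | "j < i" by (meson linorder_neqE)
  then show ?thesis
  proof cases
    case 3 then show ?thesis using c[of j i l] a(1)[of j i l] by simp
  qed (simp_all add: c a(3))
qed

lemma lift3_add: "lift3 F (u + v) = lift3 F u + lift3 F v"
  unfolding lift3_def sum.distrib[symmetric] by (rule sum.cong) (auto simp: vector_sadd_rdistrib)

lemma lift3_scale: "lift3 F (c *s u) = c *s lift3 F u"
  unfolding lift3_def smult_sum by (rule sum.cong) auto

lemma lift3_zero [simp]: "lift3 F 0 = 0"
  unfolding lift3_def by (rule sum.neutral) auto

lemma lift3_sum: "lift3 F (sum f I) = (\<Sum>i\<in>I. lift3 F (f i))"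
  by (induction I rule: infinite_finite_induct) (auto simp: lift3_add)

lemma lift3_axis:
  fixes F :: "'n::{finite,linorder} \<Rightarrow> 'n \<Rightarrow> 'n \<Rightarrow> 'k::comm_ring_1 ^ 'm::finite"
  assumes "i < j" "j < l"
  shows "lift3 F (axis {i, j, l} 1) = F i j l"
proof (unfold vec_eq_iff, rule allI)
  fix m
  have "lift3 F (axis {i, j, l} 1) $ m
      = (\<Sum>(a, b, c)\<in>{(a, b, c). a < b \<and> b < c}. F a b c $ m * of_bool ({a, b, c} = {i, j, l}))"
    unfolding lift3_def sum_component by (rule sum.cong) (auto simp: axis_def)
  then show "lift3 F (axis {i, j, l} 1) $ m = F i j l $ m" by (simp add: sum_triples_delta[OF assms])
qed

lemma decomp3_alternating:
  "alternating3 (\<lambda>i j l. decomp3 (axis i 1) (axis j 1) (axis l 1) ::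
    ('k::comm_ring_1, 'n::{finite,linorder} set) vec)"
  unfolding alternating3_def decomp3_def
proof (intro allI conjI)
  fix i j l :: 'n
  let ?e = "\<lambda>i. vec_ext (axis i 1) :: ('k, 'n set) vec"
  show "?e j \<and>\<^sub>w (?e i \<and>\<^sub>w ?e l) = - (?e i \<and>\<^sub>w (?e j \<and>\<^sub>w ?e l))"
    by (rule vec_ext_left_anticommute)
  show "?e i \<and>\<^sub>w (?e l \<and>\<^sub>w ?e j) = - (?e i \<and>\<^sub>w (?e j \<and>\<^sub>w ?e l))"
    by (subst vec_ext_anticommute) (simp add: wedge_minus_right)
qed simp

lemma lift3_basis:
  fixes F :: "'n::{finite,linorder} \<Rightarrow> 'n \<Rightarrow> 'n \<Rightarrow> 'k::comm_ring_1 ^ 'm::finite"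
  assumes "alternating3 F"
  shows "lift3 F (decomp3 (axis i 1) (axis j 1) (axis l 1)) = F i j l"
proof -
  let ?G = "\<lambda>i j l. lift3 F (decomp3 (axis i 1) (axis j 1) (axis l 1)) - F i j l"
  have neg: "lift3 F (- u) = - lift3 F u" for u
    using lift3_add[of F u "- u"] by (simp add: eq_neg_iff_add_eq_0 add.commute)
  have a: "F j i l = - F i j l" "F i l j = - F i j l" "F i i l = 0" for i j l
    using assms unfolding alternating3_def by blast+
  let ?d = "\<lambda>i j l. decomp3 (axis i 1) (axis j 1) (axis l 1) :: ('k, 'n set) vec"
  have d: "?d j i l = - ?d i j l" "?d i l j = - ?d i j l" "?d i i l = 0" for i j l
    using decomp3_alternating[where ?'k = 'k and ?'n = 'n] unfolding alternating3_def by blast+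
  have "alternating3 ?G"
    unfolding alternating3_def
  proof (intro allI conjI)
    fix i j l
    show "?G j i l = - ?G i j l" unfolding a(1)[of j i l] d(1)[of j i l] neg by simp
    show "?G i l j = - ?G i j l" unfolding a(2)[of i l j] d(2)[of i l j] neg by simp
    show "?G i i l = 0" by (simp add: a(3) d(3))
  qed
  moreover have "?G i j l = 0" if "i < j" "j < l" for i j l
    by (simp add: decomp3_sorted[OF that] lift3_axis[OF that])
  ultimately have "?G i j l = 0" by (rule alternating3_eq_0)
  then show ?thesis by simp
qed

lemma decomp3_expand:
  "decomp3 u v z = (\<Sum>i\<in>UNIV. \<Sum>j\<in>UNIV. \<Sum>l\<in>UNIV.
     (u $ i * v $ j * z $ l) *s decomp3 (axis i 1) (axis j 1) (axis l 1))"
proof -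
  have 1: "vec_ext v \<and>\<^sub>w z = (\<Sum>i\<in>UNIV. v $ i *s (vec_ext (axis i 1) \<and>\<^sub>w z))"
    for v :: "('a, 'b) vec" and z
    by (subst vec_ext_expand) (simp add: wedge_sum_left wedge_scale_left ee_def)
  have 2: "vec_ext z = (\<Sum>i\<in>UNIV. z $ i *s vec_ext (axis i 1))" for z :: "('a, 'b) vec"
    by (subst vec_ext_expand) (simp add: ee_def)
  show ?thesis
    unfolding decomp3_def 1[of u] 1[of v] unfolding 2[of z]
    by (simp add: wedge_sum_right wedge_scale_right smult_sum vector_smult_assoc mult.assoc)
qed

text \<open>The universal property of the third exterior power.\<close>

lemma lift3_decomp3:
  assumes "alternating3 F"
  shows "lift3 F (decomp3 u v z)
     = (\<Sum>i\<in>UNIV. \<Sum>j\<in>UNIV. \<Sum>l\<in>UNIV. (u $ i * v $ j * z $ l) *s F i j l)"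
  by (subst decomp3_expand) (simp add: lift3_sum lift3_scale lift3_basis[OF assms])

section \<open>Equivariance of the covariants\<close>

definition upd_row :: "('k, 'm) vec ^ 'n \<Rightarrow> 'n \<Rightarrow> ('k, 'm) vec \<Rightarrow> ('k, 'm) vec ^ 'n::finite" where
  "upd_row A i x = (\<chi> j. if j = i then x else A $ j)"

definition multilinear_rows :: "('k::field ^ 'm ^ 'n \<Rightarrow> 'k) \<Rightarrow> bool" where
  "multilinear_rows F \<longleftrightarrow>
     (\<forall>A i x y. F (upd_row A i (x + y)) = F (upd_row A i x) + F (upd_row A i y))
     \<and> (\<forall>A i c x. F (upd_row A i (c *s x)) = c * F (upd_row A i x))"

definition alternating_rows :: "('k::field ^ 'm ^ 'n \<Rightarrow> 'k) \<Rightarrow> bool" where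
  "alternating_rows F \<longleftrightarrow> multilinear_rows F \<and> (\<forall>A i j. i \<noteq> j \<longrightarrow> A $ i = A $ j \<longrightarrow> F A = 0)"

lemma upd_row_sum:
  assumes "multilinear_rows F" "finite I"
  shows "F (upd_row A i (\<Sum>b\<in>I. c b *s x b)) = (\<Sum>b\<in>I. c b * F (upd_row A i (x b)))"
  using assms(2)
proof (induction I rule: finite_induct)
  case empty
  have "F (upd_row A i (0 *s 0)) = 0 * F (upd_row A i 0)"
    using assms(1) unfolding multilinear_rows_def by blast
  then show ?case by simp
next
  case (insert b I)
  then show ?case using assms(1) by (simp add: multilinear_rows_def)
qed

lemma alternating_rows_swap:
  assumes F: "alternating_rows F" and ij: "i \<noteq> j"
  shows "F (\<chi> l. A $ Transposition.transpose i j l) = - F A"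
proof -
  let ?U = "\<lambda>x y. upd_row (upd_row A i x) j y"
  have U: "?U x y = upd_row (upd_row A j y) i x" for x y
    using ij by (auto simp: upd_row_def vec_eq_iff)
  have add: "F (upd_row B l (x + y)) = F (upd_row B l x) + F (upd_row B l y)" for B l x y
    using F unfolding alternating_rows_def multilinear_rows_def by blast
  have add1: "F (?U (x + x') y) = F (?U x y) + F (?U x' y)" for x x' y
    unfolding U by (rule add)
  have z: "F (?U x x) = 0" for x
  proof -
    have "?U x x $ i = ?U x x $ j" using ij by (simp add: upd_row_def)
    then show ?thesis using F ij unfolding alternating_rows_def by blast
  qed
  let ?a = "A $ i" and ?b = "A $ j"
  have "0 = F (?U (?a + ?b) (?a + ?b))" by (simp only: z)
  also have "\<dots> = F (?U (?a + ?b) ?a) + F (?U (?a + ?b) ?b)" by (rule add)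
  also have "\<dots> = F (?U ?b ?a) + F (?U ?a ?b)" by (simp add: add1 z)
  finally have "F (?U ?b ?a) = - F (?U ?a ?b)" by (simp add: eq_neg_iff_add_eq_0)
  moreover have "?U ?b ?a = (\<chi> l. A $ Transposition.transpose i j l)" "?U ?a ?b = A"
    by (auto simp: upd_row_def vec_eq_iff Transposition.transpose_def)
  ultimately show ?thesis by simp
qed

text \<open>
  Expanding every row in the standard basis leaves matrices whose rows are basis vectors; those with
  a repeated row contribute nothing, the others are permutations of the identity.
\<close>

lemma alternating_rows_eq_0:
  fixes F :: "'k::field ^ 'n ^ 'n::finite \<Rightarrow> 'k"
  assumes F: "alternating_rows F" and one: "F (mat 1) = 0"
  shows "F A = 0"
proof -
  have ml: "multilinear_rows F" using F by (simp add: alternating_rows_def)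
  have perm: "F (\<chi> i. axis (p i) 1) = 0" if "p permutes (UNIV :: 'n set)" for p
    using finite_class.finite_UNIV that
  proof (induction rule: permutes_rev_induct)
    case id
    have "(\<chi> i. axis (id i) 1) = (mat 1 :: 'k^'n^'n)" by (auto simp: mat_def vec_eq_iff axis_def)
    then show ?case using one by simp
  next
    case (swap a b p)
    show ?case
    proof (cases "a = b")
      case True
      then show ?thesis using swap by simp
    next
      case False
      then have "F (\<chi> l. (\<chi> i. axis (p i) (1::'k)) $ Transposition.transpose a b l) = 0"
        using swap by (simp only: alternating_rows_swap[OF F False]) simp
      then show ?thesis by (simp add: o_def)
    qed
  qed
  have base: "F A = 0" if "\<forall>j. \<exists>b. A $ j = axis b 1" for A
  proof -
    from that obtain f where f: "\<And>j. A $ j = axis (f j) 1" by metis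
    show ?thesis
    proof (cases "inj f")
      case True
      then have "f permutes UNIV"
        using finite_UNIV_inj_surj[OF _ True] by (intro bij_imp_permutes) (auto simp: bij_betw_def)
      moreover have "A = (\<chi> i. axis (f i) 1)" by (simp add: vec_eq_iff f)
      ultimately show ?thesis using perm by simp
    next
      case False
      then obtain i j where "i \<noteq> j" "f i = f j" by (auto simp: inj_def)
      then show ?thesis using F f unfolding alternating_rows_def by metis
    qed
  qed
  have "\<forall>A. (\<forall>j. j \<notin> I \<longrightarrow> (\<exists>b. A $ j = axis b 1)) \<longrightarrow> F A = 0" if "finite I" for I
    using that
  proof (induction I rule: finite_induct)
    case empty
    then show ?case using base by simp
  next
    case (insert i I)
    show ?case
    proof (intro allI impI)
      fix A :: "'k ^ 'n ^ 'n" assume A: "\<forall>j. j \<notin> insert i I \<longrightarrow> (\<exists>b. A $ j = axis b 1)"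
      have "A $ i = (\<Sum>b\<in>UNIV. (A $ i $ b) *s axis b 1)"
        by (simp add: vec_eq_iff axis_def if_distrib cong: if_cong)
      moreover have "A = upd_row A i (A $ i)"
        by (simp add: upd_row_def vec_eq_iff)
      ultimately have "F A = F (upd_row A i (\<Sum>b\<in>UNIV. (A $ i $ b) *s axis b 1))"
        by argo
      also have "\<dots> = (\<Sum>b\<in>UNIV. (A $ i $ b) * F (upd_row A i (axis b 1)))"
        by (rule upd_row_sum[OF ml finite_class.finite_UNIV])
      also have "\<dots> = 0"
      proof (intro sum.neutral ballI)
        fix b :: 'n
        have "\<forall>j. j \<notin> I \<longrightarrow> (\<exists>c. upd_row A i (axis b 1) $ j = axis c 1)"
          using A by (auto simp: upd_row_def)
        then show "A $ i $ b * F (upd_row A i (axis b 1)) = 0" using insert.IH by simp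
      qed
      finally show "F A = 0" .
    qed
  qed
  from this[OF finite_class.finite_UNIV] show ?thesis by simp
qed

subsection \<open>Coordinates on the index type\<close>

lemmas six_less = less_bit0_def bit0.Rep_numeral bit0.Rep_1 bit0.Rep_0

lemma UNIV_6: "(UNIV :: 6 set) = {0, 1, 2, 3, 4, 5}"
  by (rule sym, rule card_subset_eq) auto

lemma forall_6: "(\<forall>i::6. P i) \<longleftrightarrow> P 0 \<and> P 1 \<and> P 2 \<and> P 3 \<and> P 4 \<and> P 5"
  using UNIV_6 by (metis UNIV_I empty_iff insert_iff)

lemma sum_6: "sum f (UNIV :: 6 set) = f 0 + f 1 + f 2 + f 3 + f 4 + f 5"
  unfolding UNIV_6 by (simp add: add.assoc)

lemma six_eq_0: "(6::6) = 0" by simp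

text \<open>
  The determinant, as the top coefficient of the product of the rows.
\<close>

definition wedge6 :: "'k::field ^ 6 ^ 6 \<Rightarrow> 'k" where
  "wedge6 A = (vec_ext (A $ 0) \<and>\<^sub>w (vec_ext (A $ 1) \<and>\<^sub>w (vec_ext (A $ 2) \<and>\<^sub>w
     (vec_ext (A $ 3) \<and>\<^sub>w (vec_ext (A $ 4) \<and>\<^sub>w vec_ext (A $ 5)))))) $ UNIV"

lemma vec_ext_wedge_absorb:
  "vec_ext u \<and>\<^sub>w z = 0 \<Longrightarrow>
    vec_ext u \<and>\<^sub>w (vec_ext v \<and>\<^sub>w (z :: ('k::comm_ring_1, 'n::{finite,linorder} set) vec)) = 0"
  by (metis vec_ext_left_anticommute wedge_zero_right neg_0_equal_iff_equal)

lemma vec_ext_wedge_absorb1: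
  "vec_ext u \<and>\<^sub>w (vec_ext v \<and>\<^sub>w vec_ext (u :: 'k::comm_ring_1 ^ 'n::{finite,linorder})) = 0"
  by (metis vec_ext_wedge_self vec_ext_wedge_absorb)

lemma multilinear_wedge6: "multilinear_rows (wedge6 :: 'k::field ^ 6 ^ 6 \<Rightarrow> 'k)"
  unfolding multilinear_rows_def wedge6_def upd_row_def forall_6
  by (simp add: vec_ext_add vec_ext_scale wedge_linear)

lemma alternating_wedge6: "alternating_rows (wedge6 :: 'k::field ^ 6 ^ 6 \<Rightarrow> 'k)"
proof -
  have "wedge6 A = 0" if "i \<noteq> j" "A $ i = A $ j" for A :: "'k ^ 6 ^ 6" and i j
  proof -
    have "\<forall>i j :: 6. i < j \<longrightarrow> A $ i = A $ j \<longrightarrow> wedge6 A = 0"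
      unfolding forall_6 wedge6_def
      by (simp add: six_less vec_ext_wedge_absorb vec_ext_wedge_absorb1)
    with that show ?thesis by (metis linorder_neqE)
  qed
  then show ?thesis by (auto simp: alternating_rows_def multilinear_wedge6)
qed

lemma mat_1_row: "(mat 1 :: 'k::field ^ 'n ^ 'n) $ i = axis i 1"
  by (simp add: mat_def vec_eq_iff axis_def)

lemma wedge6_mat_1: "wedge6 (mat 1 :: 'k::field ^ 6 ^ 6) = 1"
  unfolding wedge6_def mat_1_row ee_def[symmetric] ee_axis
  by (simp add: wedge_axis shuffle_sign_insert_right six_less wedge_scale_right)
     (unfold axis_def UNIV_6, simp add: insert_commute)

text \<open>The top exterior power is a line, on which \<open>g\<close> acts by its value at the standard basis.\<close>

lemma wedge6_act:
  fixes g A :: "'k::field ^ 6 ^ 6"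
  shows "wedge6 (\<chi> i. g *v A $ i) = wedge6 (\<chi> i. g *v axis i 1) * wedge6 A"
proof -
  define F where "F A = wedge6 (\<chi> i. g *v A $ i) - wedge6 (\<chi> i. g *v axis i 1) * wedge6 A" for A
  have u: "(\<chi> j. g *v upd_row A i x $ j) = upd_row (\<chi> j. g *v A $ j) i (g *v x)" for A i x
    by (auto simp: upd_row_def vec_eq_iff)
  have ml: "wedge6 (upd_row A i (x + y)) = wedge6 (upd_row A i x) + wedge6 (upd_row A i y)"
    "wedge6 (upd_row A i (c *s x)) = c * wedge6 (upd_row A i x)" for A :: "'k^6^6" and i x y c
    using multilinear_wedge6 unfolding multilinear_rows_def by blast+
  have alt: "i \<noteq> j \<Longrightarrow> A $ i = A $ j \<Longrightarrow> wedge6 A = 0" for A :: "'k^6^6" and i j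
    using alternating_wedge6 unfolding alternating_rows_def by blast
  have "alternating_rows F"
    unfolding alternating_rows_def multilinear_rows_def F_def
  proof (intro conjI allI impI)
    fix A :: "'k^6^6" and i j :: 6 assume "i \<noteq> j" "A $ i = A $ j"
    then show "wedge6 (\<chi> i. g *v A $ i) - wedge6 (\<chi> i. g *v axis i 1) * wedge6 A = 0"
      using alt[of i j A] alt[of i j "\<chi> i. g *v A $ i"] by simp
  qed (simp_all add: u ml matrix_vector_right_distrib vector_scalar_commute algebra_simps)
  moreover have "F (mat 1) = 0"
    unfolding F_def mat_1_row wedge6_mat_1 by simp
  ultimately have "F A = 0" by (rule alternating_rows_eq_0)
  then show ?thesis by (simp add: F_def)
qed

text \<open>
  Twice the image under \<open>g\<close> of the bivector \<open>e\<^sub>1 \<and> e\<^sub>4 + e\<^sub>2 \<and> e\<^sub>5 + e\<^sub>3 \<and> e\<^sub>6\<close>, in a form in which its invariance under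
  \<open>Sp\<^sub>6\<close> is a matrix identity.
\<close>

definition omega :: "'k::field ^ 6 ^ 6 \<Rightarrow> 'k multivector6" where
  "omega g = (\<Sum>a\<in>UNIV. \<Sum>b\<in>UNIV. (MJ $ a $ b) *s (vec_ext (g *v axis a 1) \<and>\<^sub>w vec_ext (g *v axis b 1)))"

lemma MJ_entries: "MJ $ i $ j = (if (i, j) \<in> {(1, 4), (2, 5), (3, 0)} then 1
                else if (i, j) \<in> {(4, 1), (5, 2), (0, 3)} then - 1 else (0::'k::comm_ring_1))"
  unfolding MJ_def six_eq_0 by simp

lemma sum_swap4: "(\<Sum>a\<in>A. \<Sum>b\<in>B. \<Sum>i\<in>I. \<Sum>j\<in>K. X a b i j) = (\<Sum>i\<in>I. \<Sum>j\<in>K. \<Sum>a\<in>A. \<Sum>b\<in>B. X a b i j)"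
proof -
  have "(\<Sum>a\<in>A. \<Sum>b\<in>B. \<Sum>i\<in>I. \<Sum>j\<in>K. X a b i j) = (\<Sum>a\<in>A. \<Sum>i\<in>I. \<Sum>b\<in>B. \<Sum>j\<in>K. X a b i j)"
    by (rule sum.cong[OF refl], rule sum.swap)
  also have "\<dots> = (\<Sum>i\<in>I. \<Sum>a\<in>A. \<Sum>j\<in>K. \<Sum>b\<in>B. X a b i j)"
    by (subst sum.swap) (intro sum.cong refl sum.swap)
  also have "\<dots> = (\<Sum>i\<in>I. \<Sum>j\<in>K. \<Sum>a\<in>A. \<Sum>b\<in>B. X a b i j)"
    by (rule sum.cong[OF refl], rule sum.swap)
  finally show ?thesis .
qed

lemma omega_Sp6:
  fixes g :: "'k::field ^ 6 ^ 6"
  assumes "g \<in> Sp6"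
  shows "omega g = omega (mat 1)"
proof (unfold vec_eq_iff, rule allI)
  fix S :: "6 set"
  let ?e = "\<lambda>i. vec_ext (axis i 1) :: 'k multivector6"
  define f where "f i j = (?e i \<and>\<^sub>w ?e j) $ S" for i j
  have col: "vec_ext (g *v axis a 1) = (\<Sum>i\<in>UNIV. (g $ i $ a) *s ?e i)" for a
  proof -
    have "(g *v axis a 1) $ i = g $ i $ a" for i
      by (simp add: matrix_vector_mult_def axis_def if_distrib cong: if_cong)
    then show ?thesis by (subst vec_ext_expand) (simp add: ee_def)
  qed
  have "omega g $ S = (\<Sum>a\<in>UNIV. \<Sum>b\<in>UNIV. \<Sum>i\<in>UNIV. \<Sum>j\<in>UNIV. 
      g $ i $ a * MJ $ a $ b * g $ j $ b * f i j)"
  proof -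
    have "(vec_ext (g *v axis a 1) \<and>\<^sub>w vec_ext (g *v axis b 1)) $ S
        = (\<Sum>i\<in>UNIV. \<Sum>j\<in>UNIV. g $ i $ a * (g $ j $ b * f i j))" for a b
      unfolding col wedge_sum_left wedge_scale_left unfolding wedge_sum_right wedge_scale_right
      by (simp add: sum_distrib_left f_def)
    then show ?thesis
      unfolding omega_def sum_component by (simp add: sum_distrib_left mult_ac)
  qed
  also have "\<dots> = (\<Sum>i\<in>UNIV. \<Sum>j\<in>UNIV. \<Sum>a\<in>UNIV. \<Sum>b\<in>UNIV. g $ i $ a * MJ $ a $ b * g $ j $ b * f i j)"
    by (rule sum_swap4)
  also have "\<dots> = (\<Sum>i\<in>UNIV. \<Sum>j\<in>UNIV. (g ** MJ ** transpose g) $ i $ j * f i j)"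
  proof (intro sum.cong refl)
    fix i j :: 6
    have "(g ** MJ ** transpose g) $ i $ j = (\<Sum>b\<in>UNIV. \<Sum>a\<in>UNIV. g $ i $ a * MJ $ a $ b * g $ j $ b)"
      by (simp add: matrix_matrix_mult_def transpose_def sum_distrib_right)
    also have "\<dots> = (\<Sum>a\<in>UNIV. \<Sum>b\<in>UNIV. g $ i $ a * MJ $ a $ b * g $ j $ b)" by (rule sum.swap)
    finally show "(\<Sum>a\<in>UNIV. \<Sum>b\<in>UNIV. g $ i $ a * MJ $ a $ b * g $ j $ b * f i j)
       = (g ** MJ ** transpose g) $ i $ j * f i j"
      by (simp add: sum_distrib_right)
  qed
  also have "\<dots> = omega (mat 1) $ S"
    using assms by (simp add: Sp6_def omega_def sum_component f_def)
  finally show "omega g $ S = omega (mat 1) $ S" .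
qed

lemma MJ_values:
  "MJ $ 0 $ 0 = (0 :: 'k::comm_ring_1)"
  "MJ $ 0 $ 1 = (0 :: 'k::comm_ring_1)"
  "MJ $ 0 $ 2 = (0 :: 'k::comm_ring_1)"
  "MJ $ 0 $ 3 = (- 1 :: 'k::comm_ring_1)"
  "MJ $ 0 $ 4 = (0 :: 'k::comm_ring_1)"
  "MJ $ 0 $ 5 = (0 :: 'k::comm_ring_1)"
  "MJ $ 1 $ 0 = (0 :: 'k::comm_ring_1)"
  "MJ $ 1 $ 1 = (0 :: 'k::comm_ring_1)"
  "MJ $ 1 $ 2 = (0 :: 'k::comm_ring_1)"
  "MJ $ 1 $ 3 = (0 :: 'k::comm_ring_1)"
  "MJ $ 1 $ 4 = (1 :: 'k::comm_ring_1)"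
  "MJ $ 1 $ 5 = (0 :: 'k::comm_ring_1)"
  "MJ $ 2 $ 0 = (0 :: 'k::comm_ring_1)"
  "MJ $ 2 $ 1 = (0 :: 'k::comm_ring_1)"
  "MJ $ 2 $ 2 = (0 :: 'k::comm_ring_1)"
  "MJ $ 2 $ 3 = (0 :: 'k::comm_ring_1)"
  "MJ $ 2 $ 4 = (0 :: 'k::comm_ring_1)"
  "MJ $ 2 $ 5 = (1 :: 'k::comm_ring_1)"
  "MJ $ 3 $ 0 = (1 :: 'k::comm_ring_1)"
  "MJ $ 3 $ 1 = (0 :: 'k::comm_ring_1)"
  "MJ $ 3 $ 2 = (0 :: 'k::comm_ring_1)"
  "MJ $ 3 $ 3 = (0 :: 'k::comm_ring_1)"
  "MJ $ 3 $ 4 = (0 :: 'k::comm_ring_1)"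
  "MJ $ 3 $ 5 = (0 :: 'k::comm_ring_1)"
  "MJ $ 4 $ 0 = (0 :: 'k::comm_ring_1)"
  "MJ $ 4 $ 1 = (- 1 :: 'k::comm_ring_1)"
  "MJ $ 4 $ 2 = (0 :: 'k::comm_ring_1)"
  "MJ $ 4 $ 3 = (0 :: 'k::comm_ring_1)"
  "MJ $ 4 $ 4 = (0 :: 'k::comm_ring_1)"
  "MJ $ 4 $ 5 = (0 :: 'k::comm_ring_1)"
  "MJ $ 5 $ 0 = (0 :: 'k::comm_ring_1)"
  "MJ $ 5 $ 1 = (0 :: 'k::comm_ring_1)"
  "MJ $ 5 $ 2 = (- 1 :: 'k::comm_ring_1)"
  "MJ $ 5 $ 3 = (0 :: 'k::comm_ring_1)"
  "MJ $ 5 $ 4 = (0 :: 'k::comm_ring_1)"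
  "MJ $ 5 $ 5 = (0 :: 'k::comm_ring_1)"
  by (simp_all add: MJ_entries)

lemma omega_explicit:
  "omega g = 2 *s (vec_ext (g *v axis 1 1) \<and>\<^sub>w vec_ext (g *v axis 4 1) +
     vec_ext (g *v axis 2 1) \<and>\<^sub>w vec_ext (g *v axis 5 1) +
     vec_ext (g *v axis 3 1) \<and>\<^sub>w vec_ext (g *v axis 0 1))"
proof -
  define E where "E i = vec_ext (g *v axis i 1)" for i
  define X Y Z where X: "X = E 1 \<and>\<^sub>w E 4" and Y: "Y = E 2 \<and>\<^sub>w E 5" and Z: "Z = E 3 \<and>\<^sub>w E 0"
  have X': "E 4 \<and>\<^sub>w E 1 = - X" unfolding X E_def by (rule vec_ext_anticommute)
  have Y': "E 5 \<and>\<^sub>w E 2 = - Y" unfolding Y E_def by (rule vec_ext_anticommute)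
  have Z': "E 0 \<and>\<^sub>w E 3 = - Z" unfolding Z E_def by (rule vec_ext_anticommute)
  have "omega g = (\<Sum>a\<in>UNIV. \<Sum>b\<in>UNIV. (MJ $ a $ b) *s (E a \<and>\<^sub>w E b))"
    by (simp only: omega_def E_def)
  also have "\<dots> = 2 *s (X + Y + Z)"
    unfolding sum_6 MJ_values X' Y' Z' X[symmetric] Y[symmetric] Z[symmetric]
    by (simp add: vec_eq_iff algebra_simps)
  finally show ?thesis by (simp only: X Y Z E_def)
qed

lemma vec_ext_bivector_commute:
  fixes c d v :: "('k::field, 'n::{finite,linorder}) vec"
  shows "vec_ext v \<and>\<^sub>w (vec_ext c \<and>\<^sub>w vec_ext d) = vec_ext c \<and>\<^sub>w (vec_ext d \<and>\<^sub>w vec_ext v)"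
  by (subst vec_ext_left_anticommute[of v c "vec_ext d"], subst vec_ext_anticommute[of v d])
     (simp only: wedge_minus_right minus_minus)

lemma bivectors_commute:
  fixes a b c d :: "('k::field, 'n::{finite,linorder}) vec"
  shows "(vec_ext a \<and>\<^sub>w vec_ext b) \<and>\<^sub>w (vec_ext c \<and>\<^sub>w vec_ext d)
     = (vec_ext c \<and>\<^sub>w vec_ext d) \<and>\<^sub>w (vec_ext a \<and>\<^sub>w vec_ext b)"
proof -
  let ?X = "vec_ext c \<and>\<^sub>w vec_ext d"
  have comm: "vec_ext v \<and>\<^sub>w ?X = ?X \<and>\<^sub>w vec_ext v" for v
    using vec_ext_bivector_commute[of v c d] by (simp only: wedge_assoc)
  have "(vec_ext a \<and>\<^sub>w vec_ext b) \<and>\<^sub>w ?X = vec_ext a \<and>\<^sub>w (vec_ext b \<and>\<^sub>w ?X)" by (rule wedge_assoc)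
  also have "\<dots> = vec_ext a \<and>\<^sub>w (?X \<and>\<^sub>w vec_ext b)" by (simp only: comm[of b])
  also have "\<dots> = (vec_ext a \<and>\<^sub>w ?X) \<and>\<^sub>w vec_ext b" by (rule wedge_assoc[symmetric])
  also have "\<dots> = (?X \<and>\<^sub>w vec_ext a) \<and>\<^sub>w vec_ext b" by (simp only: comm[of a])
  also have "\<dots> = ?X \<and>\<^sub>w (vec_ext a \<and>\<^sub>w vec_ext b)" by (rule wedge_assoc)
  finally show ?thesis .
qed

text \<open>
  The third power of the invariant bivector is 48 times the product of the columns of \<open>g\<close> in the order
  1, 4, 2, 5, 3, 6. Comparison with the identity matrix gives the determinant, since 48 is invertible.
\<close>

lemma wedge6_Sp6:
  fixes g :: "'k::field ^ 6 ^ 6"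
  assumes "g \<in> Sp6" and k: "(2::'k) \<noteq> 0" "(3::'k) \<noteq> 0"
  shows "wedge6 (\<chi> i. g *v axis i 1) = 1"
proof -
  define \<sigma> :: "6 \<Rightarrow> 6" where "\<sigma> i = (if i = 0 then 1 else if i = 1 then 4 else
       if i = 2 then 2 else if i = 3 then 5 else if i = 4 then 3 else 0)" for i
  have cube: "(omega g \<and>\<^sub>w (omega g \<and>\<^sub>w omega g)) $ UNIV = 48 * wedge6 (\<chi> i. g *v axis (\<sigma> i) 1)"
    for g :: "'k ^ 6 ^ 6"
  proof -
    define E where "E i = vec_ext (g *v axis i 1)" for i
    define \<alpha> \<beta> \<gamma> where "\<alpha> = E 1 \<and>\<^sub>w E 4" and "\<beta> = E 2 \<and>\<^sub>w E 5" and "\<gamma> = E 3 \<and>\<^sub>w E 0"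
    have com: "\<alpha> \<and>\<^sub>w \<beta> = \<beta> \<and>\<^sub>w \<alpha>" "\<alpha> \<and>\<^sub>w \<gamma> = \<gamma> \<and>\<^sub>w \<alpha>" "\<beta> \<and>\<^sub>w \<gamma> = \<gamma> \<and>\<^sub>w \<beta>"
      unfolding \<alpha>_def \<beta>_def \<gamma>_def E_def by (rule bivectors_commute)+
    have sq: "\<alpha> \<and>\<^sub>w \<alpha> = 0" "\<beta> \<and>\<^sub>w \<beta> = 0" "\<gamma> \<and>\<^sub>w \<gamma> = 0"
      unfolding \<alpha>_def \<beta>_def \<gamma>_def E_def
      by (simp_all add: wedge_assoc vec_ext_wedge_absorb vec_ext_wedge_absorb1)
    have com': "\<alpha> \<and>\<^sub>w (\<beta> \<and>\<^sub>w z) = \<beta> \<and>\<^sub>w (\<alpha> \<and>\<^sub>w z)" "\<alpha> \<and>\<^sub>w (\<gamma> \<and>\<^sub>w z) = \<gamma> \<and>\<^sub>w (\<alpha> \<and>\<^sub>w z)"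
      "\<beta> \<and>\<^sub>w (\<gamma> \<and>\<^sub>w z) = \<gamma> \<and>\<^sub>w (\<beta> \<and>\<^sub>w z)" for z
      by (simp_all add: wedge_assoc[symmetric] com)
    have sq': "\<alpha> \<and>\<^sub>w (\<alpha> \<and>\<^sub>w z) = 0" "\<beta> \<and>\<^sub>w (\<beta> \<and>\<^sub>w z) = 0" "\<gamma> \<and>\<^sub>w (\<gamma> \<and>\<^sub>w z) = 0" for z
      by (simp_all add: wedge_assoc[symmetric] sq)
    have \<omega>: "omega g = 2 *s (\<alpha> + \<beta> + \<gamma>)"
      by (simp add: omega_explicit \<alpha>_def \<beta>_def \<gamma>_def E_def)
    have "(\<alpha> + \<beta> + \<gamma>) \<and>\<^sub>w ((\<alpha> + \<beta> + \<gamma>) \<and>\<^sub>w (\<alpha> + \<beta> + \<gamma>)) = 6 *s (\<gamma> \<and>\<^sub>w (\<beta> \<and>\<^sub>w \<alpha>))"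
      by (simp only: wedge_add_left wedge_add_right com com' sq sq' wedge_zero_right add_0_left add_0_right)
         (simp add: vec_eq_iff)
    also have "\<gamma> \<and>\<^sub>w (\<beta> \<and>\<^sub>w \<alpha>) = \<alpha> \<and>\<^sub>w (\<beta> \<and>\<^sub>w \<gamma>)" by (simp only: com com')
    finally have "((\<alpha> + \<beta> + \<gamma>) \<and>\<^sub>w ((\<alpha> + \<beta> + \<gamma>) \<and>\<^sub>w (\<alpha> + \<beta> + \<gamma>))) $ UNIV
        = 6 * (\<alpha> \<and>\<^sub>w (\<beta> \<and>\<^sub>w \<gamma>)) $ UNIV" by simp
    also have "(\<alpha> \<and>\<^sub>w (\<beta> \<and>\<^sub>w \<gamma>)) $ UNIV = wedge6 (\<chi> i. g *v axis (\<sigma> i) 1)"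
      by (simp add: wedge6_def \<alpha>_def \<beta>_def \<gamma>_def E_def \<sigma>_def wedge_assoc)
    finally have *: "((\<alpha> + \<beta> + \<gamma>) \<and>\<^sub>w ((\<alpha> + \<beta> + \<gamma>) \<and>\<^sub>w (\<alpha> + \<beta> + \<gamma>))) $ UNIV
        = 6 * wedge6 (\<chi> i. g *v axis (\<sigma> i) 1)" .
    show ?thesis
      unfolding \<omega> wedge_scale_left wedge_scale_right vector_smult_assoc vector_smult_component *
      by simp
  qed
  define c where "c = wedge6 (\<chi> i. axis (\<sigma> i) (1::'k))"
  have act: "wedge6 (\<chi> i. g *v axis (\<sigma> i) 1) = wedge6 (\<chi> i. g *v axis i 1) * c" for g
    using wedge6_act[of g "\<chi> i. axis (\<sigma> i) 1"] by (simp add: c_def)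
  have c: "c \<noteq> 0"
    unfolding c_def wedge6_def \<sigma>_def ee_def[symmetric] ee_axis
    by (simp add: ee_def[symmetric] ee_axis wedge_axis shuffle_sign_insert_right six_less wedge_scale_right
          wedge_minus_left wedge_minus_right)
       (unfold axis_def UNIV_6, simp add: insert_commute)
  have "48 * (wedge6 (\<chi> i. g *v axis i 1) * c) = 48 * c"
    using cube[of g] cube[of "mat 1"] omega_Sp6[OF assms(1)] act[of g] by (simp add: c_def)
  moreover have "(48::'k) = 2 * 2 * 2 * 2 * 3" by simp
  then have "(48::'k) \<noteq> 0" using k by (metis mult_eq_0_iff)
  ultimately show ?thesis using c by simp
qed


subsection \<open>The covariant\<close>

text \<open>
  Contraction with a covector; for a basis covector it is \<open>pd\<close>.
\<close>

definition contract :: "'k::field ^ 6 \<Rightarrow> 'k multivector6 \<Rightarrow> 'k multivector6" where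
  "contract \<xi> w = (\<Sum>m\<in>UNIV. \<xi> $ m *s pd m w)"

definition pairing :: "'k::field ^ 'n \<Rightarrow> 'k ^ 'n \<Rightarrow> 'k" where
  "pairing \<xi> u = (\<Sum>i\<in>UNIV. \<xi> $ i * u $ i)"

lemma vec_ext_ee_product:
  "(vec_ext u \<and>\<^sub>w vec_ext v) $ S = (\<Sum>i\<in>UNIV. \<Sum>j\<in>UNIV. u $ i * v $ j * (ee i \<and>\<^sub>w ee j) $ S)"
proof -
  have "vec_ext u \<and>\<^sub>w vec_ext v = (\<Sum>i\<in>UNIV. \<Sum>j\<in>UNIV. u $ i *s (v $ j *s (ee i \<and>\<^sub>w ee j)))"
    unfolding vec_ext_expand[of u] vec_ext_expand[of v] wedge_sum_left wedge_scale_left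
    unfolding wedge_sum_right wedge_scale_right smult_sum ..
  then show ?thesis by (simp add: sum_component mult.assoc)
qed

lemma ee_anticommute: "ee i \<and>\<^sub>w ee j = - (ee j \<and>\<^sub>w (ee i :: ('k::comm_ring_1, 'n::{finite,linorder} set) vec))"
  unfolding ee_def by (rule vec_ext_anticommute)

lemma alternating3_pd:
  "alternating3 (\<lambda>i j l. of_bool (i = m) *s (ee j \<and>\<^sub>w ee l) - of_bool (j = m) *s (ee i \<and>\<^sub>w ee l)
     + of_bool (l = m) *s (ee i \<and>\<^sub>w ee j) :: ('k::field, 'n::{finite,linorder} set) vec)"
proof -
  have s: "ee i \<and>\<^sub>w ee i = (0 :: ('k, 'n set) vec)" for i :: 'n by (simp add: ee_def)
  show ?thesis
    unfolding alternating3_def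
  proof (intro allI conjI)
    fix i j l :: 'n
    let ?F = "\<lambda>i j l. of_bool (i = m) *s (ee j \<and>\<^sub>w ee l) - of_bool (j = m) *s (ee i \<and>\<^sub>w ee l)
     + of_bool (l = m) *s (ee i \<and>\<^sub>w ee j) :: ('k::field, 'n::{finite,linorder} set) vec"
    show "?F j i l = - ?F i j l"
      unfolding ee_anticommute[of j i] by (simp add: vec_eq_iff)
    show "?F i l j = - ?F i j l"
      unfolding ee_anticommute[of l j] by (simp add: vec_eq_iff)
    show "?F i i l = 0" by (simp add: s)
  qed
qed

lemma sum_delta_first:
  fixes u v z :: "'k::field ^ 'n::finite"
  shows "(\<Sum>i\<in>UNIV. \<Sum>j\<in>UNIV. \<Sum>l\<in>UNIV. u $ i * v $ j * z $ l * (of_bool (i = m) * f j l))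
      = u $ m * (\<Sum>j\<in>UNIV. \<Sum>l\<in>UNIV. v $ j * z $ l * f j l)"
proof -
  have "(\<Sum>i\<in>UNIV. \<Sum>j\<in>UNIV. \<Sum>l\<in>UNIV. u $ i * v $ j * z $ l * (of_bool (i = m) * f j l))
     = (\<Sum>i\<in>UNIV. if i = m then u $ i * (\<Sum>j\<in>UNIV. \<Sum>l\<in>UNIV. v $ j * z $ l * f j l) else 0)"
    by (rule sum.cong) (auto simp: sum_distrib_left mult.assoc)
  then show ?thesis by simp
qed

lemma pd_decomp3:
  "pd m (decomp3 u v z) = u $ m *s (vec_ext v \<and>\<^sub>w vec_ext z) - v $ m *s (vec_ext u \<and>\<^sub>w vec_ext z)
     + z $ m *s (vec_ext u \<and>\<^sub>w vec_ext v)"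
proof (unfold vec_eq_iff, rule allI)
  fix S :: "6 set"
  define f where "f i j = (ee i \<and>\<^sub>w ee j :: 'a multivector6) $ S" for i j
  have P: "(vec_ext u \<and>\<^sub>w vec_ext v) $ S = (\<Sum>i\<in>UNIV. \<Sum>j\<in>UNIV. u $ i * v $ j * f i j)" for u v
    by (simp add: vec_ext_ee_product f_def)
  have "pd m (decomp3 u v z) $ S = (\<Sum>i\<in>UNIV. \<Sum>j\<in>UNIV. \<Sum>l\<in>UNIV. u $ i * v $ j * z $ l *
      (of_bool (i = m) * f j l - of_bool (j = m) * f i l + of_bool (l = m) * f i j))"
    unfolding pd_def lift3_decomp3[OF alternating3_pd] by (simp add: sum_component f_def algebra_simps)
  also have "\<dots> = (\<Sum>i\<in>UNIV. \<Sum>j\<in>UNIV. \<Sum>l\<in>UNIV. u $ i * v $ j * z $ l * (of_bool (i = m) * f j l))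
      - (\<Sum>i\<in>UNIV. \<Sum>j\<in>UNIV. \<Sum>l\<in>UNIV. u $ i * v $ j * z $ l * (of_bool (j = m) * f i l))
      + (\<Sum>i\<in>UNIV. \<Sum>j\<in>UNIV. \<Sum>l\<in>UNIV. u $ i * v $ j * z $ l * (of_bool (l = m) * f i j))"
    by (simp only: sum.distrib[symmetric] sum_subtractf[symmetric] distrib_left right_diff_distrib)
  also have "(\<Sum>i\<in>UNIV. \<Sum>j\<in>UNIV. \<Sum>l\<in>UNIV. u $ i * v $ j * z $ l * (of_bool (j = m) * f i l))
      = (\<Sum>j\<in>UNIV. \<Sum>i\<in>UNIV. \<Sum>l\<in>UNIV. v $ j * u $ i * z $ l * (of_bool (j = m) * f i l))"
    by (subst sum.swap) (simp only: mult_ac)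
  also have "(\<Sum>i\<in>UNIV. \<Sum>j\<in>UNIV. \<Sum>l\<in>UNIV. u $ i * v $ j * z $ l * (of_bool (l = m) * f i j))
      = (\<Sum>i\<in>UNIV. \<Sum>l\<in>UNIV. \<Sum>j\<in>UNIV. u $ i * v $ j * z $ l * (of_bool (l = m) * f i j))"
    by (intro sum.cong refl sum.swap)
  also have "\<dots> = (\<Sum>l\<in>UNIV. \<Sum>i\<in>UNIV. \<Sum>j\<in>UNIV. z $ l * u $ i * v $ j * (of_bool (l = m) * f i j))"
    by (subst sum.swap) (simp only: mult_ac)
  finally show "pd m (decomp3 u v z) $ S = (u $ m *s (vec_ext v \<and>\<^sub>w vec_ext z)
      - v $ m *s (vec_ext u \<and>\<^sub>w vec_ext z) + z $ m *s (vec_ext u \<and>\<^sub>w vec_ext v)) $ S"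
    unfolding sum_delta_first P[symmetric] by simp
qed

lemma pd_linear: "pd m (u + v) = pd m u + pd m v" "pd m (c *s u) = c *s pd m u" "pd m 0 = 0"
  by (simp_all add: pd_def lift3_add lift3_scale)

lemma contract_linear: "contract \<xi> (u + v) = contract \<xi> u + contract \<xi> v"
  "contract \<xi> (c *s u) = c *s contract \<xi> u" "contract \<xi> 0 = 0"
  by (simp_all add: contract_def pd_linear sum.distrib vector_add_ldistrib smult_sum vector_smult_assoc mult.commute)

lemma contract_decomp3:
  "contract \<xi> (decomp3 u v z) = pairing \<xi> u *s (vec_ext v \<and>\<^sub>w vec_ext z)
     - pairing \<xi> v *s (vec_ext u \<and>\<^sub>w vec_ext z) + pairing \<xi> z *s (vec_ext u \<and>\<^sub>w vec_ext v)"
proof -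
  have p: "(\<Sum>m\<in>UNIV. \<xi> $ m * x $ m * c) = pairing \<xi> x * c" for x and c :: 'a
    by (simp add: pairing_def sum_distrib_right)
  show ?thesis
    by (simp add: vec_eq_iff contract_def pd_decomp3 sum_component sum.distrib sum_subtractf
        distrib_left right_diff_distrib p)
qed

lemma contract_axis: "contract (axis i 1) w = pd i w"
  by (simp add: contract_def axis_def if_distrib[of "\<lambda>x. x *s _"] cong: if_cong)

lemma pd_grade: "pd m w \<in> grade 2"
  unfolding pd_def lift3_def
proof (rule grade_sum, clarify)
  fix i j l :: 6
  have e: "ee i \<and>\<^sub>w ee j \<in> grade 2" for i j :: 6
    using wedge_grade[OF vec_ext_grade vec_ext_grade, of "axis i 1" "axis j 1"] by (simp add: ee_def numeral_2_eq_2)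
  have "- z \<in> grade 2" if "z \<in> grade 2" for z using that by (simp add: grade_def)
  then show "w $ {i, j, l} *s (of_bool (i = m) *s ee j \<and>\<^sub>w ee l - of_bool (j = m) *s ee i \<and>\<^sub>w ee l +
      of_bool (l = m) *s ee i \<and>\<^sub>w ee j) \<in> grade 2"
    unfolding diff_conv_add_uminus by (intro grade_scale grade_add e) (auto intro!: grade_scale grade_zero e)
qed

lemma sum_decomp3:
  "decomp3 (\<Sum>i\<in>UNIV. u $ i *s x i) (\<Sum>i\<in>UNIV. v $ i *s x i) (\<Sum>i\<in>UNIV. z $ i *s x i)
     = (\<Sum>i\<in>UNIV. \<Sum>j\<in>UNIV. \<Sum>l\<in>UNIV. (u $ i * v $ j * z $ l) *s decomp3 (x i) (x j) (x l))"
  unfolding decomp3_def vec_ext_sum vec_ext_scale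
  unfolding wedge_sum_left wedge_scale_left
  by (simp only: wedge_sum_right wedge_scale_right smult_sum vector_smult_assoc)
     (simp only: wedge_sum_left wedge_scale_left wedge_sum_right wedge_scale_right smult_sum vector_smult_assoc mult.assoc)

lemma alternating3_decomp3: "alternating3 (\<lambda>i j l. decomp3 (x i) (x j) (x l))"
  unfolding alternating3_def decomp3_def
proof (intro allI conjI)
  fix i j l
  show "vec_ext (x j) \<and>\<^sub>w (vec_ext (x i) \<and>\<^sub>w vec_ext (x l)) = - (vec_ext (x i) \<and>\<^sub>w (vec_ext (x j) \<and>\<^sub>w vec_ext (x l)))"
    by (rule vec_ext_left_anticommute)
  show "vec_ext (x i) \<and>\<^sub>w (vec_ext (x l) \<and>\<^sub>w vec_ext (x j)) = - (vec_ext (x i) \<and>\<^sub>w (vec_ext (x j) \<and>\<^sub>w vec_ext (x l)))"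
    by (subst vec_ext_anticommute) (simp only: wedge_minus_right)
qed simp

lemma matrix_vector_sum: "(g :: 'k::field ^ 'n ^ 'm) *v u = (\<Sum>i\<in>UNIV. u $ i *s (g *v axis i 1))"
  by (simp add: vec_eq_iff matrix_vector_mult_def axis_def sum_component if_distrib mult.commute cong: if_cong)

lemma act3_eq: "act3 g = lift3 (\<lambda>i j l. decomp3 (g *v axis i 1) (g *v axis j 1) (g *v axis l 1))"
  by (simp add: act3_def decomp3_def wedge_assoc)

lemma act3_decomp3: "act3 g (decomp3 u v z) = decomp3 (g *v u) (g *v v) (g *v z)"
  unfolding act3_eq lift3_decomp3[OF alternating3_decomp3]
  unfolding matrix_vector_sum[of g u] matrix_vector_sum[of g v] matrix_vector_sum[of g z] sum_decomp3 ..

lemma act3_linear: "act3 g (u + v) = act3 g u + act3 g v" "act3 g (c *s u) = c *s act3 g u" "act3 g 0 = 0"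
  by (simp_all add: act3_def lift3_add lift3_scale)

lemma act3_grade: "act3 g w \<in> grade 3"
  unfolding act3_eq lift3_def by (rule grade_sum) (auto intro: grade_scale decomp3_grade)

text \<open>
  The matrix of this form in \<open>\<xi>\<close> and \<open>u\<close> is \<open>\<phi>(w)\<close> up to sign, if \<open>w' = w\<close>. The two trivectors are kept apart, so
  that the form is linear in each of them and its invariance can be checked on decomposable ones.
\<close>

definition top_form :: "'k::field multivector6 \<Rightarrow> 'k multivector6 \<Rightarrow> 'k ^ 6 \<Rightarrow> 'k ^ 6 \<Rightarrow> 'k" where
  "top_form w w' \<xi> u = (w \<and>\<^sub>w contract \<xi> w' \<and>\<^sub>w vec_ext u) $ UNIV"

lemma decomp_wedge6:
  "(decomp3 v0 v1 v2 \<and>\<^sub>w (vec_ext v3 \<and>\<^sub>w vec_ext v4) \<and>\<^sub>w vec_ext v5) $ UNIV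
     = wedge6 (\<chi> i. if i = 0 then v0 else if i = 1 then v1 else if i = 2 then v2
          else if i = 3 then v3 else if i = 4 then v4 else v5)"
  by (simp add: wedge6_def decomp3_def wedge_assoc)

lemma decomp_wedge6_Sp6:
  fixes g :: "'k::field ^ 6 ^ 6"
  assumes g: "g \<in> Sp6" and k: "(2::'k) \<noteq> 0" "(3::'k) \<noteq> 0"
  shows "(decomp3 (g *v v0) (g *v v1) (g *v v2) \<and>\<^sub>w (vec_ext (g *v v3) \<and>\<^sub>w vec_ext (g *v v4)) \<and>\<^sub>w vec_ext (g *v v5)) $ UNIV
     = (decomp3 v0 v1 v2 \<and>\<^sub>w (vec_ext v3 \<and>\<^sub>w vec_ext v4) \<and>\<^sub>w vec_ext v5) $ UNIV"
proof -
  let ?A = "\<chi> i::6. if i = 0 then v0 else if i = 1 then v1 else if i = 2 then v2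
          else if i = 3 then v3 else if i = 4 then v4 else v5"
  have "(\<chi> i. if i = 0 then g *v v0 else if i = 1 then g *v v1 else if i = 2 then g *v v2
          else if i = 3 then g *v v3 else if i = 4 then g *v v4 else g *v v5) = (\<chi> i. g *v ?A $ i)"
    by (simp add: vec_eq_iff)
  then show ?thesis unfolding decomp_wedge6 by (simp only: wedge6_act wedge6_Sp6[OF g k] mult_1)
qed

lemma pairing_matrix: "pairing \<xi> (g *v u) = pairing (transpose g *v \<xi>) u"
proof -
  have "pairing \<xi> (g *v u) = (\<Sum>i\<in>UNIV. \<Sum>j\<in>UNIV. \<xi> $ i * (g $ i $ j * u $ j))"
    by (simp add: pairing_def matrix_vector_mult_def sum_distrib_left)
  also have "\<dots> = (\<Sum>j\<in>UNIV. \<Sum>i\<in>UNIV. \<xi> $ i * (g $ i $ j * u $ j))" by (rule sum.swap)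
  also have "\<dots> = pairing (transpose g *v \<xi>) u"
    unfolding pairing_def matrix_vector_mult_def transpose_def
    by (simp add: sum_distrib_right sum_distrib_left mult_ac)
  finally show ?thesis .
qed

lemma top_form_linear:
  "top_form (w + w2) w' \<xi> u = top_form w w' \<xi> u + top_form w2 w' \<xi> u"
  "top_form (c *s w) w' \<xi> u = c * top_form w w' \<xi> u"
  "top_form 0 w' \<xi> u = 0"
  "top_form w (w' + w2) \<xi> u = top_form w w' \<xi> u + top_form w w2 \<xi> u"
  "top_form w (c *s w') \<xi> u = c * top_form w w' \<xi> u"
  "top_form w 0 \<xi> u = 0"
  by (simp_all add: top_form_def contract_linear wedge_linear)

lemma top_form_Sp6:
  fixes g :: "'k::field ^ 6 ^ 6"
  assumes g: "g \<in> Sp6" and k: "(2::'k) \<noteq> 0" "(3::'k) \<noteq> 0" and "w \<in> grade 3" "w' \<in> grade 3"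
  shows "top_form (act3 g w) (act3 g w') \<xi> (g *v u) = top_form w w' (transpose g *v \<xi>) u"
  using assms(4)
proof (induction w rule: grade3_induct)
  case (decomp c v0 v1 v2)
  have "top_form (act3 g (decomp3 v0 v1 v2)) (act3 g w') \<xi> (g *v u)
      = top_form (decomp3 v0 v1 v2) w' (transpose g *v \<xi>) u" using assms(5)
  proof (induction w' rule: grade3_induct)
    case (decomp c' a b d)
    show ?case
      unfolding top_form_def act3_linear act3_decomp3 contract_linear contract_decomp3 pairing_matrix
        diff_conv_add_uminus wedge_linear
      by (simp add: decomp_wedge6_Sp6[OF g k])
  qed (simp_all only: top_form_linear act3_linear)
  then show ?case by (simp only: top_form_linear act3_linear)
qed (simp_all only: top_form_linear act3_linear)

text \<open>
  The order on the index type puts \<open>e\<^sub>6\<close> first, and moving it past five vectors is an odd permutation.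
\<close>

lemma tau_nth: "(tau :: 'k::field multivector6) $ UNIV = - 1"
  unfolding tau_def six_eq_0 ee_axis wedge_assoc
  by (simp add: wedge_axis shuffle_sign_insert_right six_less wedge_scale_right
          wedge_minus_left wedge_minus_right)
     (unfold axis_def UNIV_6, simp add: insert_commute)

lemma grade_6: "z \<in> grade 6 \<Longrightarrow> (z :: 'k::field multivector6) = z $ UNIV *s axis UNIV 1"
  using grade_top[where 'n = 6 and z = z] by simp

lemma phi_nth:
  fixes w :: "'k::field multivector6"
  assumes "w \<in> grade 3"
  shows "phi w $ i $ j = - top_form w w (axis i 1) (axis j 1)"
proof -
  let ?z = "w \<and>\<^sub>w pd i w \<and>\<^sub>w ee j"
  have e1: "(ee i :: 'k multivector6) \<in> grade 1" for i unfolding ee_def by (rule vec_ext_grade)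
  have "?z \<in> grade (3 + 2 + 1)"
    by (intro wedge_grade assms pd_grade e1)
  then have z: "?z = ?z $ UNIV *s axis UNIV 1" by (intro grade_6) simp
  have "(tau :: 'k multivector6) \<in> grade (1 + 1 + 1 + 1 + 1 + 1)"
    unfolding tau_def by (intro wedge_grade e1)
  moreover have "1 + 1 + 1 + 1 + 1 + 1 = (6 :: nat)" by simp
  ultimately have "(tau :: 'k multivector6) \<in> grade 6" by metis
  from grade_6[OF this, unfolded tau_nth] have t: "(tau :: 'k multivector6) = - axis UNIV 1"
    by (rule trans) (simp add: vec_eq_iff)
  have "(THE c. ?z = c *s tau) = - ?z $ UNIV"
  proof (rule the_equality)
    have "(- ?z $ UNIV) *s tau = ?z $ UNIV *s axis UNIV 1" unfolding t by (simp add: vec_eq_iff)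
    then show "?z = (- ?z $ UNIV) *s tau" using z by argo
    fix c assume "?z = c *s tau"
    then have "?z $ UNIV = c * tau $ UNIV" by simp
    then show "c = - ?z $ UNIV" by (simp add: tau_nth)
  qed
  then show ?thesis by (simp add: phi_def top_form_def contract_axis ee_def)
qed

lemma top_form_sums:
  "top_form w w' \<xi> (\<Sum>i\<in>I. c i *s x i) = (\<Sum>i\<in>I. c i * top_form w w' \<xi> (x i))"
  "top_form w w' (\<Sum>i\<in>I. c i *s x i) u = (\<Sum>i\<in>I. c i * top_form w w' (x i) u)"
proof -
  show "top_form w w' \<xi> (\<Sum>i\<in>I. c i *s x i) = (\<Sum>i\<in>I. c i * top_form w w' \<xi> (x i))"
    by (simp add: top_form_def vec_ext_sum vec_ext_scale wedge_sum_right wedge_scale_right sum_component)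
  have c: "contract (\<Sum>i\<in>I. c i *s x i) w' = (\<Sum>i\<in>I. c i *s contract (x i) w')"
    by (simp add: vec_eq_iff contract_def sum_component sum_distrib_right sum_distrib_left mult.assoc)
       (intro allI sum.swap)
  show "top_form w w' (\<Sum>i\<in>I. c i *s x i) u = (\<Sum>i\<in>I. c i * top_form w w' (x i) u)"
    by (simp add: top_form_def c wedge_sum_right wedge_sum_left wedge_scale_right wedge_scale_left sum_component)
qed

text \<open>
  On decomposable trivectors the form that defines \<open>\<phi>\<close> is a combination of determinants, so it is invariant under
  matrices of determinant one.
\<close>

theorem phi_equivariant:
  fixes g :: "'k::field ^ 6 ^ 6"
  assumes g: "g \<in> Sp6" and k: "(2::'k) \<noteq> 0" "(3::'k) \<noteq> 0" and w: "w \<in> grade 3"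
  shows "phi (act3 g w) ** g = g ** phi w"
proof (unfold vec_eq_iff, intro allI)
  fix i j
  have gj: "(\<Sum>m\<in>UNIV. g $ m $ j *s axis m 1) = g *v axis j 1"
    by (simp add: vec_eq_iff matrix_vector_mult_def axis_def sum_component if_distrib cong: if_cong)
  have gi: "(\<Sum>m\<in>UNIV. g $ i $ m *s axis m 1) = transpose g *v axis i 1"
    by (simp add: vec_eq_iff matrix_vector_mult_def transpose_def axis_def sum_component if_distrib cong: if_cong)
  have "(phi (act3 g w) ** g) $ i $ j = - (\<Sum>m\<in>UNIV. g $ m $ j * top_form (act3 g w) (act3 g w) (axis i 1) (axis m 1))"
    by (simp add: matrix_matrix_mult_def phi_nth[OF act3_grade] sum_negf mult.commute)
  also have "\<dots> = - top_form (act3 g w) (act3 g w) (axis i 1) (g *v axis j 1)"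
    unfolding top_form_sums(1)[symmetric] gj ..
  also have "\<dots> = - top_form w w (transpose g *v axis i 1) (axis j 1)"
    by (simp only: top_form_Sp6[OF g k w w])
  also have "\<dots> = - (\<Sum>m\<in>UNIV. g $ i $ m * top_form w w (axis m 1) (axis j 1))"
    unfolding gi[symmetric] top_form_sums(2) ..
  also have "\<dots> = (g ** phi w) $ i $ j"
    by (simp add: matrix_matrix_mult_def phi_nth[OF w] sum_negf)
  finally show "(phi (act3 g w) ** g) $ i $ j = (g ** phi w) $ i $ j" .
qed

section \<open>Coordinates on \<open>X\<close>\<close>

lemma greaterThan_6:
  "{0 <.. (5 :: 6)} = {1, 2, 3, 4, 5}"
  "{1 <.. (5 :: 6)} = {2, 3, 4, 5}"
  "{2 <.. (5 :: 6)} = {3, 4, 5}"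
  "{3 <.. (5 :: 6)} = {4, 5}"
  "{4 <.. (5 :: 6)} = {5}"
  "{5 <.. (5 :: 6)} = {}"
  unfolding set_eq_iff forall_6 by (simp_all add: six_less less_eq_bit0_def)

lemma sum_triples_6:
  fixes f :: "6 \<Rightarrow> 6 \<Rightarrow> 6 \<Rightarrow> 'a::comm_monoid_add"
  shows "(\<Sum>(i, j, l)\<in>{(i, j, l). i < j \<and> j < l}. f i j l) = f 0 1 2 + f 0 1 3 + f 0 1 4 + f 0 1 5 + f 0 2 3 + f 0 2 4 + f 0 2 5 + f 0 3 4 + f 0 3 5 + f 0 4 5 + f 1 2 3 + f 1 2 4 + f 1 2 5 + f 1 3 4 + f 1 3 5 + f 1 4 5 + f 2 3 4 + f 2 3 5 + f 2 4 5 + f 3 4 5"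
proof -
  have le: "j \<le> 5" for j :: 6
  proof -
    have "\<forall>j :: 6. j \<le> 5" unfolding forall_6 by (simp add: six_less less_eq_bit0_def)
    then show ?thesis ..
  qed
  have "(\<Sum>(i, j, l)\<in>{(i, j, l). i < j \<and> j < l}. f i j l)
      = (\<Sum>(i, j, l)\<in>(SIGMA i:UNIV. SIGMA j:{i<..5}. {j<..5}). f i j l)"
    by (rule sum.cong) (auto simp: le)
  also have "\<dots> = (\<Sum>i\<in>UNIV. \<Sum>j\<in>{i<..5}. \<Sum>l\<in>{j<..5}. f i j l)"
    by (simp add: sum.Sigma[symmetric])
  also have "\<dots> = f 0 1 2 + f 0 1 3 + f 0 1 4 + f 0 1 5 + f 0 2 3 + f 0 2 4 + f 0 2 5 + f 0 3 4 + f 0 3 5 + f 0 4 5 + f 1 2 3 + f 1 2 4 + f 1 2 5 + f 1 3 4 + f 1 3 5 + f 1 4 5 + f 2 3 4 + f 2 3 5 + f 2 4 5 + f 3 4 5"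
    unfolding sum_6 by (simp add: greaterThan_6 add.assoc)
  finally show ?thesis .
qed

lemma lift3_6:
  fixes F :: "6 \<Rightarrow> 6 \<Rightarrow> 6 \<Rightarrow> 'k::comm_ring_1 ^ 'm::finite"
  shows "lift3 F w = w $ {0, 1, 2} *s F 0 1 2
     + w $ {0, 1, 3} *s F 0 1 3
     + w $ {0, 1, 4} *s F 0 1 4
     + w $ {0, 1, 5} *s F 0 1 5
     + w $ {0, 2, 3} *s F 0 2 3
     + w $ {0, 2, 4} *s F 0 2 4
     + w $ {0, 2, 5} *s F 0 2 5
     + w $ {0, 3, 4} *s F 0 3 4
     + w $ {0, 3, 5} *s F 0 3 5
     + w $ {0, 4, 5} *s F 0 4 5
     + w $ {1, 2, 3} *s F 1 2 3
     + w $ {1, 2, 4} *s F 1 2 4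
     + w $ {1, 2, 5} *s F 1 2 5
     + w $ {1, 3, 4} *s F 1 3 4
     + w $ {1, 3, 5} *s F 1 3 5
     + w $ {1, 4, 5} *s F 1 4 5
     + w $ {2, 3, 4} *s F 2 3 4
     + w $ {2, 3, 5} *s F 2 3 5
     + w $ {2, 4, 5} *s F 2 4 5
     + w $ {3, 4, 5} *s F 3 4 5"
  unfolding lift3_def sum_triples_6 ..

text \<open>
  The elements of \<open>X\<close> in the coordinates of a Freudenthal triple system: two scalars \<open>p, q\<close> and two
  symmetric \<open>3 \<times> 3\<close> matrices, which hold the coefficients at the basis trivectors obtained from
  \<open>e\<^sub>1 \<and> e\<^sub>2 \<and> e\<^sub>3\<close> or \<open>e\<^sub>4 \<and> e\<^sub>5 \<and> e\<^sub>6\<close> by exchanging one vector. Here \<open>e\<^sub>6\<close> has index \<open>0\<close>.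
\<close>

definition Xcoords where
  "Xcoords w p q x11 x22 x33 x12 x13 x23 y11 y22 y33 y12 y13 y23 \<longleftrightarrow> (w :: 'k::field multivector6) \<in> grade 3 \<and>
     w $ {0, 1, 2} = x33 \<and> w $ {0, 1, 3} = - x23 \<and> w $ {0, 1, 4} = - y12 \<and> w $ {0, 1, 5} = y11 \<and> w $ {0, 2, 3} = x13 \<and> w $ {0, 2, 4} = - y22 \<and> w $ {0, 2, 5} = y12 \<and> w $ {0, 3, 4} = - y23 \<and> w $ {0, 3, 5} = y13 \<and> w $ {0, 4, 5} = q \<and> w $ {1, 2, 3} = p \<and> w $ {1, 2, 4} = x13 \<and> w $ {1, 2, 5} = x23 \<and> w $ {1, 3, 4} = - x12 \<and> w $ {1, 3, 5} = - x22 \<and> w $ {1, 4, 5} = y13 \<and> w $ {2, 3, 4} = x11 \<and> w $ {2, 3, 5} = x12 \<and> w $ {2, 4, 5} = y23 \<and> w $ {3, 4, 5} = y33"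

lemma bform_axis: "bform M (axis i 1) (axis j 1) = (M :: 'k::comm_ring_1 ^ 6 ^ 6) $ i $ j"
proof -
  have "(M *v axis j 1) $ l = M $ l $ j" for l
    by (simp add: matrix_vector_mult_def axis_def if_distrib cong: if_cong)
  then have "bform M (axis i 1) (axis j 1) = (\<Sum>l\<in>UNIV. if l = i then M $ i $ j else 0)"
    unfolding bform_def by (intro sum.cong) (auto simp: axis_def)
  then show ?thesis by simp
qed

lemma psi_coords:
  "psi w $ 0 = w $ {0, 1, 4}  + w $ {0, 2, 5}"
  "psi w $ 1 = w $ {1, 2, 5}  + w $ {0, 1, 3}"
  "psi w $ 2 = - w $ {1, 2, 4}  + w $ {0, 2, 3}"
  "psi w $ 3 = - w $ {1, 3, 4}  - w $ {2, 3, 5}"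
  "psi w $ 4 = - w $ {2, 4, 5}  - w $ {0, 3, 4}"
  "psi w $ 5 = w $ {1, 4, 5}  - w $ {0, 3, 5}"
  unfolding psi_def lift3_6 bform_axis MJ_values
  by (simp_all only: vector_smult_lzero diff_zero diff_0 add_0_left add_0_right vector_add_component
      vector_smult_component vector_minus_component vector_uminus_component zero_index mult_zero_right)
     (simp_all add: axis_def)

lemma Xspace_coords: "w \<in> Xspace \<longleftrightarrow> (\<exists>p q x11 x22 x33 x12 x13 x23 y11 y22 y33 y12 y13 y23. Xcoords w p q x11 x22 x33 x12 x13 x23 y11 y22 y33 y12 y13 y23)"
proof
  assume w: "w \<in> Xspace"
  then have psi: "psi w $ m = 0" for m by (simp add: Xspace_def)
  have "Xcoords w (w $ {1, 2, 3}) (w $ {0, 4, 5}) (w $ {2, 3, 4}) (- w $ {1, 3, 5}) (w $ {0, 1, 2}) (w $ {2, 3, 5}) (w $ {0, 2, 3}) (- w $ {0, 1, 3}) (w $ {0, 1, 5}) (- w $ {0, 2, 4}) (w $ {3, 4, 5}) (w $ {0, 2, 5}) (w $ {0, 3, 5}) (- w $ {0, 3, 4})"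
    using psi[of 0] psi[of 1] psi[of 2] psi[of 3] psi[of 4] psi[of 5] w
    unfolding psi_coords Xcoords_def Xspace_def
    by (simp add: eq_neg_iff_add_eq_0 neg_eq_iff_add_eq_0 add.commute)
  then show "\<exists>p q x11 x22 x33 x12 x13 x23 y11 y22 y33 y12 y13 y23. Xcoords w p q x11 x22 x33 x12 x13 x23 y11 y22 y33 y12 y13 y23" by blast
next
  assume "\<exists>p q x11 x22 x33 x12 x13 x23 y11 y22 y33 y12 y13 y23. Xcoords w p q x11 x22 x33 x12 x13 x23 y11 y22 y33 y12 y13 y23"
  then obtain p q x11 x22 x33 x12 x13 x23 y11 y22 y33 y12 y13 y23 where c: "Xcoords w p q x11 x22 x33 x12 x13 x23 y11 y22 y33 y12 y13 y23" by blast
  have "psi w = 0"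
    using c unfolding vec_eq_iff forall_6 psi_coords Xcoords_def by simp
  then show "w \<in> Xspace" using c by (simp add: Xspace_def Xcoords_def)
qed

definition bivector_coeff :: "'k::field multivector6 \<Rightarrow> 6 \<Rightarrow> 6 \<Rightarrow> 6 \<Rightarrow> 'k" where
  "bivector_coeff w b c j = (w \<and>\<^sub>w (ee b \<and>\<^sub>w ee c) \<and>\<^sub>w ee j) $ UNIV"

lemma top_form_coords:
  assumes "w' \<in> grade 3"
  shows "top_form w w' (axis i 1) (axis j 1) = (\<Sum>(a, b, c)\<in>{(a, b, c). a < b \<and> b < c}. w' $ {a, b, c} *
    (of_bool (a = i) * bivector_coeff w b c j - of_bool (b = i) * bivector_coeff w a c j + of_bool (c = i) * bivector_coeff w a b j))"
proof -
  have "top_form w w' (axis i 1) (axis j 1) = (w \<and>\<^sub>w pd i w' \<and>\<^sub>w ee j) $ UNIV"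
    by (simp add: top_form_def contract_axis ee_def)
  also have "\<dots> = (\<Sum>(a, b, c)\<in>{(a, b, c). a < b \<and> b < c}. w' $ {a, b, c} *
    (of_bool (a = i) * bivector_coeff w b c j - of_bool (b = i) * bivector_coeff w a c j + of_bool (c = i) * bivector_coeff w a b j))"
    unfolding pd_def lift3_def wedge_sum_right wedge_sum_left sum_component
    by (rule sum.cong)
       (auto simp: bivector_coeff_def wedge_linear diff_conv_add_uminus simp del: add_uminus_conv_diff)
  finally show ?thesis .
qed

lemma shuffle_sign_insert2_left:
  fixes A B :: "'n::{finite,linorder} set"
  assumes "a \<notin> insert a' A"
  shows "shuffle_sign (insert a (insert a' A)) B
    = shuffle_sign {a} B * (shuffle_sign (insert a' A) B :: 'k::comm_ring_1)"
  using assms by (rule shuffle_sign_insert_left)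

text \<open>
  The entries of \<open>\<phi>\<close> are quadratic polynomials in the coordinates. All further properties of \<open>\<phi>\<close> on \<open>X\<close> are polynomial
  identities between them.
\<close>

lemma phi_coords:
  assumes "Xcoords w p q x11 x22 x33 x12 x13 x23 y11 y22 y33 y12 y13 y23"
  shows
    "phi w $ 0 $ 0 = p * q - x11 * y11 - 2 * x12 * y12 - x22 * y22 + x33 * y33"
    "phi w $ 0 $ 1 = - 2 * q * x13 + 2 * y12 * y23 - 2 * y13 * y22"
    "phi w $ 0 $ 2 = - 2 * q * x23 - 2 * y11 * y23 + 2 * y12 * y13"
    "phi w $ 0 $ 3 = - 2 * q * x33 + 2 * y11 * y22 - 2 * y12\<^sup>2"
    "phi w $ 0 $ 4 = 2 * x13 * y11 + 2 * x23 * y12 + 2 * x33 * y13"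
    "phi w $ 0 $ 5 = 2 * x13 * y12 + 2 * x23 * y22 + 2 * x33 * y23"
    "phi w $ 1 $ 0 = 2 * p * y13 - 2 * x12 * x23 + 2 * x13 * x22"
    "phi w $ 1 $ 1 = - p * q - x11 * y11 + x22 * y22 + 2 * x23 * y23 + x33 * y33"
    "phi w $ 1 $ 2 = - 2 * x12 * y11 - 2 * x22 * y12 - 2 * x23 * y13"
    "phi w $ 1 $ 3 = - 2 * x13 * y11 - 2 * x23 * y12 - 2 * x33 * y13"
    "phi w $ 1 $ 4 = 2 * p * y11 - 2 * x22 * x33 + 2 * x23\<^sup>2"
    "phi w $ 1 $ 5 = 2 * p * y12 + 2 * x12 * x33 - 2 * x13 * x23"
    "phi w $ 2 $ 0 = 2 * p * y23 + 2 * x11 * x23 - 2 * x12 * x13"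
    "phi w $ 2 $ 1 = - 2 * x11 * y12 - 2 * x12 * y22 - 2 * x13 * y23"
    "phi w $ 2 $ 2 = - p * q + x11 * y11 + 2 * x13 * y13 - x22 * y22 + x33 * y33"
    "phi w $ 2 $ 3 = - 2 * x13 * y12 - 2 * x23 * y22 - 2 * x33 * y23"
    "phi w $ 2 $ 4 = 2 * p * y12 + 2 * x12 * x33 - 2 * x13 * x23"
    "phi w $ 2 $ 5 = 2 * p * y22 - 2 * x11 * x33 + 2 * x13\<^sup>2"
    "phi w $ 3 $ 0 = 2 * p * y33 - 2 * x11 * x22 + 2 * x12\<^sup>2"
    "phi w $ 3 $ 1 = - 2 * x11 * y13 - 2 * x12 * y23 - 2 * x13 * y33"
    "phi w $ 3 $ 2 = - 2 * x12 * y13 - 2 * x22 * y23 - 2 * x23 * y33"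
    "phi w $ 3 $ 3 = - p * q + x11 * y11 + 2 * x12 * y12 + x22 * y22 - x33 * y33"
    "phi w $ 3 $ 4 = 2 * p * y13 - 2 * x12 * x23 + 2 * x13 * x22"
    "phi w $ 3 $ 5 = 2 * p * y23 + 2 * x11 * x23 - 2 * x12 * x13"
    "phi w $ 4 $ 0 = 2 * x11 * y13 + 2 * x12 * y23 + 2 * x13 * y33"
    "phi w $ 4 $ 1 = - 2 * q * x11 + 2 * y22 * y33 - 2 * y23\<^sup>2"
    "phi w $ 4 $ 2 = - 2 * q * x12 - 2 * y12 * y33 + 2 * y13 * y23"
    "phi w $ 4 $ 3 = - 2 * q * x13 + 2 * y12 * y23 - 2 * y13 * y22"
    "phi w $ 4 $ 4 = p * q + x11 * y11 - x22 * y22 - 2 * x23 * y23 - x33 * y33"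
    "phi w $ 4 $ 5 = 2 * x11 * y12 + 2 * x12 * y22 + 2 * x13 * y23"
    "phi w $ 5 $ 0 = 2 * x12 * y13 + 2 * x22 * y23 + 2 * x23 * y33"
    "phi w $ 5 $ 1 = - 2 * q * x12 - 2 * y12 * y33 + 2 * y13 * y23"
    "phi w $ 5 $ 2 = - 2 * q * x22 + 2 * y11 * y33 - 2 * y13\<^sup>2"
    "phi w $ 5 $ 3 = - 2 * q * x23 - 2 * y11 * y23 + 2 * y12 * y13"
    "phi w $ 5 $ 4 = 2 * x12 * y11 + 2 * x22 * y12 + 2 * x23 * y13"
    "phi w $ 5 $ 5 = p * q - x11 * y11 - 2 * x13 * y13 + x22 * y22 - x33 * y33"
proof -
  have g: "w \<in> grade 3" using assms by (simp add: Xcoords_def)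
  have b: "bivector_coeff w b c j = (if b = c \<or> b = j \<or> c = j then 0 else
      (if c < b then - 1 else 1) * (if j < b then - 1 else 1) * (if j < c then - 1 else 1)
        * (shuffle_sign (UNIV - {b, c, j}) {b, c, j} * w $ (UNIV - {b, c, j})))" for b c j
  proof (cases "b = c \<or> b = j \<or> c = j")
    case True
    then have "ee b \<and>\<^sub>w (ee c \<and>\<^sub>w ee j) = (0 :: 'a multivector6)"
      by (elim disjE) (simp_all add: ee_def vec_ext_wedge_absorb1)
    then show ?thesis using True by (simp add: bivector_coeff_def wedge_assoc)
  next
    case False
    then have "ee b \<and>\<^sub>w (ee c \<and>\<^sub>w ee j) = ((if c < b then - 1 else 1) * (if j < b then - 1 else 1)
        * (if j < c then - 1 else 1)) *s (axis {b, c, j} 1 :: 'a multivector6)"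
      unfolding ee_axis
      by (simp add: wedge_axis shuffle_sign_insert_right wedge_scale_right vector_smult_assoc insert_commute mult_ac)
    then show ?thesis using False
      by (simp add: bivector_coeff_def wedge_assoc wedge_axis_nth wedge_scale_right)
  qed
  show
    "phi w $ 0 $ 0 = p * q - x11 * y11 - 2 * x12 * y12 - x22 * y22 + x33 * y33"
    "phi w $ 0 $ 1 = - 2 * q * x13 + 2 * y12 * y23 - 2 * y13 * y22"
    "phi w $ 0 $ 2 = - 2 * q * x23 - 2 * y11 * y23 + 2 * y12 * y13"
    "phi w $ 0 $ 3 = - 2 * q * x33 + 2 * y11 * y22 - 2 * y12\<^sup>2"
    "phi w $ 0 $ 4 = 2 * x13 * y11 + 2 * x23 * y12 + 2 * x33 * y13"
    "phi w $ 0 $ 5 = 2 * x13 * y12 + 2 * x23 * y22 + 2 * x33 * y23"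
    "phi w $ 1 $ 0 = 2 * p * y13 - 2 * x12 * x23 + 2 * x13 * x22"
    "phi w $ 1 $ 1 = - p * q - x11 * y11 + x22 * y22 + 2 * x23 * y23 + x33 * y33"
    "phi w $ 1 $ 2 = - 2 * x12 * y11 - 2 * x22 * y12 - 2 * x23 * y13"
    "phi w $ 1 $ 3 = - 2 * x13 * y11 - 2 * x23 * y12 - 2 * x33 * y13"
    "phi w $ 1 $ 4 = 2 * p * y11 - 2 * x22 * x33 + 2 * x23\<^sup>2"
    "phi w $ 1 $ 5 = 2 * p * y12 + 2 * x12 * x33 - 2 * x13 * x23"
    "phi w $ 2 $ 0 = 2 * p * y23 + 2 * x11 * x23 - 2 * x12 * x13"
    "phi w $ 2 $ 1 = - 2 * x11 * y12 - 2 * x12 * y22 - 2 * x13 * y23"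
    "phi w $ 2 $ 2 = - p * q + x11 * y11 + 2 * x13 * y13 - x22 * y22 + x33 * y33"
    "phi w $ 2 $ 3 = - 2 * x13 * y12 - 2 * x23 * y22 - 2 * x33 * y23"
    "phi w $ 2 $ 4 = 2 * p * y12 + 2 * x12 * x33 - 2 * x13 * x23"
    "phi w $ 2 $ 5 = 2 * p * y22 - 2 * x11 * x33 + 2 * x13\<^sup>2"
    "phi w $ 3 $ 0 = 2 * p * y33 - 2 * x11 * x22 + 2 * x12\<^sup>2"
    "phi w $ 3 $ 1 = - 2 * x11 * y13 - 2 * x12 * y23 - 2 * x13 * y33"
    "phi w $ 3 $ 2 = - 2 * x12 * y13 - 2 * x22 * y23 - 2 * x23 * y33"
    "phi w $ 3 $ 3 = - p * q + x11 * y11 + 2 * x12 * y12 + x22 * y22 - x33 * y33"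
    "phi w $ 3 $ 4 = 2 * p * y13 - 2 * x12 * x23 + 2 * x13 * x22"
    "phi w $ 3 $ 5 = 2 * p * y23 + 2 * x11 * x23 - 2 * x12 * x13"
    "phi w $ 4 $ 0 = 2 * x11 * y13 + 2 * x12 * y23 + 2 * x13 * y33"
    "phi w $ 4 $ 1 = - 2 * q * x11 + 2 * y22 * y33 - 2 * y23\<^sup>2"
    "phi w $ 4 $ 2 = - 2 * q * x12 - 2 * y12 * y33 + 2 * y13 * y23"
    "phi w $ 4 $ 3 = - 2 * q * x13 + 2 * y12 * y23 - 2 * y13 * y22"
    "phi w $ 4 $ 4 = p * q + x11 * y11 - x22 * y22 - 2 * x23 * y23 - x33 * y33"
    "phi w $ 4 $ 5 = 2 * x11 * y12 + 2 * x12 * y22 + 2 * x13 * y23"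
    "phi w $ 5 $ 0 = 2 * x12 * y13 + 2 * x22 * y23 + 2 * x23 * y33"
    "phi w $ 5 $ 1 = - 2 * q * x12 - 2 * y12 * y33 + 2 * y13 * y23"
    "phi w $ 5 $ 2 = - 2 * q * x22 + 2 * y11 * y33 - 2 * y13\<^sup>2"
    "phi w $ 5 $ 3 = - 2 * q * x23 - 2 * y11 * y23 + 2 * y12 * y13"
    "phi w $ 5 $ 4 = 2 * x12 * y11 + 2 * x22 * y12 + 2 * x23 * y13"
    "phi w $ 5 $ 5 = p * q - x11 * y11 - 2 * x13 * y13 + x22 * y22 - x33 * y33"
    unfolding phi_nth[OF g] top_form_coords[OF g] sum_triples_6
    using assms unfolding Xcoords_def
    apply (simp_all add: b six_less)
    apply (simp_all only: UNIV_6)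
    apply (simp_all add: insert_Diff_if)
    apply (simp_all add: shuffle_sign_insert2_left shuffle_sign_insert_right six_less power2_eq_square)
    done
qed

section \<open>Identities for the covariant\<close>

text \<open>The quartic form of the Freudenthal triple system of symmetric matrices.\<close>

lemma phi_square:
  assumes "Xcoords w p q x11 x22 x33 x12 x13 x23 y11 y22 y33 y12 y13 y23"
  shows "phi w ** phi w = mat ((p * q - x11 * y11 - x22 * y22 - x33 * y33 - 2 * (x12 * y12 + x13 * y13 + x23 * y23))\<^sup>2
      - 4 * ((x22 * x33 - x23\<^sup>2) * (y22 * y33 - y23\<^sup>2) + (x11 * x33 - x13\<^sup>2) * (y11 * y33 - y13\<^sup>2)
        + (x11 * x22 - x12\<^sup>2) * (y11 * y22 - y12\<^sup>2)
        + 2 * (x13 * x23 - x12 * x33) * (y13 * y23 - y12 * y33)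
        + 2 * (x12 * x23 - x13 * x22) * (y12 * y23 - y13 * y22)
        + 2 * (x12 * x13 - x23 * x11) * (y12 * y13 - y23 * y11))
      + 4 * p * (y11 * y22 * y33 + 2 * y12 * y13 * y23 - y11 * y23\<^sup>2 - y22 * y13\<^sup>2 - y33 * y12\<^sup>2)
      + 4 * q * (x11 * x22 * x33 + 2 * x12 * x13 * x23 - x11 * x23\<^sup>2 - x22 * x13\<^sup>2 - x33 * x12\<^sup>2))"
  unfolding vec_eq_iff forall_6 matrix_matrix_mult_def
  by (simp add: sum_6 phi_coords[OF assms] mat_def) (simp add: power2_eq_square algebra_simps)

lemma mat_inject: "mat a = (mat b :: 'k::field ^ 6 ^ 6) \<longleftrightarrow> a = b"
proof
  assume "mat a = (mat b :: 'k ^ 6 ^ 6)"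
  then have "(mat a :: 'k ^ 6 ^ 6) $ 1 $ 1 = (mat b :: 'k ^ 6 ^ 6) $ 1 $ 1" by simp
  then show "a = b" by (simp add: mat_def)
qed simp

lemma quartic_eq: "phi w ** phi w = mat c \<Longrightarrow> quartic w = c"
  unfolding quartic_def by (rule the_equality) (auto simp: mat_inject)

lemma phi_square_quartic: "w \<in> Xspace \<Longrightarrow> phi w ** phi w = mat (quartic w)"
proof -
  have "phi w ** phi w = mat (quartic w)" if "phi w ** phi w = mat c" for c
    using that quartic_eq[OF that] by simp
  moreover assume "w \<in> Xspace"
  ultimately show ?thesis unfolding Xspace_coords using phi_square by blast
qed

text \<open>The covariant takes values in the Lie algebra of \<open>Sp\<^sub>6\<close>.\<close>

lemma phi_skew:
  assumes "w \<in> Xspace"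
  shows "phi w ** MJ = - (MJ ** transpose (phi w))"
proof -
  obtain p q x11 x22 x33 x12 x13 x23 y11 y22 y33 y12 y13 y23 where c: "Xcoords w p q x11 x22 x33 x12 x13 x23 y11 y22 y33 y12 y13 y23"
    using assms unfolding Xspace_coords by blast
  show ?thesis
    unfolding vec_eq_iff forall_6 matrix_matrix_mult_def transpose_def
    by (simp add: sum_6 phi_coords[OF c] MJ_values)
qed

subsection \<open>Trivectors as alternating trilinear forms\<close>

definition det3 :: "'k::field ^ 'n \<Rightarrow> 'k ^ 'n \<Rightarrow> 'k ^ 'n \<Rightarrow> 'n \<Rightarrow> 'n \<Rightarrow> 'n \<Rightarrow> 'k" where
  "det3 \<xi> \<eta> \<zeta> i j l = \<xi> $ i * (\<eta> $ j * \<zeta> $ l - \<eta> $ l * \<zeta> $ j) - \<xi> $ j * (\<eta> $ i * \<zeta> $ l - \<eta> $ l * \<zeta> $ i)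
     + \<xi> $ l * (\<eta> $ i * \<zeta> $ j - \<eta> $ j * \<zeta> $ i)"

text \<open>
  The alternating trilinear form on covectors that is dual to the trivector \<open>w\<close>.
\<close>

definition tri :: "'k::field multivector6 \<Rightarrow> 'k ^ 6 \<Rightarrow> 'k ^ 6 \<Rightarrow> 'k ^ 6 \<Rightarrow> 'k" where
  "tri w \<xi> \<eta> \<zeta> = lift3 (\<lambda>i j l. vec (det3 \<xi> \<eta> \<zeta> i j l) :: 'k ^ 1) w $ 1"

lemma tri_sum: "tri w \<xi> \<eta> \<zeta> = (\<Sum>(i, j, l)\<in>{(i, j, l). i < j \<and> j < l}. w $ {i, j, l} * det3 \<xi> \<eta> \<zeta> i j l)"
  unfolding tri_def lift3_def sum_component by (rule sum.cong) auto

lemma tri_add: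
  "tri w (\<xi> + \<xi>') \<eta> \<zeta> = tri w \<xi> \<eta> \<zeta> + tri w \<xi>' \<eta> \<zeta>"
  "tri w \<eta> (\<xi> + \<xi>') \<zeta> = tri w \<eta> \<xi> \<zeta> + tri w \<eta> \<xi>' \<zeta>"
  "tri w \<eta> \<zeta> (\<xi> + \<xi>') = tri w \<eta> \<zeta> \<xi> + tri w \<eta> \<zeta> \<xi>'"
  unfolding tri_sum sum.distrib[symmetric] by (rule sum.cong, simp, auto simp: det3_def algebra_simps)+

lemma tri_scale:
  "tri w (c *s \<xi>) \<eta> \<zeta> = c * tri w \<xi> \<eta> \<zeta>"
  "tri w \<eta> (c *s \<xi>) \<zeta> = c * tri w \<eta> \<xi> \<zeta>"
  "tri w \<eta> \<zeta> (c *s \<xi>) = c * tri w \<eta> \<zeta> \<xi>"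
  unfolding tri_sum sum_distrib_left by (rule sum.cong, simp, auto simp: det3_def algebra_simps)+

lemma tri_swap: "tri w \<eta> \<xi> \<zeta> = - tri w \<xi> \<eta> \<zeta>" "tri w \<xi> \<zeta> \<eta> = - tri w \<xi> \<eta> \<zeta>"
  unfolding tri_sum sum_negf[symmetric] by (rule sum.cong, simp, auto simp: det3_def algebra_simps)+

lemma tri_same: "tri w \<xi> \<xi> \<zeta> = 0" "tri w \<xi> \<zeta> \<zeta> = 0" "tri w \<xi> \<zeta> \<xi> = 0"
  unfolding tri_sum by (rule sum.neutral, auto simp: det3_def algebra_simps)+

lemma tri_expand: "tri w \<xi> \<eta> \<zeta> = (\<Sum>a\<in>UNIV. \<Sum>b\<in>UNIV. \<Sum>c\<in>UNIV.
    \<xi> $ a * \<eta> $ b * \<zeta> $ c * tri w (axis a 1) (axis b 1) (axis c 1))"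
proof -
  have z: "tri w 0 \<eta> \<zeta> = 0" "tri w \<eta> 0 \<zeta> = 0" "tri w \<eta> \<zeta> 0 = 0" for \<eta> \<zeta>
    using tri_scale(1)[of w 0 0] tri_scale(2)[of w _ 0 0] tri_scale(3)[of w _ _ 0 0] by simp_all
  have s1: "tri w (sum f I) \<eta> \<zeta> = (\<Sum>i\<in>I. tri w (f i) \<eta> \<zeta>)" for f and I :: "6 set" and \<eta> \<zeta>
    by (induction I rule: infinite_finite_induct) (auto simp: tri_add z)
  have s2: "tri w \<eta> (sum f I) \<zeta> = (\<Sum>i\<in>I. tri w \<eta> (f i) \<zeta>)" for f and I :: "6 set" and \<eta> \<zeta>
    by (induction I rule: infinite_finite_induct) (auto simp: tri_add z)
  have s3: "tri w \<eta> \<zeta> (sum f I) = (\<Sum>i\<in>I. tri w \<eta> \<zeta> (f i))" for f and I :: "6 set" and \<eta> \<zeta>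
    by (induction I rule: infinite_finite_induct) (auto simp: tri_add z)
  have e: "\<xi> = (\<Sum>a\<in>UNIV. \<xi> $ a *s axis a 1)" for \<xi> :: "'a ^ 6"
    by (simp add: vec_eq_iff axis_def if_distrib cong: if_cong)
  have "tri w \<xi> \<eta> \<zeta> = tri w (\<Sum>a\<in>UNIV. \<xi> $ a *s axis a 1) (\<Sum>b\<in>UNIV. \<eta> $ b *s axis b 1) (\<Sum>c\<in>UNIV. \<zeta> $ c *s axis c 1)"
    using e by metis
  then show ?thesis
    unfolding s1 unfolding s2 unfolding s3 tri_scale by (simp add: sum_distrib_left mult_ac)
qed

lemma tri_axis:
  assumes "a < b" "b < c"
  shows "tri w (axis a 1) (axis b 1) (axis c 1) = w $ {a, b, c}"
proof -
  have "det3 (axis a 1) (axis b 1) (axis c 1) i j l = (of_bool ({i, j, l} = {a, b, c}) :: 'a)"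
    if "i < j" "j < l" for i j l
  proof -
    have "{i, j, l} = {a, b, c} \<longleftrightarrow> i = a \<and> j = b \<and> l = c"
    proof
      assume eq: "{i, j, l} = {a, b, c}"
      have "Min {i, j, l} = i" "Min {a, b, c} = a" "Max {i, j, l} = l" "Max {a, b, c} = c"
        using that assms by (auto simp: min_def max_def)
      then have "i = a" "l = c" using eq by auto
      moreover have "j \<in> {a, b, c}" using eq by blast
      ultimately show "i = a \<and> j = b \<and> l = c" using that by auto
    qed simp
    then show ?thesis using that assms by (auto simp: det3_def axis_def)
  qed
  then have "tri w (axis a 1) (axis b 1) (axis c 1)
      = (\<Sum>(i, j, l)\<in>{(i, j, l). i < j \<and> j < l}. w $ {i, j, l} * of_bool ({i, j, l} = {a, b, c}))"
    unfolding tri_sum by (intro sum.cong) auto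
  then show ?thesis by (simp add: sum_triples_delta[OF assms])
qed

lemma tri_sort:
  "b < a \<Longrightarrow> tri w (axis a 1) (axis b 1) (axis c 1) = - tri w (axis b 1) (axis a 1) (axis c 1)"
  "c < b \<Longrightarrow> tri w (axis a 1) (axis b 1) (axis c 1) = - tri w (axis a 1) (axis c 1) (axis b 1)"
  by (rule tri_swap)+

lemma alternating3_det3: "alternating3 (\<lambda>i j l. vec (det3 \<xi> \<eta> \<zeta> i j l) :: 'k::field ^ 1)"
  unfolding alternating3_def by (auto simp: vec_eq_iff det3_def algebra_simps)

lemma sum_product3:
  fixes u v z :: "'k::field ^ 'n::finite"
  shows "(\<Sum>i\<in>UNIV. \<Sum>j\<in>UNIV. \<Sum>l\<in>UNIV. u $ i * v $ j * z $ l * (a $ i * (b $ j * c $ l)))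
     = pairing a u * (pairing b v * pairing c z)"
  unfolding pairing_def sum_product by (simp add: sum_product sum_distrib_left mult_ac)

lemma tri_decomp3:
  "tri (decomp3 u v z) \<xi> \<eta> \<zeta> =
     pairing \<xi> u * (pairing \<eta> v * pairing \<zeta> z - pairing \<zeta> v * pairing \<eta> z)
     - pairing \<eta> u * (pairing \<xi> v * pairing \<zeta> z - pairing \<zeta> v * pairing \<xi> z)
     + pairing \<zeta> u * (pairing \<xi> v * pairing \<eta> z - pairing \<eta> v * pairing \<xi> z)"
proof -
  have "tri (decomp3 u v z) \<xi> \<eta> \<zeta> = (\<Sum>i\<in>UNIV. \<Sum>j\<in>UNIV. \<Sum>l\<in>UNIV. u $ i * v $ j * z $ l * det3 \<xi> \<eta> \<zeta> i j l)"
    unfolding tri_def lift3_decomp3[OF alternating3_det3] by (simp add: sum_component)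
  also have "\<dots> = (\<Sum>i\<in>UNIV. \<Sum>j\<in>UNIV. \<Sum>l\<in>UNIV.
      u $ i * v $ j * z $ l * (\<xi> $ i * (\<eta> $ j * \<zeta> $ l)) - u $ i * v $ j * z $ l * (\<xi> $ i * (\<zeta> $ j * \<eta> $ l))
      - u $ i * v $ j * z $ l * (\<eta> $ i * (\<xi> $ j * \<zeta> $ l)) + u $ i * v $ j * z $ l * (\<eta> $ i * (\<zeta> $ j * \<xi> $ l))
      + u $ i * v $ j * z $ l * (\<zeta> $ i * (\<xi> $ j * \<eta> $ l)) - u $ i * v $ j * z $ l * (\<zeta> $ i * (\<eta> $ j * \<xi> $ l)))"
    by (intro sum.cong refl) (simp add: det3_def algebra_simps)
  also have "\<dots> = pairing \<xi> u * (pairing \<eta> v * pairing \<zeta> z) - pairing \<xi> u * (pairing \<zeta> v * pairing \<eta> z)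
     - pairing \<eta> u * (pairing \<xi> v * pairing \<zeta> z) + pairing \<eta> u * (pairing \<zeta> v * pairing \<xi> z)
     + pairing \<zeta> u * (pairing \<xi> v * pairing \<eta> z) - pairing \<zeta> u * (pairing \<eta> v * pairing \<xi> z)"
    unfolding sum.distrib sum_subtractf sum_product3 ..
  finally show ?thesis by (simp add: algebra_simps)
qed

lemma tri_act3:
  assumes "w \<in> grade 3"
  shows "tri (act3 g w) \<xi> \<eta> \<zeta> = tri w (transpose g *v \<xi>) (transpose g *v \<eta>) (transpose g *v \<zeta>)"
  using assms
proof (induction w rule: grade3_induct)
  case zero
  show ?case by (simp add: tri_def act3_linear)
next
  case (add u v)
  then show ?case by (simp add: tri_def act3_linear lift3_add)
next
  case (decomp c u v z)
  have "tri (act3 g (decomp3 u v z)) \<xi> \<eta> \<zeta>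
      = tri (decomp3 u v z) (transpose g *v \<xi>) (transpose g *v \<eta>) (transpose g *v \<zeta>)"
    unfolding act3_decomp3 tri_decomp3 pairing_matrix ..
  then show ?case by (simp add: tri_def act3_linear lift3_scale)
qed

text \<open>
  Over a field in which the quartic form of \<open>w\<close> is a square, \<open>w\<close> is a sum of two decomposable
  trivectors, spanned by eigenvectors of \<open>phi w\<close> for opposite eigenvalues. Hence \<open>phi w\<close> can be moved
  between the arguments of the trilinear form. The identity is polynomial and is checked in coordinates.
\<close>

lemma tri_phi_basis:
  assumes c: "Xcoords w p q x11 x22 x33 x12 x13 x23 y11 y22 y33 y12 y13 y23"
  shows "\<forall>a b c. (\<Sum>m\<in>UNIV. phi w $ a $ m * tri w (axis m 1) (axis b 1) (axis c 1))
    = (\<Sum>m\<in>UNIV. phi w $ b $ m * tri w (axis a 1) (axis m 1) (axis c 1))"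
proof -
  note W = c[unfolded Xcoords_def]
  have table: 
    "tri w (axis 0 1) (axis 1 1) (axis 2 1) = x33"
    "tri w (axis 0 1) (axis 1 1) (axis 3 1) = - x23"
    "tri w (axis 0 1) (axis 1 1) (axis 4 1) = - y12"
    "tri w (axis 0 1) (axis 1 1) (axis 5 1) = y11"
    "tri w (axis 0 1) (axis 2 1) (axis 3 1) = x13"
    "tri w (axis 0 1) (axis 2 1) (axis 4 1) = - y22"
    "tri w (axis 0 1) (axis 2 1) (axis 5 1) = y12"
    "tri w (axis 0 1) (axis 3 1) (axis 4 1) = - y23"
    "tri w (axis 0 1) (axis 3 1) (axis 5 1) = y13"
    "tri w (axis 0 1) (axis 4 1) (axis 5 1) = q"
    "tri w (axis 1 1) (axis 2 1) (axis 3 1) = p"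
    "tri w (axis 1 1) (axis 2 1) (axis 4 1) = x13"
    "tri w (axis 1 1) (axis 2 1) (axis 5 1) = x23"
    "tri w (axis 1 1) (axis 3 1) (axis 4 1) = - x12"
    "tri w (axis 1 1) (axis 3 1) (axis 5 1) = - x22"
    "tri w (axis 1 1) (axis 4 1) (axis 5 1) = y13"
    "tri w (axis 2 1) (axis 3 1) (axis 4 1) = x11"
    "tri w (axis 2 1) (axis 3 1) (axis 5 1) = x12"
    "tri w (axis 2 1) (axis 4 1) (axis 5 1) = y23"
    "tri w (axis 3 1) (axis 4 1) (axis 5 1) = y33"
    using W by (simp_all add: tri_axis six_less)
  show ?thesis
    unfolding sum_6 unfolding forall_6
    apply (intro conjI)
    apply (simp_all only: tri_same mult_zero_right add_0_left add_0_right)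
    apply (simp_all add: tri_sort six_less table)
    apply (simp_all add: phi_coords[OF c])
    apply (simp_all add: power2_eq_square algebra_simps)
    done
qed

lemma tri_phi:
  fixes x :: "'k::field multivector6"
  assumes "x \<in> Xspace"
  shows "tri x (transpose (phi x) *v \<xi>) \<eta> \<zeta> = tri x \<xi> (transpose (phi x) *v \<eta>) \<zeta>"
proof -
  define T where "T a b c = tri x (axis a 1) (axis b 1) (axis c 1)" for a b c
  have P: "(\<Sum>m\<in>UNIV. phi x $ a $ m * T m b c) = (\<Sum>m\<in>UNIV. phi x $ b $ m * T a m c)" for a b c
    using assms tri_phi_basis[of x] unfolding Xspace_coords T_def by blast
  have tr: "(transpose (phi x) *v \<xi>) $ m = (\<Sum>a\<in>UNIV. \<xi> $ a * phi x $ a $ m)" for \<xi> m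
    by (simp add: matrix_vector_mult_def transpose_def mult.commute)
  have "tri x (transpose (phi x) *v \<xi>) \<eta> \<zeta> = (\<Sum>m\<in>UNIV. \<Sum>b\<in>UNIV. \<Sum>c\<in>UNIV. \<Sum>a\<in>UNIV.
      \<xi> $ a * \<eta> $ b * \<zeta> $ c * (phi x $ a $ m * T m b c))"
    unfolding tri_expand[of x "transpose (phi x) *v \<xi>"] tr T_def[symmetric] sum_distrib_right by (simp only: mult_ac)
  also have "\<dots> = (\<Sum>c\<in>UNIV. \<Sum>a\<in>UNIV. \<Sum>m\<in>UNIV. \<Sum>b\<in>UNIV.
      \<xi> $ a * \<eta> $ b * \<zeta> $ c * (phi x $ a $ m * T m b c))"
    by (rule sum_swap4)
  also have "\<dots> = (\<Sum>c\<in>UNIV. \<Sum>a\<in>UNIV. \<Sum>b\<in>UNIV. \<xi> $ a * \<eta> $ b * \<zeta> $ c * (\<Sum>m\<in>UNIV. phi x $ a $ m * T m b c))"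
    unfolding sum_distrib_left by (intro sum.cong refl sum.swap)
  also have "\<dots> = (\<Sum>c\<in>UNIV. \<Sum>a\<in>UNIV. \<Sum>b\<in>UNIV. \<Sum>m\<in>UNIV. \<xi> $ a * \<eta> $ b * \<zeta> $ c * (phi x $ b $ m * T a m c))"
    unfolding P sum_distrib_left ..
  also have "\<dots> = (\<Sum>b\<in>UNIV. \<Sum>m\<in>UNIV. \<Sum>c\<in>UNIV. \<Sum>a\<in>UNIV. \<xi> $ a * \<eta> $ b * \<zeta> $ c * (phi x $ b $ m * T a m c))"
    by (rule sum_swap4)
  also have "\<dots> = (\<Sum>m\<in>UNIV. \<Sum>b\<in>UNIV. \<Sum>a\<in>UNIV. \<Sum>c\<in>UNIV. \<xi> $ a * \<eta> $ b * \<zeta> $ c * (phi x $ b $ m * T a m c))"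
    by (subst sum.swap) (intro sum.cong refl sum.swap)
  also have "\<dots> = (\<Sum>a\<in>UNIV. \<Sum>c\<in>UNIV. \<Sum>m\<in>UNIV. \<Sum>b\<in>UNIV. \<xi> $ a * \<eta> $ b * \<zeta> $ c * (phi x $ b $ m * T a m c))"
    by (rule sum_swap4)
  also have "\<dots> = (\<Sum>a\<in>UNIV. \<Sum>m\<in>UNIV. \<Sum>c\<in>UNIV. \<Sum>b\<in>UNIV. \<xi> $ a * \<eta> $ b * \<zeta> $ c * (phi x $ b $ m * T a m c))"
    by (intro sum.cong refl sum.swap)
  also have "\<dots> = tri x \<xi> (transpose (phi x) *v \<eta>) \<zeta>"
    unfolding tri_expand[of x \<xi> "transpose (phi x) *v \<eta>"] tr T_def[symmetric] sum_distrib_right sum_distrib_left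
    by (simp only: mult_ac)
  finally show ?thesis .
qed

section \<open>Invariants\<close>

lemma Sp6_invertible: "g \<in> Sp6 \<Longrightarrow> \<exists>h. h ** g = mat 1 \<and> g ** h = mat 1"
  unfolding Sp6_def invertible_def by blast

text \<open>
  Conjugation by \<open>g\<close> fixes the scalar matrix \<open>\<phi>(w)\<^sup>2\<close>.
\<close>

lemma quartic_act3:
  fixes g :: "'k::field ^ 6 ^ 6"
  assumes g: "g \<in> Sp6" and k: "(2::'k) \<noteq> 0" "(3::'k) \<noteq> 0" and w: "w \<in> grade 3"
    and q: "phi w ** phi w = mat (quartic w)"
  shows "phi (act3 g w) ** phi (act3 g w) = mat (quartic w)" "quartic (act3 g w) = quartic w"
proof -
  obtain h where h: "h ** g = mat 1" "g ** h = mat 1" using Sp6_invertible[OF g] by blast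
  have e: "phi (act3 g w) ** g = g ** phi w" using phi_equivariant[OF g k w] .
  have mc: "g ** mat c = mat c ** g" for c :: 'k
  proof (unfold vec_eq_iff, intro allI)
    fix i j
    have "(g ** mat c) $ i $ j = (\<Sum>l\<in>UNIV. if l = j then c * g $ i $ j else 0)"
      unfolding matrix_matrix_mult_def vec_lambda_beta by (rule sum.cong) (auto simp: mat_def)
    moreover have "(mat c ** g) $ i $ j = (\<Sum>l\<in>UNIV. if l = i then c * g $ i $ j else 0)"
      unfolding matrix_matrix_mult_def vec_lambda_beta by (rule sum.cong) (auto simp: mat_def)
    ultimately show "(g ** mat c) $ i $ j = (mat c ** g) $ i $ j" by simp
  qed
  have "phi (act3 g w) ** phi (act3 g w) = phi (act3 g w) ** (phi (act3 g w) ** g) ** h"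
    by (simp add: matrix_mul_assoc[symmetric] h)
  also have "\<dots> = (phi (act3 g w) ** g) ** phi w ** h" by (simp add: e matrix_mul_assoc)
  also have "\<dots> = g ** (phi w ** phi w) ** h" by (simp add: e matrix_mul_assoc)
  also have "\<dots> = mat (quartic w)" by (simp add: q mc matrix_mul_assoc[symmetric] h)
  finally show "phi (act3 g w) ** phi (act3 g w) = mat (quartic w)" .
  then show "quartic (act3 g w) = quartic w" by (rule quartic_eq)
qed

lemma Xspace_grade: "x \<in> Xspace \<Longrightarrow> x \<in> grade 3"
  by (simp add: Xspace_def)

lemma f1_act3:
  fixes g :: "'k::field ^ 6 ^ 6"
  assumes "g \<in> Sp6" "(2::'k) \<noteq> 0" "(3::'k) \<noteq> 0" "x \<in> Xspace"
  shows "f1 (act3 g x) = f1 x"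
  using quartic_act3(2)[OF assms(1-3) Xspace_grade[OF assms(4)] phi_square_quartic[OF assms(4)]]
  by (simp add: f1_def)

lemma MJ_MJ: "MJ ** MJ = (- mat 1 :: 'k::field ^ 6 ^ 6)"
  unfolding vec_eq_iff forall_6 matrix_matrix_mult_def by (simp add: sum_6 MJ_values mat_def)

lemma matrix_mul_minus: "(A :: 'k::field ^ 'n ^ 'm) ** (- B) = - (A ** B)" "(- A) ** B = - (A ** B)"
  by (simp_all add: vec_eq_iff matrix_matrix_mult_def sum_negf)

lemma Sp6_transpose: "g \<in> Sp6 \<Longrightarrow> transpose g ** MJ ** g = (MJ :: 'k::field ^ 6 ^ 6)"
proof -
  assume "g \<in> Sp6"
  then have g: "g ** MJ ** transpose g = MJ" by (simp add: Sp6_def)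
  have "g ** (- (MJ ** transpose g ** MJ)) = mat 1"
    by (simp add: matrix_mul_minus matrix_mul_assoc g MJ_MJ)
  then have "- (MJ ** transpose g ** MJ) ** g = mat 1" by (simp add: matrix_left_right_inverse)
  then have "MJ ** (- (MJ ** transpose g ** MJ) ** g) = MJ" by simp
  then show ?thesis by (simp add: matrix_mul_minus matrix_mul_assoc MJ_MJ)
qed

lemma bform_matrix:
  fixes g h M :: "'k::field ^ 6 ^ 6"
  shows "bform M (g *v u) (h *v v) = bform (transpose g ** M ** h) u v"
proof -
  have b: "bform M u v = pairing u (M *v v)" for M and u v :: "'k ^ 6" by (simp add: bform_def pairing_def)
  have sym: "pairing u v = pairing v u" for u v :: "'k ^ 6" by (simp add: pairing_def mult.commute)
  show ?thesis
    unfolding b sym[of "g *v u"] pairing_matrix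
    by (simp add: sym[of u] matrix_vector_mul_assoc matrix_mul_assoc matrix_transpose_mul del: transpose_matrix_vector)
qed

text \<open>
  The covariant transforms by conjugation and \<open>M\<close> by congruence, so \<open>M \<phi>\<close> transforms by congruence, which cancels
  against the transformation of \<open>v\<close>.
\<close>

lemma f2_act3:
  fixes g :: "'k::field ^ 6 ^ 6"
  assumes g: "g \<in> Sp6" and k: "(2::'k) \<noteq> 0" "(3::'k) \<noteq> 0" and w: "w \<in> grade 3"
  shows "f2 (act3 g w, g *v v) = f2 (w, v)"
proof -
  have "transpose g ** (MJ ** phi (act3 g w)) ** g = transpose g ** MJ ** (phi (act3 g w) ** g)"
    by (simp add: matrix_mul_assoc)
  also have "\<dots> = MJ ** phi w"
    unfolding phi_equivariant[OF g k w] by (simp add: matrix_mul_assoc Sp6_transpose[OF g])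
  finally show ?thesis by (simp add: f2_def bform_matrix)
qed

lemma mat_1_Sp6: "mat 1 \<in> Sp6"
  by (auto simp add: Sp6_def invertible_def)

lemma act3_mat_1:
  assumes "w \<in> grade 3" shows "act3 (mat 1) w = w"
  using assms by (induction w rule: grade3_induct) (simp_all add: act3_linear act3_decomp3)

section \<open>Normal forms\<close>

lemma Xcoords_normal_form: "Xcoords (normal_form y0 y1 y2 y3) (- 1) (- y0) 0 0 0 0 0 0 y1 y2 y3 0 0 0"
proof -
  have a: "ee 1 \<and>\<^sub>w ee 2 \<and>\<^sub>w ee 3 = (axis {1, 2, 3} 1 :: 'a multivector6)"
    "ee 4 \<and>\<^sub>w ee 5 \<and>\<^sub>w ee 0 = (axis {0, 4, 5} 1 :: 'a multivector6)"
    "ee 1 \<and>\<^sub>w ee 5 \<and>\<^sub>w ee 0 = (axis {0, 1, 5} 1 :: 'a multivector6)"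
    "ee 4 \<and>\<^sub>w ee 2 \<and>\<^sub>w ee 0 = (- axis {0, 2, 4} 1 :: 'a multivector6)"
    "ee 4 \<and>\<^sub>w ee 5 \<and>\<^sub>w ee 3 = (axis {3, 4, 5} 1 :: 'a multivector6)"
    unfolding ee_axis wedge_assoc
    by (simp_all add: wedge_axis shuffle_sign_insert_right six_less wedge_scale_right wedge_minus_right insert_commute)
  have g: "axis S (1::'a) \<in> grade (card S)" for S :: "6 set" by (auto simp: grade_def axis_def)
  have g3: "axis S (1::'a) \<in> grade 3" if "card S = 3" for S :: "6 set" using g[of S] that by simp
  have neg: "- w \<in> grade 3" if "w \<in> grade 3" for w :: "'a multivector6" using that by (simp add: grade_def)
  have "normal_form y0 y1 y2 y3 \<in> grade 3"
    unfolding normal_form_def six_eq_0 a diff_conv_add_uminus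
    by (intro grade_add neg grade_scale g3) simp_all
  then show ?thesis
    unfolding Xcoords_def normal_form_def six_eq_0 a axis_def
    by (simp add: set_eq_subset)
qed

lemma normal_form_Xspace: "normal_form y0 y1 y2 y3 \<in> Xspace"
  unfolding Xspace_coords using Xcoords_normal_form by blast

lemma f1_normal_form:
  assumes "(2::'k::field) \<noteq> 0"
  shows "f1 (normal_form y0 y1 y2 y3 :: 'k multivector6) = y1 * y2 * y3 - 1 / 4 * y0\<^sup>2"
proof -
  have "(4::'k) = 2 * 2" by simp
  then have 4: "(4::'k) \<noteq> 0" using assms by (metis mult_eq_0_iff)
  have "quartic (normal_form y0 y1 y2 y3) = y0\<^sup>2 - 4 * (y1 * y2 * y3)"
    using quartic_eq[OF phi_square[OF Xcoords_normal_form[of y0 y1 y2 y3]]] by simp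
  then show ?thesis using 4 by (simp add: f1_def field_simps)
qed

lemma f2_normal_form:
  assumes "(2::'k::field) \<noteq> 0"
  shows "f2 (normal_form y0 y1 y2 y3 :: 'k multivector6, v) = -
    (y2 * y3 * (v $ 1)\<^sup>2 + y0 * (v $ 1 * v $ 4) + y1 * (v $ 4)\<^sup>2
     + (y1 * y3 * (v $ 2)\<^sup>2 + y0 * (v $ 2 * v $ 5) + y2 * (v $ 5)\<^sup>2)
     + (y1 * y2 * (v $ 3)\<^sup>2 + y0 * (v $ 3 * v $ 0) + y3 * (v $ 0)\<^sup>2))"
proof -
  have "bform (MJ ** phi (normal_form y0 y1 y2 y3)) v v = 2 *
    (y2 * y3 * (v $ 1)\<^sup>2 + y0 * (v $ 1 * v $ 4) + y1 * (v $ 4)\<^sup>2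
     + (y1 * y3 * (v $ 2)\<^sup>2 + y0 * (v $ 2 * v $ 5) + y2 * (v $ 5)\<^sup>2)
     + (y1 * y2 * (v $ 3)\<^sup>2 + y0 * (v $ 3 * v $ 0) + y3 * (v $ 0)\<^sup>2))"
    unfolding bform_def matrix_vector_mult_def matrix_matrix_mult_def
    by (simp add: sum_6 MJ_values phi_coords[OF Xcoords_normal_form])
       (simp add: power2_eq_square algebra_simps)
  moreover have "- (1 / 2) * (2 * e) = - e" for e :: 'k using assms by simp
  ultimately show ?thesis unfolding f2_def prod.case by presburger
qed

lemma Xcoords_unique:
  assumes "Xcoords w p q x11 x22 x33 x12 x13 x23 y11 y22 y33 y12 y13 y23"
    and "Xcoords w' p q x11 x22 x33 x12 x13 x23 y11 y22 y33 y12 y13 y23"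
  shows "w = w'"
proof -
  have "(\<Sum>(i, j, l)\<in>{(i, j, l). i < j \<and> j < l}. w $ {i, j, l} *s axis {i, j, l} 1)
     = (\<Sum>(i, j, l)\<in>{(i, j, l). i < j \<and> j < l}. w' $ {i, j, l} *s axis {i, j, l} 1)"
    unfolding sum_triples_6 using assms unfolding Xcoords_def by simp
  then show ?thesis using assms grade3_expand[of w] grade3_expand[of w'] unfolding Xcoords_def by argo
qed

section \<open>Existence of normal forms\<close>

lemma matrix_vector_minus:
  "(- A) *v v = - (A *v v)" "A *v (- v) = - (A *v v)" for A :: "'k::field ^ 'n ^ 'm"
  by (simp_all add: vec_eq_iff matrix_vector_mult_def sum_negf)

lemma mat_vector: "mat c *v u = c *s u" for c :: "'k::field"
proof (unfold vec_eq_iff, rule allI)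
  fix i
  have "(mat c *v u) $ i = (\<Sum>j\<in>UNIV. if j = i then c * u $ i else 0)"
    unfolding matrix_vector_mult_def vec_lambda_beta by (rule sum.cong) (auto simp: mat_def)
  then show "(mat c *v u) $ i = (c *s u) $ i" by simp
qed

text \<open>
  If \<open>q\<close> vanishes on the complement of the hermitian lines through \<open>W\<close>, this complement lies in the radical of \<open>q\<close>
  and is zero. Then the lines span the space, whose dimension is too large for that.
\<close>

lemma hermitian_complement:
  fixes q :: "'k::field ^ 6 \<Rightarrow> 'k"
  assumes H: "herm_space (*s) q S d" and nd: "\<And>x. (\<And>y. polar q x y = 0) \<Longrightarrow> x = 0"
    and W: "finite W" "2 * card W < 6" "\<And>w. w \<in> W \<Longrightarrow> q w \<noteq> 0"
    and orth: "\<And>w w'. w \<in> W \<Longrightarrow> w' \<in> W \<Longrightarrow> w \<noteq> w' \<Longrightarrow> polar q w w' = 0 \<and> polar q w (S w') = 0"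
  shows "\<exists>v. q v \<noteq> 0 \<and> (\<forall>w\<in>W. polar q v w = 0 \<and> polar q v (S w) = 0)"
proof (rule ccontr)
  assume neg: "\<not> ?thesis"
  interpret herm_space "(*s)" q S d by fact
  have b0: "b 0 z = 0" for z using polar_scale[of 0 0 z] by simp
  have b_sum: "b (sum f I) z = (\<Sum>i\<in>I. b (f i) z)" for f and I :: "('k ^ 6) set" and z
    by (induction I rule: infinite_finite_induct) (auto simp: polar_add b0)
  have b_sum_right: "b z (sum f I) = (\<Sum>i\<in>I. b z (f i))" for f and I :: "('k ^ 6) set" and z
    by (simp only: b_sym[of z] b_sum)
  define P where "P u = (\<Sum>w\<in>W. (b u w / (2 * q w)) *s w + (b u (S w) / (2 * q (S w))) *s S w)" for u
  have o1: "b (u - P u) w' = 0" if w': "w' \<in> W" for u w'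
  proof -
    have "b (P u) w' = (\<Sum>w\<in>W. if w = w' then b u w' else 0)"
      unfolding P_def b_sum
    proof (rule sum.cong[OF refl])
      fix w assume w: "w \<in> W"
      show "b ((b u w / (2 * q w)) *s w + (b u (S w) / (2 * q (S w))) *s S w) w' = (if w = w' then b u w' else 0)"
        using orth[OF w w'] W(3)[OF w] two by (auto simp: polar_add polar_scale S_skew b_self b_S_self)
    qed
    then show ?thesis using W(1) w' by (simp add: b_diff)
  qed
  have o2: "b (u - P u) (S w') = 0" if w': "w' \<in> W" for u w'
  proof -
    have "b (P u) (S w') = (\<Sum>w\<in>W. if w = w' then b u (S w') else 0)"
      unfolding P_def b_sum
    proof (rule sum.cong[OF refl])
      fix w assume w: "w \<in> W"
      have "q (S w) \<noteq> 0" using W(3)[OF w] d0 by (simp add: q_S)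
      then show "b ((b u w / (2 * q w)) *s w + (b u (S w) / (2 * q (S w))) *s S w) (S w') = (if w = w' then b u (S w') else 0)"
        unfolding polar_add polar_scale b_S_S
        using orth[OF w w'] two d0 W(3)[OF w] by (auto simp: b_S_self b_self q_S)
    qed
    then show ?thesis using W(1) w' by (simp add: b_diff)
  qed
  have iso: "q v = 0" if "\<And>w. w \<in> W \<Longrightarrow> b v w = 0 \<and> b v (S w) = 0" for v
    using neg that by blast
  have "u - P u = 0" for u
  proof (rule nd)
    fix y
    have 1: "q (u - P u) = 0" "q (y - P y) = 0" "q ((u - P u) + (y - P y)) = 0"
      by (rule iso, simp only: polar_add o1 o2 add_0_left simp_thms)+
    have "b (u - P u) (P y) = 0"
      unfolding P_def[of y] b_sum_right b_right using o1 o2 by (intro sum.neutral ballI) simp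
    moreover have "b (u - P u) (y - P y) = 0" using 1 by (simp add: q_add)
    ultimately show "b (u - P u) y = 0" by (simp add: b_diff(2))
  qed
  then have "u = P u" for u by (metis eq_iff_diff_eq_0)
  moreover have "P u \<in> vec.span (W \<union> S ` W)" for u
    unfolding P_def by (intro vec.span_sum vec.span_add vec.span_scale vec.span_base) auto
  ultimately have "UNIV \<subseteq> vec.span (W \<union> S ` W)" by (metis subsetI)
  then have "vec.dim (UNIV :: ('k ^ 6) set) \<le> card (W \<union> S ` W)"
    using W(1) by (intro vec.dim_le_card) auto
  also have "\<dots> \<le> card W + card (S ` W)" by (rule card_Un_le)
  also have "\<dots> \<le> 2 * card W" using card_image_le[OF W(1), of S] by simp
  finally show False using W(2) by (simp add: card_cart_basis)
qed

text \<open>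
  A point of \<open>X\<close> whose quadratic algebra is a field. In this context \<open>k\<^sup>6\<close> is given the structure of a hermitian
  space of dimension 3 over that field.
\<close>

locale nonsplit_point =
  fixes x :: "'k::field multivector6"
  assumes two: "(2::'k) \<noteq> 0" and three: "(3::'k) \<noteq> 0" and x: "x \<in> Xspace"
    and f1: "f1 x \<noteq> 0" and nonsq: "\<not> nonzero_square (- f1 x)"
begin

definition d where "d = - f1 x"

text \<open>
  The transposed covariant acts on covectors, which are the arguments of the trilinear form of \<open>x\<close>. Halving it
  turns its square \<open>quartic x = 4 d\<close> into \<open>d\<close>.
\<close>

definition S :: "'k ^ 6 \<Rightarrow> 'k ^ 6" where "S u = (1 / 2) *s (transpose (phi x) *v u)"

definition q where "q v = J v (S v)"

lemma four: "(4::'k) \<noteq> 0"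
proof -
  have "(4::'k) = 2 * 2" by simp
  then show ?thesis using two by (metis mult_eq_0_iff)
qed

lemma quartic: "quartic x = 4 * d"
  using four by (simp add: d_def f1_def)

lemma S_linear: "S (u + v) = S u + S v" "S (c *s u) = c *s S u"
  by (simp_all add: S_def matrix_vector_right_distrib vector_add_ldistrib vector_scalar_commute mult.commute
      vector_smult_assoc del: transpose_matrix_vector)

lemma S_S: "S (S u) = d *s u"
proof -
  have "transpose (phi x) ** transpose (phi x) = transpose (mat (quartic x))"
    by (simp add: matrix_transpose_mul[symmetric] phi_square_quartic[OF x])
  then have "transpose (phi x) *v (transpose (phi x) *v u) = quartic x *s u"
    by (simp add: matrix_vector_mul_assoc transpose_mat mat_vector del: transpose_matrix_vector)
  then show ?thesis using two four
    by (simp add: S_def vector_scalar_commute vector_smult_assoc quartic del: transpose_matrix_vector)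
qed

lemma J_pairing: "J u v = pairing u (MJ *v v)"
  by (simp add: bform_def pairing_def)

lemma J_linear: "J (u + u') v = J u v + J u' v" "J v (u + u') = J v u + J v u'"
  "J (c *s u) v = c * J u v" "J v (c *s u) = c * J v u" for u u' v :: "'k ^ 6"
  by (simp_all add: bform_def matrix_vector_right_distrib vector_scalar_commute sum.distrib sum_distrib_left algebra_simps)

lemma J_skew: "J u v = - J v u" for u v :: "'k ^ 6"
  by (simp add: bform_def matrix_vector_mult_def sum_6 MJ_values)

lemma J_S: "J (S u) v = - J u (S v)"
proof -
  have "J (transpose (phi x) *v u) v = pairing u (phi x *v (MJ *v v))"
    unfolding J_pairing pairing_matrix ..
  also have "\<dots> = pairing u (- (MJ ** transpose (phi x)) *v v)"
    by (simp add: matrix_vector_mul_assoc phi_skew[OF x])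
  also have "\<dots> = - J u (transpose (phi x) *v v)"
    by (simp add: J_pairing matrix_vector_mul_assoc matrix_vector_minus pairing_def sum_negf
        del: transpose_matrix_vector)
  finally show ?thesis by (simp add: S_def J_linear del: transpose_matrix_vector)
qed

lemma polar_q: "polar q u v = 2 * J u (S v)"
proof -
  have "polar q u v = J u (S v) + J v (S u)" by (simp add: polar_def q_def S_linear J_linear)
  also have "J v (S u) = J u (S v)" using J_skew[of v "S u"] J_S[of u v] by simp
  finally show ?thesis by simp
qed

lemma d_nonzero: "d \<noteq> 0"
  using f1 by (simp add: d_def)

lemma herm: "herm_space (*s) q S d"
  by unfold_locales
     (simp_all add: vector_add_ldistrib vector_sadd_rdistrib vector_smult_assoc polar_q S_linear J_linear J_S S_S
       two d_nonzero q_def power2_eq_square algebra_simps)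

lemma q_nondegenerate: "(\<And>v. polar q u v = 0) \<Longrightarrow> u = 0"
proof -
  assume z: "\<And>v. polar q u v = 0"
  have J0: "J u v = 0" for v
    using z[of "(1 / d) *s S v"] two d_nonzero by (simp add: polar_q S_linear S_S J_linear)
  have "u $ i = 0" for i
  proof -
    have "MJ *v (- (MJ *v axis i 1)) = (axis i 1 :: 'k ^ 6)"
      by (simp add: matrix_vector_minus matrix_vector_mul_assoc MJ_MJ mat_vector)
    then have "J u (- (MJ *v axis i 1)) = u $ i"
      by (simp add: bform_def axis_def if_distrib cong: if_cong)
    then show ?thesis using J0 by simp
  qed
  then show "u = 0" by (simp add: vec_eq_iff)
qed

definition hermitian_basis :: "'k ^ 6 \<Rightarrow> 'k ^ 6 \<Rightarrow> 'k ^ 6 \<Rightarrow> bool" where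
  "hermitian_basis v1 v2 v3 \<longleftrightarrow> q v1 \<noteq> 0 \<and> q v2 \<noteq> 0 \<and> q v3 \<noteq> 0
     \<and> J v1 v2 = 0 \<and> J v1 v3 = 0 \<and> J v2 v3 = 0 \<and> J v1 (S v2) = 0 \<and> J v1 (S v3) = 0 \<and> J v2 (S v3) = 0"

lemma hermitian_basis_exists: "\<exists>v1 v2 v3. hermitian_basis v1 v2 v3"
proof -
  have orth: "J u v = 0 \<and> J u (S v) = 0" if "polar q u v = 0 \<and> polar q u (S v) = 0" for u v
    using that two d_nonzero by (simp add: polar_q S_S J_linear)
  note ext = hermitian_complement[OF herm q_nondegenerate]
  obtain v3 where v3: "q v3 \<noteq> 0" using ext[of "{}"] by auto
  obtain v2 where v2: "q v2 \<noteq> 0" "polar q v2 v3 = 0 \<and> polar q v2 (S v3) = 0"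
    using ext[of "{v3}"] v3 by auto
  have "q w \<noteq> 0" if "w \<in> {v2, v3}" for w using that v2 v3 by auto
  moreover have "polar q w w' = 0 \<and> polar q w (S w') = 0" if "w \<in> {v2, v3}" "w' \<in> {v2, v3}" "w \<noteq> w'" for w w'
  proof -
    have "J v3 v2 = 0" using orth[OF v2(2)] J_skew[of v3 v2] by simp
    moreover have "J v3 (S v2) = 0" using orth[OF v2(2)] J_skew[of v3 "S v2"] J_S[of v2 v3] by simp
    ultimately show ?thesis using that v2(2) by (auto simp: polar_q S_S J_linear)
  qed
  moreover have "2 * card {v2, v3} < 6" using card_insert_le_m1[of 2 "{v3}" v2] by (auto simp: card_insert_if)
  ultimately obtain v1 where v1: "q v1 \<noteq> 0"
    "\<And>w. w \<in> {v2, v3} \<Longrightarrow> polar q v1 w = 0 \<and> polar q v1 (S w) = 0"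
    using ext[of "{v2, v3}"] by auto
  show ?thesis
    unfolding hermitian_basis_def using v1(1) v2(1) v3 orth[OF v2(2)] orth[OF v1(2)[of v2]] orth[OF v1(2)[of v3]] by blast
qed

lemma tri_S: "tri x (S u) v w = tri x u (S v) w" "tri x u (S v) w = tri x u v (S w)"
proof -
  show 1: "tri x (S u) v w = tri x u (S v) w" for u v w
    unfolding S_def tri_scale tri_phi[OF x] ..
  show "tri x u (S v) w = tri x u v (S w)"
    using 1[of v w u] tri_swap[of x] by metis
qed

lemma tri_S_same: "tri x u (S u) w = 0" "tri x (S u) u w = 0" "tri x u w (S u) = 0" "tri x (S u) w u = 0"
  "tri x w u (S u) = 0" "tri x w (S u) u = 0"
proof -
  show 1: "tri x u (S u) w = 0" for w
  proof -
    have "tri x u (S u) w = - tri x u (S u) w" using tri_S(1)[of u u w] tri_swap(1)[of x u "S u" w] by simp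
    then have "2 * tri x u (S u) w = 0" by (metis add.right_inverse mult_2)
    then show ?thesis using two by simp
  qed
  show "tri x (S u) u w = 0" using 1 tri_swap(1)[of x "S u" u w] by simp
  show "tri x u w (S u) = 0" using 1[of w] tri_swap(2)[of x u w "S u"] by simp
  show "tri x (S u) w u = 0" using 1[of w] tri_swap(1)[of x "S u" u w] tri_swap(2)[of x "S u" w u] by simp
  show "tri x w u (S u) = 0" using 1[of w] tri_swap(1)[of x w u "S u"] tri_swap(2)[of x u w "S u"] by simp
  show "tri x w (S u) u = 0" using 1[of w] tri_swap(1)[of x w u "S u"] tri_swap(2)[of x u w "S u"] tri_swap(2)[of x w "S u" u] by simp
qed

text \<open>
  A hermitian basis, completed by its multiples under \<open>S\<close>, is a symplectic basis; in it the trivector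
  has diagonal coordinates, because it is trilinear over the quadratic extension.
\<close>

lemma coords_in_basis:
  assumes "hermitian_basis v1 v2 v3"
  defines "\<alpha> \<equiv> tri x v1 v2 v3" and "\<beta> \<equiv> tri x (S v1) v2 v3"
  shows "\<exists>g\<in>Sp6. Xcoords (act3 g x) \<alpha> (d * \<beta> / (q v1 * q v2 * q v3)) (\<beta> / q v1) (\<beta> / q v2) (\<beta> / q v3) 0 0 0
     (d * \<alpha> / (q v2 * q v3)) (d * \<alpha> / (q v1 * q v3)) (d * \<alpha> / (q v1 * q v2)) 0 0 0"
proof -
  have nz: "q v1 \<noteq> 0" "q v2 \<noteq> 0" "q v3 \<noteq> 0"
    and J0: "J v1 v2 = 0" "J v1 v3 = 0" "J v2 v3 = 0" "J v1 (S v2) = 0" "J v1 (S v3) = 0" "J v2 (S v3) = 0"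
    using assms(1) by (simp_all add: hermitian_basis_def)
  define r where "r i = (if i = 1 then v1 else if i = 2 then v2 else if i = 3 then v3
     else if i = 4 then (1 / q v1) *s S v1 else if i = 5 then (1 / q v2) *s S v2 else (1 / q v3) *s S v3)" for i :: 6
  define g where "g = (\<chi> i. r i)"
  have r: "r 0 = (1 / q v3) *s S v3" "r 1 = v1" "r 2 = v2" "r 3 = v3" "r 4 = (1 / q v1) *s S v1" "r 5 = (1 / q v2) *s S v2"
    by (simp_all add: r_def)
  have Jself: "J u u = 0" for u :: "'k ^ 6"
  proof -
    have "2 * J u u = 0" using J_skew[of u u] by (metis add.right_inverse mult_2)
    then show ?thesis using two by simp
  qed
  have J1: "J v2 v1 = 0" "J v3 v1 = 0" "J v3 v2 = 0" "J v2 (S v1) = 0" "J v3 (S v1) = 0" "J v3 (S v2) = 0"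
    using J0 J_skew[of v2 v1] J_skew[of v3 v1] J_skew[of v3 v2] J_skew[of v2 "S v1"] J_skew[of v3 "S v1"] J_skew[of v3 "S v2"]
    by (simp_all add: J_S)
  have gJ: "(g ** MJ ** transpose g) $ i $ j = J (r i) (r j)" for i j
    by (simp add: g_def matrix_matrix_mult_def transpose_def bform_def matrix_vector_mult_def
        sum_distrib_left sum_distrib_right mult.assoc) (rule sum.swap)
  have symp: "g ** MJ ** transpose g = MJ"
    unfolding vec_eq_iff gJ forall_6 r MJ_values
    using nz by (simp add: J_linear J_S S_S Jself J0 J1 q_def[symmetric])
  have "invertible g"
  proof -
    have "g ** (- (MJ ** transpose g ** MJ)) = mat 1"
      by (simp add: matrix_mul_minus matrix_mul_assoc symp MJ_MJ)
    then show ?thesis unfolding invertible_def using matrix_left_right_inverse by blast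
  qed
  then have g: "g \<in> Sp6" using symp by (simp add: Sp6_def)
  have row: "transpose g *v axis i 1 = r i" for i
    by (simp add: g_def vec_eq_iff matrix_vector_mult_def transpose_def axis_def if_distrib
        del: transpose_matrix_vector cong: if_cong)
  have t: "act3 g x $ {a, b, c} = tri x (r a) (r b) (r c)" if "a < b" "b < c" for a b c
    using tri_axis[OF that, of "act3 g x"] unfolding tri_act3[OF Xspace_grade[OF x]] row by simp
  have cyc: "tri x c a b = tri x a b c" for a b c
    using tri_swap(1)[of x c a b] tri_swap(2)[of x a c b] by simp
  have T: "tri x v1 v2 v3 = \<alpha>" "tri x (S v1) v2 v3 = \<beta>" "tri x v1 (S v2) v3 = \<beta>" "tri x v1 v2 (S v3) = \<beta>"
    "tri x v1 (S v2) (S v3) = d * \<alpha>" "tri x (S v1) v2 (S v3) = d * \<alpha>" "tri x (S v1) (S v2) v3 = d * \<alpha>"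
    "tri x (S v1) (S v2) (S v3) = d * \<beta>"
  proof -
    show "tri x v1 v2 v3 = \<alpha>" and b: "tri x (S v1) v2 v3 = \<beta>" by (simp_all add: \<alpha>_def \<beta>_def)
    show "tri x v1 (S v2) v3 = \<beta>" "tri x v1 v2 (S v3) = \<beta>" using b tri_S by metis+
    have "tri x (S (S v1)) v2 v3 = d * \<alpha>" by (simp add: S_S tri_scale \<alpha>_def)
    then show "tri x v1 (S v2) (S v3) = d * \<alpha>" "tri x (S v1) v2 (S v3) = d * \<alpha>" "tri x (S v1) (S v2) v3 = d * \<alpha>"
      using tri_S by metis+
    have "tri x (S (S (S v1))) v2 v3 = d * \<beta>" by (simp only: S_S S_linear(2) tri_scale b)
    then show "tri x (S v1) (S v2) (S v3) = d * \<beta>" using tri_S by metis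
  qed
  have T': "tri x (S v3) v1 v2 = \<beta>" "tri x v2 v3 (S v1) = \<beta>" "tri x (S v3) v1 (S v2) = d * \<alpha>"
    "tri x v3 (S v1) (S v2) = d * \<alpha>" "tri x (S v3) (S v1) (S v2) = d * \<beta>"
    using T cyc[of "S v3" v1 v2] cyc[of "S v1" v2 v3] cyc[of "S v3" v1 "S v2"]
      cyc[of v3 "S v1" "S v2"] cyc[of "S v3" "S v1" "S v2"]
    by simp_all
  have T'': "tri x v1 v3 (S v2) = - \<beta>" "tri x (S v3) v2 (S v1) = - (d * \<alpha>)"
  proof -
    have "tri x v1 v3 (S v2) = - tri x v1 (S v2) v3" by (rule tri_swap(2))
    then show "tri x v1 v3 (S v2) = - \<beta>" by (simp add: T)
    have "tri x (S v3) v2 (S v1) = tri x v2 (S v1) (S v3)" by (rule cyc)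
    also have "\<dots> = - tri x (S v1) v2 (S v3)" by (rule tri_swap(1))
    finally show "tri x (S v3) v2 (S v1) = - (d * \<alpha>)" by (simp add: T)
  qed
  have "Xcoords (act3 g x) \<alpha> (d * \<beta> / (q v1 * q v2 * q v3)) (\<beta> / q v1) (\<beta> / q v2) (\<beta> / q v3) 0 0 0
     (d * \<alpha> / (q v2 * q v3)) (d * \<alpha> / (q v1 * q v3)) (d * \<alpha> / (q v1 * q v2)) 0 0 0"
    unfolding Xcoords_def
    by (simp add: act3_grade t six_less r tri_scale T T' T'' tri_S_same)
  then show ?thesis using g by blast
qed

lemma norm_nonzero:
  assumes "a \<noteq> 0 \<or> b \<noteq> 0" shows "a\<^sup>2 - d * b\<^sup>2 \<noteq> 0"
proof
  assume eq: "a\<^sup>2 - d * b\<^sup>2 = 0"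
  show False
  proof (cases "b = 0")
    case True
    then show False using eq assms by simp
  next
    case False
    then have "d = (a / b)\<^sup>2" using eq by (simp add: power_divide)
    moreover from this have "a / b \<noteq> 0" using d_nonzero by auto
    ultimately show False using nonsq unfolding nonzero_square_def d_def by blast
  qed
qed

text \<open>
  In a hermitian basis only diagonal coordinates remain, and they are given by the values \<open>\<alpha>\<close> and \<open>\<beta>\<close> of the
  trilinear form. They cannot both vanish, since \<open>f\<^sub>1 x\<close> is nonzero. Replacing the first basis vector by a multiple
  over the quadratic field multiplies \<open>\<alpha>\<close> and \<open>\<beta>\<close>, as components of one element of this field, so that they can be
  moved to \<open>- 1\<close> and \<open>0\<close>.
\<close>

theorem normal_form_exists:
  "\<exists>g\<in>Sp6. \<exists>y1 y2 y3. y1 \<noteq> 0 \<and> y2 \<noteq> 0 \<and> y3 \<noteq> 0 \<and> y1 * y2 * y3 = f1 x \<and> act3 g x = normal_form 0 y1 y2 y3"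
proof -
  obtain v1 v2 v3 where v: "hermitian_basis v1 v2 v3" using hermitian_basis_exists by blast
  define \<alpha> \<beta> where "\<alpha> = tri x v1 v2 v3" and "\<beta> = tri x (S v1) v2 v3"
  have nz: "\<alpha> \<noteq> 0 \<or> \<beta> \<noteq> 0"
  proof (rule ccontr)
    assume "\<not> ?thesis"
    then obtain g where g: "g \<in> Sp6" "Xcoords (act3 g x) 0 0 0 0 0 0 0 0 0 0 0 0 0 0"
      using coords_in_basis[OF v] unfolding \<alpha>_def[symmetric] \<beta>_def[symmetric] by auto
    have "quartic (act3 g x) = 0" using quartic_eq[OF phi_square[OF g(2)]] by simp
    then have "f1 (act3 g x) = 0" by (simp add: f1_def)
    then show False using f1_act3[OF g(1) two three x] f1 by simp
  qed
  define c where "c = 1 / (\<beta>\<^sup>2 - d * \<alpha>\<^sup>2)"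
  have c: "c * (\<beta>\<^sup>2 - d * \<alpha>\<^sup>2) = 1" "c \<noteq> 0" using norm_nonzero[of \<beta> \<alpha>] nz by (auto simp: c_def)
  \<comment> \<open>The coefficients of \<open>u\<close> solve \<open>tri x u v2 v3 = - 1\<close> and \<open>tri x (S u) v2 v3 = 0\<close>.\<close>
  define u where "u = (c * d * \<alpha>) *s v1 + (- (c * \<beta>)) *s S v1"
  have Su: "S u = (c * d * \<alpha>) *s S v1 + (- (c * \<beta>) * d) *s v1"
    unfolding u_def S_linear S_S vector_smult_assoc ..
  have \<alpha>': "tri x u v2 v3 = - 1"
  proof -
    have "tri x u v2 v3 = - (c * (\<beta>\<^sup>2 - d * \<alpha>\<^sup>2))"
      unfolding u_def tri_add tri_scale \<alpha>_def[symmetric] \<beta>_def[symmetric]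
      by (simp add: power2_eq_square algebra_simps)
    then show ?thesis by (simp add: c)
  qed
  have \<beta>': "tri x (S u) v2 v3 = 0"
    unfolding Su tri_add tri_scale \<alpha>_def[symmetric] \<beta>_def[symmetric] by (simp add: algebra_simps)
  have "J (S v1) (S v1) = 0" "J v1 v1 = 0"
    using J_skew[of "S v1" "S v1"] J_skew[of v1 v1] two by (metis add.right_inverse mult_2 mult_eq_0_iff)+
  then have "q u = ((c * d * \<alpha>)\<^sup>2 - d * (c * \<beta>)\<^sup>2) * q v1"
    unfolding q_def Su unfolding u_def J_linear J_S by (simp add: power2_eq_square algebra_simps)
  moreover have "c * d * \<alpha> \<noteq> 0 \<or> c * \<beta> \<noteq> 0" using nz c d_nonzero by simp
  then have "(c * d * \<alpha>)\<^sup>2 - d * (c * \<beta>)\<^sup>2 \<noteq> 0" by (rule norm_nonzero)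
  ultimately have "q u \<noteq> 0" using v by (simp add: hermitian_basis_def)
  then have hu: "hermitian_basis u v2 v3"
    using v unfolding hermitian_basis_def unfolding u_def J_linear J_S S_S by (simp add: J_linear)
  from coords_in_basis[OF hu] obtain g where g: "g \<in> Sp6"
    "Xcoords (act3 g x) (- 1) 0 0 0 0 0 0 0 (- d / (q v2 * q v3)) (- d / (q u * q v3)) (- d / (q u * q v2)) 0 0 0"
    unfolding \<alpha>' \<beta>' by auto
  let ?y1 = "- d / (q v2 * q v3)" and ?y2 = "- d / (q u * q v3)" and ?y3 = "- d / (q u * q v2)"
  have eq: "act3 g x = normal_form 0 ?y1 ?y2 ?y3"
    using Xcoords_unique[OF g(2)] Xcoords_normal_form[of 0 ?y1 ?y2 ?y3] by simp
  have "?y1 * ?y2 * ?y3 = f1 x"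
    using f1_act3[OF g(1) two three x] f1_normal_form[OF two, of 0 ?y1 ?y2 ?y3] unfolding eq by simp
  moreover from this have "?y1 \<noteq> 0 \<and> ?y2 \<noteq> 0 \<and> ?y3 \<noteq> 0" using f1 by auto
  ultimately show ?thesis using g(1) eq by blast
qed

end

section \<open>Octonion algebras\<close>

text \<open>The Cayley-Dickson double of an algebra, with a new generator of norm \<open>c\<close>.\<close>

definition doubling :: "('k::field, 'a::ab_group_add) normed_alg \<Rightarrow> 'k \<Rightarrow> ('k, 'a \<times> 'a) normed_alg" where
  "doubling A c = \<lparr>carrier = UNIV, smul = (\<lambda>t (x, y). (smul A t x, smul A t y)),
     mul = (\<lambda>(x, y) (x', y'). (mul A x x' - smul A c (mul A (conj_of A y') y), mul A y' x + mul A y (conj_of A x'))),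
     unit = (unit A, 0), nrm = (\<lambda>(x, y). nrm A x + c * nrm A y)\<rparr>"

lemma doubling_simps [simp]:
  "carrier (doubling A c) = UNIV" "smul (doubling A c) t (x, y) = (smul A t x, smul A t y)"
  "mul (doubling A c) (x, y) (x', y') = (mul A x x' - smul A c (mul A (conj_of A y') y), mul A y' x + mul A y (conj_of A x'))"
  "unit (doubling A c) = (unit A, 0)" "nrm (doubling A c) (x, y) = nrm A x + c * nrm A y"
  by (simp_all add: doubling_def)

lemma polar_doubling: "polar (nrm (doubling A c)) (x, y) (x', y') = polar (nrm A) x x' + c * polar (nrm A) y y'"
  by (simp add: polar_def algebra_simps)

locale full_comp_alg = comp_alg C for C :: "('k::field, 'a::ab_group_add) normed_alg" +
  assumes full [simp]: "carrier C = UNIV"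
begin

lemma mul_zero: "m 0 x = 0" "m x 0 = 0"
  using mul_bilinear(3)[of 0 x 0] mul_bilinear(4)[of x 0 0] by simp_all

lemma conj_zero: "cj 0 = 0"
  using conj_scale[of 0 0] by simp

lemma conj_neg: "cj (- x) = - cj x"
  using conj_scale[of x "- 1"] by simp

lemma conj_diff: "cj (x - y) = cj x - cj y"
  using conj_add[of x "- y"] by (simp add: conj_neg)

lemma nrm_conj: "N (cj x) = N x"
proof -
  have "N (cj x) = N (s (b x e) e) + N (- x) + b (s (b x e) e) (- x)"
    by (simp add: conj_of_def polar_def)
  moreover have "N (- x) = N x" using nrm_scale[of x "- 1"] by simp
  moreover have "b (s (b x e) e) (- x) = - (b x e * b x e)"
    using polar_neg[of x "s (b x e) e"] by (simp add: polar_sym[of _ "- x"] polar_bilinear)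
  ultimately show ?thesis by (simp add: nrm_scale nrm_unit power2_eq_square)
qed

text \<open>
  The norm of a doubling is multiplicative because the two cross terms, moved to one side by the
  adjoint identities, differ only by a bracketing.
\<close>

lemma composition_algebra_doubling:
  assumes assoc: "\<And>x y z. m (m x y) z = m x (m y z)" and c: "c \<noteq> 0"
  shows "composition_algebra (doubling C c)"
proof -
  let ?D = "doubling C c"
  have vsD: "vector_space (smul ?D)"
    by unfold_locales (auto simp: V.scale_right_distrib V.scale_left_distrib)
  then interpret D: vector_space "smul ?D" .
  have "vspace ?D" by (simp add: vspace_def vsD)
  moreover have "nrm ?D (mul ?D x y) = nrm ?D x * nrm ?D y" for x y
  proof (cases x; cases y)
    fix u v u' v' assume xy: "x = (u, v)" "y = (u', v')"
    have "b (m u u') (m (cj v') v) = b (m v' (m u u')) v"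
      using polar_adjoint(1)[of v' "m u u'" v] by simp
    moreover have "b (m v' u) (m v (cj u')) = b (m (m v' u) u') v"
      using polar_adjoint(2)[of "m v' u" u' v] by simp
    ultimately have cross: "b (m v' u) (m v (cj u')) = b (m u u') (m (cj v') v)" by (simp add: assoc)
    have "N (m u u' - s c (m (cj v') v)) = N u * N u' + c\<^sup>2 * (N v' * N v) - c * b (m u u') (m (cj v') v)"
    proof -
      have "N (m u u' - s c (m (cj v') v)) = N (m u u') + N (s (- c) (m (cj v') v)) + b (m u u') (s (- c) (m (cj v') v))"
        by (simp add: polar_def)
      then show ?thesis by (simp only: nrm_scale[OF closed(6)] polar_bilinear full UNIV_I nrm_mul nrm_conj) simp
    qed
    moreover have "N (m v' u + m v (cj u')) = N v' * N u + N v * N u' + b (m v' u) (m v (cj u'))"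
    proof -
      have "N (m v' u + m v (cj u')) = N (m v' u) + N (m v (cj u')) + b (m v' u) (m v (cj u'))" by (simp add: polar_def)
      then show ?thesis by (simp add: nrm_mul nrm_conj)
    qed
    ultimately show ?thesis by (simp add: xy cross power2_eq_square algebra_simps)
  qed
  moreover have "nondegenerate ?D (nrm ?D)"
    unfolding nondegenerate_def
  proof (intro ballI impI)
    fix x assume z: "\<forall>y\<in>carrier ?D. polar (nrm ?D) x y = 0"
    obtain u v where x: "x = (u, v)" by (cases x)
    have b0: "b w 0 = 0" for w using polar_bilinear(4)[of w 0 0] by simp
    have "polar (nrm ?D) (u, v) (y, 0) = 0" "polar (nrm ?D) (u, v) (0, y) = 0" for y using z x by auto
    then have "b u y = 0" "b v y = 0" for y using c by (simp_all add: polar_doubling b0)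
    then show "x = 0" using nondeg[of u] nondeg[of v] by (simp add: x zero_prod_def)
  qed
  moreover have "quadratic_form ?D (nrm ?D)"
    unfolding quadratic_form_def by (auto simp: polar_doubling polar_bilinear nrm_scale algebra_simps)
  moreover have "mul ?D (x + y) z = mul ?D x z + mul ?D y z \<and> mul ?D z (x + y) = mul ?D z x + mul ?D z y" for x y z
    by (cases x; cases y; cases z) (simp add: mul_bilinear conj_add V.scale_right_distrib)
  moreover have "mul ?D (smul ?D t x) y = smul ?D t (mul ?D x y) \<and> mul ?D x (smul ?D t y) = smul ?D t (mul ?D x y)" for t x y
    by (cases x; cases y)
       (simp add: mul_bilinear conj_scale V.scale_right_distrib V.scale_right_diff_distrib mult.commute)
  moreover have "mul ?D (unit ?D) x = x \<and> mul ?D x (unit ?D) = x" for x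
    by (cases x) (simp add: conj_unit mul_zero conj_zero)
  ultimately show ?thesis
    unfolding composition_algebra_def nalgebra_def by (simp add: zero_prod_def)
qed

lemma doubling_assoc:
  assumes assoc: "\<And>x y z. m (m x y) z = m x (m y z)" and comm: "\<And>x y. m x y = m y x"
  shows "mul (doubling C c) (mul (doubling C c) x y) z = mul (doubling C c) x (mul (doubling C c) y z)"
proof (cases x; cases y; cases z)
  fix u v u' v' u'' v'' assume xyz: "x = (u, v)" "y = (u', v')" "z = (u'', v'')"
  have ac: "m x (m y z) = m y (m x z)" for x y z by (metis assoc comm)
  have cm: "conj_of (doubling C c) (x, y) = (cj x, - y)" for x y
  proof -
    have b0: "b y 0 = 0" for y using polar_bilinear(4)[of y 0 0] by simp
    show ?thesis by (simp add: conj_of_def polar_doubling b0)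
  qed
  show ?thesis
    by (simp add: xyz mul_bilinear mul_diff conj_add conj_diff conj_scale conj_mul conj_conj V.scale_right_distrib
        V.scale_right_diff_distrib assoc ac comm algebra_simps)
qed

end

text \<open>The octonion algebra with norm form \<open>N \<otimes> \<langle>1, p, r, p r\<rangle>\<close>, for the norm \<open>N\<close> of \<open>k[t] / (t\<^sup>2 - d)\<close>.\<close>

definition octonions :: "'k::field \<Rightarrow> 'k \<Rightarrow> 'k \<Rightarrow> ('k, (('k \<times> 'k) \<times> ('k \<times> 'k)) \<times> (('k \<times> 'k) \<times> ('k \<times> 'k))) normed_alg" where
  "octonions d p r = doubling (doubling (quad_ext d) p) r"

lemma composition_algebra_octonions:
  assumes two: "(2::'k::field) \<noteq> 0" and nz: "(d::'k) \<noteq> 0" "p \<noteq> 0" "r \<noteq> 0"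
  shows "composition_algebra (octonions d p r)"
proof -
  interpret Q: full_comp_alg "quad_ext d"
    by unfold_locales (simp_all add: composition_algebra_quad_ext two nz)
  have a: "mul (quad_ext d) (mul (quad_ext d) x y) z = mul (quad_ext d) x (mul (quad_ext d) y z)" for x y z
    by (simp add: mul_quad_ext algebra_simps)
  have c: "mul (quad_ext d) x y = mul (quad_ext d) y x" for x y
    by (simp add: mul_quad_ext algebra_simps)
  interpret H: full_comp_alg "doubling (quad_ext d) p"
    by unfold_locales (simp_all add: Q.composition_algebra_doubling[OF a nz(2)])
  show ?thesis
    unfolding octonions_def
    by (rule H.composition_algebra_doubling[OF _ nz(3)]) (rule Q.doubling_assoc[OF a c])
qed

lemma Zorn_simps [simp]:
  "carrier Zorn = UNIV" "smul Zorn c (a, u, v, b) = (c * a, c *s u, c *s v, c * b)"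
  "mul Zorn (a, u, v, b) (a', u', v', b') =
       (a * a' + dot3 u v', a *s u' + b' *s u - crossp3 v v', a' *s v + b *s v' + crossp3 u u', b * b' + dot3 v u')"
  "unit Zorn = (1, 0, 0, 1)" "nrm Zorn (a, u, v, b) = a * b - dot3 u v"
  by (simp_all add: Zorn_def)

lemma polar_Zorn: "polar (nrm Zorn) (a, u, v, b) (a', u', v', b') = a * b' + a' * b - dot3 u v' - dot3 u' v"
  by (simp add: polar_def dot3_def sum_3 algebra_simps)

lemma composition_algebra_Zorn: "composition_algebra (Zorn :: ('k::field, _) normed_alg)"
proof -
  let ?Z = "Zorn :: ('k, _) normed_alg"
  have vsZ: "vector_space (smul ?Z)"
    by unfold_locales (auto simp: algebra_simps vector_add_ldistrib vector_sadd_rdistrib vector_smult_assoc)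
  then interpret Z: vector_space "smul ?Z" .
  have "vspace ?Z" by (simp add: vspace_def vsZ)
  moreover have "nrm ?Z (mul ?Z x y) = nrm ?Z x * nrm ?Z y" for x y
    by (cases x; cases y) (simp add: dot3_def crossp3_def sum_3 vector_3 algebra_simps)
  moreover have "nondegenerate ?Z (nrm ?Z)"
    unfolding nondegenerate_def
  proof (intro ballI impI)
    fix x assume z: "\<forall>y\<in>carrier ?Z. polar (nrm ?Z) x y = 0"
    obtain a u v b where x: "x = (a, u, v, b)" by (cases x)
    have p: "polar (nrm ?Z) (a, u, v, b) y = 0" for y using z unfolding x Zorn_simps(1) by blast
    have d: "dot3 w (axis i 1) = w $ i" "dot3 (axis i 1) w = w $ i" "dot3 w 0 = 0" "dot3 0 w = 0" for w :: "'k ^ 3" and i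
      by (simp_all add: dot3_def axis_def if_distrib[of "\<lambda>x. _ * x"] if_distrib[of "\<lambda>x. x * _"] cong: if_cong)
    have "a = 0" "b = 0" using p[of "(0, 0, 0, 1)"] p[of "(1, 0, 0, 0)"] by (simp_all add: polar_Zorn d)
    moreover have "u $ i = 0" "v $ i = 0" for i
      using p[of "(0, 0, axis i 1, 0)"] p[of "(0, axis i 1, 0, 0)"] by (simp_all add: polar_Zorn d)
    ultimately show "x = 0" by (simp add: x zero_prod_def vec_eq_iff)
  qed
  moreover have "quadratic_form ?Z (nrm ?Z)"
    unfolding quadratic_form_def
    by (auto simp: polar_Zorn dot3_def sum_3 power2_eq_square algebra_simps)
  moreover have "mul ?Z (x + y) z = mul ?Z x z + mul ?Z y z \<and> mul ?Z z (x + y) = mul ?Z z x + mul ?Z z y" for x y z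
    by (cases x; cases y; cases z)
       (simp add: dot3_def crossp3_def sum_3 vec_eq_iff forall_3 vector_3 algebra_simps)
  moreover have "mul ?Z (smul ?Z t x) y = smul ?Z t (mul ?Z x y) \<and> mul ?Z x (smul ?Z t y) = smul ?Z t (mul ?Z x y)" for t x y
    by (cases x; cases y) (simp add: dot3_def crossp3_def sum_3 vec_eq_iff forall_3 vector_3 algebra_simps)
  moreover have "mul ?Z (unit ?Z) x = x \<and> mul ?Z x (unit ?Z) = x" for x
    by (cases x) (simp add: dot3_def crossp3_def sum_3 vec_eq_iff forall_3 vector_3)
  ultimately show ?thesis
    unfolding composition_algebra_def nalgebra_def by (simp add: zero_prod_def)
qed

section \<open>Transport of structure\<close>

text \<open>
  The structure that makes a linear bijection \<open>f\<close> an isomorphism.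
\<close>

definition pullback :: "('k \<Rightarrow> 'b \<Rightarrow> 'b) \<Rightarrow> ('b::ab_group_add \<Rightarrow> 'a::ab_group_add) \<Rightarrow> ('k::field, 'a) normed_alg \<Rightarrow> ('k, 'b) normed_alg" where
  "pullback sc f M = \<lparr>carrier = f -` carrier M, smul = sc, mul = (\<lambda>x y. inv f (mul M (f x) (f y))),
     unit = inv f (unit M), nrm = nrm M \<circ> f\<rparr>"

lemma pullback_simps [simp]:
  "carrier (pullback sc f M) = f -` carrier M" "smul (pullback sc f M) = sc"
  "mul (pullback sc f M) x y = inv f (mul M (f x) (f y))" "unit (pullback sc f M) = inv f (unit M)"
  "nrm (pullback sc f M) x = nrm M (f x)"
  by (simp_all add: pullback_def)

lemma pullback_restrict: "pullback sc f (M\<lparr>carrier := D\<rparr>) = (pullback sc f M)\<lparr>carrier := f -` D\<rparr>"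
  by (simp add: pullback_def)

lemma pullback_composition:
  assumes M: "composition_algebra M" and sc: "vector_space sc" and bij: "bij f"
    and add: "\<And>x y. f (x + y) = f x + f y" and scale: "\<And>c x. f (sc c x) = smul M c (f x)"
  shows "composition_algebra (pullback sc f M)" and "alg_iso f (pullback sc f M) M"
proof -
  interpret M: comp_alg M using M by (rule comp_alg.intro)
  interpret S: vector_space sc by fact
  let ?P = "pullback sc f M"
  have fi: "f (inv f y) = y" for y using bij by (simp add: bij_is_surj surj_f_inv_f)
  have if': "inv f (f x) = x" for x using bij by (simp add: bij_is_inj)
  have inj: "f x = f y \<longleftrightarrow> x = y" for x y using bij by (simp add: bij_is_inj inj_eq)
  have f0: "f 0 = 0" using add[of 0 0] by simp
  have pol: "polar (nrm ?P) x y = polar (nrm M) (f x) (f y)" for x y by (simp add: polar_def add)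
  have "vspace ?P"
    unfolding vspace_def S.subspace_def[unfolded pullback_simps] using sc
    by (simp add: S.subspace_def f0 add scale)
  moreover have "quadratic_form ?P (nrm ?P)"
    unfolding quadratic_form_def pol by (simp add: add scale M.nrm_scale M.polar_bilinear)
  moreover have "nondegenerate ?P (nrm ?P)"
    unfolding nondegenerate_def pol
  proof (intro ballI impI)
    fix x assume x: "x \<in> carrier ?P" and z: "\<forall>y\<in>carrier ?P. polar (nrm M) (f x) (f y) = 0"
    have "f x = 0"
    proof (rule M.nondeg)
      show "f x \<in> carrier M" using x by simp
      fix y assume "y \<in> carrier M"
      then show "polar (nrm M) (f x) y = 0" using z[rule_format, of "inv f y"] by (simp add: fi)
    qed
    then show "x = 0" using inj[of x 0] f0 by simp
  qed
  moreover have "unit ?P \<noteq> 0"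
  proof
    assume "unit ?P = 0"
    then have "f (unit ?P) = f 0" by (rule arg_cong)
    then show False using M.unit_mul(3) by (simp add: fi f0)
  qed
  moreover have "mul ?P (x + y) z = mul ?P x z + mul ?P y z \<and> mul ?P z (x + y) = mul ?P z x + mul ?P z y"
    if "x \<in> carrier ?P" "y \<in> carrier ?P" "z \<in> carrier ?P" for x y z
    using that by (simp add: inj[symmetric] fi add M.mul_bilinear)
  moreover have "mul ?P (sc c x) y = sc c (mul ?P x y) \<and> mul ?P x (sc c y) = sc c (mul ?P x y)"
    if "x \<in> carrier ?P" "y \<in> carrier ?P" for c x y
    using that by (simp add: inj[symmetric] fi scale M.mul_bilinear)
  ultimately show "composition_algebra ?P"
    unfolding composition_algebra_def nalgebra_def
    by (simp add: fi if' M.nrm_mul)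
  show "alg_iso f ?P M"
    unfolding alg_iso_def lin_iso_def
    using bij by (auto simp: add scale fi bij_betw_def inj_on_def inj intro!: image_eqI[of _ f "inv f _"])
qed

section \<open>Flags of composition algebras\<close>

lemma four_nonzero: "(2::'k::field) \<noteq> 0 \<Longrightarrow> (4::'k) \<noteq> 0"
  by (metis mult_2 mult_eq_0_iff numeral_Bit0)

text \<open>Multiplication of each coordinate by an invertible \<open>n i\<close> of the quadratic algebra scales its norm by the norm of \<open>n i\<close>.\<close>

lemma isometric_scale:
  fixes d :: "'k::field"
  assumes n: "\<forall>i. c $ i = c' $ i * ((fst (n i))\<^sup>2 - d * (snd (n i))\<^sup>2) \<and> (fst (n i))\<^sup>2 - d * (snd (n i))\<^sup>2 \<noteq> 0"
  shows "isometric (fourfold (quad_ext d)) (norm_tensor (quad_ext d) c) (fourfold (quad_ext d)) (norm_tensor (quad_ext d) c')"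
proof -
  let ?N = "\<lambda>i. (fst (n i))\<^sup>2 - d * (snd (n i))\<^sup>2"
  define h where "h z = (\<chi> i. mul (quad_ext d) (n i) (z $ i))" for z :: "('k \<times> 'k) ^ 4"
  define g where "g z = (\<chi> i. smul (quad_ext d) (1 / ?N i) (mul (quad_ext d) (fst (n i), - snd (n i)) (z $ i)))" for z :: "('k \<times> 'k) ^ 4"
  have e: "mul (quad_ext d) (n i) (smul (quad_ext d) (1 / ?N i) (mul (quad_ext d) (fst (n i), - snd (n i)) y)) = y"
    "smul (quad_ext d) (1 / ?N i) (mul (quad_ext d) (fst (n i), - snd (n i)) (mul (quad_ext d) (n i) y)) = y" for i y
  proof -
    define t where "t = 1 / ?N i"
    have t: "t * ?N i = 1" using n by (simp add: t_def)
    have "mul (quad_ext d) (n i) (smul (quad_ext d) t (mul (quad_ext d) (fst (n i), - snd (n i)) y)) = smul (quad_ext d) (t * ?N i) y"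
      "smul (quad_ext d) t (mul (quad_ext d) (fst (n i), - snd (n i)) (mul (quad_ext d) (n i) y)) = smul (quad_ext d) (t * ?N i) y"
      by (simp_all add: mul_quad_ext smul_quad_ext power2_eq_square algebra_simps)
    then show "mul (quad_ext d) (n i) (smul (quad_ext d) (1 / ?N i) (mul (quad_ext d) (fst (n i), - snd (n i)) y)) = y"
      "smul (quad_ext d) (1 / ?N i) (mul (quad_ext d) (fst (n i), - snd (n i)) (mul (quad_ext d) (n i) y)) = y"
      unfolding t by (simp_all add: smul_quad_ext t_def)
  qed
  have "h (g z) = z" "g (h z) = z" for z by (simp_all add: h_def g_def e)
  then have "bij h" by (metis o_bij comp_def eq_id_iff ext)
  moreover have "norm_tensor (quad_ext d) c' (h z) = norm_tensor (quad_ext d) c z" for z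
    unfolding norm_tensor_quad_ext
  proof (rule sum.cong)
    fix i
    have "(fst (h z $ i))\<^sup>2 - d * (snd (h z $ i))\<^sup>2 = ?N i * ((fst (z $ i))\<^sup>2 - d * (snd (z $ i))\<^sup>2)"
      by (simp add: h_def mul_quad_ext power2_eq_square algebra_simps)
    then show "c' $ i * ((fst (h z $ i))\<^sup>2 - d * (snd (h z $ i))\<^sup>2) = c $ i * ((fst (z $ i))\<^sup>2 - d * (snd (z $ i))\<^sup>2)"
      using n by simp
  qed simp
  moreover have "h (x + y) = h x + h y" for x y by (simp add: h_def vec_eq_iff mul_quad_ext algebra_simps)
  moreover have "h (smul (fourfold (quad_ext d)) a x) = smul (fourfold (quad_ext d)) a (h x)" for a x
    by (simp add: h_def vec_eq_iff mul_quad_ext smul_quad_ext algebra_simps)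
  ultimately show ?thesis
    unfolding isometric_def lin_iso_def by (intro exI[of _ h]) simp
qed

lemma vdim_quad_ext: "vdim (quad_ext (d :: 'k::field)) = 2"
proof -
  interpret V: vector_space "smul (quad_ext d)" by (rule vector_space_quad_ext)
  have "V.independent {(1, 0), (0, 1)}"
    by (auto simp: V.independent_insert V.span_singleton zero_prod_def)
  moreover have "x \<in> V.span {(1, 0), (0, 1)}" for x
  proof -
    have "x = smul (quad_ext d) (fst x) (1, 0) + smul (quad_ext d) (snd x) (0, 1)" by (simp add: prod_eq_iff)
    also have "\<dots> \<in> V.span {(1, 0), (0, 1)}" by (intro V.span_add V.span_scale V.span_base) auto
    finally show ?thesis .
  qed
  ultimately show ?thesis unfolding vdim_def
    by (intro V.dim_unique[of "{(1, 0), (0, 1)}"]) auto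
qed

lemma vector_space_smult: "vector_space ((*s) :: 'k::field \<Rightarrow> 'k ^ 'n \<Rightarrow> 'k ^ 'n)"
  by unfold_locales (auto simp: vector_add_ldistrib vector_sadd_rdistrib vector_smult_assoc)

text \<open>Octonion algebras arise on various types of dimension 8; this moves them, with a subalgebra, to \<open>k\<^sup>8\<close>.\<close>

lemma two_flag_realisation:
  fixes M :: "('k::field, 'a::ab_group_add) normed_alg" and f :: "'k ^ 8 \<Rightarrow> 'a"
  assumes M: "composition_algebra M" "carrier M = UNIV" and D: "composition_algebra (M\<lparr>carrier := D\<rparr>)"
    and dim: "vdim (M\<lparr>carrier := D\<rparr>) = 2"
    and f: "bij f" "\<And>x y. f (x + y) = f x + f y" "\<And>c x. f (c *s x) = smul M c (f x)"
  shows "\<exists>(K :: ('k, 'k ^ 8) normed_alg) C. two_flag K C \<and> alg_iso f C M \<and> f ` carrier K = D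
     \<and> alg_iso f K (M\<lparr>carrier := D\<rparr>)"
proof -
  let ?C = "pullback (*s) f M" and ?K = "pullback (*s) f (M\<lparr>carrier := D\<rparr>)"
  have scD: "f (c *s x) = smul (M\<lparr>carrier := D\<rparr>) c (f x)" for c x using f(3) by simp
  note C = pullback_composition[OF M(1) vector_space_smult f]
  note K = pullback_composition[OF D vector_space_smult f(1,2) scD]
  have "vdim ?C = 8"
    unfolding vdim_def using M(2) by (simp add: card_cart_basis)
  moreover have "vdim ?K = 2"
    using vdim_iso[of f ?K "M\<lparr>carrier := D\<rparr>"] K D dim
    by (simp add: alg_iso_def composition_algebra_def nalgebra_def)
  moreover have "?K = ?C\<lparr>carrier := carrier ?K\<rparr>" by (simp add: pullback_restrict)
  ultimately have "two_flag ?K ?C" unfolding two_flag_def using C(1) K(1) M(2) by simp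
  moreover have "f ` carrier ?K = D" using f(1) by (simp add: bij_is_surj surj_image_vimage_eq)
  ultimately show ?thesis using C(2) K(2) by blast
qed

lemma forall_8: "(\<forall>i::8. P i) \<longleftrightarrow> P 1 \<and> P 2 \<and> P 3 \<and> P 4 \<and> P 5 \<and> P 6 \<and> P 7 \<and> P 8"
proof -
  have "(UNIV :: 8 set) = {1, 2, 3, 4, 5, 6, 7, 8}" by (rule sym, rule card_subset_eq) auto
  then show ?thesis by (metis UNIV_I empty_iff insert_iff)
qed

text \<open>Both 2-dimensional subalgebras below, of Zorn's algebra and of an iterated doubling, are recognised as images
  of the quadratic algebra.\<close>

lemma image_subalgebra:
  assumes Q: "composition_algebra Q" "carrier Q = UNIV" and M: "composition_algebra M" "carrier M = UNIV"
    and j: "inj j" "\<And>x y. j (x + y) = j x + j y" "\<And>c x. j (smul Q c x) = smul M c (j x)"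
      "\<And>x y. j (mul Q x y) = mul M (j x) (j y)" "j (unit Q) = unit M" "\<And>x. nrm M (j x) = nrm Q x"
  shows "composition_algebra (M\<lparr>carrier := range j\<rparr>)" and "alg_iso (inv j) (M\<lparr>carrier := range j\<rparr>) Q"
proof -
  interpret Q: comp_alg Q using Q(1) by (rule comp_alg.intro)
  interpret M: comp_alg M using M(1) by (rule comp_alg.intro)
  let ?D = "M\<lparr>carrier := range j\<rparr>"
  have j0: "j 0 = 0" using j(2)[of 0 0] by simp
  have pol: "polar (nrm M) (j x) (j y) = polar (nrm Q) x y" for x y
    unfolding polar_def j(2)[symmetric] j(6) ..
  have cl: "x + y \<in> range j" "smul M c x \<in> range j" "mul M x y \<in> range j" if xy: "x \<in> range j" "y \<in> range j" for x y c
  proof -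
    obtain x' y' where "x = j x'" "y = j y'" using xy by blast
    then show "x + y \<in> range j" "smul M c x \<in> range j" "mul M x y \<in> range j"
      by (simp_all add: j(2-4)[symmetric])
  qed
  have U: "x \<in> carrier M" for x using M(2) by simp
  have "nalgebra ?D"
    unfolding nalgebra_def
  proof (intro conjI ballI allI)
    have "0 \<in> range j" using j0 by (metis rangeI)
    then show "vspace ?D"
      using M.vs by (simp add: vspace_def M.V.subspace_def cl)
  qed (simp_all add: cl M.mul_bilinear U)
  moreover have "nondegenerate ?D (nrm M)"
    unfolding nondegenerate_def
  proof (intro ballI impI)
    fix x assume "x \<in> carrier ?D" and z: "\<forall>y\<in>carrier ?D. polar (nrm M) x y = 0"
    then obtain x' where x': "x = j x'" by auto
    have "polar (nrm Q) x' y = 0" for y using z by (simp add: x' pol)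
    then show "x = 0" using Q.nondeg[of x'] Q(2) by (simp add: x' j0)
  qed
  moreover have "quadratic_form ?D (nrm M)"
    unfolding quadratic_form_def by (simp add: M.nrm_scale M.polar_bilinear U)
  moreover have "unit M \<in> range j" using j(5) by (metis rangeI)
  ultimately show "composition_algebra ?D"
    using M.unit_mul(3) unfolding composition_algebra_def by (simp add: M.unit_mul M.nrm_mul U)
  have ij: "inv j (j x) = x" for x using j(1) by simp
  have "bij_betw (inv j) (range j) UNIV"
    using j(1) by (intro bij_betw_inv_into) (simp add: bij_betw_def)
  moreover have "inv j (x + y) = inv j x + inv j y" "inv j (smul M c x) = smul Q c (inv j x)"
    "inv j (mul M x y) = mul Q (inv j x) (inv j y)" if xy: "x \<in> range j" "y \<in> range j" for x y c
  proof -
    obtain x' y' where "x = j x'" "y = j y'" using xy by blast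
    then show "inv j (x + y) = inv j x + inv j y" "inv j (smul M c x) = smul Q c (inv j x)"
      "inv j (mul M x y) = mul Q (inv j x) (inv j y)"
      by (simp_all add: j(2-4)[symmetric] ij)
  qed
  ultimately show "alg_iso (inv j) ?D Q"
    unfolding alg_iso_def lin_iso_def using Q(2) by simp
qed

section \<open>The split flag\<close>

lemma Zorn_diag_quad_ext:
  assumes two: "(2::'k::field) \<noteq> 0"
  shows "composition_algebra ((Zorn :: ('k, _) normed_alg)\<lparr>carrier := Zorn_diag\<rparr>)"
    and "\<exists>h. alg_iso h ((Zorn :: ('k, _) normed_alg)\<lparr>carrier := Zorn_diag\<rparr>) (quad_ext 1)"
proof -
  let ?Z = "Zorn :: ('k, _) normed_alg"
  define j where "j z = (fst z + snd z, 0 :: 'k ^ 3, 0 :: 'k ^ 3, fst z - snd z)" for z :: "'k \<times> 'k"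
  have four: "(4::'k) \<noteq> 0" by (rule four_nonzero[OF two])
  have half: "(p + q) / 2 + (p - q) / 2 = p" "(p + q) / 2 - (p - q) / 2 = q" for p q :: 'k
    using two four by (simp_all add: field_simps)
  have d0: "dot3 0 w = 0" "dot3 w 0 = 0" "crossp3 0 0 = (0 :: 'k ^ 3)" for w :: "'k ^ 3"
    by (simp_all add: dot3_def crossp3_def vec_eq_iff forall_3 vector_3)
  have "inj j"
  proof (rule injI)
    fix z w assume "j z = j w"
    then have s: "fst z + snd z = fst w + snd w" "fst z - snd z = fst w - snd w" by (simp_all add: j_def)
    have "2 * fst z = (fst z + snd z) + (fst z - snd z)" by simp
    also have "\<dots> = 2 * fst w" unfolding s by simp
    finally have "fst z = fst w" using two by simp
    then show "z = w" using s(1) by (simp add: prod_eq_iff)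
  qed
  moreover have "j (x + y) = j x + j y" "j (smul (quad_ext 1) c x) = smul ?Z c (j x)"
    "j (mul (quad_ext 1) x y) = mul ?Z (j x) (j y)" "j (unit (quad_ext 1)) = unit ?Z" "nrm ?Z (j x) = nrm (quad_ext 1) x" for x y c
    by (cases x, simp add: j_def smul_quad_ext mul_quad_ext d0 power2_eq_square algebra_simps)+
  ultimately have *: "composition_algebra (?Z\<lparr>carrier := range j\<rparr>)" "alg_iso (inv j) (?Z\<lparr>carrier := range j\<rparr>) (quad_ext 1)"
    using image_subalgebra[of "quad_ext 1" ?Z j] composition_algebra_quad_ext[OF two, of 1] composition_algebra_Zorn[where 'k='k]
    by simp_all
  have "(p, 0, 0, q) = j ((p + q) / 2, (p - q) / 2)" for p q by (simp add: j_def half)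
  then have "(p, 0, 0, q) \<in> range j" for p q by (metis rangeI)
  then have "Zorn_diag \<subseteq> range j" by (auto simp: Zorn_diag_def)
  moreover have "range j \<subseteq> Zorn_diag" by (auto simp: j_def Zorn_diag_def)
  ultimately have "range j = Zorn_diag" by (rule equalityI[rotated])
  then show "composition_algebra (?Z\<lparr>carrier := Zorn_diag\<rparr>)" "\<exists>h. alg_iso h (?Z\<lparr>carrier := Zorn_diag\<rparr>) (quad_ext 1)"
    using * by auto
qed

lemma vdim_2_if_iso_quad_ext:
  assumes "alg_iso h K (quad_ext d)" "composition_algebra K"
  shows "vdim K = 2"
proof -
  interpret V: vector_space "smul (quad_ext d)" by (rule vector_space_quad_ext)
  have "vspace (quad_ext d)" by (simp add: vspace_def V.vector_space_axioms)
  then show ?thesis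
    using vdim_iso[of h K "quad_ext d"] vdim_quad_ext[of d] assms
    by (simp add: alg_iso_def composition_algebra_def nalgebra_def)
qed

lemma split_flag_exists:
  assumes two: "(2::'k::field) \<noteq> 0"
  shows "\<exists>(K :: ('k, 'k ^ 8) normed_alg) C. two_flag K C \<and> (\<exists>h. alg_iso h C (Zorn :: ('k, _) normed_alg) \<and> h ` carrier K = Zorn_diag)"
proof -
  define f where "f v = (v $ 1, vector [v $ 2, v $ 3, v $ 4] :: 'k ^ 3, vector [v $ 5, v $ 6, v $ 7] :: 'k ^ 3, v $ 8)" for v :: "'k ^ 8"
  define g where "g x = (\<chi> i :: 8. if i = 1 then fst x else if i = 2 then fst (snd x) $ 1 else if i = 3 then fst (snd x) $ 2
    else if i = 4 then fst (snd x) $ 3 else if i = 5 then fst (snd (snd x)) $ 1 else if i = 6 then fst (snd (snd x)) $ 2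
    else if i = 7 then fst (snd (snd x)) $ 3 else snd (snd (snd x)))" for x :: "'k \<times> ('k ^ 3) \<times> ('k ^ 3) \<times> 'k"
  have "f (g x) = x" for x by (cases x) (simp add: f_def g_def vec_eq_iff forall_3 vector_3)
  moreover have "g (f x) = x" for x
    unfolding vec_eq_iff forall_8 by (simp add: f_def g_def vector_3)
  ultimately have bij: "bij f" by (metis o_bij comp_def eq_id_iff ext)
  have add: "f (x + y) = f x + f y" and scale: "f (c *s x) = smul Zorn c (f x)" for x y c
    by (simp_all add: f_def vec_eq_iff forall_3 vector_3)
  obtain h where h: "alg_iso h ((Zorn :: ('k, _) normed_alg)\<lparr>carrier := Zorn_diag\<rparr>) (quad_ext 1)"
    using Zorn_diag_quad_ext(2)[OF two] by blast
  show ?thesis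
    using two_flag_realisation[OF composition_algebra_Zorn _ Zorn_diag_quad_ext(1)[OF two]
      vdim_2_if_iso_quad_ext[OF h Zorn_diag_quad_ext(1)[OF two]] bij add scale]
    by auto
qed

text \<open>
  Over \<open>k \<times> k\<close> every element of \<open>k\<close> is a norm, so the norm of the split octonions is
  \<open>N \<otimes> \<langle>1, c\<^sub>2, c\<^sub>3, c\<^sub>4\<rangle>\<close> for every choice of the entries \<open>c\<^sub>i\<close>.
\<close>

lemma split_flag:
  fixes K C :: "('k::field, 'a::ab_group_add) normed_alg"
  assumes two: "(2::'k) \<noteq> 0" and fl: "two_flag K C"
    and h: "alg_iso h C (Zorn :: ('k, _) normed_alg)" "h ` carrier K = Zorn_diag"
    and c: "c2 \<noteq> 0" "c3 \<noteq> 0" "c4 \<noteq> 0"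
  shows "K \<simeq>\<^sub>a quad_ext 1"
    and "isometric C (nrm C) (fourfold (quad_ext 1)) (norm_tensor (quad_ext 1) (vector [1, c2, c3, c4]))"
proof -
  let ?Z = "Zorn :: ('k, _) normed_alg"
  have K: "K = C\<lparr>carrier := carrier K\<rparr>" "carrier K \<subseteq> carrier C" "composition_algebra C" using fl by (auto simp: two_flag_def)
  have "smul K = smul C" "mul K = mul C" using arg_cong[OF K(1), of smul] arg_cong[OF K(1), of mul] by simp_all
  moreover have "bij_betw h (carrier K) Zorn_diag"
    using h K(2) by (auto simp: alg_iso_def lin_iso_def bij_betw_def intro: inj_on_subset)
  ultimately have "alg_iso h K (?Z\<lparr>carrier := Zorn_diag\<rparr>)"
    using h(1) by (simp add: alg_iso_def lin_iso_def subsetD[OF K(2)])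
  then show "K \<simeq>\<^sub>a quad_ext 1"
    using Zorn_diag_quad_ext(2)[OF two] alg_isomorphic_trans unfolding alg_isomorphic_def by blast
  have "isometric C (nrm C) ?Z (nrm ?Z)"
    unfolding isometric_def
    using h(1) alg_iso_nrm[OF h(1) comp_alg_intro[OF K(3)] comp_alg_intro[OF composition_algebra_Zorn]]
    by (auto simp: alg_iso_def)
  moreover have "isometric ?Z (nrm ?Z) (fourfold (quad_ext 1)) (norm_tensor (quad_ext 1) (vector [1, c2, c3, c4]))"
  proof -
    define \<phi> where "\<phi> x = (vector [((fst x + snd (snd (snd x))) / 2, (fst x - snd (snd (snd x))) / 2),
      ((fst (snd (snd x)) $ 1 - fst (snd x) $ 1 / c2) / 2, (- fst (snd (snd x)) $ 1 - fst (snd x) $ 1 / c2) / 2),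
      ((fst (snd (snd x)) $ 2 - fst (snd x) $ 2 / c3) / 2, (- fst (snd (snd x)) $ 2 - fst (snd x) $ 2 / c3) / 2),
      ((fst (snd (snd x)) $ 3 - fst (snd x) $ 3 / c4) / 2, (- fst (snd (snd x)) $ 3 - fst (snd x) $ 3 / c4) / 2)] :: ('k \<times> 'k) ^ 4)"
      for x :: "'k \<times> ('k ^ 3) \<times> ('k ^ 3) \<times> 'k"
    define \<psi> where "\<psi> z = (fst (z $ 1) + snd (z $ 1),
      vector [- c2 * (fst (z $ 2) + snd (z $ 2)), - c3 * (fst (z $ 3) + snd (z $ 3)), - c4 * (fst (z $ 4) + snd (z $ 4))] :: 'k ^ 3,
      vector [fst (z $ 2) - snd (z $ 2), fst (z $ 3) - snd (z $ 3), fst (z $ 4) - snd (z $ 4)] :: 'k ^ 3,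
      fst (z $ 1) - snd (z $ 1))" for z :: "('k \<times> 'k) ^ 4"
    have four: "(4::'k) \<noteq> 0" by (rule four_nonzero[OF two])
    have "\<psi> (\<phi> x) = x" for x
      by (cases x) (use two four c in \<open>simp add: \<phi>_def \<psi>_def vector_4 vec_eq_iff forall_3 vector_3 field_simps\<close>)
    moreover have "\<phi> (\<psi> z) = z" for z
      using two four c by (simp add: \<phi>_def \<psi>_def vector_4 vec_eq_iff forall_4 vector_3 prod_eq_iff field_simps)
    ultimately have "bij \<phi>" by (metis o_bij comp_def eq_id_iff ext)
    moreover have "norm_tensor (quad_ext 1) (vector [1, c2, c3, c4]) (\<phi> x) = nrm ?Z x" for x
    proof (cases x)
      case (fields a u v b)
      have "(16::'k) = 4 * 4" by simp
      then have sixteen: "(16::'k) \<noteq> 0" using four by (metis mult_eq_0_iff)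
      have t: "((s + r) / 2)\<^sup>2 - ((s - r) / 2)\<^sup>2 = s * r" for s r :: 'k
        using two four sixteen by (simp add: field_simps power2_eq_square)
      have t': "e * (((s - r / e) / 2)\<^sup>2 - ((- s - r / e) / 2)\<^sup>2) = - (r * s)" if "e \<noteq> 0" for e s r :: 'k
        using two four sixteen that by (simp add: field_simps power2_eq_square)
      show ?thesis
        unfolding norm_tensor_quad_ext sum_4 \<phi>_def fields
        by (simp add: vector_4 t t' c dot3_def sum_3)
    qed
    moreover have "\<phi> (x + y) = \<phi> x + \<phi> y" for x y
      by (simp add: \<phi>_def vec_eq_iff forall_4 vector_4 add_divide_distrib diff_divide_distrib)
    moreover have "\<phi> (smul ?Z a x) = smul (fourfold (quad_ext 1)) a (\<phi> x)" for a x
      by (cases x) (simp add: \<phi>_def vec_eq_iff forall_4 vector_4 smul_quad_ext right_diff_distrib distrib_left)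
    ultimately show ?thesis
      unfolding isometric_def lin_iso_def by (intro exI[of _ \<phi>]) simp
  qed
  ultimately show "isometric C (nrm C) (fourfold (quad_ext 1)) (norm_tensor (quad_ext 1) (vector [1, c2, c3, c4]))"
    by (rule isometric_trans)
qed

section \<open>Flags with a given norm form\<close>

lemma octonion_flag_exists:
  assumes two: "(2::'k::field) \<noteq> 0" and nz: "(d::'k) \<noteq> 0" "p \<noteq> 0" "r \<noteq> 0"
  shows "\<exists>(K :: ('k, 'k ^ 8) normed_alg) C. two_flag K C \<and> K \<simeq>\<^sub>a quad_ext d
    \<and> isometric C (nrm C) (fourfold (quad_ext d)) (norm_tensor (quad_ext d) (vector [1, p, r, p * r]))"
proof -
  let ?M = "octonions d p r" and ?Q = "quad_ext d"
  note M = composition_algebra_octonions[OF two nz] and Q = composition_algebra_quad_ext[OF two nz(1)]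
  define f where "f v = (((v $ 1, v $ 2), (v $ 3, v $ 4)), ((v $ 5, v $ 6), (v $ 7, v $ 8)))" for v :: "'k ^ 8"
  define g where "g x = (\<chi> i :: 8. if i = 1 then fst (fst (fst x)) else if i = 2 then snd (fst (fst x)) else if i = 3 then fst (snd (fst x))
    else if i = 4 then snd (snd (fst x)) else if i = 5 then fst (fst (snd x)) else if i = 6 then snd (fst (snd x))
    else if i = 7 then fst (snd (snd x)) else snd (snd (snd x)))" for x :: "(('k \<times> 'k) \<times> ('k \<times> 'k)) \<times> (('k \<times> 'k) \<times> ('k \<times> 'k))"
  have "f (g x) = x" for x by (cases x) (simp add: f_def g_def)
  moreover have "g (f x) = x" for x
    unfolding vec_eq_iff forall_8 by (simp add: f_def g_def)
  ultimately have bij: "bij f" by (metis o_bij comp_def eq_id_iff ext)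
  have add: "f (x + y) = f x + f y" and scale: "f (c *s x) = smul ?M c (f x)" for x y c
    by (simp_all add: f_def octonions_def smul_quad_ext)
  define j where "j z = ((z, 0 :: 'k \<times> 'k), 0 :: ('k \<times> 'k) \<times> ('k \<times> 'k))" for z :: "'k \<times> 'k"
  have "inj j" by (rule injI) (simp add: j_def)
  moreover have "j (x + y) = j x + j y" "j (smul ?Q c x) = smul ?M c (j x)"
    "j (mul ?Q x y) = mul ?M (j x) (j y)" "j (unit ?Q) = unit ?M" "nrm ?M (j x) = nrm ?Q x" for x y c
    by (simp_all add: j_def octonions_def zero_prod_def conj_of_def polar_doubling polar_def smul_quad_ext mul_quad_ext
      power2_eq_square)
  ultimately have *: "composition_algebra (?M\<lparr>carrier := range j\<rparr>)" "alg_iso (inv j) (?M\<lparr>carrier := range j\<rparr>) ?Q"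
    using image_subalgebra[of ?Q ?M j] Q M by (simp_all add: octonions_def)
  have "carrier ?M = UNIV" by (simp add: octonions_def)
  from two_flag_realisation[OF M this *(1) vdim_2_if_iso_quad_ext[OF *(2,1)] bij add scale]
  obtain K :: "('k, 'k ^ 8) normed_alg" and C where KC: "two_flag K C" "alg_iso f C ?M" "alg_iso f K (?M\<lparr>carrier := range j\<rparr>)"
    by blast
  have C: "composition_algebra C" using KC(1) by (simp add: two_flag_def)
  have "isometric C (nrm C) ?M (nrm ?M)"
    unfolding isometric_def
    using KC(2) alg_iso_nrm[OF KC(2) comp_alg_intro[OF C] comp_alg_intro[OF M]]
    by (auto simp: alg_iso_def)
  moreover have "isometric ?M (nrm ?M) (fourfold ?Q) (norm_tensor ?Q (vector [1, p, r, p * r]))"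
  proof -
    define \<phi> where "\<phi> x = (vector [fst (fst x), snd (fst x), fst (snd x), snd (snd x)] :: ('k \<times> 'k) ^ 4)"
      for x :: "(('k \<times> 'k) \<times> ('k \<times> 'k)) \<times> (('k \<times> 'k) \<times> ('k \<times> 'k))"
    define \<psi> where "\<psi> z = ((z $ 1, z $ 2), (z $ 3, z $ 4))" for z :: "('k \<times> 'k) ^ 4"
    have "\<psi> (\<phi> x) = x" "\<phi> (\<psi> z) = z" for x z
      by (simp_all add: \<phi>_def \<psi>_def vector_4 vec_eq_iff forall_4)
    then have "bij \<phi>" by (metis o_bij comp_def eq_id_iff ext)
    moreover have "norm_tensor ?Q (vector [1, p, r, p * r]) (\<phi> x) = nrm ?M x" for x
    proof -
      obtain a b c e where "x = ((a, b), (c, e))" by (metis surj_pair)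
      then show ?thesis
        unfolding norm_tensor_def sum_4 by (simp add: \<phi>_def vector_4 octonions_def algebra_simps)
    qed
    moreover have "\<phi> (x + y) = \<phi> x + \<phi> y" "\<phi> (smul ?M a x) = smul (fourfold ?Q) a (\<phi> x)" for x y a
    proof -
      obtain b c e f where "x = ((b, c), (e, f))" by (metis surj_pair)
      then show "\<phi> (x + y) = \<phi> x + \<phi> y" "\<phi> (smul ?M a x) = smul (fourfold ?Q) a (\<phi> x)"
        by (simp_all add: \<phi>_def vec_eq_iff forall_4 vector_4 octonions_def smul_quad_ext)
    qed
    ultimately show ?thesis
      unfolding isometric_def lin_iso_def by (intro exI[of _ \<phi>]) (simp add: octonions_def)
  qed
  ultimately have "isometric C (nrm C) (fourfold ?Q) (norm_tensor ?Q (vector [1, p, r, p * r]))" by (rule isometric_trans)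
  moreover have "K \<simeq>\<^sub>a ?Q" unfolding alg_isomorphic_def using alg_iso_trans[OF KC(3) *(2)] by blast
  ultimately show ?thesis using KC(1) by blast
qed

lemma isometric_fourfold_iff_quad_ext:
  fixes K :: "('k::field, 'a::ab_group_add) normed_alg"
  assumes two: "(2::'k) \<noteq> 0" and d: "d \<noteq> 0" and K: "composition_algebra K" "K \<simeq>\<^sub>a quad_ext d"
  shows "isometric A q (fourfold K) (norm_tensor K c) \<longleftrightarrow> isometric A q (fourfold (quad_ext d)) (norm_tensor (quad_ext d) c)"
proof -
  obtain h where h: "alg_iso h K (quad_ext d)" using K(2) by (auto simp: alg_isomorphic_def)
  have K': "comp_alg K" "comp_alg (quad_ext d)"
    using K(1) composition_algebra_quad_ext[OF two d] by (simp_all add: comp_alg_intro)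
  note i = isometric_fourfold[OF h K'] 
  show ?thesis using isometric_trans[OF _ i] isometric_trans[OF _ isometric_sym[OF i vspace_fourfold[OF K'(1)]]] by blast
qed

text \<open>
  The octonions with parameters \<open>y1\<close> and \<open>y2\<close> have \<open>y1 y2\<close> as the last entry of their norm. As \<open>y1 y2 y3 = - d\<close>, this
  is \<open>y3\<close> times the norm of \<open>t / y3\<close>.
\<close>

lemma nonsplit_flag_exists:
  assumes two: "(2::'k::field) \<noteq> 0" and y: "y1 \<noteq> 0" "y2 \<noteq> 0" "(y3::'k) \<noteq> 0" "y1 * y2 * y3 = - d"
  shows "\<exists>(K :: ('k, 'k ^ 8) normed_alg) C. two_flag K C \<and> K \<simeq>\<^sub>a quad_ext d
    \<and> isometric C (nrm C) (fourfold (quad_ext d)) (norm_tensor (quad_ext d) (vector [1, y1, y2, y3]))"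
proof -
  have d: "d \<noteq> 0" using y by auto
  have "y1 * y2 = y3 * (0\<^sup>2 - d * (1 / y3)\<^sup>2)"
    using y(3) by (simp add: field_simps power2_eq_square flip: y(4))
  then have "isometric (fourfold (quad_ext d)) (norm_tensor (quad_ext d) (vector [1, y1, y2, y1 * y2]))
      (fourfold (quad_ext d)) (norm_tensor (quad_ext d) (vector [1, y1, y2, y3]))"
    using y d by (intro isometric_scale[of _ _ "\<lambda>i. if i = 4 then (0, 1 / y3) else (1, 0)"])
      (simp add: forall_4 vector_4)
  then show ?thesis using octonion_flag_exists[OF two d y(1,2)] isometric_trans by blast
qed

section \<open>The invariant \<open>f\<^sub>2\<close> determines the norm form\<close>

text \<open>
  The pairs \<open>(v\<^bsub>i+3\<^esub> + y\<^sub>0 v\<^sub>i / (2 y\<^sub>i), v\<^sub>i / y\<^sub>i)\<close>, which complete the squares in \<open>f\<^sub>2\<close> of a normal form, after a first entry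
  \<open>a\<close>. The sixth coordinate of \<open>v\<close> has index \<open>0\<close>.
\<close>

definition nf_coords :: "'k::field \<Rightarrow> 'k \<Rightarrow> 'k \<Rightarrow> 'k \<Rightarrow> 'k \<times> 'k \<Rightarrow> 'k ^ 6 \<Rightarrow> ('k \<times> 'k) ^ 4" where
  "nf_coords y0 y1 y2 y3 a v = vector [a, (v $ 4 + y0 * v $ 1 / (2 * y1), v $ 1 / y1),
     (v $ 5 + y0 * v $ 2 / (2 * y2), v $ 2 / y2), (v $ 0 + y0 * v $ 3 / (2 * y3), v $ 3 / y3)]"

definition nf_vector :: "'k::field \<Rightarrow> 'k \<Rightarrow> 'k \<Rightarrow> 'k \<Rightarrow> ('k \<times> 'k) ^ 4 \<Rightarrow> 'k ^ 6" where
  "nf_vector y0 y1 y2 y3 z = (\<chi> i. if i = 1 then y1 * snd (z $ 2) else if i = 2 then y2 * snd (z $ 3)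
     else if i = 3 then y3 * snd (z $ 4) else if i = 4 then fst (z $ 2) - y0 * snd (z $ 2) / 2
     else if i = 5 then fst (z $ 3) - y0 * snd (z $ 3) / 2 else fst (z $ 4) - y0 * snd (z $ 4) / 2)"

lemma nf_coords_1: "nf_coords y0 y1 y2 y3 a v $ 1 = a"
  by (simp add: nf_coords_def vector_4)

lemma nf_coords_linear:
  "nf_coords y0 y1 y2 y3 (a + a') (v + v') = nf_coords y0 y1 y2 y3 a v + nf_coords y0 y1 y2 y3 a' v'"
  "nf_coords y0 y1 y2 y3 (smul (quad_ext d) t a) (t *s v) = smul (fourfold (quad_ext d)) t (nf_coords y0 y1 y2 y3 a v)"
  by (simp_all add: nf_coords_def vec_eq_iff forall_4 vector_4 smul_quad_ext add_divide_distrib algebra_simps)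

lemma nf_vector_linear:
  "nf_vector y0 y1 y2 y3 (z + z') = nf_vector y0 y1 y2 y3 z + nf_vector y0 y1 y2 y3 z'"
  "nf_vector y0 y1 y2 y3 (smul (fourfold (quad_ext d)) t z) = t *s nf_vector y0 y1 y2 y3 z"
  by (simp_all add: nf_vector_def vec_eq_iff smul_quad_ext add_divide_distrib algebra_simps)

context
  fixes y0 y1 y2 y3 :: "'k::field"
  assumes y: "y1 \<noteq> 0" "y2 \<noteq> 0" "y3 \<noteq> 0" and two: "(2::'k) \<noteq> 0"
begin

lemma nf_vector_coords: "nf_vector y0 y1 y2 y3 (nf_coords y0 y1 y2 y3 a v) = v"
  unfolding vec_eq_iff forall_6 using y two four_nonzero[OF two] by (simp add: nf_vector_def nf_coords_def vector_4 field_simps)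

lemma nf_coords_vector: "nf_coords y0 y1 y2 y3 (z $ 1) (nf_vector y0 y1 y2 y3 z) = z"
  unfolding vec_eq_iff forall_4 using y two four_nonzero[OF two] by (simp add: nf_vector_def nf_coords_def vector_4 prod_eq_iff field_simps)

lemma norm_tensor_nf_coords:
  assumes d: "y1 * y2 * y3 - 1 / 4 * y0\<^sup>2 = - d"
  shows "norm_tensor (quad_ext d) (vector [1, y1, y2, y3]) (nf_coords y0 y1 y2 y3 a v)
    = (fst a)\<^sup>2 - d * (snd a)\<^sup>2 - f2 (normal_form y0 y1 y2 y3, v)"
proof -
  have four: "(4::'k) \<noteq> 0" by (rule four_nonzero[OF two])
  have sq: "e * ((q + y0 * p / (2 * e))\<^sup>2 - d * (p / e)\<^sup>2) = e * q\<^sup>2 + y0 * (p * q) + y1 * y2 * y3 / e * p\<^sup>2"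
    if "e \<noteq> 0" for e p q
  proof -
    have d': "y1 * y2 * y3 = y0\<^sup>2 / 4 - d" using d by (simp add: algebra_simps)
    show ?thesis unfolding d' using that two four by (simp add: field_simps power2_eq_square)
  qed
  have "y1 * y2 * y3 / y1 = y2 * y3" "y1 * y2 * y3 / y2 = y1 * y3" "y1 * y2 * y3 / y3 = y1 * y2" using y by simp_all
  then show ?thesis
    unfolding norm_tensor_quad_ext sum_4 f2_normal_form[OF two] nf_coords_def
    by (simp add: vector_4 sq y)
qed

end

text \<open>
  The norm form attached to a normal form is \<open>N \<bottom> - f\<^sub>2\<close> in suitable coordinates, so two normal forms whose
  \<open>f\<^sub>2\<close> are equivalent have isometric norm forms.
\<close>

lemma isometric_normal_forms:
  fixes d :: "'k::field"
  assumes two: "(2::'k) \<noteq> 0"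
    and y: "y1 \<noteq> 0" "y2 \<noteq> 0" "y3 \<noteq> 0" "y1 * y2 * y3 - 1 / 4 * y0\<^sup>2 = - d"
    and z: "z1 \<noteq> 0" "z2 \<noteq> 0" "z3 \<noteq> 0" "z1 * z2 * z3 - 1 / 4 * z0\<^sup>2 = - d"
    and G: "G ** H = mat 1" "H ** G = mat 1"
    and f2: "\<And>v. f2 (normal_form z0 z1 z2 z3, G *v v) = f2 (normal_form y0 y1 y2 y3, v)"
  shows "isometric (fourfold (quad_ext d)) (norm_tensor (quad_ext d) (vector [1, y1, y2, y3]))
    (fourfold (quad_ext d)) (norm_tensor (quad_ext d) (vector [1, z1, z2, z3]))"
proof -
  let ?cy = "nf_coords y0 y1 y2 y3" and ?vy = "nf_vector y0 y1 y2 y3" and ?cz = "nf_coords z0 z1 z2 z3" and ?vz = "nf_vector z0 z1 z2 z3"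
  define h where "h w = ?cz (w $ 1) (G *v ?vy w)" for w
  define g where "g w = ?cy (w $ 1) (H *v ?vz w)" for w
  have "h (g w) = w" "g (h w) = w" for w
    by (simp_all add: h_def g_def nf_coords_1 nf_vector_coords nf_coords_vector y z two matrix_vector_mul_assoc G)
  then have "bij h" by (metis o_bij comp_def eq_id_iff ext)
  moreover have "norm_tensor (quad_ext d) (vector [1, z1, z2, z3]) (h w) = norm_tensor (quad_ext d) (vector [1, y1, y2, y3]) w" for w
  proof -
    have "norm_tensor (quad_ext d) (vector [1, y1, y2, y3]) (?cy (w $ 1) (?vy w)) =
      (fst (w $ 1))\<^sup>2 - d * (snd (w $ 1))\<^sup>2 - f2 (normal_form y0 y1 y2 y3, ?vy w)"
      by (rule norm_tensor_nf_coords) (use y two in auto)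
    moreover have "norm_tensor (quad_ext d) (vector [1, z1, z2, z3]) (h w) =
      (fst (w $ 1))\<^sup>2 - d * (snd (w $ 1))\<^sup>2 - f2 (normal_form z0 z1 z2 z3, G *v ?vy w)"
      unfolding h_def by (rule norm_tensor_nf_coords) (use z two in auto)
    ultimately show ?thesis by (simp add: nf_coords_vector y two f2)
  qed
  moreover have "h (w + w') = h w + h w'" for w w'
    by (simp add: h_def nf_vector_linear matrix_vector_right_distrib nf_coords_linear)
  moreover have "h (smul (fourfold (quad_ext d)) a w) = smul (fourfold (quad_ext d)) a (h w)" for a w
    unfolding h_def nf_vector_linear nf_coords_linear(2)[symmetric] by (simp add: vector_scalar_commute)
  ultimately show ?thesis
    unfolding isometric_def lin_iso_def by (intro exI[of _ h]) (simp del: fourfold_simps(2))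
qed

text \<open>In the nonsplit case the two normal forms are related by an element of \<open>Sp\<^sub>6\<close>, and \<open>f\<^sub>2\<close> is invariant under it.
  In the split case both norms are isometric to one and the same form.\<close>

lemma attached_unique:
  fixes x0 :: "'k::field multivector6" and K :: "('k, 'a::ab_group_add) normed_alg" and L :: "('k, 'b::ab_group_add) normed_alg"
  assumes two: "(2::'k) \<noteq> 0" and three: "(3::'k) \<noteq> 0" and x0: "x0 \<in> Xspace" "f1 x0 \<noteq> 0"
    and g: "g \<in> Sp6" "g' \<in> Sp6"
    and K: "attached (act3 g x0) K C" and L: "attached (act3 g' x0) L D"
  shows "\<exists>d. d \<noteq> 0 \<and> K \<simeq>\<^sub>a quad_ext d \<and> L \<simeq>\<^sub>a quad_ext d \<and> isometric C (nrm C) D (nrm D)"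
proof -
  have f1: "f1 (act3 g x0) = f1 x0" "f1 (act3 g' x0) = f1 x0" using f1_act3[OF _ two three x0(1)] g by auto
  have fl: "two_flag K C" "two_flag L D" using K L by (auto simp: attached_def)
  then have ca: "composition_algebra K" "composition_algebra L" "composition_algebra D" by (auto simp: two_flag_def)
  then have vD: "vspace D" by (simp add: composition_algebra_def nalgebra_def)
  show ?thesis
  proof (cases "nonzero_square (- f1 x0)")
    case True
    then obtain h h' where "alg_iso h C (Zorn :: ('k, _) normed_alg)" "h ` carrier K = Zorn_diag"
      "alg_iso h' D (Zorn :: ('k, _) normed_alg)" "h' ` carrier L = Zorn_diag"
      using K L f1 by (auto simp: attached_def)
    note s = split_flag[OF two fl(1) this(1,2) one_neq_zero one_neq_zero one_neq_zero] split_flag[OF two fl(2) this(3,4) one_neq_zero one_neq_zero one_neq_zero]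
    show ?thesis
      using s isometric_trans[OF s(2) isometric_sym[OF s(4) vD]] by (intro exI[of _ 1]) simp
  next
    case False
    define d where "d = - f1 x0"
    have d: "d \<noteq> 0" using x0(2) by (simp add: d_def)
    obtain y0 y1 y2 y3 a where y: "y1 \<noteq> 0" "y2 \<noteq> 0" "y3 \<noteq> 0" "y1 * y2 * y3 - 1 / 4 * y0\<^sup>2 = - d"
      "a \<in> Sp6" "act3 a (act3 g x0) = normal_form y0 y1 y2 y3"
      and KQ: "K \<simeq>\<^sub>a quad_ext d" and iK: "isometric C (nrm C) (fourfold K) (norm_tensor K (vector [1, y1, y2, y3]))"
      using K False unfolding attached_def f1 d_def by auto
    obtain z0 z1 z2 z3 b where z: "z1 \<noteq> 0" "z2 \<noteq> 0" "z3 \<noteq> 0" "z1 * z2 * z3 - 1 / 4 * z0\<^sup>2 = - d"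
      "b \<in> Sp6" "act3 b (act3 g' x0) = normal_form z0 z1 z2 z3"
      and LQ: "L \<simeq>\<^sub>a quad_ext d" and iL: "isometric D (nrm D) (fourfold L) (norm_tensor L (vector [1, z1, z2, z3]))"
      using L False unfolding attached_def f1 d_def by auto
    have fy: "f2 (normal_form y0 y1 y2 y3, a *v (g *v v)) = f2 (x0, v)" for v
      unfolding y(6)[symmetric] f2_act3[OF y(5) two three act3_grade] f2_act3[OF g(1) two three Xspace_grade[OF x0(1)]] ..
    have fz: "f2 (normal_form z0 z1 z2 z3, b *v (g' *v v)) = f2 (x0, v)" for v
      unfolding z(6)[symmetric] f2_act3[OF z(5) two three act3_grade] f2_act3[OF g(2) two three Xspace_grade[OF x0(1)]] ..
    obtain ai bi gi gi' where inv: "ai ** a = mat 1" "a ** ai = mat 1" "bi ** b = mat 1" "b ** bi = mat 1"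
      "gi ** g = mat 1" "g ** gi = mat 1" "gi' ** g' = mat 1" "g' ** gi' = mat 1"
      using Sp6_invertible y(5) z(5) g by metis
    have cancel: "P ** (Q ** R) = R" if "P ** Q = mat 1" for P Q R :: "'k ^ 6 ^ 6"
      using that by (simp add: matrix_mul_assoc)
    have vcancel: "P *v (Q *v v) = v" if "P ** Q = mat 1" for P Q :: "'k ^ 6 ^ 6" and v
      using that by (simp add: matrix_vector_mul_assoc)
    have "isometric (fourfold (quad_ext d)) (norm_tensor (quad_ext d) (vector [1, y1, y2, y3]))
      (fourfold (quad_ext d)) (norm_tensor (quad_ext d) (vector [1, z1, z2, z3]))"
    proof (rule isometric_normal_forms[OF two y(1-4) z(1-4)])
      show "(b ** (g' ** (gi ** ai))) ** (a ** (g ** (gi' ** bi))) = mat 1" "(a ** (g ** (gi' ** bi))) ** (b ** (g' ** (gi ** ai))) = mat 1"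
        unfolding matrix_mul_assoc[symmetric] using inv by (simp_all add: cancel)
      fix v
      have "f2 (normal_form z0 z1 z2 z3, (b ** (g' ** (gi ** ai))) *v v) = f2 (x0, gi *v (ai *v v))"
        unfolding matrix_vector_mul_assoc[symmetric] by (rule fz)
      also have "\<dots> = f2 (normal_form y0 y1 y2 y3, a *v (g *v (gi *v (ai *v v))))" by (rule fy[symmetric])
      also have "\<dots> = f2 (normal_form y0 y1 y2 y3, v)" unfolding vcancel[OF inv(6)] vcancel[OF inv(2)] ..
      finally show "f2 (normal_form z0 z1 z2 z3, (b ** (g' ** (gi ** ai))) *v v) = f2 (normal_form y0 y1 y2 y3, v)" .
    qed
    from isometric_trans[OF iK[unfolded isometric_fourfold_iff_quad_ext[OF two d ca(1) KQ]]
        isometric_trans[OF this isometric_sym[OF iL[unfolded isometric_fourfold_iff_quad_ext[OF two d ca(2) LQ]] vD]]]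
    have "isometric C (nrm C) D (nrm D)" .
    then show ?thesis using d KQ LQ by blast
  qed
qed

lemma H3_iso_if_iso:
  assumes "K \<simeq>\<^sub>a L" "composition_algebra K" "composition_algebra L"
  shows "H3 K \<gamma> \<simeq>\<^sub>a H3 L \<gamma>"
proof -
  obtain h where "alg_iso h K L" using assms(1) by (auto simp: alg_isomorphic_def)
  then show ?thesis using H3_iso comp_alg_intro[OF assms(2)] comp_alg_intro[OF assms(3)] by metis
qed

text \<open>
  Both algebras are brought over the same quadratic algebra, where the orbit has fixed the isometry class of the
  norm form.
\<close>

lemma represents_unique:
  fixes x0 :: "'k::field multivector6" and A :: "('k, 'a::ab_group_add) nalg" and B :: "('k, 'b::ab_group_add) nalg"
  assumes two: "(2::'k) \<noteq> 0" and three: "(3::'k) \<noteq> 0" and x0: "(x0, v0) \<in> Vss"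
    and A: "represents (orbit (x0, v0)) A" and B: "represents (orbit (x0, v0)) B" "nalgebra B"
  shows "A \<simeq>\<^sub>a B"
proof -
  have x0': "x0 \<in> Xspace" "f1 x0 \<noteq> 0" using x0 by (auto simp: Vss_def)
  let ?e = "\<lambda>\<gamma> :: 'k ^ 3. vector [1, \<gamma> $ 2 * \<gamma> $ 3, \<gamma> $ 1 * \<gamma> $ 3, \<gamma> $ 1 * \<gamma> $ 2] :: 'k ^ 4"
  obtain g K C K' \<gamma> where a: "g \<in> Sp6" "attached (act3 g x0) (K :: ('k, 'k ^ 8) normed_alg) C"
    "composition_algebra (K' :: ('k, 'k ^ 8) normed_alg)" "\<forall>i. \<gamma> $ i \<noteq> 0" "A \<simeq>\<^sub>a H3 K' \<gamma>" "K' \<simeq>\<^sub>a K"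
    "isometric C (nrm C) (fourfold K) (norm_tensor K (?e \<gamma>))"
    using A unfolding represents_def orbit_def by auto
  obtain h L D L' \<delta> where b: "h \<in> Sp6" "attached (act3 h x0) (L :: ('k, 'k ^ 8) normed_alg) D"
    "composition_algebra (L' :: ('k, 'k ^ 8) normed_alg)" "\<forall>i. \<delta> $ i \<noteq> 0" "B \<simeq>\<^sub>a H3 L' \<delta>" "L' \<simeq>\<^sub>a L"
    "isometric D (nrm D) (fourfold L) (norm_tensor L (?e \<delta>))"
    using B(1) unfolding represents_def orbit_def by auto
  obtain d where d: "d \<noteq> 0" "K \<simeq>\<^sub>a quad_ext d" "L \<simeq>\<^sub>a quad_ext d" "isometric C (nrm C) D (nrm D)"
    using attached_unique[OF two three x0' a(1) b(1) a(2) b(2)] by blast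
  have ca: "composition_algebra K" "composition_algebra L" "composition_algebra C"
    using a(2) b(2) by (auto simp: attached_def two_flag_def)
  note Q = composition_algebra_quad_ext[OF two d(1)]
  have vC: "vspace C" using ca(3) by (simp add: composition_algebra_def nalgebra_def)
  note iC = a(7)[unfolded isometric_fourfold_iff_quad_ext[OF two d(1) ca(1) d(2)]]
  note iD = b(7)[unfolded isometric_fourfold_iff_quad_ext[OF two d(1) ca(2) d(3)]]
  have "isometric (fourfold (quad_ext d)) (norm_tensor (quad_ext d) (?e \<gamma>)) (fourfold (quad_ext d)) (norm_tensor (quad_ext d) (?e \<delta>))"
    using isometric_trans[OF isometric_sym[OF iC vC] isometric_trans[OF d(4) iD]] .
  then have "H3 (quad_ext d) \<gamma> \<simeq>\<^sub>a H3 (quad_ext d) \<delta>"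
    by (rule H3_iso_of_isometric[OF two d(1) a(4) b(4)])
  moreover have "H3 K' \<gamma> \<simeq>\<^sub>a H3 (quad_ext d) \<gamma>" "H3 L' \<delta> \<simeq>\<^sub>a H3 (quad_ext d) \<delta>"
    using H3_iso_if_iso alg_isomorphic_trans a(3,6) b(3,6) d(2,3) Q by blast+
  moreover note a(5) alg_isomorphic_sym[OF b(5) B(2)]
  moreover have "nalgebra (H3 L' \<delta>)" by (rule comp_alg.nalgebra_H3[OF comp_alg_intro[OF b(3)] b(4)])
  ultimately show ?thesis by (meson alg_isomorphic_trans alg_isomorphic_sym)
qed

section \<open>Every flag and every algebra occur\<close>

lemma quad_ext_square:
  assumes two: "(2::'k::field) \<noteq> 0" and b: "(b::'k) \<noteq> 0"
  shows "quad_ext (b\<^sup>2) \<simeq>\<^sub>a quad_ext 1"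
proof -
  have "bij (\<lambda>(p, q). (p, b * q))"
    by (rule o_bij[of "\<lambda>(p, q). (p, q / b)"]) (auto simp: fun_eq_iff b)
  then show ?thesis
    unfolding alg_isomorphic_def alg_iso_def lin_iso_def
    by (intro exI[of _ "\<lambda>(p, q). (p, b * q)"]) (auto simp: power2_eq_square algebra_simps)
qed

lemma split_attached_exists:
  fixes x :: "'k::field multivector6" and \<gamma> :: "'k ^ 3"
  assumes two: "(2::'k) \<noteq> 0" and x: "nonzero_square (- f1 x)" and \<gamma>: "\<forall>i. \<gamma> $ i \<noteq> 0"
  shows "\<exists>(K :: ('k, 'k ^ 8) normed_alg) C. attached x K C \<and> K \<simeq>\<^sub>a quad_ext 1
     \<and> isometric C (nrm C) (fourfold K) (norm_tensor K (vector [1, \<gamma> $ 2 * \<gamma> $ 3, \<gamma> $ 1 * \<gamma> $ 3, \<gamma> $ 1 * \<gamma> $ 2]))"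
proof -
  obtain K :: "('k, 'k ^ 8) normed_alg" and C h where f: "two_flag K C" "alg_iso h C (Zorn :: ('k, _) normed_alg)" "h ` carrier K = Zorn_diag"
    using split_flag_exists[OF two] by blast
  have K: "composition_algebra K" using f(1) by (simp add: two_flag_def)
  have "\<gamma> $ 2 * \<gamma> $ 3 \<noteq> 0" "\<gamma> $ 1 * \<gamma> $ 3 \<noteq> 0" "\<gamma> $ 1 * \<gamma> $ 2 \<noteq> 0" using \<gamma> by simp_all
  note s = split_flag[OF two f this]
  have "attached x K C" unfolding attached_def using f x by auto
  then show ?thesis
    using s(1) s(2)[folded isometric_fourfold_iff_quad_ext[OF two one_neq_zero K s(1)]] by blast
qed

lemma nonsplit_attached_exists:
  fixes x :: "'k::field multivector6"
  assumes two: "(2::'k) \<noteq> 0" and x: "\<not> nonzero_square (- f1 x)"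
    and y: "y1 \<noteq> 0" "y2 \<noteq> 0" "y3 \<noteq> 0" "y1 * y2 * y3 = f1 x" and g: "g \<in> Sp6" "act3 g x = normal_form 0 y1 y2 y3"
    and n: "\<forall>i. (vector [1, y1, y2, y3] :: 'k ^ 4) $ i = c $ i * ((fst (n i))\<^sup>2 - (- f1 x) * (snd (n i))\<^sup>2) \<and> (fst (n i))\<^sup>2 - (- f1 x) * (snd (n i))\<^sup>2 \<noteq> 0"
  shows "\<exists>(K :: ('k, 'k ^ 8) normed_alg) C. attached x K C \<and> K \<simeq>\<^sub>a quad_ext (- f1 x) \<and> isometric C (nrm C) (fourfold K) (norm_tensor K c)"
proof -
  have d: "- f1 x \<noteq> 0" using y by auto
  obtain K :: "('k, 'k ^ 8) normed_alg" and C where f: "two_flag K C" "K \<simeq>\<^sub>a quad_ext (- f1 x)"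
    "isometric C (nrm C) (fourfold (quad_ext (- f1 x))) (norm_tensor (quad_ext (- f1 x)) (vector [1, y1, y2, y3]))"
    using nonsplit_flag_exists[OF two y(1-3), of "- f1 x"] y(4) by auto
  have K: "composition_algebra K" using f(1) by (simp add: two_flag_def)
  note e = isometric_fourfold_iff_quad_ext[OF two d K f(2)]
  have "\<exists>y0 y1 y2 y3. y1 \<noteq> 0 \<and> y2 \<noteq> 0 \<and> y3 \<noteq> 0 \<and> y1 * y2 * y3 - 1 / 4 * y0\<^sup>2 = f1 x
           \<and> (\<exists>g\<in>Sp6. act3 g x = normal_form y0 y1 y2 y3)
           \<and> isometric C (nrm C) (fourfold K) (norm_tensor K (vector [1, y1, y2, y3]))"
    unfolding e by (rule exI[of _ 0], rule exI[of _ y1], rule exI[of _ y2], rule exI[of _ y3]) (use y g f in auto)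
  then have "attached x K C" unfolding attached_def using f x by simp
  moreover have "isometric C (nrm C) (fourfold K) (norm_tensor K c)"
    unfolding e by (rule isometric_trans[OF f(3) isometric_scale[OF n]])
  ultimately show ?thesis using f(2) by blast
qed

lemma attached_exists:
  fixes x :: "'k::field multivector6"
  assumes two: "(2::'k) \<noteq> 0" and three: "(3::'k) \<noteq> 0" and x: "x \<in> Xspace" "f1 x \<noteq> 0"
  shows "\<exists>(K :: ('k, 'k ^ 8) normed_alg) C (\<gamma> :: 'k ^ 3). attached x K C \<and> (\<forall>i. \<gamma> $ i \<noteq> 0)
     \<and> isometric C (nrm C) (fourfold K) (norm_tensor K (vector [1, \<gamma> $ 2 * \<gamma> $ 3, \<gamma> $ 1 * \<gamma> $ 3, \<gamma> $ 1 * \<gamma> $ 2]))"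
proof (cases "nonzero_square (- f1 x)")
  case True
  define \<gamma> :: "'k ^ 3" where "\<gamma> = (\<chi> i. 1)"
  then have "\<forall>i. \<gamma> $ i \<noteq> 0" by simp
  from split_attached_exists[OF two True this] this show ?thesis by blast
next
  case False
  then interpret P: nonsplit_point x using two three x by unfold_locales
  obtain g y1 y2 y3 where y: "g \<in> Sp6" "y1 \<noteq> 0" "y2 \<noteq> 0" "y3 \<noteq> 0" "y1 * y2 * y3 = f1 x" "act3 g x = normal_form 0 y1 y2 y3"
    using P.normal_form_exists by blast
  \<comment> \<open>With this choice \<open>y1 = \<gamma>\<^sub>2 \<gamma>\<^sub>3 f\<^sub>1(x)\<close>, and likewise for \<open>y2\<close> and \<open>y3\<close>; the factor is the norm of \<open>t\<close>.\<close>
  define \<gamma> :: "'k ^ 3" where "\<gamma> = vector [1 / y1, 1 / y2, 1 / y3]"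
  have "\<forall>i. (vector [1, y1, y2, y3] :: 'k ^ 4) $ i
       = (vector [1, \<gamma> $ 2 * \<gamma> $ 3, \<gamma> $ 1 * \<gamma> $ 3, \<gamma> $ 1 * \<gamma> $ 2] :: 'k ^ 4) $ i
         * ((fst (if i = 1 then (1, 0) else (0, 1)))\<^sup>2 - (- f1 x) * (snd (if i = 1 then (1, 0) else (0, 1)))\<^sup>2)
       \<and> (fst (if i = 1 then (1, 0) else (0, 1)))\<^sup>2 - (- f1 x) * (snd (if i = 1 then (1, 0) else (0, 1)))\<^sup>2 \<noteq> 0"
    using y x(2) by (simp add: forall_4 vector_4 \<gamma>_def vector_3 flip: y(5))
  note nonsplit_attached_exists[OF two False y(2-5,1,6) this]
  moreover have "\<forall>i. \<gamma> $ i \<noteq> 0" using y(2-4) by (simp add: forall_3 \<gamma>_def vector_3)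
  ultimately show ?thesis by blast
qed

lemma representsI:
  fixes K K' :: "('k::field, 'k ^ 8) normed_alg"
  assumes two: "(2::'k) \<noteq> 0" and x: "x \<in> Xspace" and K: "attached x K C" "composition_algebra K'" "vdim K' = 2"
    "\<forall>i. \<gamma> $ i \<noteq> 0" "A \<simeq>\<^sub>a H3 K' \<gamma>" "K' \<simeq>\<^sub>a K"
    "isometric C (nrm C) (fourfold K) (norm_tensor K (vector [1, \<gamma> $ 2 * \<gamma> $ 3, \<gamma> $ 1 * \<gamma> $ 3, \<gamma> $ 1 * \<gamma> $ 2]))"
  shows "represents (orbit (x, v)) A"
proof -
  have "(x, v) = (act3 (mat 1) x, mat 1 *v v)" using act3_mat_1[OF Xspace_grade[OF x]] by simp
  then have "(x, v) \<in> orbit (x, v)" unfolding orbit_def using mat_1_Sp6 by auto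
  then show ?thesis unfolding represents_def
    by (rule bexI[rotated]) (simp only: prod.case, use K in blast)
qed

lemma alg_isomorphic_refl: "A \<simeq>\<^sub>a A"
  unfolding alg_isomorphic_def alg_iso_def lin_iso_def by (intro exI[of _ id]) auto

lemma orbit_represents:
  fixes x :: "'k::field multivector6"
  assumes two: "(2::'k) \<noteq> 0" and three: "(3::'k) \<noteq> 0" and x: "(x, v) \<in> Vss"
  shows "\<exists>A :: ('k, ('k ^ 8) ^ 3 ^ 3) nalg. reduced_freudenthal A \<and> vdim A = 9 \<and> represents (orbit (x, v)) A"
proof -
  have x': "x \<in> Xspace" "f1 x \<noteq> 0" using x by (auto simp: Vss_def)
  obtain K :: "('k, 'k ^ 8) normed_alg" and C and \<gamma> :: "'k ^ 3" where a: "attached x K C" "\<forall>i. \<gamma> $ i \<noteq> 0"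
     "isometric C (nrm C) (fourfold K) (norm_tensor K (vector [1, \<gamma> $ 2 * \<gamma> $ 3, \<gamma> $ 1 * \<gamma> $ 3, \<gamma> $ 1 * \<gamma> $ 2]))"
    using attached_exists[OF two three x'] by blast
  have K: "composition_algebra K" "vdim K = 2" using a(1) by (auto simp: attached_def two_flag_def)
  interpret K: comp_alg K by (rule comp_alg_intro) (rule K)
  have "reduced_freudenthal (H3 K \<gamma>)"
    unfolding reduced_freudenthal_def using K.nalgebra_H3[OF a(2)] K(1) a(2) alg_isomorphic_refl by blast
  moreover have "vdim (H3 K \<gamma>) = 9" using K.vdim_H3[OF a(2) two] K(2) by simp
  moreover have "represents (orbit (x, v)) (H3 K \<gamma>)"
    by (rule representsI[OF two x'(1) a(1) K a(2) alg_isomorphic_refl alg_isomorphic_refl a(3)])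
  ultimately show ?thesis by blast
qed

lemma algebra_represented:
  fixes A :: "('k::field, 'a::ab_group_add) nalg"
  assumes two: "(2::'k) \<noteq> 0" and three: "(3::'k) \<noteq> 0" and A: "reduced_freudenthal A" "vdim A = 9"
  shows "\<exists>x v. (x, v) \<in> Vss \<and> represents (orbit (x, v)) A"
proof -
  obtain K' :: "('k, 'k ^ 8) normed_alg" and \<gamma> where K': "composition_algebra K'" "\<forall>i. \<gamma> $ i \<noteq> 0" "A \<simeq>\<^sub>a H3 K' \<gamma>" and nA: "nalgebra A"
    using A(1) unfolding reduced_freudenthal_def by blast
  interpret K': comp_alg K' by (rule comp_alg_intro) (rule K')
  obtain h where h: "lin_iso h A (H3 K' \<gamma>)" using K'(3) by (auto simp: alg_isomorphic_def alg_iso_def)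
  have "vdim A = vdim (H3 K' \<gamma>)"
    using nA K'.nalgebra_H3[OF K'(2)] by (intro vdim_iso[OF h]) (auto simp: nalgebra_def)
  from this A(2) have dim: "vdim K' = 2" using K'.vdim_H3[OF K'(2) two] by simp
  obtain d i where d: "d \<noteq> 0" "alg_iso i (quad_ext d) K'"
    using alg_iso_quad_ext[OF K'.comp_alg_axioms dim two] by (elim exE conjE)
  note Q = composition_algebra_quad_ext[OF two]
  have "nalgebra (quad_ext d)"
    using Q[OF d(1)] unfolding composition_algebra_def by (elim conjE)
  moreover have "quad_ext d \<simeq>\<^sub>a K'" unfolding alg_isomorphic_def by (rule exI) (rule d(2))
  ultimately have K'Q: "K' \<simeq>\<^sub>a quad_ext d" by (rule alg_isomorphic_sym[rotated])
  define \<delta> where "\<delta> = \<gamma> $ 1 * \<gamma> $ 2 * \<gamma> $ 3"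
  have nz: "\<gamma> $ 1 \<noteq> 0" "\<gamma> $ 2 \<noteq> 0" "\<gamma> $ 3 \<noteq> 0" "\<delta> \<noteq> 0" using K'(2) by (auto simp: \<delta>_def)
  \<comment> \<open>The factor \<open>- d / \<delta>\<^sup>2\<close> is the norm of \<open>t / \<delta>\<close>; it makes the product of the three entries equal to \<open>- d\<close>.\<close>
  define y1 y2 y3 where "y1 = - d * (\<gamma> $ 2 * \<gamma> $ 3) / \<delta>\<^sup>2" and "y2 = \<gamma> $ 1 * \<gamma> $ 3" and "y3 = \<gamma> $ 1 * \<gamma> $ 2"
  have y: "y1 \<noteq> 0" "y2 \<noteq> 0" "y3 \<noteq> 0" using nz d(1) by (simp_all add: y1_def y2_def y3_def)
  have "y1 * y2 * y3 * \<delta>\<^sup>2 = - d * (\<gamma> $ 2 * \<gamma> $ 3) * y2 * y3" using nz(4) by (simp add: y1_def)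
  also have "\<dots> = - d * \<delta>\<^sup>2" by (simp add: y2_def y3_def \<delta>_def power2_eq_square algebra_simps)
  finally have prod: "y1 * y2 * y3 = - d"
    by (rule mult_right_cancel[THEN iffD1, rotated]) (simp add: nz(4))
  define x where "x = normal_form 0 y1 y2 y3"
  have x: "x \<in> Xspace" and f1: "f1 x = - d" using f1_normal_form[OF two, of 0 y1 y2 y3] prod by (simp_all add: x_def normal_form_Xspace)
  have "f2 (x, axis 4 1) = - y1" unfolding x_def f2_normal_form[OF two] by (simp add: axis_def)
  then have V: "(x, axis 4 1) \<in> Vss" using x f1 d(1) y(1) by (simp add: Vss_def)
  have "\<exists>(K :: ('k, 'k ^ 8) normed_alg) C. attached x K C \<and> K' \<simeq>\<^sub>a K
      \<and> isometric C (nrm C) (fourfold K) (norm_tensor K (vector [1, \<gamma> $ 2 * \<gamma> $ 3, \<gamma> $ 1 * \<gamma> $ 3, \<gamma> $ 1 * \<gamma> $ 2]))"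
  proof (cases "nonzero_square (- f1 x)")
    case True
    then obtain b where b: "b \<noteq> 0" "d = b\<^sup>2" by (auto simp: nonzero_square_def f1)
    obtain K :: "('k, 'k ^ 8) normed_alg" and C where KC: "attached x K C" "K \<simeq>\<^sub>a quad_ext 1"
      "isometric C (nrm C) (fourfold K) (norm_tensor K (vector [1, \<gamma> $ 2 * \<gamma> $ 3, \<gamma> $ 1 * \<gamma> $ 3, \<gamma> $ 1 * \<gamma> $ 2]))"
      using split_attached_exists[OF two True K'(2)] by blast
    have "nalgebra K" using KC(1) by (simp add: attached_def two_flag_def composition_algebra_def)
    then have 1: "quad_ext 1 \<simeq>\<^sub>a K" by (rule alg_isomorphic_sym[OF KC(2)])
    have "quad_ext d \<simeq>\<^sub>a quad_ext 1" unfolding b(2) by (rule quad_ext_square[OF two b(1)])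
    from alg_isomorphic_trans[OF K'Q alg_isomorphic_trans[OF this 1]]
    show ?thesis using KC(1,3) by (intro exI conjI)
  next
    case False
    let ?n = "\<lambda>i :: 4. if i = 2 then (0, 1 / \<delta>) else (1, 0)"
    have g: "mat 1 \<in> Sp6" "act3 (mat 1) x = normal_form 0 y1 y2 y3"
      using mat_1_Sp6 act3_mat_1[OF Xspace_grade[OF x]] by (simp_all add: x_def)
    have "\<forall>i. (vector [1, y1, y2, y3] :: 'k ^ 4) $ i
       = (vector [1, \<gamma> $ 2 * \<gamma> $ 3, \<gamma> $ 1 * \<gamma> $ 3, \<gamma> $ 1 * \<gamma> $ 2] :: 'k ^ 4) $ i
         * ((fst (?n i))\<^sup>2 - (- f1 x) * (snd (?n i))\<^sup>2)
       \<and> (fst (?n i))\<^sup>2 - (- f1 x) * (snd (?n i))\<^sup>2 \<noteq> 0"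
      using nz d(1) unfolding forall_4 f1
      by (simp add: vector_4 y2_def y3_def) (simp add: y1_def power_divide)
    from nonsplit_attached_exists[OF two False y _ g this]
    obtain K :: "('k, 'k ^ 8) normed_alg" and C where KC: "attached x K C" "K \<simeq>\<^sub>a quad_ext d"
      "isometric C (nrm C) (fourfold K) (norm_tensor K (vector [1, \<gamma> $ 2 * \<gamma> $ 3, \<gamma> $ 1 * \<gamma> $ 3, \<gamma> $ 1 * \<gamma> $ 2]))"
      using prod by (auto simp: f1)
    have "nalgebra K" using KC(1) by (simp add: attached_def two_flag_def composition_algebra_def)
    from alg_isomorphic_trans[OF K'Q alg_isomorphic_sym[OF KC(2) this]]
    show ?thesis using KC(1,3) by (intro exI conjI)
  qed
  then obtain K :: "('k, 'k ^ 8) normed_alg" and C where KC: "attached x K C" "K' \<simeq>\<^sub>a K"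
      "isometric C (nrm C) (fourfold K) (norm_tensor K (vector [1, \<gamma> $ 2 * \<gamma> $ 3, \<gamma> $ 1 * \<gamma> $ 3, \<gamma> $ 1 * \<gamma> $ 2]))"
    by (elim exE conjE)
  show ?thesis
    using V representsI[OF two x KC(1) K'(1) dim K'(2,3) KC(2,3)] by (intro exI conjI)
qed

theorem theorem6p3:
  assumes "(2 :: 'k::field) \<noteq> 0" and "(3 :: 'k) \<noteq> 0"
  shows "(\<forall>Orb \<in> (Vss_orbits :: ('k multivector6 \<times> ('k ^ 6)) set set).
            \<exists>A :: ('k, ('k ^ 8) ^ 3 ^ 3) nalg.
              reduced_freudenthal A \<and> vdim A = 9 \<and> represents Orb A
              \<and> (\<forall>B :: ('k, 'b::ab_group_add) nalg.
                    reduced_freudenthal B \<and> vdim B = 9 \<and> represents Orb B \<longrightarrow> A \<simeq>\<^sub>a B))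
       \<and> (\<forall>A :: ('k, 'a::ab_group_add) nalg.
            reduced_freudenthal A \<and> vdim A = 9
            \<longrightarrow> (\<exists>Orb \<in> (Vss_orbits :: ('k multivector6 \<times> ('k ^ 6)) set set). represents Orb A))"
proof (intro conjI ballI allI impI)
  fix Orb :: "('k multivector6 \<times> ('k ^ 6)) set"
  assume "Orb \<in> Vss_orbits"
  then obtain x v where x: "(x, v) \<in> Vss" and Orb: "Orb = orbit (x, v)" by (auto simp: Vss_orbits_def)
  obtain A :: "('k, ('k ^ 8) ^ 3 ^ 3) nalg" where A: "reduced_freudenthal A" "vdim A = 9" "represents (orbit (x, v)) A"
    using orbit_represents[OF assms x] by blast
  have "A \<simeq>\<^sub>a B" if "reduced_freudenthal B" "represents Orb B" for B :: "('k, 'b) nalg"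
    using represents_unique[OF assms x A(3)] that unfolding Orb reduced_freudenthal_def by blast
  then show "\<exists>A :: ('k, ('k ^ 8) ^ 3 ^ 3) nalg. reduced_freudenthal A \<and> vdim A = 9 \<and> represents Orb A
      \<and> (\<forall>B :: ('k, 'b) nalg. reduced_freudenthal B \<and> vdim B = 9 \<and> represents Orb B \<longrightarrow> A \<simeq>\<^sub>a B)"
    using A Orb by blast
next
  fix A :: "('k, 'a) nalg"
  assume "reduced_freudenthal A \<and> vdim A = 9"
  then show "\<exists>Orb \<in> (Vss_orbits :: ('k multivector6 \<times> ('k ^ 6)) set set). represents Orb A"
    using algebra_represented[OF assms, of A] by (auto simp: Vss_orbits_def)
qed

end
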